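(* Let $d$ be a positive integer, let $\{|k\rangle\}_{k=1}^d$ be an orthonormal basis of $\mathbb C^d$, let $U$ be the quantum Fourier transform on $d$ dimensions, and consider the state $$\rho_{AA'BB'E}=\frac1{2d}\sum_{k=1}^d\Big(|00\rangle\langle00|_{AB}\otimes|kk\rangle\langle kk|_{A'B'}\otimes|k\rangle\langle k|_E+|11\rangle\langle11|_{AB}\otimes|kk\rangle\langle kk|_{A'B'}\otimes U|k\rangle\langle k|_EU^\dagger\Big),$$ where Alice holds $AA'$, Bob holds $BB'$ and Eve holds $E$. Then $$K_D(\rho_{AA'BB'E})=K_D(\rho_{AB})=1 .$$ If, on the other hand, Eve applies to her system $E$ a measurement, optimal in the sense that it maximises the mutual information between its classical outcome and Alice's systems $AA'$, and this measurement transforms $\rho_{AA'BB'E}$ into the ccc state $\sigma_{AA'BB'E}$, then $$K_D(\sigma_{AA'BB'E})=1+\tfrac12\log d .$$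
   Context: Hilbert spaces are finite-dimensional and $\log$ is to base 2. The quantum Fourier transform is the unitary with matrix entries $\frac1{\sqrt d}e^{2\pi i jk/d}$ in the basis $\{|k\rangle\}$. A ccc state is a state classical (diagonal in fixed product orthonormal bases) on Alice's, Bob's and Eve's systems; $\sigma_{AA'BB'E}$ is obtained from $\rho_{AA'BB'E}$ by replacing Eve's system by the classical outcome of her measurement (POVM). In $K_D(\rho_{AB})$, $\rho_{AB}=\mathrm{Tr}_{A'B'E}\rho_{AA'BB'E}$ with Eve's system trivial. Key rate. A tripartite state $\rho_{ABE}$ is a density operator on $\mathcal H_A\otimes\mathcal H_B\otimes\mathcal H_E$, held by Alice, Bob and the adversary Eve. Distance: $\|\rho-\sigma\|:=\frac12\mathrm{Tr}|\rho-\sigma|$. LOPC operation: a concatenation of finitely many steps, each being either (i) a local quantum operation of Bob, $\rho_{ABE}\mapsto(I_{AE}\otimes\Lambda_B)(\rho_{ABE})$ with $\Lambda_B$ completely positive trace preserving (CPTP), or the analogue for Alice; or (ii) public classical communication from Alice to Bob: a state $\sum_i\rho^i_{ABE}\otimes|i\rangle\langle i|_{C}$ ($C$ a classical register of Alice) is transformed into $\sum_i\rho^i_{ABE}\otimes|iii\rangle\langle iii|_{CC'C''}$ with $C'$ held by Bob and $C''$ by Eve, or the analogue from Bob to Alice. LOPC protocol: a family $\mathcal P=\{\Lambda_n\}_{n\in\mathbb N}$ of CPTP maps $\Lambda_n:(\mathcal H_A\otimes\mathcal H_B\otimes\mathcal H_E)^{\otimes n}\to\mathcal H_A^n\otimes\mathcal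 H_B^n\otimes\mathcal H_E^n$, each an LOPC operation. Let $\tau^\ell_{ABE}:=\frac1{2^\ell}\sum_{i=1}^{2^\ell}|ii\rangle\langle ii|_{AB}\otimes\tau_E$ for some arbitrary state $\tau_E$. $\mathcal P$ distills key at rate $R_{\mathcal P}$ from $\rho_{ABE}$ if there is a sequence $\{\ell_n\}$ with $\limsup_{n\to\infty}\ell_n/n=R_{\mathcal P}$ and $\lim_{n\to\infty}\|\Lambda_n(\rho_{ABE}^{\otimes n})-\tau^{\ell_n}_{ABE}\|=0$. The key rate is $K_D(\rho_{ABE}):=\sup_{\mathcal P}R_{\mathcal P}$. (These definitions are applied with Alice's system $AA'$ and Bob's system $BB'$.) *)

theory Defs
  imports
    "Jordan_Normal_Form.Spectral_Radius"
    "Jordan_Normal_Form.Schur_Decomposition"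
    "HOL-Library.Extended_Real"
    "HOL-Library.Liminf_Limsup"
begin

text \<open>
  Operators on finite-dimensional Hilbert spaces are complex matrices, and a system is given by its
  dimension. In a tensor product the leftmost factor is the most significant part of the index:
  the basis vector \<open>|i\<rangle> \<otimes> |j\<rangle>\<close> of \<open>\<complex>^m \<otimes> \<complex>^n\<close> has index \<open>i * n + j\<close>.
\<close>

type_synonym cmat = "complex mat"
type_synonym dims = "nat \<times> nat \<times> nat"


section \<open>Matrices, states and channels\<close>

definition kron :: "cmat \<Rightarrow> cmat \<Rightarrow> cmat"  (infixl "\<otimes>\<^sub>m" 71) where
  "A \<otimes>\<^sub>m B = mat (dim_row A * dim_row B) (dim_col A * dim_col B)
     (\<lambda>(i, j). A $$ (i div dim_row B, j div dim_col B) * B $$ (i mod dim_row B, j mod dim_col B))"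

definition mat_sum :: "nat \<Rightarrow> 'i set \<Rightarrow> ('i \<Rightarrow> cmat) \<Rightarrow> cmat" where
  "mat_sum n I F = mat n n (\<lambda>ij. \<Sum>k\<in>I. F k $$ ij)"

definition mat_trace :: "cmat \<Rightarrow> complex" where
  "mat_trace A = (\<Sum>i<dim_row A. A $$ (i, i))"

definition ketbra :: "complex vec \<Rightarrow> complex vec \<Rightarrow> cmat" where
  "ketbra v w = mat (dim_vec v) (dim_vec w) (\<lambda>(i, j). v $ i * cnj (w $ j))"

abbreviation proj :: "complex vec \<Rightarrow> cmat" where
  "proj v \<equiv> ketbra v v"

text \<open>Here \<open>\<le>\<close> is the order on \<open>complex\<close> for which \<open>0 \<le> z\<close> means that \<open>z\<close> is real and nonnegative.\<close>

definition psd :: "nat \<Rightarrow> cmat \<Rightarrow> bool" where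
  "psd n A \<longleftrightarrow> A \<in> carrier_mat n n \<and> (\<forall>v\<in>carrier_vec n. 0 \<le> (A *\<^sub>v v) \<bullet>c v)"

definition density :: "nat \<Rightarrow> cmat \<Rightarrow> bool" where
  "density n \<rho> \<longleftrightarrow> psd n \<rho> \<and> mat_trace \<rho> = 1"

definition mat_abs :: "nat \<Rightarrow> cmat \<Rightarrow> cmat" where
  "mat_abs n A = (THE P. psd n P \<and> P * P = mat_adjoint A * A)"

definition tdist :: "nat \<Rightarrow> cmat \<Rightarrow> cmat \<Rightarrow> real" where
  "tdist n \<rho> \<sigma> = Re (mat_trace (mat_abs n (\<rho> - \<sigma>))) / 2"

text \<open>
  \<open>local_map p m n q \<Lambda>\<close> is \<open>id \<otimes> \<Lambda> \<otimes> id\<close> from \<open>\<complex>^p \<otimes> \<complex>^m \<otimes> \<complex>^q\<close> to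
  \<open>\<complex>^p \<otimes> \<complex>^n \<otimes> \<complex>^q\<close>: it applies \<open>\<Lambda>\<close> to each of the \<open>m\<close>-by-\<open>m\<close> blocks that are obtained by
  fixing the row and column indices of the outer two factors.
\<close>

definition local_map :: "nat \<Rightarrow> nat \<Rightarrow> nat \<Rightarrow> nat \<Rightarrow> (cmat \<Rightarrow> cmat) \<Rightarrow> cmat \<Rightarrow> cmat" where
  "local_map p m n q \<Lambda> X = mat (p * n * q) (p * n * q) (\<lambda>(r, s).
     \<Lambda> (mat m m (\<lambda>(i, j). X $$ ((r div (n * q) * m + i) * q + r mod q,
                               (s div (n * q) * m + j) * q + s mod q)))
       $$ (r div q mod n, s div q mod n))"

definition linear_map :: "nat \<Rightarrow> nat \<Rightarrow> (cmat \<Rightarrow> cmat) \<Rightarrow> bool" where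
  "linear_map m n \<Lambda> \<longleftrightarrow>
     (\<forall>X\<in>carrier_mat m m. \<Lambda> X \<in> carrier_mat n n) \<and>
     (\<forall>X\<in>carrier_mat m m. \<forall>Y\<in>carrier_mat m m. \<Lambda> (X + Y) = \<Lambda> X + \<Lambda> Y) \<and>
     (\<forall>c. \<forall>X\<in>carrier_mat m m. \<Lambda> (c \<cdot>\<^sub>m X) = c \<cdot>\<^sub>m \<Lambda> X)"

definition cptp :: "nat \<Rightarrow> nat \<Rightarrow> (cmat \<Rightarrow> cmat) \<Rightarrow> bool" where
  "cptp m n \<Lambda> \<longleftrightarrow> linear_map m n \<Lambda> \<and>
     (\<forall>k X. psd (k * m) X \<longrightarrow> psd (k * n) (local_map k m n 1 \<Lambda> X)) \<and>
     (\<forall>X\<in>carrier_mat m m. mat_trace (\<Lambda> X) = mat_trace X)"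

text \<open>\<open>ptrace p m q\<close> traces out the middle factor of \<open>\<complex>^p \<otimes> \<complex>^m \<otimes> \<complex>^q\<close>.\<close>

definition ptrace :: "nat \<Rightarrow> nat \<Rightarrow> nat \<Rightarrow> cmat \<Rightarrow> cmat" where
  "ptrace p m q = local_map p m 1 q (\<lambda>Y. mat 1 1 (\<lambda>_. mat_trace Y))"


section \<open>LOPC operations and the key rate\<close>

text \<open>
  A triple \<open>(a, b, e)\<close> lists the dimensions of Alice's, Bob's and Eve's systems; the tripartite
  state is a matrix on \<open>\<complex>^a \<otimes> \<complex>^b \<otimes> \<complex>^e\<close>.

  \<open>comm_alice a c b e\<close> sends Alice's register \<open>C\<close> (the last factor of \<open>\<complex>^a \<otimes> \<complex>^c\<close>) to Bob and Eve,
  as \<open>X \<mapsto> \<Sum>\<^sub>i V\<^sub>i X V\<^sub>i\<^sup>\<dagger>\<close> with \<open>V\<^sub>i = (1 \<otimes> |i\<rangle>\<langle>i|) \<otimes> (1 \<otimes> |i\<rangle>) \<otimes> (1 \<otimes> |i\<rangle>)\<close>. On states that are classical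
  on \<open>C\<close> this is the copying map \<open>\<Sum>\<^sub>i \<rho>\<^sub>i \<otimes> |i\<rangle>\<langle>i| \<mapsto> \<Sum>\<^sub>i \<rho>\<^sub>i \<otimes> |iii\<rangle>\<langle>iii|\<close>; on other states it first
  dephases \<open>C\<close>, which Alice could do locally.
\<close>

definition ket_col :: "nat \<Rightarrow> nat \<Rightarrow> cmat" where
  "ket_col c i = mat_of_cols c [unit_vec c i]"

definition comm_alice :: "nat \<Rightarrow> nat \<Rightarrow> nat \<Rightarrow> nat \<Rightarrow> cmat \<Rightarrow> cmat" where
  "comm_alice a c b e X = mat_sum (a * c * (b * c) * (e * c)) {..<c} (\<lambda>i.
     let V = (1\<^sub>m a \<otimes>\<^sub>m proj (unit_vec c i)) \<otimes>\<^sub>m (1\<^sub>m b \<otimes>\<^sub>m ket_col c i) \<otimes>\<^sub>m (1\<^sub>m e \<otimes>\<^sub>m ket_col c i)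
     in V * X * mat_adjoint V)"

definition comm_bob :: "nat \<Rightarrow> nat \<Rightarrow> nat \<Rightarrow> nat \<Rightarrow> cmat \<Rightarrow> cmat" where
  "comm_bob a c b e X = mat_sum (a * c * (b * c) * (e * c)) {..<c} (\<lambda>i.
     let V = (1\<^sub>m a \<otimes>\<^sub>m ket_col c i) \<otimes>\<^sub>m (1\<^sub>m b \<otimes>\<^sub>m proj (unit_vec c i)) \<otimes>\<^sub>m (1\<^sub>m e \<otimes>\<^sub>m ket_col c i)
     in V * X * mat_adjoint V)"

inductive lopc_step :: "dims \<Rightarrow> dims \<Rightarrow> (cmat \<Rightarrow> cmat) \<Rightarrow> bool" where
  local_alice: "cptp a a' \<Lambda> \<Longrightarrow> lopc_step (a, b, e) (a', b, e) (local_map 1 a a' (b * e) \<Lambda>)"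
| local_bob: "cptp b b' \<Lambda> \<Longrightarrow> lopc_step (a, b, e) (a, b', e) (local_map a b b' e \<Lambda>)"
| alice_to_bob: "lopc_step (a * c, b, e) (a * c, b * c, e * c) (comm_alice a c b e)"
| bob_to_alice: "lopc_step (a, b * c, e) (a * c, b * c, e * c) (comm_bob a c b e)"

inductive lopc :: "dims \<Rightarrow> dims \<Rightarrow> (cmat \<Rightarrow> cmat) \<Rightarrow> bool" where
  lopc_id: "lopc D D (\<lambda>X. X)"
| lopc_comp: "lopc D D' \<Phi> \<Longrightarrow> lopc_step D' D'' \<Psi> \<Longrightarrow> lopc D D'' (\<Psi> \<circ> \<Phi>)"

fun total_dim :: "dims \<Rightarrow> nat" where
  "total_dim (a, b, e) = a * b * e"

fun pow_dims :: "dims \<Rightarrow> nat \<Rightarrow> dims" where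
  "pow_dims (a, b, e) n = (a ^ n, b ^ n, e ^ n)"

text \<open>
  \<open>tensor_power (a, b, e) n \<rho>\<close> is \<open>\<rho>\<^sup>\<otimes>\<^sup>n\<close> with its factors regrouped from \<open>(A \<otimes> B \<otimes> E)\<^sup>\<otimes>\<^sup>n\<close> to
  \<open>A\<^sup>\<otimes>\<^sup>n \<otimes> B\<^sup>\<otimes>\<^sup>n \<otimes> E\<^sup>\<otimes>\<^sup>n\<close>: \<open>copy_index (a, b, e) n t i\<close> is the index in \<open>A \<otimes> B \<otimes> E\<close> of the \<open>t\<close>-th copy,
  made of the \<open>t\<close>-th base-\<open>a\<close>, base-\<open>b\<close> and base-\<open>e\<close> digits of the three components of \<open>i\<close>.
\<close>

fun copy_index :: "dims \<Rightarrow> nat \<Rightarrow> nat \<Rightarrow> nat \<Rightarrow> nat" where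
  "copy_index (a, b, e) n t i =
     (let x = i div (b ^ n * e ^ n); y = i div e ^ n mod b ^ n; z = i mod e ^ n
      in (x div a ^ t mod a * b + y div b ^ t mod b) * e + z div e ^ t mod e)"

definition tensor_power :: "dims \<Rightarrow> nat \<Rightarrow> cmat \<Rightarrow> cmat" where
  "tensor_power D n \<rho> = mat (total_dim (pow_dims D n)) (total_dim (pow_dims D n))
     (\<lambda>(i, j). \<Prod>t<n. \<rho> $$ (copy_index D n t i, copy_index D n t j))"

fun key_state :: "dims \<Rightarrow> nat \<Rightarrow> cmat \<Rightarrow> cmat" where
  "key_state (a, b, e) l \<tau> = complex_of_real (1 / 2 ^ l) \<cdot>\<^sub>m
     mat_sum (a * b * e) {..<2 ^ l} (\<lambda>i. proj (unit_vec a i) \<otimes>\<^sub>m proj (unit_vec b i) \<otimes>\<^sub>m \<tau>)"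

definition lopc_protocol :: "dims \<Rightarrow> (nat \<Rightarrow> dims) \<Rightarrow> (nat \<Rightarrow> cmat \<Rightarrow> cmat) \<Rightarrow> bool" where
  "lopc_protocol D D' \<Lambda> \<longleftrightarrow> (\<forall>n. lopc (pow_dims D n) (D' n) (\<Lambda> n))"

text \<open>\<open>key_state\<close> needs room for \<open>2 ^ l\<close> basis vectors on each side; excess dimensions are allowed.\<close>

definition distills_key ::
  "dims \<Rightarrow> cmat \<Rightarrow> (nat \<Rightarrow> dims) \<Rightarrow> (nat \<Rightarrow> cmat \<Rightarrow> cmat) \<Rightarrow> ereal \<Rightarrow> bool" where
  "distills_key D \<rho> D' \<Lambda> R \<longleftrightarrow> (\<exists>l \<tau>.
     (\<forall>n. case D' n of (a, b, e) \<Rightarrow> 2 ^ l n \<le> a \<and> 2 ^ l n \<le> b \<and> density e (\<tau> n)) \<and>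
     limsup (\<lambda>n. ereal (real (l n) / real n)) = R \<and>
     (\<lambda>n. tdist (total_dim (D' n)) (\<Lambda> n (tensor_power D n \<rho>)) (key_state (D' n) (l n) (\<tau> n)))
       \<longlonglongrightarrow> 0)"

definition key_rate :: "dims \<Rightarrow> cmat \<Rightarrow> ereal" where
  "key_rate D \<rho> = Sup {R. \<exists>D' \<Lambda>. lopc_protocol D D' \<Lambda> \<and> distills_key D \<rho> D' \<Lambda> R}"


section \<open>Eve's measurement and mutual information\<close>

text \<open>Eigenvalues are counted with their multiplicity as roots of the characteristic polynomial.\<close>

definition vn_entropy :: "cmat \<Rightarrow> real" where
  "vn_entropy \<rho> =
     - (\<Sum>x\<in>spectrum \<rho>. real (Polynomial.order x (char_poly \<rho>)) * (Re x * log 2 (Re x)))"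

definition mutual_info :: "nat \<Rightarrow> nat \<Rightarrow> cmat \<Rightarrow> real" where
  "mutual_info m n \<rho> =
     vn_entropy (ptrace m n 1 \<rho>) + vn_entropy (ptrace 1 m n \<rho>) - vn_entropy \<rho>"

definition povm :: "nat \<Rightarrow> nat \<Rightarrow> (nat \<Rightarrow> cmat) \<Rightarrow> bool" where
  "povm e m M \<longleftrightarrow> (\<forall>z<m. psd e (M z)) \<and> mat_sum e {..<m} M = 1\<^sub>m e"

definition measure_eve :: "dims \<Rightarrow> nat \<Rightarrow> (nat \<Rightarrow> cmat) \<Rightarrow> cmat \<Rightarrow> cmat" where
  "measure_eve = (\<lambda>(a, b, e) m M.
     local_map (a * b) e m 1 (\<lambda>Y. mat m m (\<lambda>(z, z'). if z = z' then mat_trace (M z * Y) else 0)))"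

definition outcome_info :: "dims \<Rightarrow> cmat \<Rightarrow> nat \<Rightarrow> (nat \<Rightarrow> cmat) \<Rightarrow> real" where
  "outcome_info = (\<lambda>(a, b, e) \<rho> m M. mutual_info a m (ptrace a b m (measure_eve (a, b, e) m M \<rho>)))"

definition optimal_measurement :: "dims \<Rightarrow> cmat \<Rightarrow> nat \<Rightarrow> (nat \<Rightarrow> cmat) \<Rightarrow> bool" where
  "optimal_measurement = (\<lambda>(a, b, e) \<rho> m M. povm e m M \<and>
     (\<forall>m' M'. povm e m' M' \<longrightarrow> outcome_info (a, b, e) \<rho> m' M' \<le> outcome_info (a, b, e) \<rho> m M))"


section \<open>The state\<close>

text \<open>A family of \<open>d\<close> orthonormal vectors in \<open>\<complex>^d\<close> is automatically a basis.\<close>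

definition orthonormal_basis :: "nat \<Rightarrow> (nat \<Rightarrow> complex vec) \<Rightarrow> bool" where
  "orthonormal_basis d ket \<longleftrightarrow> (\<forall>k\<in>{1..d}. ket k \<in> carrier_vec d) \<and>
     (\<forall>j\<in>{1..d}. \<forall>k\<in>{1..d}. ket j \<bullet>c ket k = (if j = k then 1 else 0))"

definition qft :: "nat \<Rightarrow> (nat \<Rightarrow> complex vec) \<Rightarrow> cmat" where
  "qft d ket = mat_sum d ({1..d} \<times> {1..d}) (\<lambda>(j, k).
     (1 / complex_of_real (sqrt (real d)) *
       exp (2 * complex_of_real pi * \<i> * of_nat j * of_nat k / of_nat d)) \<cdot>\<^sub>m ketbra (ket j) (ket k))"

text \<open>The tensor factors are ordered \<open>A, A', B, B', E\<close>, of dimensions \<open>2, d, 2, d, d\<close>.\<close>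

definition rho_AABBE :: "nat \<Rightarrow> (nat \<Rightarrow> complex vec) \<Rightarrow> cmat" where
  "rho_AABBE d ket = (1 / (2 * of_nat d)) \<cdot>\<^sub>m mat_sum (2 * d * (2 * d) * d) {1..d} (\<lambda>k.
       (proj (unit_vec 2 0) \<otimes>\<^sub>m proj (ket k)) \<otimes>\<^sub>m (proj (unit_vec 2 0) \<otimes>\<^sub>m proj (ket k))
         \<otimes>\<^sub>m proj (ket k)
     + (proj (unit_vec 2 1) \<otimes>\<^sub>m proj (ket k)) \<otimes>\<^sub>m (proj (unit_vec 2 1) \<otimes>\<^sub>m proj (ket k))
         \<otimes>\<^sub>m (qft d ket * proj (ket k) * mat_adjoint (qft d ket)))"

definition rho_AB :: "nat \<Rightarrow> (nat \<Rightarrow> complex vec) \<Rightarrow> cmat" where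
  "rho_AB d ket = ptrace 2 d 2 (ptrace (2 * d * 2) d 1 (ptrace (2 * d * 2 * d) d 1 (rho_AABBE d ket)))"

end

theory Submission
  imports "HOL-Complex_Analysis.Conformal_Mappings" "HOL-Real_Asymp.Real_Asymp" Defs
begin

unbundle no vec_syntax

text \<open>
  An LOPC operation that starts from a product vector of Alice and Bob leaves them, for each public
  transcript \<open>t\<close>, in a product state \<open>A\<^sub>t \<otimes> B\<^sub>t\<close>. Hence, if Alice and Bob share a classical string \<open>x\<close>,
  somebody who knows \<open>x\<close> and \<open>t\<close> can guess the key by sampling from Bob's marginal. If Eve's states
  \<open>\<omega>\<^sub>x\<close> pass tests \<open>Q\<^sub>x\<close> with \<open>\<Sum>\<^sub>x Q\<^sub>x \<le> L\<close>, she turns this into one bounded test that succeeds on the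
  actual state but on an ideal key of length \<open>l\<close> only with probability of order \<open>L / 2\<^sup>l\<close>, so that
  \<open>l \<le> log L + O(1)\<close>.

  For the unmeasured state \<open>Q\<^sub>x = \<omega>\<^sub>x\<close> and \<open>L = 2\<^sup>n\<close>, which gives \<open>K\<^sub>D \<le> 1\<close>; one bit per copy is obtained by
  discarding \<open>A'B'\<close>. For a classical Eve the typical sets give \<open>K\<^sub>D \<le> H(X|Z)\<close>, and a hash function found by
  the method of conditional expectations gives equality. Finally \<open>I(X:Z) \<le> 1/2 log d\<close> is the
  Maassen-Uffink uncertainty relation for the two bases, which follows by differentiating the three
  lines bound at the boundary of the strip.
\<close>

section \<open>An entropic uncertainty relation\<close>

text \<open>The dimensions of a protocol's output are arbitrary, and the definition of the rate
  controls it through the trace distance alone. The converse is therefore run with operator tests at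
  a constant error probability. The obstacle is that tests for different strings overlap: the
  operator collecting all of Eve's guesses of one key value can have norm far above 1, while the
  trace distance controls a test only up to its norm. Replacing this operator by a majorant of norm
  at most 2 costs a constant factor. The state, its marginal on AB and the measured state all have
  one shape: a uniform letter known to both Alice and Bob, and a state of Eve depending on it.
  Tensor powers keep the shape, so the honest parties only have to make their common string secret.
  About an optimal measurement nothing is known but its optimality. Its conditional entropy is
  pinned down by a lower bound valid for every POVM and one measurement that attains it: reading E
  in the first basis reveals the letter if the bit is 0 and nothing about k if it is 1.\<close>

text \<open>Dividing by r^z brings both boundary bounds to 1. As the strip is unbounded, a Gaussian
  factor decaying along it is added; the maximum modulus principle then applies on a rectangle with
  remote horizontal edges, and letting \<epsilon> tend to 0 removes the factor.\<close>

lemma three_lines_bound: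
  fixes F :: "complex \<Rightarrow> complex"
  assumes hol: "F holomorphic_on UNIV"
    and bd: "\<And>z. 0 \<le> Re z \<Longrightarrow> Re z \<le> 1 \<Longrightarrow> norm (F z) \<le> B"
    and b0: "\<And>z. Re z = 0 \<Longrightarrow> norm (F z) \<le> 1"
    and b1: "\<And>z. Re z = 1 \<Longrightarrow> norm (F z) \<le> r"
    and r: "0 < r" and t: "0 \<le> t" "t \<le> 1"
  shows "norm (F (of_real t)) \<le> r powr t"
proof -
  define C where "C = max B 1 * max 1 (1 / r)"
  have C0: "C \<ge> 1" unfolding C_def using mult_mono[of 1 "max B 1" 1 "max 1 (1/r)"] by simp
  have main: "norm (F (of_real t)) \<le> r powr t * exp (\<epsilon> * (1 - t^2))" if e: "\<epsilon> > 0" for \<epsilon>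
  proof -
    define G where "G z = F z * exp (- z * of_real (ln r)) * exp (of_real \<epsilon> * (z^2 - 1))" for z
    have normG: "norm (G z) = norm (F z) * exp (- Re z * ln r) * exp (\<epsilon> * ((Re z)^2 - (Im z)^2 - 1))" for z
      by (simp add: G_def norm_mult Re_power2)
    have rp: "exp (- x * ln r) \<le> max 1 (1/r)" if "0 \<le> x" "x \<le> 1" for x
    proof (cases "r \<ge> 1")
      case True
      then have "exp (- x * ln r) \<le> exp 0" using that by (subst exp_le_cancel_iff) auto
      then show ?thesis by (simp add: le_max_iff_disj)
    next
      case False
      then have "- x * ln r \<le> - ln r" using that r by (simp add: mult_le_cancel_right1) 
      then have "exp (- x * ln r) \<le> exp (- ln r)" by (subst exp_le_cancel_iff)
      also have "exp (- ln r) = 1 / r" using r by (simp add: exp_minus field_simps)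
      finally show ?thesis by simp
    qed
    \<comment> \<open>C bounds |F r^(-z)| on the strip, and at height R the Gaussian factor is at
      most exp(-\<epsilon> R^2) \<le> 1/C. The summand 1 keeps the rectangle nondegenerate when C =
      1.\<close>
    define R where "R = 1 + sqrt (ln C / \<epsilon>)"
    have R0: "R > 0" unfolding R_def using C0 e by (simp add: add_pos_nonneg)
    define S where "S = cbox (Complex 0 (- R)) (Complex 1 R)"
    have inS: "z \<in> S \<longleftrightarrow> 0 \<le> Re z \<and> Re z \<le> 1 \<and> -R \<le> Im z \<and> Im z \<le> R" for z
      by (auto simp: S_def in_cbox_complex_iff)
    have "norm (G (of_real t)) \<le> 1"
    proof (rule maximum_modulus_frontier[of G S])
      show "G holomorphic_on interior S" unfolding G_def
        by (intro holomorphic_intros holomorphic_on_subset[OF hol]) auto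
      have "G holomorphic_on UNIV" unfolding G_def by (intro holomorphic_intros hol)
      then show "continuous_on (closure S) G" 
        by (meson continuous_on_subset holomorphic_on_imp_continuous_on subset_UNIV)
      show "bounded S" by (simp add: S_def)
      show "of_real t \<in> S" using t R0 by (simp add: inS)
      fix z assume z: "z \<in> frontier S"
      have zS: "z \<in> S" using z by (simp add: S_def frontier_def)
      have nb: "z \<notin> box (Complex 0 (- R)) (Complex 1 R)" using z by (simp add: S_def frontier_def)
      then consider "Re z = 0" | "Re z = 1" | "\<bar>Im z\<bar> = R" using zS by (force simp: inS in_box_complex_iff)
      then show "norm (G z) \<le> 1"
      proof cases
        case 1
        have "\<epsilon> * (- (Im z)\<^sup>2 - 1) \<le> 0"
          using e zero_le_power2[of "Im z"] by (intro mult_nonneg_nonpos) linarith+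
        then have "norm (G z) \<le> 1 * 1 * 1" unfolding normG using 1 b0[OF 1] e
          by (intro mult_mono) auto
        then show ?thesis by simp
      next
        case 2
        have "norm (G z) \<le> r * (1/r) * 1" unfolding normG using 2 b1[OF 2] e r
          by (intro mult_mono) (auto simp: mult_nonneg_nonpos exp_minus field_simps)
        then show ?thesis using r by simp
      next
        case 3
        have z01: "0 \<le> Re z" "Re z \<le> 1" using zS by (auto simp: inS)
        have "(Re z)^2 \<le> 1" using z01 by (simp add: power_le_one)
        moreover have "(Im z)^2 = R^2" using 3 by (metis power2_abs)
        moreover have "R^2 \<ge> ln C / \<epsilon>"
        proof -
          have "(sqrt (ln C / \<epsilon>))^2 \<le> R^2" unfolding R_def using C0 e by (intro power_mono) auto
          then show ?thesis using C0 e by simp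
        qed
        ultimately have "(Re z)^2 - (Im z)^2 - 1 \<le> - (ln C / \<epsilon>)" by linarith
        then have "\<epsilon> * ((Re z)^2 - (Im z)^2 - 1) \<le> \<epsilon> * (- (ln C / \<epsilon>))" using e by (intro mult_left_mono) auto
        then have "exp (\<epsilon> * ((Re z)^2 - (Im z)^2 - 1)) \<le> exp (- ln C)" using e by simp
        also have "\<dots> = 1 / C" using C0 by (simp add: exp_minus field_simps)
        finally have ex: "exp (\<epsilon> * ((Re z)^2 - (Im z)^2 - 1)) \<le> 1 / C" .
        have "norm (G z) \<le> max B 1 * max 1 (1/r) * (1 / C)" unfolding normG
          using bd[OF z01] rp[OF z01] ex r
          by (intro mult_mono) (auto simp: le_max_iff_disj intro: mult_nonneg_nonneg)
        also have "\<dots> = 1" using C0 by (simp add: C_def[symmetric])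
        finally show ?thesis .
      qed
    qed
    then have "norm (F (of_real t)) * (exp (- t * ln r) * exp (\<epsilon> * (t^2 - 1))) \<le> 1"
      by (simp add: normG mult.assoc)
    then have "norm (F (of_real t)) \<le> 1 / (exp (- t * ln r) * exp (\<epsilon> * (t^2 - 1)))"
      by (simp add: field_simps)
    also have "\<dots> = r powr t * exp (\<epsilon> * (1 - t^2))"
      using r by (simp add: powr_def exp_minus [symmetric] exp_add [symmetric] divide_inverse algebra_simps)
    finally show ?thesis .
  qed
  have lim: "((\<lambda>\<epsilon>. r powr t * exp (\<epsilon> * (1 - t^2))) \<longlongrightarrow> r powr t * exp (0 * (1 - t^2))) (at_right 0)"
    by (intro tendsto_intros)
  show ?thesis
  proof (rule tendsto_lowerbound)
    show "((\<lambda>\<epsilon>. r powr t * exp (\<epsilon> * (1 - t^2))) \<longlongrightarrow> r powr t) (at_right 0)" using lim by simp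
    show "\<forall>\<^sub>F \<epsilon> in at_right 0. norm (F (of_real t)) \<le> r powr t * exp (\<epsilon> * (1 - t^2))"
      using eventually_at_right_less[of 0] by eventually_elim (use main in auto)
  qed simp
qed

text \<open>The bound |F t| \<le> r^t is an equality at t = 0, so a larger slope of Re F \<le> |F|
  would violate it immediately to the right of 0.\<close>

lemma three_lines_derivative:
  fixes F :: "complex \<Rightarrow> complex"
  assumes hol: "F holomorphic_on UNIV"
    and bd: "\<And>z. 0 \<le> Re z \<Longrightarrow> Re z \<le> 1 \<Longrightarrow> norm (F z) \<le> B"
    and b0: "\<And>z. Re z = 0 \<Longrightarrow> norm (F z) \<le> 1"
    and b1: "\<And>z. Re z = 1 \<Longrightarrow> norm (F z) \<le> r"
    and r: "0 < r" and F0: "F 0 = 1"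
    and D: "(F has_field_derivative D) (at 0)"
  shows "Re D \<le> ln r"
proof (rule ccontr)
  assume "\<not> Re D \<le> ln r"
  then have pos: "0 < Re D - ln r" by simp
  define g where "g t = Re (F (of_real t)) - r powr t" for t :: real
  have "((\<lambda>t. F (of_real t)) has_vector_derivative D) (at (0::real))"
    using has_vector_derivative_real_field[of F D 0 UNIV] D by simp
  then have "((\<lambda>t. Re (F (of_real t))) has_vector_derivative Re D) (at (0::real))"
    by (rule bounded_linear.has_vector_derivative[OF bounded_linear_Re])
  then have "((\<lambda>t. Re (F (of_real t))) has_real_derivative Re D) (at (0::real))"
    by (simp add: has_real_derivative_iff_has_vector_derivative)
  moreover have "((\<lambda>t. r powr t) has_real_derivative ln r) (at 0)"
    using r by (auto intro!: derivative_eq_intros)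
  ultimately have "(g has_real_derivative (Re D - ln r)) (at 0)"
    unfolding g_def by (rule DERIV_diff)
  from DERIV_pos_inc_right[OF this pos] obtain h where h: "h > 0" "\<And>x. 0 < x \<Longrightarrow> x < h \<Longrightarrow> g 0 < g (0 + x)"
    by auto
  define x where "x = min (h/2) 1"
  have x: "0 < x" "x < h" "x \<le> 1" using h(1) by (auto simp: x_def)
  have "g 0 < g x" using h(2)[OF x(1,2)] by simp
  moreover have "g 0 = 0" using F0 r by (simp add: g_def)
  moreover have "norm (F (of_real x)) \<le> r powr x"
    using x by (intro three_lines_bound[OF hol bd b0 b1 r]) auto
  ultimately show False using complex_Re_le_cmod[of "F (of_real x)"] by (simp add: g_def)
qed

lemma isometry_sum:
  fixes c :: "'k \<Rightarrow> 'j \<Rightarrow> complex"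
  assumes fin: "finite J"
    and uni: "\<And>j j'. j \<in> J \<Longrightarrow> j' \<in> J \<Longrightarrow> (\<Sum>k\<in>K. cnj (c k j) * c k j') = (if j = j' then 1 else 0)"
  shows "(\<Sum>k\<in>K. (norm (\<Sum>j\<in>J. c k j * x j))^2) = (\<Sum>j\<in>J. (norm (x j))^2)"
proof -
  have "complex_of_real (\<Sum>k\<in>K. (norm (\<Sum>j\<in>J. c k j * x j))^2)
      = (\<Sum>k\<in>K. \<Sum>j\<in>J. \<Sum>j'\<in>J. cnj (x j) * x j' * (cnj (c k j) * c k j'))"
    unfolding of_real_sum complex_norm_square cnj_sum sum_product
    by (subst sum.swap[where A=J and B=J]) (simp add: mult_ac)
  also have "\<dots> = (\<Sum>j\<in>J. \<Sum>j'\<in>J. cnj (x j) * x j' * (\<Sum>k\<in>K. cnj (c k j) * c k j'))"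
    unfolding sum_distrib_left
    by (subst sum.swap, rule sum.cong[OF refl], subst sum.swap, rule refl)
  also have "\<dots> = (\<Sum>j\<in>J. \<Sum>j'\<in>J. if j = j' then cnj (x j) * x j' else 0)"
    by (intro sum.cong refl) (simp add: uni)
  also have "\<dots> = complex_of_real (\<Sum>j\<in>J. (norm (x j))^2)"
    using fin by (simp add: complex_norm_square mult_ac del: of_real_power)
  finally show ?thesis using of_real_eq_iff by blast
qed

text \<open>The index i runs over a decomposition of a mixed state into unnormalised vectors, so the
  Maassen-Uffink relation comes out for density operators at once; p and q are the distributions
  before and after the isometry c. The derivative at z = 0 of the weights q^(z/2) p^(z/2) is half
  the sum of the two logarithms, hence the factor 2 in front of ln r.\<close>

theorem entropic_uncertainty:
  fixes a :: "'i \<Rightarrow> 'j \<Rightarrow> complex" and c :: "'k \<Rightarrow> 'j \<Rightarrow> complex"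
  assumes fin: "finite I" "finite J" "finite K"
    and uni: "\<And>j j'. j \<in> J \<Longrightarrow> j' \<in> J \<Longrightarrow> (\<Sum>k\<in>K. cnj (c k j) * c k j') = (if j = j' then 1 else 0)"
    and cr: "\<And>k j. k \<in> K \<Longrightarrow> j \<in> J \<Longrightarrow> norm (c k j) \<le> r" and r: "0 < r"
    and p: "\<And>j. p j = (\<Sum>i\<in>I. (norm (a i j))^2)"
    and q: "\<And>k. q k = (\<Sum>i\<in>I. (norm (\<Sum>j\<in>J. c k j * a i j))^2)"
    and p1: "(\<Sum>j\<in>J. p j) = 1"
  shows "(\<Sum>j\<in>J. p j * ln (p j)) + (\<Sum>k\<in>K. q k * ln (q k)) \<le> 2 * ln r"
proof -
  define b where "b i k = (\<Sum>j\<in>J. c k j * a i j)" for i k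
  \<comment> \<open>The power x^(z/2). For x = 0 its value is 1, as ln 0 = 0; this is harmless
    because p j = 0 forces every \<open>a i j\<close>, and q k = 0 every \<open>b i k\<close>, to
    vanish.\<close>
  define e where "e z x = exp (z * of_real (ln x / 2))" for z :: complex and x :: real
  define F where "F z = (\<Sum>i\<in>I. \<Sum>k\<in>K. \<Sum>j\<in>J. cnj (b i k) * e z (q k) * (c k j * (a i j * e z (p j))))" for z
  text \<open>
    \<open>F 0 = 1\<close>; unitarity gives \<open>|F| \<le> 1\<close> on the imaginary axis, and the Cauchy-Schwarz inequality gives
    \<open>|F| \<le> r\<close> on the line \<open>Re z = 1\<close>.
  \<close>
  define D where "D = (\<Sum>i\<in>I. \<Sum>k\<in>K. \<Sum>j\<in>J. cnj (b i k) * c k j * a i j * (of_real (ln (q k) / 2) + of_real (ln (p j) / 2)))"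
  have qb: "q k = (\<Sum>i\<in>I. (norm (b i k))^2)" for k by (simp add: q b_def)
  have p0: "0 \<le> p j" for j by (simp add: p sum_nonneg)
  have q0: "0 \<le> q k" for k by (simp add: qb sum_nonneg)
  have bn: "(\<Sum>k\<in>K. (norm (b i k))^2) = (\<Sum>j\<in>J. (norm (a i j))^2)" for i
    unfolding b_def by (rule isometry_sum[OF fin(2) uni])
  have tot: "(\<Sum>i\<in>I. \<Sum>j\<in>J. (norm (a i j))^2) = 1"
    using p1 unfolding p by (subst sum.swap)
  have q1: "(\<Sum>k\<in>K. q k) = 1" using tot unfolding qb by (subst sum.swap) (simp add: bn)
  have ne: "norm (e z x) = exp (Re z * ln x / 2)" for z x by (simp add: e_def)
  have "Re D \<le> ln r"
  proof (rule three_lines_derivative[of F])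
    show "F holomorphic_on UNIV" unfolding F_def e_def by (intro holomorphic_intros)
    show "0 < r" by fact
    have "F 0 = (\<Sum>i\<in>I. \<Sum>k\<in>K. cnj (b i k) * b i k)"
      unfolding F_def e_def b_def[of _ _] by (simp add: sum_distrib_left)
    also have "\<dots> = of_real (\<Sum>i\<in>I. \<Sum>k\<in>K. (norm (b i k))^2)"
      by (simp add: complex_norm_square mult_ac del: of_real_power)
    finally show "F 0 = 1" by (simp add: bn tot)
    show "(F has_field_derivative D) (at 0)" unfolding F_def e_def D_def
      by (rule DERIV_cong, (rule derivative_eq_intros refl)+) (simp add: algebra_simps sum.distrib)
    \<comment> \<open>A termwise bound, uniform on the strip; its size is irrelevant to the three
      lines argument.\<close>
    show "norm (F z) \<le> (\<Sum>i\<in>I. \<Sum>k\<in>K. \<Sum>j\<in>J. norm (cnj (b i k)) * exp (\<bar>ln (q k) / 2\<bar>) * (norm (c k j) * (norm (a i j) * exp (\<bar>ln (p j) / 2\<bar>))))"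
      if z: "0 \<le> Re z" "Re z \<le> 1" for z
    proof -
      have "norm (e z x) \<le> exp (\<bar>ln x / 2\<bar>)" for x
      proof -
        have "Re z * (ln x / 2) \<le> \<bar>Re z\<bar> * \<bar>ln x / 2\<bar>" by (metis abs_ge_self abs_mult)
        also have "\<dots> \<le> 1 * \<bar>ln x / 2\<bar>" using z by (intro mult_right_mono) auto
        finally show ?thesis by (simp add: ne)
      qed
      then show ?thesis unfolding F_def
        by (intro order.trans[OF norm_sum] sum_mono) (simp add: norm_mult mult_left_mono mult_mono)
    qed
    show "norm (F z) \<le> 1" if z: "Re z = 0" for z
    proof -
      have n1: "norm (e z x) = 1" for x by (simp add: ne z)
      define y where "y i k = (\<Sum>j\<in>J. c k j * (a i j * e z (p j)))" for i k
      have yn: "(\<Sum>k\<in>K. (norm (y i k))^2) = (\<Sum>j\<in>J. (norm (a i j))^2)" for i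
        unfolding y_def by (subst isometry_sum[OF fin(2) uni]) (simp_all add: norm_mult n1)
      have "F z = (\<Sum>i\<in>I. \<Sum>k\<in>K. cnj (b i k) * e z (q k) * y i k)"
        unfolding F_def y_def by (simp add: sum_distrib_left)
      also have "norm \<dots> \<le> (\<Sum>i\<in>I. \<Sum>k\<in>K. norm (b i k) * norm (y i k))"
        by (intro order.trans[OF norm_sum] sum_mono) (simp add: norm_mult n1)
      also have "\<dots> \<le> (\<Sum>i\<in>I. \<Sum>k\<in>K. ((norm (b i k))^2 + (norm (y i k))^2) / 2)"
      proof (intro sum_mono)
        fix i k
        show "norm (b i k) * norm (y i k) \<le> ((norm (b i k))^2 + (norm (y i k))^2) / 2"
          using sum_squares_bound[of "norm (b i k)" "norm (y i k)"] by (simp add: algebra_simps)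
      qed
      also have "\<dots> = 1" using tot by (simp add: sum_divide_distrib[symmetric] sum.distrib bn yn)
      finally show ?thesis .
    qed
    show "norm (F z) \<le> r" if z: "Re z = 1" for z
    proof -
      have n1: "norm (e z x) = sqrt x" if "x > 0" for x
        using that by (simp add: ne z ln_sqrt[symmetric])
      \<comment> \<open>With k and j fixed, the sum over the ensemble is at most sqrt(q k p j), and
        the weights contribute the same factor again. What remains is r times the product of two
        total probabilities.\<close>
      have "F z = (\<Sum>k\<in>K. \<Sum>j\<in>J. \<Sum>i\<in>I. cnj (b i k) * e z (q k) * (c k j * (a i j * e z (p j))))"
        unfolding F_def by (subst sum.swap, rule sum.cong[OF refl], subst sum.swap, rule refl)
      also have "\<dots> = (\<Sum>k\<in>K. \<Sum>j\<in>J. c k j * (e z (q k) * e z (p j)) * (\<Sum>i\<in>I. cnj (b i k) * a i j))"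
        by (simp add: sum_distrib_left mult_ac)
      also have "norm \<dots> \<le> (\<Sum>k\<in>K. \<Sum>j\<in>J. r * (q k * p j))"
      proof (intro order.trans[OF norm_sum] sum_mono)
        fix k j assume kj: "k \<in> K" "j \<in> J"
        define s where "s = (\<Sum>i\<in>I. cnj (b i k) * a i j)"
        have "norm s \<le> (\<Sum>i\<in>I. \<bar>norm (b i k)\<bar> * \<bar>norm (a i j)\<bar>)" unfolding s_def
          by (intro order.trans[OF norm_sum] sum_mono) (simp add: norm_mult)
        also have "\<dots> \<le> sqrt (q k) * sqrt (p j)"
          using L2_set_mult_ineq[of "\<lambda>i. norm (b i k)" "\<lambda>i. norm (a i j)" I]
          by (simp add: L2_set_def qb p)
        finally have s: "norm s \<le> sqrt (q k) * sqrt (p j)" .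
        have "norm (e z (q k)) * norm (e z (p j)) * norm s \<le> q k * p j"
        proof (cases "q k = 0 \<or> p j = 0")
          case True
          then have "norm s = 0" using s by auto
          then show ?thesis using p0 q0 by simp
        next
          case False
          then have pq: "q k > 0" "p j > 0" using p0[of j] q0[of k] by linarith+
          have "norm (e z (q k)) * norm (e z (p j)) * norm s \<le> sqrt (q k) * sqrt (p j) * (sqrt (q k) * sqrt (p j))"
            using s pq by (auto simp: n1 intro!: mult_left_mono)
          also have "\<dots> = (sqrt (q k))^2 * (sqrt (p j))^2" by (simp only: power2_eq_square mult_ac)
          also have "\<dots> = q k * p j" using pq by simp
          finally show ?thesis .
        qed
        then have "norm (c k j) * (norm (e z (q k)) * norm (e z (p j)) * norm s) \<le> r * (q k * p j)"
          using r by (intro mult_mono[OF cr[OF kj]]) auto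
        then show "norm (c k j * (e z (q k) * e z (p j)) * (\<Sum>i\<in>I. cnj (b i k) * a i j)) \<le> r * (q k * p j)"
          by (simp add: norm_mult s_def mult.assoc)
      qed
      also have "\<dots> = r" by (simp add: sum_distrib_left[symmetric] p1 q1)
      finally show ?thesis .
    qed
  qed
  moreover have "D = of_real ((\<Sum>k\<in>K. q k * ln (q k)) / 2 + (\<Sum>j\<in>J. p j * ln (p j)) / 2)"
  proof -
    \<comment> \<open>The two logarithms are separated: for ln q the sum over j rebuilds b, for ln p
      the sum over k collapses by the isometry property.\<close>
    have "D = (\<Sum>i\<in>I. \<Sum>k\<in>K. cnj (b i k) * b i k * of_real (ln (q k) / 2))
       + (\<Sum>i\<in>I. \<Sum>k\<in>K. \<Sum>j\<in>J. cnj (b i k) * c k j * a i j * of_real (ln (p j) / 2))"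
      unfolding D_def
    proof (simp only: sum.distrib[symmetric], intro sum.cong refl)
      fix i k
      have "(\<Sum>j\<in>J. cnj (b i k) * c k j * a i j * (of_real (ln (q k) / 2) + of_real (ln (p j) / 2)))
        = cnj (b i k) * (\<Sum>j\<in>J. c k j * a i j) * of_real (ln (q k) / 2)
          + (\<Sum>j\<in>J. cnj (b i k) * c k j * a i j * of_real (ln (p j) / 2))"
        unfolding distrib_left sum.distrib by (simp add: sum_distrib_left sum_distrib_right mult_ac sum_divide_distrib)
      then show "(\<Sum>j\<in>J. cnj (b i k) * c k j * a i j * (of_real (ln (q k) / 2) + of_real (ln (p j) / 2)))
        = cnj (b i k) * b i k * of_real (ln (q k) / 2)
          + (\<Sum>j\<in>J. cnj (b i k) * c k j * a i j * of_real (ln (p j) / 2))"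
        by (simp add: b_def)
    qed
    also have "(\<Sum>i\<in>I. \<Sum>k\<in>K. cnj (b i k) * b i k * of_real (ln (q k) / 2)) = of_real ((\<Sum>k\<in>K. q k * ln (q k)) / 2)"
      unfolding qb
      by (subst sum.swap) (simp add: complex_norm_square sum_distrib_right sum_divide_distrib mult_ac del: of_real_power)
    also have "(\<Sum>i\<in>I. \<Sum>k\<in>K. \<Sum>j\<in>J. cnj (b i k) * c k j * a i j * of_real (ln (p j) / 2))
       = (\<Sum>i\<in>I. \<Sum>j\<in>J. (\<Sum>k\<in>K. cnj (b i k) * c k j) * a i j * of_real (ln (p j) / 2))"
      by (rule sum.cong[OF refl], subst sum.swap) (simp add: sum_distrib_right sum_divide_distrib)
    also have "\<dots> = (\<Sum>i\<in>I. \<Sum>j\<in>J. cnj (a i j) * a i j * of_real (ln (p j) / 2))"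
    proof (intro sum.cong refl)
      fix i j assume j: "j \<in> J"
      have "(\<Sum>k\<in>K. cnj (b i k) * c k j) = (\<Sum>j'\<in>J. cnj (a i j') * (\<Sum>k\<in>K. cnj (c k j') * c k j))"
        unfolding b_def cnj_sum sum_distrib_left sum_distrib_right by (subst sum.swap) (simp add: mult_ac)
      also have "\<dots> = (\<Sum>j'\<in>J. if j' = j then cnj (a i j') else 0)"
        by (intro sum.cong refl) (simp add: uni j)
      also have "\<dots> = cnj (a i j)" using j fin by simp
      finally show "(\<Sum>k\<in>K. cnj (b i k) * c k j) * a i j * of_real (ln (p j) / 2) = cnj (a i j) * a i j * of_real (ln (p j) / 2)" by simp
    qed
    also have "\<dots> = of_real ((\<Sum>j\<in>J. p j * ln (p j)) / 2)"
      unfolding p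
      by (subst sum.swap) (simp add: complex_norm_square sum_distrib_right sum_divide_distrib mult_ac del: of_real_power)
    finally show ?thesis by simp
  qed
  ultimately show ?thesis by simp
qed

section \<open>Hermitian matrices and the trace distance\<close>

lemma sum_lessThan_mult:
  fixes g :: "nat \<Rightarrow> 'a :: comm_monoid_add"
  shows "(\<Sum>r<a*b. g r) = (\<Sum>i<a. \<Sum>j<b. g (i * b + j))"
proof -
  have "(\<Sum>i<a. \<Sum>j<b. g (i * b + j)) = (\<Sum>i<a. sum g {i * b..<i * b + b})"
  proof (rule sum.cong[OF refl])
    fix i
    show "(\<Sum>j<b. g (i * b + j)) = sum g {i * b..<i * b + b}"
      using sum.shift_bounds_nat_ivl[of g 0 "i * b" b] by (simp add: atLeast0LessThan add.commute)
  qed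
  then show ?thesis using sum.nat_group[of g b a] by simp
qed

lemma sum_rotate3: "(\<Sum>i\<in>A. \<Sum>j\<in>B. \<Sum>k\<in>C. f i j k) = (\<Sum>k\<in>C. \<Sum>i\<in>A. \<Sum>j\<in>B. f i j k)"
  by (rule trans[OF sum.cong[OF refl sum.swap] sum.swap])

lemma mult_add_less: "i < a \<Longrightarrow> j < b \<Longrightarrow> i * b + j < a * (b::nat)"
proof -
  assume "i < a" "j < b"
  then have "i * b + j < (i + 1) * b" by simp
  also have "\<dots> \<le> a * b" using \<open>i < a\<close> by (intro mult_right_mono) auto
  finally show ?thesis .
qed

lemma less_mult_cases:
  assumes "r < a * (b::nat)"
  obtains i j where "i < a" "j < b" "r = i * b + j"
proof
  show "r div b < a" using assms by (simp add: less_mult_imp_div_less)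
  show "r mod b < b" using assms by (metis mod_less_divisor mult_is_0 not_less_zero gr0I)
  show "r = r div b * b + r mod b" by simp
qed

lemma all_less_mult: "(\<forall>r<a * (b::nat). P r) \<longleftrightarrow> (\<forall>i<a. \<forall>j<b. P (i * b + j))"
  by (auto elim!: less_mult_cases simp: mult_add_less)

section \<open>Adjoints, quadratic forms and positive matrices\<close>

lemma mat_adjoint_dim[simp]: "dim_row (mat_adjoint A) = dim_col A" "dim_col (mat_adjoint A) = dim_row A"
  by (simp_all add: mat_adjoint_def)

lemma mat_adjoint_carrier[simp]: "A \<in> carrier_mat n m \<Longrightarrow> mat_adjoint A \<in> carrier_mat m n"
  by auto

lemma mat_adjoint_index[simp]:
  "i < dim_col A \<Longrightarrow> j < dim_row A \<Longrightarrow> mat_adjoint (A :: cmat) $$ (i, j) = cnj (A $$ (j, i))"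
  by (simp add: mat_adjoint_def mat_of_rows_def)

lemma mat_mult_index:
  "A \<in> carrier_mat n m \<Longrightarrow> B \<in> carrier_mat m k \<Longrightarrow> i < n \<Longrightarrow> j < k \<Longrightarrow>
   (A * B) $$ (i, j) = (\<Sum>l<m. A $$ (i, l) * B $$ (l, j))"
  by (auto simp: scalar_prod_def atLeast0LessThan)

text \<open>The vector is an arbitrary function of which only the first n values enter; this removes
  carrier conditions on vectors.\<close>

definition qform :: "nat \<Rightarrow> cmat \<Rightarrow> (nat \<Rightarrow> complex) \<Rightarrow> complex" where
  "qform n A v = (\<Sum>i<n. \<Sum>j<n. cnj (v i) * A $$ (i, j) * v j)"

lemma qform_vec:
  assumes "A \<in> carrier_mat n n" "v \<in> carrier_vec n"
  shows "(A *\<^sub>v v) \<bullet>c v = qform n A (\<lambda>i. v $ i)"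
  using assms by (auto simp: scalar_prod_def qform_def atLeast0LessThan sum_distrib_left sum_distrib_right mult_ac intro!: sum.cong)

lemma psd_qform: "psd n A \<longleftrightarrow> A \<in> carrier_mat n n \<and> (\<forall>v. 0 \<le> qform n A v)"
proof (safe)
  assume p: "psd n A"
  then show A: "A \<in> carrier_mat n n" by (simp add: psd_def)
  fix v
  have "qform n A v = qform n A (\<lambda>i. vec n v $ i)" unfolding qform_def by (auto intro!: sum.cong)
  also have "\<dots> = (A *\<^sub>v vec n v) \<bullet>c vec n v" by (rule qform_vec[OF A, symmetric]) simp
  also have "0 \<le> \<dots>" using p unfolding psd_def by (meson vec_carrier)
  finally show "0 \<le> qform n A v" .
next
  assume "A \<in> carrier_mat n n" "\<forall>v. 0 \<le> qform n A v"
  then show "psd n A" by (auto simp: psd_def qform_vec)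
qed

definition hermitian :: "nat \<Rightarrow> cmat \<Rightarrow> bool" where
  "hermitian n A \<longleftrightarrow> A \<in> carrier_mat n n \<and> (\<forall>i<n. \<forall>j<n. cnj (A $$ (i, j)) = A $$ (j, i))"

lemma sum_one_support:
  fixes f :: "nat \<Rightarrow> 'a :: comm_monoid_add"
  assumes "i < n" "\<And>k. k < n \<Longrightarrow> k \<noteq> i \<Longrightarrow> f k = 0"
  shows "(\<Sum>k<n. f k) = f i"
proof -
  have "(\<Sum>k<n. f k) = (\<Sum>k\<in>{i}. f k)"
    by (rule sum.mono_neutral_right) (use assms in auto)
  then show ?thesis by simp
qed

lemma sum_two_support:
  fixes f :: "nat \<Rightarrow> complex"
  assumes "i < n" "j < n" "i \<noteq> j" "\<And>k. k \<noteq> i \<Longrightarrow> k \<noteq> j \<Longrightarrow> f k = 0"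
  shows "(\<Sum>k<n. f k) = f i + f j"
proof -
  have "(\<Sum>k<n. f k) = (\<Sum>k\<in>{i,j}. f k)"
    by (rule sum.mono_neutral_right) (use assms in auto)
  then show ?thesis using assms by simp
qed

text \<open>Polarisation: that the form is real at e_i, at e_i + e_j and at e_i +
  \<open>\<i>\<close> e_j determines the imaginary part of the diagonal and relates the entries (i,
  j) and (j, i).\<close>

lemma psd_hermitian:
  assumes "psd n A"
  shows "hermitian n A"
proof -
  have A: "A \<in> carrier_mat n n" and p: "\<And>v. 0 \<le> qform n A v" using assms by (auto simp: psd_qform)
  have im: "Im (qform n A v) = 0" for v using p[of v] by (simp add: less_eq_complex_def)
  have diag: "Im (A $$ (i,i)) = 0" if "i < n" for i
  proof -
    have "qform n A (\<lambda>k. if k = i then 1 else 0) = A $$ (i,i)"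
      unfolding qform_def by (subst sum_one_support[OF that], simp, subst sum_one_support[OF that]) auto
    then show ?thesis using im by metis
  qed
  have "A $$ (j, i) = cnj (A $$ (i, j))" if ij: "i < n" "j < n" for i j
  proof (cases "i = j")
    case True
    then show ?thesis using diag ij by (simp add: complex_eq_iff)
  next
    case False
    have two: "qform n A (\<lambda>k. if k = i then x else if k = j then y else 0) =
       cnj x * A $$ (i,i) * x + cnj x * A $$ (i,j) * y + cnj y * A $$ (j,i) * x + cnj y * A $$ (j,j) * y" for x y
      unfolding qform_def using ij False
      by (subst sum_two_support[OF ij False], simp, subst (1 2) sum_two_support[OF ij False]) auto
    have a: "Im (A $$ (i,j)) + Im (A $$ (j,i)) = 0"
      using im[of "\<lambda>k. if k = i then 1 else if k = j then 1 else 0"] diag ij unfolding two by simp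
    have b: "Re (A $$ (i,j)) - Re (A $$ (j,i)) = 0"
      using im[of "\<lambda>k. if k = i then 1 else if k = j then \<i> else 0"] diag ij unfolding two by simp
    show ?thesis using a b by (simp add: complex_eq_iff)
  qed
  then have "cnj (A $$ (i, j)) = A $$ (j, i)" if "i < n" "j < n" for i j using that by metis
  then show ?thesis using A unfolding hermitian_def by blast
qed

section \<open>Orthonormal families and the spectral theorem\<close>

definition orthonormal :: "nat \<Rightarrow> nat \<Rightarrow> (nat \<Rightarrow> nat \<Rightarrow> complex) \<Rightarrow> bool" where
  "orthonormal n m u \<longleftrightarrow> (\<forall>s<m. \<forall>s'<m. (\<Sum>k<n. cnj (u s k) * u s' k) = (if s = s' then 1 else 0))"

text \<open>A left inverse of a square matrix is also a right inverse.\<close>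

lemma orthonormal_complete:
  assumes "orthonormal n n u" "i < n" "j < n"
  shows "(\<Sum>s<n. u s i * cnj (u s j)) = (if i = j then 1 else 0)"
proof -
  define U where "U = mat n n (\<lambda>(i, s). u s i)"
  define V where "V = mat n n (\<lambda>(s, i). cnj (u s i))"
  have UV: "U \<in> carrier_mat n n" "V \<in> carrier_mat n n" by (auto simp: U_def V_def)
  have "V * U = 1\<^sub>m n"
  proof (rule eq_matI)
    fix s s' assume "s < dim_row (1\<^sub>m n :: cmat)" "s' < dim_col (1\<^sub>m n :: cmat)"
    then have s: "s < n" "s' < n" by auto
    have "(V * U) $$ (s, s') = (\<Sum>k<n. cnj (u s k) * u s' k)"
      using s by (subst mat_mult_index[OF UV(2,1)]) (auto simp: U_def V_def)
    then show "(V * U) $$ (s, s') = 1\<^sub>m n $$ (s, s')" using assms(1) s by (auto simp: orthonormal_def)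
  qed (use UV in auto)
  then have "U * V = 1\<^sub>m n" by (rule mat_mult_left_right_inverse[OF UV(2,1)])
  then have "(U * V) $$ (i, j) = (if i = j then 1 else 0)" using assms by auto
  moreover have "(U * V) $$ (i, j) = (\<Sum>s<n. u s i * cnj (u s j))"
    using assms by (subst mat_mult_index[OF UV(1,2)]) (auto simp: U_def V_def)
  ultimately show ?thesis by simp
qed

text \<open>The phase is fixed so that c 0 is real and nonpositive: then 1 - c 0 is at least 1, and
  the Householder reflection taking the first basis vector to c can divide by it.\<close>

lemma exists_unit_eigenvector:
  fixes A :: "nat \<Rightarrow> nat \<Rightarrow> complex"
  assumes n: "0 < n"
  shows "\<exists>c e. (\<Sum>k<n. cnj (c k) * c k) = 1 \<and> Im (c 0) = 0 \<and> Re (c 0) \<le> 0 \<and> (\<forall>k<n. (\<Sum>l<n. A k l * c l) = e * c k)"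
proof -
  define M where "M = mat n n (\<lambda>(i, j). A i j)"
  have M: "M \<in> carrier_mat n n" by (simp add: M_def)
  obtain e where "eigenvalue M e" using spectrum_non_empty[OF M n] by (auto simp: spectrum_def)
  then obtain v where v: "v \<in> carrier_vec n" "v \<noteq> 0\<^sub>v n" "M *\<^sub>v v = e \<cdot>\<^sub>v v"
    using M by (auto simp: eigenvalue_def eigenvector_def)
  define N where "N = sqrt (\<Sum>k<n. (norm (v $ k))^2)"
  have "\<exists>k<n. v $ k \<noteq> 0" using v(1,2) by (metis carrier_vecD eq_vecI index_zero_vec)
  then obtain k0 where "k0 < n" "v $ k0 \<noteq> 0" by blast
  then have "(\<Sum>k<n. (norm (v $ k))^2) > 0"
    by (intro sum_pos2[of _ k0]) auto
  then have N: "N > 0" "N^2 = (\<Sum>k<n. (norm (v $ k))^2)" by (auto simp: N_def)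
  define ph where "ph = (if v $ 0 = 0 then 1 else - cnj (v $ 0) / norm (v $ 0))"
  have ph1: "cnj ph * ph = 1"
  proof (cases "v $ 0 = 0")
    case False
    have "cnj ph * ph = (v $ 0 * cnj (v $ 0)) / (of_real (norm (v $ 0)) * of_real (norm (v $ 0)))"
      using False by (simp add: ph_def)
    also have "v $ 0 * cnj (v $ 0) = of_real (norm (v $ 0)) * of_real (norm (v $ 0))"
      by (simp add: complex_norm_square[symmetric] power2_eq_square)
    finally show ?thesis using False by simp
  qed (simp add: ph_def)
  define c where "c k = ph / N * v $ k" for k
  have "cnj (c k) * c k = of_real ((norm (v $ k))^2 / N^2)" for k
  proof -
    have "cnj (c k) * c k = (cnj ph * ph) * (v $ k * cnj (v $ k)) / (of_real N * of_real N)"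
      by (simp add: c_def mult_ac)
    also have "\<dots> = of_real ((norm (v $ k))^2) / (of_real N * of_real N)"
      by (simp only: ph1 complex_norm_square mult_1_left)
    finally show ?thesis by (simp add: power2_eq_square)
  qed
  then have "(\<Sum>k<n. cnj (c k) * c k) = of_real (\<Sum>k<n. (norm (v $ k))^2 / N^2)" by simp
  also have "(\<Sum>k<n. (norm (v $ k))^2 / N^2) = N^2 / N^2"
    unfolding sum_divide_distrib[symmetric] by (simp only: N(2))
  also have "of_real (N^2 / N^2) = (1 :: complex)" using N(1) by simp
  finally have 1: "(\<Sum>k<n. cnj (c k) * c k) = 1" .
  have c0: "c 0 = of_real (- norm (v $ 0) / N)"
  proof (cases "v $ 0 = 0")
    case False
    have "c 0 = - (v $ 0 * cnj (v $ 0)) / (of_real (norm (v $ 0)) * of_real N)"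
      using False by (simp add: c_def ph_def)
    also have "v $ 0 * cnj (v $ 0) = of_real (norm (v $ 0)) * of_real (norm (v $ 0))"
      by (simp add: complex_norm_square[symmetric] power2_eq_square)
    finally show ?thesis using False by simp
  qed (simp add: c_def)
  have 2: "Im (c 0) = 0" "Re (c 0) \<le> 0" using N unfolding c0 by auto
  have 3: "(\<Sum>l<n. A k l * c l) = e * c k" if k: "k < n" for k
  proof -
    have "(\<Sum>l<n. A k l * v $ l) = (M *\<^sub>v v) $ k"
      using k v(1) by (auto simp: M_def scalar_prod_def atLeast0LessThan)
    also have "\<dots> = e * v $ k" using v k by simp
    finally have "(\<Sum>l<n. A k l * v $ l) = e * v $ k" .
    then have "ph / N * (\<Sum>l<n. A k l * v $ l) = ph / N * (e * v $ k)" by simp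
    then show ?thesis by (simp add: c_def sum_distrib_left mult_ac sum_divide_distrib)
  qed
  show ?thesis using 1 2 3 by blast
qed

text \<open>The operator with terms l_s |u_s><u_s|. For orthonormal u this is the spectral form, on
  which products, traces and absolute values act through l alone.\<close>

definition sdiag :: "nat \<Rightarrow> (nat \<Rightarrow> nat \<Rightarrow> complex) \<Rightarrow> (nat \<Rightarrow> real) \<Rightarrow> cmat" where
  "sdiag n u l = mat n n (\<lambda>(i, j). \<Sum>s<n. of_real (l s) * u s i * cnj (u s j))"

lemma sdiag_carrier[simp]: "sdiag n u l \<in> carrier_mat n n" by (simp add: sdiag_def)
lemma sdiag_dim[simp]: "dim_row (sdiag n u l) = n" "dim_col (sdiag n u l) = n" by (simp_all add: sdiag_def)
lemma sdiag_index: "i < n \<Longrightarrow> j < n \<Longrightarrow> sdiag n u l $$ (i, j) = (\<Sum>s<n. of_real (l s) * u s i * cnj (u s j))"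
  by (simp add: sdiag_def)

text \<open>Deflation: after conjugation by a reflection that takes the first basis vector to an
  eigenvector, the first row and column vanish off the corner, and the induction hypothesis
  diagonalises the remaining block.\<close>

theorem hermitian_spectral:
  assumes "hermitian n A"
  shows "\<exists>u l. orthonormal n n u \<and> A = sdiag n u l"
  using assms
proof (induction n arbitrary: A)
  case 0
  then show ?case by (auto simp: orthonormal_def hermitian_def sdiag_def intro!: eq_matI)
next
  case (Suc n)
  define N where "N = Suc n"
  have A: "A \<in> carrier_mat N N" and Ah: "\<And>i j. i < N \<Longrightarrow> j < N \<Longrightarrow> cnj (A $$ (i, j)) = A $$ (j, i)"
    using Suc.prems by (auto simp: hermitian_def N_def)
  have N0: "0 < N" by (simp add: N_def)
  obtain c e where c1: "(\<Sum>k<N. cnj (c k) * c k) = 1" and c0: "Im (c 0) = 0" "Re (c 0) \<le> 0"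
    and ev: "\<And>k. k < N \<Longrightarrow> (\<Sum>l<N. A $$ (k, l) * c l) = e * c k"
    using exists_unit_eigenvector[OF N0, of "\<lambda>i j. A $$ (i, j)"] by blast
  \<comment> \<open>Half the squared norm of w, because c is a unit vector and c 0 is real.\<close>
  define \<kappa> where "\<kappa> = 1 - c 0"
  have k0: "\<kappa> \<noteq> 0" using c0 by (auto simp: \<kappa>_def complex_eq_iff)
  have kc: "cnj \<kappa> = \<kappa>" using c0 by (simp add: \<kappa>_def complex_eq_iff)
  define w where "w i = (if i = 0 then 1 else 0) - c i" for i :: nat
  text \<open>Householder reflection that maps the first basis vector to \<open>c\<close>.\<close>
  define H where "H i j = (if i = j then 1 else 0) - w i * cnj (w j) / \<kappa>" for i j :: nat
  have ww: "(\<Sum>k<N. cnj (w k) * w k) = 2 * \<kappa>"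
  proof -
    have "cnj (w k) * w k = (if k = 0 then 1 - c 0 - cnj (c 0) else 0) + cnj (c k) * c k" for k
      by (simp add: w_def algebra_simps)
    then have "(\<Sum>k<N. cnj (w k) * w k) = 1 - c 0 - cnj (c 0) + 1"
      using N0 by (simp add: sum.distrib c1)
    moreover have "cnj (c 0) = c 0" using c0 by (simp add: complex_eq_iff)
    ultimately show ?thesis by (simp add: \<kappa>_def)
  qed
  have Hc: "cnj (H i j) = H j i" for i j by (simp add: H_def kc)
  have HH: "(\<Sum>k<N. H i k * H k j) = (if i = j then 1 else 0)" if "i < N" "j < N" for i j
  proof -
    have "H i k * H k j = (if k = i then (if i = j then 1 else 0) - w i * cnj (w j) / \<kappa> else 0)
       + (if k = j then - (w i * cnj (w j) / \<kappa>) else 0) + w i * cnj (w j) / (\<kappa> * \<kappa>) * (cnj (w k) * w k)" for k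
      by (simp add: H_def algebra_simps)
    moreover have "(\<Sum>k<N. w i * cnj (w j) / (\<kappa> * \<kappa>) * (cnj (w k) * w k)) = w i * cnj (w j) / (\<kappa> * \<kappa>) * (2 * \<kappa>)"
      by (simp only: sum_distrib_left[symmetric] ww)
    ultimately have "(\<Sum>k<N. H i k * H k j) = ((if i = j then 1 else 0) - w i * cnj (w j) / \<kappa>)
       + (- (w i * cnj (w j) / \<kappa>)) + w i * cnj (w j) / (\<kappa> * \<kappa>) * (2 * \<kappa>)"
      using that by (simp only: sum.distrib) simp
    then show ?thesis using k0 by (simp add: field_simps)
  qed
  have w0: "w 0 = \<kappa>" by (simp add: w_def \<kappa>_def)
  have H0: "H i 0 = c i" for i using k0 by (simp add: H_def w0 kc) (auto simp: w_def \<kappa>_def)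
  define A' where "A' i j = (\<Sum>l<N. \<Sum>k<N. H i k * A $$ (k, l) * H l j)" for i j
  have A'h: "cnj (A' i j) = A' j i" for i j
    unfolding A'_def cnj_sum
    by (subst sum.swap) (auto simp: Hc Ah mult_ac intro!: sum.cong)
  have A'0: "A' i 0 = (if i = 0 then e else 0)" if i: "i < N" for i
  proof -
    have "A' i 0 = (\<Sum>k<N. H i k * (\<Sum>l<N. A $$ (k, l) * c l))"
      unfolding A'_def H0 sum_distrib_left by (subst sum.swap) (simp add: mult_ac)
    also have "\<dots> = (\<Sum>k<N. H i k * (e * c k))" by (intro sum.cong) (auto simp: ev)
    also have "\<dots> = e * (\<Sum>k<N. H i k * H k 0)" by (simp add: H0 sum_distrib_left mult_ac)
    finally show ?thesis using HH[OF i N0] by simp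
  qed
  \<comment> \<open>The eigenvalue is the corner entry of a hermitian matrix. Its being real also
    makes the first row of A' the mirror image of the first column.\<close>
  have e: "e = of_real (Re e)" using A'h[of 0 0] A'0[OF N0] by (simp add: complex_eq_iff)
  have A'0': "A' 0 i = (if i = 0 then e else 0)" if i: "i < N" for i
    using A'h[of i 0] A'0[OF i] e by (metis complex_cnj_complex_of_real complex_cnj_zero)
  define A'' where "A'' = mat n n (\<lambda>(i, j). A' (Suc i) (Suc j))"
  have "hermitian n A''" by (simp add: hermitian_def A''_def A'h)
  then obtain u'' l'' where u'': "orthonormal n n u''" and A'': "A'' = sdiag n u'' l''" using Suc.IH by blast
  have A''i: "A' (Suc i) (Suc j) = (\<Sum>s<n. of_real (l'' s) * u'' s i * cnj (u'' s j))" if "i < n" "j < n" for i j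
    using that sdiag_index[OF that, of u'' l''] by (simp add: A''[symmetric]) (simp add: A''_def)
  define u' where "u' s k = (case s of 0 \<Rightarrow> (if k = 0 then 1 else 0) | Suc t \<Rightarrow> (case k of 0 \<Rightarrow> 0 | Suc k' \<Rightarrow> u'' t k'))" for s k :: nat
  define l where "l s = (case s of 0 \<Rightarrow> Re e | Suc t \<Rightarrow> l'' t)" for s
  have u'simp: "u' 0 0 = 1" "u' 0 (Suc k) = 0" "u' (Suc t) 0 = 0" "u' (Suc t) (Suc k) = u'' t k" for t k
    by (simp_all add: u'_def)
  have lsimp: "l 0 = Re e" "l (Suc t) = l'' t" for t by (simp_all add: l_def)
  have u'o: "(\<Sum>k<N. cnj (u' s k) * u' s' k) = (if s = s' then 1 else 0)" if "s < N" "s' < N" for s s'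
    using u'' that unfolding N_def orthonormal_def sum.lessThan_Suc_shift
    by (cases s; cases s') (simp_all add: u'simp)
  have A'u: "A' i j = (\<Sum>s<N. of_real (l s) * u' s i * cnj (u' s j))" if "i < N" "j < N" for i j
    using that A'0[of i] A'0'[of j] e A''i unfolding N_def sum.lessThan_Suc_shift
    by (cases i; cases j) (simp_all add: u'simp lsimp)
  define u where "u s i = (\<Sum>k<N. H i k * u' s k)" for s i
  have "orthonormal N N u" unfolding orthonormal_def
  proof (intro allI impI)
    fix s s' assume s: "s < N" "s' < N"
    have "(\<Sum>i<N. cnj (u s i) * u s' i) = (\<Sum>i<N. \<Sum>k<N. \<Sum>k'<N. cnj (u' s k) * u' s' k' * (H k i * H i k'))"
      unfolding u_def cnj_sum sum_product by (simp add: Hc mult_ac)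
    also have "\<dots> = (\<Sum>k<N. \<Sum>k'<N. \<Sum>i<N. cnj (u' s k) * u' s' k' * (H k i * H i k'))"
      by (subst sum.swap, rule sum.cong[OF refl], subst sum.swap, rule refl)
    also have "\<dots> = (\<Sum>k<N. \<Sum>k'<N. if k' = k then cnj (u' s k) * u' s' k' else 0)"
      by (intro sum.cong refl) (auto simp: sum_distrib_left[symmetric] HH)
    also have "\<dots> = (if s = s' then 1 else 0)" using u'o[OF s] by simp
    finally show "(\<Sum>k<N. cnj (u s k) * u s' k) = (if s = s' then 1 else 0)" .
  qed
  moreover have "A = sdiag N u l"
  proof (rule eq_matI)
    fix i j assume "i < dim_row (sdiag N u l)" "j < dim_col (sdiag N u l)"
    then have ij: "i < N" "j < N" by auto
    \<comment> \<open>H is an involution, so H A' H gives back A, and the eigenvectors of A are the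
      reflected ones of A'.\<close>
    have "(\<Sum>l'<N. \<Sum>k<N. H i k * A' k l' * H l' j)
      = (\<Sum>l'<N. \<Sum>k<N. \<Sum>m<N. \<Sum>m'<N. H i k * H k m' * (A $$ (m', m) * (H m l' * H l' j)))"
      unfolding A'_def by (simp add: sum_distrib_left sum_distrib_right mult_ac)
    also have "\<dots> = (\<Sum>m<N. \<Sum>m'<N. \<Sum>l'<N. \<Sum>k<N. H i k * H k m' * (A $$ (m', m) * (H m l' * H l' j)))"
    proof -
      have "(\<Sum>l'<N. \<Sum>k<N. \<Sum>m<N. \<Sum>m'<N. f l' k m m') = (\<Sum>m<N. \<Sum>m'<N. \<Sum>l'<N. \<Sum>k<N. f l' k m m')" for f :: "nat \<Rightarrow> nat \<Rightarrow> nat \<Rightarrow> nat \<Rightarrow> complex"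
      proof -
        have "(\<Sum>l'<N. \<Sum>k<N. \<Sum>m<N. \<Sum>m'<N. f l' k m m') = (\<Sum>l'<N. \<Sum>m<N. \<Sum>k<N. \<Sum>m'<N. f l' k m m')"
          by (rule sum.cong[OF refl], rule sum.swap)
        also have "\<dots> = (\<Sum>m<N. \<Sum>l'<N. \<Sum>k<N. \<Sum>m'<N. f l' k m m')" by (rule sum.swap)
        also have "\<dots> = (\<Sum>m<N. \<Sum>l'<N. \<Sum>m'<N. \<Sum>k<N. f l' k m m')"
          by (rule sum.cong[OF refl], rule sum.cong[OF refl], rule sum.swap)
        also have "\<dots> = (\<Sum>m<N. \<Sum>m'<N. \<Sum>l'<N. \<Sum>k<N. f l' k m m')"
          by (rule sum.cong[OF refl], rule sum.swap)
        finally show ?thesis .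
      qed
      then show ?thesis .
    qed
    also have "\<dots> = (\<Sum>m<N. \<Sum>m'<N. (\<Sum>k<N. H i k * H k m') * (A $$ (m', m) * (\<Sum>l'<N. H m l' * H l' j)))"
      by (simp add: sum_distrib_left sum_distrib_right mult_ac)
    also have "\<dots> = (\<Sum>m<N. \<Sum>m'<N. if m' = i then (if m = j then A $$ (i, j) else 0) else 0)"
      using ij by (intro sum.cong refl) (auto simp: HH)
    also have "\<dots> = A $$ (i, j)" using ij by simp
    finally have "A $$ (i, j) = (\<Sum>l'<N. \<Sum>k<N. H i k * A' k l' * H l' j)" by simp
    also have "\<dots> = (\<Sum>l'<N. \<Sum>k<N. \<Sum>s<N. of_real (l s) * (H i k * u' s k) * (H l' j * cnj (u' s l')))"
      by (intro sum.cong refl) (auto simp: A'u sum_distrib_left sum_distrib_right mult_ac intro!: sum.cong)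
    also have "\<dots> = (\<Sum>s<N. \<Sum>l'<N. \<Sum>k<N. of_real (l s) * (H i k * u' s k) * (H l' j * cnj (u' s l')))"
    proof -
      have "(\<Sum>l'<N. \<Sum>k<N. \<Sum>s<N. f l' k s) = (\<Sum>s<N. \<Sum>l'<N. \<Sum>k<N. f l' k s)" for f :: "nat \<Rightarrow> nat \<Rightarrow> nat \<Rightarrow> complex"
        by (rule sum_rotate3) 
      then show ?thesis .
    qed
    also have "\<dots> = (\<Sum>s<N. of_real (l s) * u s i * cnj (u s j))"
      unfolding u_def cnj_sum
      by (rule sum.cong[OF refl], subst sum.swap) (simp add: Hc sum_distrib_left sum_distrib_right mult_ac)
    finally show "A $$ (i, j) = sdiag N u l $$ (i, j)" using ij by (simp add: sdiag_index)
  qed (use A in auto)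
  ultimately show ?case by (auto simp: N_def)
qed

lemma sdiag_mult:
  assumes o: "orthonormal n n u"
  shows "sdiag n u l * sdiag n u m = sdiag n u (\<lambda>s. l s * m s)"
proof (rule eq_matI)
  fix i j assume "i < dim_row (sdiag n u (\<lambda>s. l s * m s))" "j < dim_col (sdiag n u (\<lambda>s. l s * m s))"
  then have ij: "i < n" "j < n" by auto
  have "(sdiag n u l * sdiag n u m) $$ (i, j) = (\<Sum>k<n. \<Sum>s<n. \<Sum>s'<n. of_real (l s) * u s i * of_real (m s') * cnj (u s' j) * (cnj (u s k) * u s' k))"
    using ij by (subst mat_mult_index[of _ n n _ n]) (auto simp: sdiag_index sum_product mult_ac)
  also have "\<dots> = (\<Sum>s<n. \<Sum>s'<n. \<Sum>k<n. of_real (l s) * u s i * of_real (m s') * cnj (u s' j) * (cnj (u s k) * u s' k))"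
    by (subst sum.swap, rule sum.cong[OF refl], rule sum.swap)
  also have "\<dots> = (\<Sum>s<n. \<Sum>s'<n. if s = s' then of_real (l s * m s) * u s i * cnj (u s j) else 0)"
    using o by (intro sum.cong refl) (simp add: sum_distrib_left[symmetric] orthonormal_def)
  finally show "(sdiag n u l * sdiag n u m) $$ (i, j) = sdiag n u (\<lambda>s. l s * m s) $$ (i, j)"
    using ij by (simp add: sdiag_index)
qed auto

lemma sdiag_adjoint: "mat_adjoint (sdiag n u l) = sdiag n u l"
  by (rule eq_matI) (auto simp: sdiag_index mult_ac)

lemma qform_sdiag: "qform n (sdiag n u l) v = of_real (\<Sum>s<n. l s * (norm (\<Sum>i<n. cnj (u s i) * v i))^2)"
proof -
  have "qform n (sdiag n u l) v = (\<Sum>i<n. \<Sum>j<n. \<Sum>s<n. of_real (l s) * ((cnj (u s j) * v j) * (u s i * cnj (v i))))"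
    unfolding qform_def by (auto simp: sdiag_index sum_distrib_left sum_distrib_right mult_ac intro!: sum.cong)
  also have "\<dots> = (\<Sum>s<n. \<Sum>i<n. \<Sum>j<n. of_real (l s) * ((cnj (u s j) * v j) * (u s i * cnj (v i))))"
    by (rule sum_rotate3)
  also have "\<dots> = (\<Sum>s<n. of_real (l s) * ((\<Sum>j<n. cnj (u s j) * v j) * cnj (\<Sum>j<n. cnj (u s j) * v j)))"
    unfolding cnj_sum sum_product
    by (rule sum.cong[OF refl], subst sum.swap) (simp add: sum_distrib_left)
  also have "\<dots> = of_real (\<Sum>s<n. l s * (norm (\<Sum>i<n. cnj (u s i) * v i))^2)"
    unfolding of_real_sum of_real_mult by (simp only: complex_norm_square)
  finally show ?thesis .
qed

lemma psd_sdiag: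
  assumes "\<And>s. s < n \<Longrightarrow> 0 \<le> l s"
  shows "psd n (sdiag n u l)"
  using assms by (auto simp: psd_qform qform_sdiag less_eq_complex_def intro!: sum_nonneg)

lemma trace_sdiag:
  assumes "orthonormal n n u"
  shows "mat_trace (sdiag n u l) = of_real (\<Sum>s<n. l s)"
proof -
  have "mat_trace (sdiag n u l) = (\<Sum>s<n. of_real (l s) * (\<Sum>i<n. cnj (u s i) * u s i))"
    unfolding sum_distrib_left mat_trace_def by (subst sum.swap) (simp add: sdiag_index mult_ac)
  also have "\<dots> = of_real (\<Sum>s<n. l s)"
    using assms by (simp add: orthonormal_def)
  finally show ?thesis .
qed

lemma sdiag_eigen:
  assumes "orthonormal n n u" "s < n" "i < n"
  shows "(\<Sum>j<n. sdiag n u l $$ (i, j) * u s j) = of_real (l s) * u s i"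
proof -
  have "(\<Sum>j<n. sdiag n u l $$ (i, j) * u s j) = (\<Sum>j<n. \<Sum>t<n. of_real (l t) * u t i * (cnj (u t j) * u s j))"
    using assms by (auto simp: sdiag_index sum_distrib_left mult_ac intro!: sum.cong)
  also have "\<dots> = (\<Sum>t<n. of_real (l t) * u t i * (\<Sum>j<n. cnj (u t j) * u s j))"
    by (subst sum.swap) (simp add: sum_distrib_left)
  also have "\<dots> = (\<Sum>t<n. if t = s then of_real (l s) * u s i else 0)"
    using assms by (intro sum.cong) (auto simp: orthonormal_def)
  finally show ?thesis using assms by simp
qed

section \<open>Positive square roots, absolute values and the trace distance\<close>

lemma qform_square:
  assumes h: "hermitian n P"
  shows "qform n (P * P) v = of_real (\<Sum>i<n. (norm (\<Sum>j<n. P $$ (i, j) * v j))^2)"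
proof -
  have P: "P \<in> carrier_mat n n" and Ph: "\<And>i j. i < n \<Longrightarrow> j < n \<Longrightarrow> cnj (P $$ (i, j)) = P $$ (j, i)"
    using h by (auto simp: hermitian_def)
  have "qform n (P * P) v = (\<Sum>i<n. \<Sum>j<n. \<Sum>k<n. (P $$ (k, j) * v j) * cnj (P $$ (k, i) * v i))"
    unfolding qform_def
    by (intro sum.cong refl, subst mat_mult_index[OF P P]) (auto simp: Ph sum_distrib_left sum_distrib_right mult_ac)
  also have "\<dots> = (\<Sum>k<n. \<Sum>i<n. \<Sum>j<n. (P $$ (k, j) * v j) * cnj (P $$ (k, i) * v i))"
    by (rule sum_rotate3)
  also have "\<dots> = (\<Sum>k<n. (\<Sum>j<n. P $$ (k, j) * v j) * cnj (\<Sum>j<n. P $$ (k, j) * v j))"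
    unfolding cnj_sum sum_product by (rule sum.cong[OF refl], rule sum.swap)
  finally show ?thesis unfolding of_real_sum complex_norm_square .
qed

text \<open>Applied with both signs, this shows that every eigenvalue of \<open>P - Q\<close> vanishes.\<close>

lemma psd_square_shift:
  assumes P: "psd n P" and Q: "psd n Q" and eq: "P * P = Q * Q"
    and v: "(\<Sum>i<n. (norm (v i))^2) = 1" "\<And>i. i < n \<Longrightarrow> (\<Sum>j<n. (P $$ (i, j) - Q $$ (i, j)) * v j) = of_real l * v i"
  shows "l \<le> 0"
proof (rule ccontr)
  assume l: "\<not> l \<le> 0"
  define y where "y i = (\<Sum>j<n. Q $$ (i, j) * v j)" for i
  have Pv: "(\<Sum>j<n. P $$ (i, j) * v j) = y i + of_real l * v i" if "i < n" for i
    using v(2)[OF that] by (simp add: y_def left_diff_distrib sum_subtractf algebra_simps)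
  \<comment> \<open>Here P v = Q v + l v with |P v| = |Q v|. Expanding the square leaves 2 l <v, Q
    v> + l^2 = 0, which is impossible for l > 0 because Q is positive.\<close>
  have nsq: "(norm (y i + of_real l * v i))^2 = (norm (y i))^2 + 2 * l * Re (cnj (v i) * y i) + l^2 * (norm (v i))^2" for i
    unfolding cmod_power2 by (simp add: power2_eq_square algebra_simps)
  have "(\<Sum>i<n. (norm (y i + of_real l * v i))^2) = (\<Sum>i<n. (norm (y i))^2)"
  proof -
    have "complex_of_real (\<Sum>i<n. (norm (y i + of_real l * v i))^2) = complex_of_real (\<Sum>i<n. (norm (y i))^2)"
      using qform_square[OF psd_hermitian[OF P], of v] qform_square[OF psd_hermitian[OF Q], of v] eq
      by (simp add: Pv y_def del: of_real_sum of_real_power)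
    then show ?thesis by (simp only: of_real_eq_iff)
  qed
  then have "2 * l * (\<Sum>i<n. Re (cnj (v i) * y i)) + l^2 = 0"
    using v(1) unfolding nsq by (simp add: sum.distrib sum_distrib_left[symmetric])
  moreover have "(\<Sum>i<n. Re (cnj (v i) * y i)) = Re (qform n Q v)"
    unfolding qform_def y_def by (simp add: sum_distrib_left mult.assoc)
  moreover have "0 \<le> Re (qform n Q v)" using Q by (auto simp: psd_qform less_eq_complex_def)
  ultimately have "2 * l * Re (qform n Q v) + l^2 = 0" "0 \<le> Re (qform n Q v)" by simp_all
  moreover have "0 \<le> 2 * l * Re (qform n Q v)" using l \<open>0 \<le> Re (qform n Q v)\<close> by simp
  ultimately show False using l by (simp add: add_nonneg_eq_0_iff)
qed

text \<open>\<open>mat_abs\<close> is a definite description, so its value can only be computed once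
  positive square roots are known to be unique.\<close>

lemma psd_sqrt_unique:
  assumes P: "psd n P" and Q: "psd n Q" and eq: "P * P = Q * Q"
  shows "P = Q"
proof -
  have C: "P \<in> carrier_mat n n" "Q \<in> carrier_mat n n" using P Q by (auto simp: psd_def)
  have "hermitian n (P - Q)"
    using psd_hermitian[OF P] psd_hermitian[OF Q] by (auto simp: hermitian_def)
  then obtain u l where u: "orthonormal n n u" and D: "P - Q = sdiag n u l" using hermitian_spectral by blast
  have "l s = 0" if s: "s < n" for s
  proof -
    have "complex_of_real (\<Sum>i<n. (norm (u s i))^2) = 1"
      using u s unfolding of_real_sum complex_norm_square orthonormal_def by (auto simp: mult.commute)
    then have n1: "(\<Sum>i<n. (norm (u s i))^2) = 1" by (simp only: of_real_eq_1_iff)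
    have e: "(\<Sum>j<n. (P $$ (i, j) - Q $$ (i, j)) * u s j) = of_real (l s) * u s i" if "i < n" for i
    proof -
      have "(\<Sum>j<n. (P $$ (i, j) - Q $$ (i, j)) * u s j) = (\<Sum>j<n. (P - Q) $$ (i, j) * u s j)"
        using C that by (intro sum.cong) auto
      then show ?thesis unfolding D using sdiag_eigen[OF u s that] by simp
    qed
    have "l s \<le> 0" by (rule psd_square_shift[OF P Q eq n1 e])
    moreover have "- l s \<le> 0"
    proof (rule psd_square_shift[OF Q P eq[symmetric] n1])
      fix i assume "i < n"
      from e[OF this] show "(\<Sum>j<n. (Q $$ (i, j) - P $$ (i, j)) * u s j) = of_real (- l s) * u s i"
        by (simp add: left_diff_distrib sum_subtractf) (metis minus_diff_eq)
    qed
    ultimately show ?thesis by simp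
  qed
  then have "P - Q = 0\<^sub>m n n" unfolding D by (intro eq_matI) (auto simp: sdiag_index)
  then have z: "(P - Q) $$ (i, j) = 0" if "i < n" "j < n" for i j using that by simp
  show ?thesis
  proof (rule eq_matI)
    fix i j assume "i < dim_row Q" "j < dim_col Q"
    then show "P $$ (i, j) = Q $$ (i, j)" using z[of i j] C by auto
  qed (use C in auto)
qed

lemma mat_abs_sdiag:
  assumes o: "orthonormal n n u"
  shows "mat_abs n (sdiag n u l) = sdiag n u (\<lambda>s. \<bar>l s\<bar>)"
proof -
  have p: "psd n (sdiag n u (\<lambda>s. \<bar>l s\<bar>))" by (rule psd_sdiag) simp
  have e: "sdiag n u (\<lambda>s. \<bar>l s\<bar>) * sdiag n u (\<lambda>s. \<bar>l s\<bar>) = mat_adjoint (sdiag n u l) * sdiag n u l"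
    by (simp add: sdiag_mult[OF o] sdiag_adjoint)
  show ?thesis unfolding mat_abs_def
  proof (rule the_equality)
    show "psd n (sdiag n u (\<lambda>s. \<bar>l s\<bar>)) \<and>
      sdiag n u (\<lambda>s. \<bar>l s\<bar>) * sdiag n u (\<lambda>s. \<bar>l s\<bar>) = mat_adjoint (sdiag n u l) * sdiag n u l"
      using p e by blast
    fix P assume "psd n P \<and> P * P = mat_adjoint (sdiag n u l) * sdiag n u l"
    then have "psd n P" "P * P = sdiag n u (\<lambda>s. \<bar>l s\<bar>) * sdiag n u (\<lambda>s. \<bar>l s\<bar>)" using e by simp_all
    then show "P = sdiag n u (\<lambda>s. \<bar>l s\<bar>)" by (rule psd_sqrt_unique[OF _ p])
  qed
qed

lemma tdist_sdiag:
  assumes "orthonormal n n u" "\<rho> - \<sigma> = sdiag n u l"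
  shows "tdist n \<rho> \<sigma> = (\<Sum>s<n. \<bar>l s\<bar>) / 2"
  unfolding tdist_def assms(2) by (simp add: mat_abs_sdiag[OF assms(1)] trace_sdiag[OF assms(1)])

section \<open>Traces of tests against states\<close>

definition mtr :: "nat \<Rightarrow> cmat \<Rightarrow> cmat \<Rightarrow> complex" where
  "mtr n T X = (\<Sum>i<n. \<Sum>j<n. T $$ (i, j) * X $$ (j, i))"

lemma mtr_sdiag: "mtr n T (sdiag n u l) = (\<Sum>s<n. of_real (l s) * qform n T (u s))"
proof -
  have "mtr n T (sdiag n u l) = (\<Sum>i<n. \<Sum>j<n. \<Sum>s<n. of_real (l s) * (cnj (u s i) * T $$ (i, j) * u s j))"
    unfolding mtr_def by (auto simp: sdiag_index sum_distrib_left mult_ac intro!: sum.cong)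
  also have "\<dots> = (\<Sum>s<n. \<Sum>i<n. \<Sum>j<n. of_real (l s) * (cnj (u s i) * T $$ (i, j) * u s j))"
    by (rule sum_rotate3)
  finally show ?thesis by (simp add: qform_def sum_distrib_left)
qed

lemma orthonormal_norm:
  assumes "orthonormal n m u" "s < m"
  shows "(\<Sum>i<n. (norm (u s i))^2) = 1"
proof -
  have "complex_of_real (\<Sum>i<n. (norm (u s i))^2) = 1"
    using assms unfolding of_real_sum complex_norm_square orthonormal_def by (auto simp: mult.commute)
  then show ?thesis by (simp only: of_real_eq_1_iff)
qed

text \<open>In an eigenbasis of the difference each eigenvalue is weighted by a number between 0 and
  c. The factor 2 arises since the sum of the absolute eigenvalues is twice
  \<open>tdist\<close>.\<close>

lemma tdist_test:
  assumes h: "hermitian n (\<rho> - \<sigma>)"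
    and T: "\<And>v. 0 \<le> Re (qform n T v)" "\<And>v. Re (qform n T v) \<le> c * (\<Sum>i<n. (norm (v i))^2)"
  shows "\<bar>Re (mtr n T (\<rho> - \<sigma>))\<bar> \<le> 2 * c * tdist n \<rho> \<sigma>"
proof -
  obtain u l where u: "orthonormal n n u" and D: "\<rho> - \<sigma> = sdiag n u l" using hermitian_spectral[OF h] by blast
  have "\<bar>Re (mtr n T (\<rho> - \<sigma>))\<bar> = \<bar>\<Sum>s<n. l s * Re (qform n T (u s))\<bar>" unfolding D mtr_sdiag by simp
  also have "\<dots> \<le> (\<Sum>s<n. \<bar>l s\<bar> * c)"
  proof (intro order.trans[OF sum_abs] sum_mono)
    fix s assume s: "s \<in> {..<n}"
    have "\<bar>l s * Re (qform n T (u s))\<bar> = \<bar>l s\<bar> * Re (qform n T (u s))" using T(1) by (simp add: abs_mult)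
    also have "\<dots> \<le> \<bar>l s\<bar> * c" using T(2)[of "u s"] orthonormal_norm[OF u, of s] s by (intro mult_left_mono) auto
    finally show "\<bar>l s * Re (qform n T (u s))\<bar> \<le> \<bar>l s\<bar> * c" .
  qed
  also have "\<dots> = 2 * c * tdist n \<rho> \<sigma>" unfolding tdist_sdiag[OF u D] by (simp add: sum_distrib_left mult_ac)
  finally show ?thesis .
qed

lemma psd_spectral:
  assumes "psd n \<tau>"
  shows "\<exists>u l. orthonormal n n u \<and> \<tau> = sdiag n u l \<and> (\<forall>s<n. 0 \<le> l s)"
proof -
  obtain u l where u: "orthonormal n n u" and D: "\<tau> = sdiag n u l"
    using hermitian_spectral[OF psd_hermitian[OF assms]] by blast
  have "0 \<le> l s" if s: "s < n" for s
  proof -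
    have "qform n \<tau> (u s) = (\<Sum>t<n. of_real (l t * (norm (\<Sum>i<n. cnj (u t i) * u s i))^2))"
      unfolding D qform_sdiag by simp
    also have "\<dots> = (\<Sum>t<n. if t = s then of_real (l s) else 0)"
      using u s by (intro sum.cong) (auto simp: orthonormal_def)
    finally have "Re (qform n \<tau> (u s)) = l s" using s by simp
    moreover have "0 \<le> Re (qform n \<tau> (u s))" using assms by (auto simp: psd_qform less_eq_complex_def)
    ultimately show ?thesis by simp
  qed
  then show ?thesis using u D by blast
qed

lemma mtr_mono:
  assumes "psd n \<tau>" "\<And>v. Re (qform n M v) \<le> Re (qform n Z v)"
  shows "Re (mtr n M \<tau>) \<le> Re (mtr n Z \<tau>)"
proof -
  obtain u l where "orthonormal n n u" "\<tau> = sdiag n u l" "\<forall>s<n. 0 \<le> l s" using psd_spectral[OF assms(1)] by blast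
  then show ?thesis using assms(2) by (auto simp: mtr_sdiag intro!: sum_mono mult_left_mono)
qed

text \<open>Every unit eigenvector of \<tau> contributes at most C, and the eigenvalues sum to the
  trace.\<close>

lemma mtr_sum_le:
  assumes "psd n \<tau>" "\<And>v. (\<Sum>i\<in>I. Re (qform n (M i) v)) \<le> C * (\<Sum>i<n. (norm (v i))^2)"
  shows "(\<Sum>i\<in>I. Re (mtr n (M i) \<tau>)) \<le> C * Re (mat_trace \<tau>)"
proof -
  obtain u l where u: "orthonormal n n u" "\<tau> = sdiag n u l" "\<forall>s<n. 0 \<le> l s" using psd_spectral[OF assms(1)] by blast
  have "(\<Sum>i\<in>I. Re (mtr n (M i) \<tau>)) = (\<Sum>s<n. l s * (\<Sum>i\<in>I. Re (qform n (M i) (u s))))"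
    unfolding u(2) mtr_sdiag sum_distrib_left by (subst sum.swap) simp
  also have "\<dots> \<le> (\<Sum>s<n. l s * C)"
  proof (intro sum_mono mult_left_mono)
    fix s assume s: "s \<in> {..<n}"
    show "(\<Sum>i\<in>I. Re (qform n (M i) (u s))) \<le> C" using assms(2)[of "u s"] orthonormal_norm[OF u(1), of s] s by simp
    show "0 \<le> l s" using u(3) s by simp
  qed
  also have "\<dots> = C * Re (mat_trace \<tau>)" unfolding u(2) trace_sdiag[OF u(1)] by (simp add: sum_distrib_left mult_ac)
  finally show ?thesis .
qed

lemma parseval:
  assumes "orthonormal n n u"
  shows "(\<Sum>s<n. (norm (\<Sum>i<n. cnj (u s i) * v i))^2) = (\<Sum>i<n. (norm (v i))^2)"
  by (rule isometry_sum) (use orthonormal_complete[OF assms] in auto)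

lemma qform_parallelogram:
  assumes "psd n M"
  shows "Re (qform n M (\<lambda>i. w i + y i)) \<le> 2 * Re (qform n M w) + 2 * Re (qform n M y)"
proof -
  have "qform n M (\<lambda>i. w i + y i) + qform n M (\<lambda>i. w i - y i) = 2 * qform n M w + 2 * qform n M y"
    unfolding qform_def sum.distrib[symmetric] sum_distrib_left
    by (intro sum.cong refl) (simp add: algebra_simps)
  then have "Re (qform n M (\<lambda>i. w i + y i)) + Re (qform n M (\<lambda>i. w i - y i)) = 2 * Re (qform n M w) + 2 * Re (qform n M y)"
    by (metis (no_types, lifting) complex_add_cnj mult_2 plus_complex.simps(1))
  moreover have "0 \<le> Re (qform n M (\<lambda>i. w i - y i))" using assms by (auto simp: psd_qform less_eq_complex_def)
  ultimately show ?thesis by linarith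
qed

text \<open>
  \<open>2Y(Y + 1)\<^sup>-\<^sup>1\<close> dominates every \<open>M \<le> min(Y, 1)\<close> although it is bounded by \<open>2\<close>, which
  in general fails for \<open>Y\<close> itself.
\<close>

lemma bounded_majorant:
  assumes Y: "psd n Y"
  shows "\<exists>Z. psd n Z \<and> (\<forall>v. Re (qform n Z v) \<le> 2 * (\<Sum>i<n. (norm (v i))^2)) \<and>
    (\<forall>v. Re (qform n Z v) \<le> 2 * Re (qform n Y v)) \<and>
    (\<forall>M. psd n M \<longrightarrow> (\<forall>v. Re (qform n M v) \<le> Re (qform n Y v)) \<longrightarrow>
      (\<forall>v. Re (qform n M v) \<le> (\<Sum>i<n. (norm (v i))^2)) \<longrightarrow> (\<forall>v. Re (qform n M v) \<le> Re (qform n Z v)))"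
proof -
  obtain u l where u: "orthonormal n n u" "Y = sdiag n u l" "\<forall>s<n. 0 \<le> l s" using psd_spectral[OF Y] by blast
  define Z where "Z = sdiag n u (\<lambda>s. 2 * l s / (1 + l s))"
  define c where "c v s = (\<Sum>i<n. cnj (u s i) * v i)" for v :: "nat \<Rightarrow> complex" and s
  have qZ: "Re (qform n Z v) = (\<Sum>s<n. 2 * l s / (1 + l s) * (norm (c v s))^2)" for v
    by (simp add: Z_def qform_sdiag c_def)
  have qY: "Re (qform n Y v) = (\<Sum>s<n. l s * (norm (c v s))^2)" for v
    by (simp add: u(2) qform_sdiag c_def)
  have pv: "(\<Sum>s<n. (norm (c v s))^2) = (\<Sum>i<n. (norm (v i))^2)" for v
    unfolding c_def by (rule parseval[OF u(1)])
  have "psd n Z" unfolding Z_def using u(3) by (intro psd_sdiag) auto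
  moreover have "Re (qform n Z v) \<le> 2 * (\<Sum>i<n. (norm (v i))^2)" for v
  proof -
    have "Re (qform n Z v) \<le> (\<Sum>s<n. 2 * (norm (c v s))^2)" unfolding qZ
    proof (intro sum_mono mult_right_mono)
      fix s assume "s \<in> {..<n}"
      then have "0 \<le> l s" using u(3) by auto
      then show "2 * l s / (1 + l s) \<le> 2" by (simp add: field_simps)
    qed auto
    then show ?thesis by (simp add: sum_distrib_left[symmetric] pv)
  qed
  moreover have "Re (qform n Z v) \<le> 2 * Re (qform n Y v)" for v
    unfolding qZ qY sum_distrib_left
  proof (intro sum_mono)
    fix s assume "s \<in> {..<n}"
    then have l: "0 \<le> l s" using u(3) by auto
    then have "2 * l s / (1 + l s) \<le> 2 * l s" by (simp add: divide_le_eq mult_le_cancel_left1)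
    then have "2 * l s / (1 + l s) * (norm (c v s))^2 \<le> 2 * l s * (norm (c v s))^2" by (rule mult_right_mono) simp
    then show "2 * l s / (1 + l s) * (norm (c v s))^2 \<le> 2 * (l s * (norm (c v s))^2)" by (simp add: mult.assoc)
  qed
  moreover have "Re (qform n M v) \<le> Re (qform n Z v)"
    if M: "psd n M" and MY: "\<forall>v. Re (qform n M v) \<le> Re (qform n Y v)"
      and M1: "\<forall>v. Re (qform n M v) \<le> (\<Sum>i<n. (norm (v i))^2)" for M v
  proof -
    define comb where "comb g i = (\<Sum>s<n. of_real (g s) * c v s * u s i)" for g :: "nat \<Rightarrow> real" and i
    have cc: "c (comb g) s = of_real (g s) * c v s" if s: "s < n" for g s
    proof -
      have "c (comb g) s = (\<Sum>t<n. of_real (g t) * c v t * (\<Sum>i<n. cnj (u s i) * u t i))"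
        unfolding c_def[of "comb g"] comb_def sum_distrib_left by (subst sum.swap) (simp add: mult_ac)
      also have "\<dots> = (\<Sum>t<n. if t = s then of_real (g s) * c v s else 0)"
        using u(1) s by (intro sum.cong) (auto simp: orthonormal_def)
      finally show ?thesis using s by simp
    qed
    \<comment> \<open>These are w = (1 + Y)^(-1) v and y = Y (1 + Y)^(-1) v, with sum v. Bounding M
      by Y on w and by 1 on y gives, for an eigenvalue l of Y, the weight 2 (l + l^2) / (1 + l)^2 =
      2 l / (1 + l), which is that of Z.\<close>
    define w where "w = comb (\<lambda>s. 1 / (1 + l s))"
    define y where "y = comb (\<lambda>s. l s / (1 + l s))"
    have v: "v i = w i + y i" if i: "i < n" for i
    proof -
      have "w i + y i = (\<Sum>s<n. c v s * u s i)"
        unfolding w_def y_def comb_def sum.distrib[symmetric]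
      proof (intro sum.cong refl)
        fix s assume "s \<in> {..<n}"
        then have "1 + l s \<noteq> 0" using u(3) by (auto simp: add_nonneg_eq_0_iff)
        then have "1 / (1 + l s) + l s / (1 + l s) = 1" by (simp add: add_divide_distrib[symmetric])
        then have "complex_of_real (1 / (1 + l s)) + of_real (l s / (1 + l s)) = 1" by (metis of_real_1 of_real_add)
        then show "complex_of_real (1 / (1 + l s)) * c v s * u s i + complex_of_real (l s / (1 + l s)) * c v s * u s i = c v s * u s i"
          by (metis (no_types, lifting) distrib_right mult_1)
      qed
      also have "\<dots> = (\<Sum>k<n. v k * (\<Sum>s<n. u s i * cnj (u s k)))"
        unfolding c_def sum_distrib_left sum_distrib_right by (subst sum.swap) (simp add: mult_ac)
      also have "\<dots> = (\<Sum>k<n. if k = i then v i else 0)"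
        using i by (intro sum.cong) (auto simp: orthonormal_complete[OF u(1)])
      finally show ?thesis using i by simp
    qed
    have "Re (qform n M v) = Re (qform n M (\<lambda>i. w i + y i))"
      unfolding qform_def by (auto simp: v intro!: arg_cong[of _ _ Re] sum.cong)
    also have "\<dots> \<le> 2 * Re (qform n M w) + 2 * Re (qform n M y)" by (rule qform_parallelogram[OF M])
    also have "\<dots> \<le> 2 * Re (qform n Y w) + 2 * (\<Sum>i<n. (norm (y i))^2)" using MY M1 by (intro add_mono mult_left_mono) auto
    also have "\<dots> = (\<Sum>s<n. 2 * (l s * (norm (c w s))^2) + 2 * (norm (c y s))^2)"
      unfolding qY pv[of y, symmetric] sum_distrib_left sum.distrib ..
    also have "\<dots> = Re (qform n Z v)" unfolding qZ
    proof (intro sum.cong refl)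
      fix s assume "s \<in> {..<n}"
      then have s: "s < n" and l: "0 \<le> l s" using u(3) by auto
      then have ne: "1 + l s \<noteq> 0" by (simp add: add_nonneg_eq_0_iff)
      have "2 * (l s * (norm (c w s))^2) + 2 * (norm (c y s))^2 = (2 * l s * (1 / (1 + l s))^2 + 2 * (l s / (1 + l s))^2) * (norm (c v s))^2"
        unfolding w_def y_def cc[OF s] norm_mult norm_of_real power_mult_distrib power2_abs by (simp add: algebra_simps)
      also have "2 * l s * (1 / (1 + l s))^2 + 2 * (l s / (1 + l s))^2 = 2 * l s / (1 + l s)"
      proof -
        have "2 * l s * (1 / (1 + l s))^2 + 2 * (l s / (1 + l s))^2 = (2 * l s + 2 * (l s * l s)) / ((1 + l s) * (1 + l s))"
          by (simp add: power_divide power2_eq_square add_divide_distrib)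
        also have "2 * l s + 2 * (l s * l s) = 2 * l s * (1 + l s)" by (simp add: algebra_simps)
        finally show ?thesis using ne by simp
      qed
      finally show "2 * (l s * (norm (c w s))^2) + 2 * (norm (c y s))^2 = 2 * l s / (1 + l s) * (norm (c v s))^2" .
    qed
    finally show ?thesis .
  qed
  ultimately show ?thesis by blast
qed

lemma tdist_diag:
  assumes "\<rho> - \<sigma> = mat n n (\<lambda>(i, j). if i = j then of_real (g i) else 0)"
  shows "tdist n \<rho> \<sigma> = (\<Sum>i<n. \<bar>g i\<bar>) / 2"
proof (rule tdist_sdiag)
  define u where "u s i = (if s = i then 1 else 0 :: complex)" for s i :: nat
  show "orthonormal n n u" unfolding orthonormal_def
  proof (intro allI impI)
    fix s s' assume "s < n" "s' < n"
    then show "(\<Sum>k<n. cnj (u s k) * u s' k) = (if s = s' then 1 else 0)"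
      by (subst sum_one_support[of s]) (auto simp: u_def)
  qed
  show "\<rho> - \<sigma> = sdiag n u g" unfolding assms
  proof (rule eq_matI)
    fix i j assume "i < dim_row (sdiag n u g)" "j < dim_col (sdiag n u g)"
    then have ij: "i < n" "j < n" by auto
    have "sdiag n u g $$ (i, j) = of_real (g i) * u i i * cnj (u i j)"
      unfolding sdiag_index[OF ij] by (rule sum_one_support[OF ij(1)]) (auto simp: u_def)
    then show "mat n n (\<lambda>(i, j). if i = j then complex_of_real (g i) else 0) $$ (i, j) = sdiag n u g $$ (i, j)"
      using ij by (simp add: u_def)
  qed auto
qed

lemma tdist_self:
  assumes "\<rho> \<in> carrier_mat n n"
  shows "tdist n \<rho> \<rho> = 0"
proof -
  have "\<rho> - \<rho> = mat n n (\<lambda>(i, j). if i = j then of_real ((\<lambda>_. 0) i) else 0)"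
    using assms by (intro eq_matI) auto
  from tdist_diag[OF this] show ?thesis by simp
qed

section \<open>LOPC operations on product states\<close>

lemma kron_dim[simp]:
  "dim_row (A \<otimes>\<^sub>m B) = dim_row A * dim_row B" "dim_col (A \<otimes>\<^sub>m B) = dim_col A * dim_col B"
  by (simp_all add: kron_def)

lemma kron_carrier: "A \<in> carrier_mat a b \<Longrightarrow> B \<in> carrier_mat c d \<Longrightarrow> A \<otimes>\<^sub>m B \<in> carrier_mat (a * c) (b * d)"
  by auto

lemma div_mod_add: "k < (b::nat) \<Longrightarrow> (i * b + k) div b = i" "k < b \<Longrightarrow> (i * b + k) mod b = k"
  by simp_all

lemma kron_index:
  assumes "A \<in> carrier_mat a a'" "B \<in> carrier_mat b b'" "i < a" "k < b" "j < a'" "l < b'"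
  shows "(A \<otimes>\<^sub>m B) $$ (i * b + k, j * b' + l) = A $$ (i, j) * B $$ (k, l)"
  using assms by (auto simp: kron_def mult_add_less)

lemma eq_mat_kronI:
  assumes "X \<in> carrier_mat (a * b) (a' * b')" "Y \<in> carrier_mat (a * b) (a' * b')"
    and "\<And>i k j l. i < a \<Longrightarrow> k < b \<Longrightarrow> j < a' \<Longrightarrow> l < b' \<Longrightarrow> X $$ (i * b + k, j * b' + l) = Y $$ (i * b + k, j * b' + l)"
  shows "X = Y"
proof (rule eq_matI)
  fix r s assume "r < dim_row Y" "s < dim_col Y"
  then have "r < a * b" "s < a' * b'" using assms by auto
  then show "X $$ (r, s) = Y $$ (r, s)" using assms(3) by (auto elim!: less_mult_cases)
qed (use assms in auto)

lemma kron_assoc: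
  assumes "A \<in> carrier_mat a a'" "B \<in> carrier_mat b b'" "C \<in> carrier_mat c c'"
  shows "A \<otimes>\<^sub>m B \<otimes>\<^sub>m C = A \<otimes>\<^sub>m (B \<otimes>\<^sub>m C)"
proof (rule eq_mat_kronI[where a=a and b="b * c" and a'=a' and b'="b' * c'"])
  fix i k j l assume i: "i < a" and k: "k < b * c" and j: "j < a'" and l: "l < b' * c'"
  obtain k1 k2 where k12: "k1 < b" "k2 < c" "k = k1 * c + k2" using k by (rule less_mult_cases)
  obtain l1 l2 where l12: "l1 < b'" "l2 < c'" "l = l1 * c' + l2" using l by (rule less_mult_cases)
  have "(A \<otimes>\<^sub>m (B \<otimes>\<^sub>m C)) $$ (i * (b * c) + k, j * (b' * c') + l) = A $$ (i, j) * (B $$ (k1, l1) * C $$ (k2, l2))"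
    using kron_index[OF assms(1) kron_carrier[OF assms(2,3)] i k j l]
      kron_index[OF assms(2,3) k12(1,2) l12(1,2)] by (simp add: k12 l12)
  moreover have "(A \<otimes>\<^sub>m B \<otimes>\<^sub>m C) $$ ((i * b + k1) * c + k2, (j * b' + l1) * c' + l2) = A $$ (i, j) * B $$ (k1, l1) * C $$ (k2, l2)"
    using kron_index[OF kron_carrier[OF assms(1,2)] assms(3) mult_add_less[OF i k12(1)] k12(2) mult_add_less[OF j l12(1)] l12(2)]
      kron_index[OF assms(1,2) i k12(1) j l12(1)] by simp
  ultimately show "(A \<otimes>\<^sub>m B \<otimes>\<^sub>m C) $$ (i * (b * c) + k, j * (b' * c') + l) = (A \<otimes>\<^sub>m (B \<otimes>\<^sub>m C)) $$ (i * (b * c) + k, j * (b' * c') + l)"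
    by (simp add: k12 l12 algebra_simps)
qed (use assms in \<open>auto simp: mult.assoc\<close>)

lemma kron_mult:
  assumes "A \<in> carrier_mat a a'" "B \<in> carrier_mat b b'" "C \<in> carrier_mat a' a''" "D \<in> carrier_mat b' b''"
  shows "(A \<otimes>\<^sub>m B) * (C \<otimes>\<^sub>m D) = (A * C) \<otimes>\<^sub>m (B * D)"
proof (rule eq_mat_kronI[where a=a and b=b and a'=a'' and b'=b''])
  fix i k j l assume i: "i < a" and k: "k < b" and j: "j < a''" and l: "l < b''"
  have "((A \<otimes>\<^sub>m B) * (C \<otimes>\<^sub>m D)) $$ (i * b + k, j * b'' + l)
     = (\<Sum>m<a'. \<Sum>n<b'. (A \<otimes>\<^sub>m B) $$ (i * b + k, m * b' + n) * (C \<otimes>\<^sub>m D) $$ (m * b' + n, j * b'' + l))"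
    using mat_mult_index[OF kron_carrier[OF assms(1,2)] kron_carrier[OF assms(3,4)] mult_add_less[OF i k] mult_add_less[OF j l]]
    by (simp add: sum_lessThan_mult)
  also have "\<dots> = (\<Sum>m<a'. \<Sum>n<b'. (A $$ (i, m) * C $$ (m, j)) * (B $$ (k, n) * D $$ (n, l)))"
    using i j k l by (intro sum.cong refl) (simp add: kron_index[OF assms(1,2)] kron_index[OF assms(3,4)])
  also have "\<dots> = (A * C) $$ (i, j) * (B * D) $$ (k, l)"
    using mat_mult_index[OF assms(1,3) i j] mat_mult_index[OF assms(2,4) k l] by (simp add: sum_product)
  also have "\<dots> = ((A * C) \<otimes>\<^sub>m (B * D)) $$ (i * b + k, j * b'' + l)"
    using kron_index[of "A * C" a a'' "B * D" b b''] assms i j k l by auto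
  finally show "((A \<otimes>\<^sub>m B) * (C \<otimes>\<^sub>m D)) $$ (i * b + k, j * b'' + l) = ((A * C) \<otimes>\<^sub>m (B * D)) $$ (i * b + k, j * b'' + l)" .
qed (use assms in auto)

lemma kron_adjoint:
  assumes "A \<in> carrier_mat a a'" "B \<in> carrier_mat b b'"
  shows "mat_adjoint (A \<otimes>\<^sub>m B) = mat_adjoint A \<otimes>\<^sub>m mat_adjoint B"
proof (rule eq_mat_kronI[where a=a' and b=b' and a'=a and b'=b])
  fix i k j l assume i: "i < a'" and k: "k < b'" and j: "j < a" and l: "l < b"
  show "mat_adjoint (A \<otimes>\<^sub>m B) $$ (i * b' + k, j * b + l) = (mat_adjoint A \<otimes>\<^sub>m mat_adjoint B) $$ (i * b' + k, j * b + l)"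
    using kron_index[OF assms j l i k] kron_index[of "mat_adjoint A" a' a "mat_adjoint B" b' b i k j l] assms i j k l
    by (simp add: mult_add_less)
qed (use assms in auto)

lemma kron_one_right: "A \<in> carrier_mat a b \<Longrightarrow> A \<otimes>\<^sub>m 1\<^sub>m 1 = A"
  by (rule eq_matI) (auto simp: kron_def)

lemma kron_one_left: "A \<in> carrier_mat a b \<Longrightarrow> 1\<^sub>m 1 \<otimes>\<^sub>m A = A"
  by (rule eq_matI) (auto simp: kron_def)

lemma kron_sandwich:
  assumes "V \<in> carrier_mat a' a" "W \<in> carrier_mat b' b" "A \<in> carrier_mat a a" "B \<in> carrier_mat b b"
  shows "(V \<otimes>\<^sub>m W) * (A \<otimes>\<^sub>m B) * mat_adjoint (V \<otimes>\<^sub>m W) = (V * A * mat_adjoint V) \<otimes>\<^sub>m (W * B * mat_adjoint W)"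
  unfolding kron_adjoint[OF assms(1,2)] kron_mult[OF assms(1,2,3,4)]
  by (rule kron_mult) (use assms in auto)

lemma mat_trace_kron:
  assumes "A \<in> carrier_mat a a" "B \<in> carrier_mat b b"
  shows "mat_trace (A \<otimes>\<^sub>m B) = mat_trace A * mat_trace B"
  using assms by (auto simp: mat_trace_def sum_lessThan_mult sum_product kron_index[OF assms] intro!: sum.cong)

lemma hermitian_kron:
  assumes "hermitian a A" "hermitian b B"
  shows "hermitian (a * b) (A \<otimes>\<^sub>m B)"
  using assms unfolding hermitian_def all_less_mult
  by (auto simp: kron_index[of A a a B b b])

text \<open>The form of V A V* at v is the form of A at V* v.\<close>

lemma psd_sandwich:
  assumes "psd n A" "V \<in> carrier_mat m n"
  shows "psd m (V * A * mat_adjoint V)"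
  unfolding psd_qform
proof (intro conjI allI)
  have A: "A \<in> carrier_mat n n" using assms by (simp add: psd_def)
  show "V * A * mat_adjoint V \<in> carrier_mat m m" using assms A by auto
  fix v
  have "qform m (V * A * mat_adjoint V) v = (\<Sum>i<m. \<Sum>j<m. \<Sum>l<n. \<Sum>k<n. (cnj (cnj (V $$ (i, k)) * v i)) * A $$ (k, l) * (cnj (V $$ (j, l)) * v j))"
    unfolding qform_def
  proof (intro sum.cong refl)
    fix i j assume "i \<in> {..<m}" "j \<in> {..<m}"
    then have ij: "i < m" "j < m" by auto
    have "(V * A * mat_adjoint V) $$ (i, j) = (\<Sum>l<n. (\<Sum>k<n. V $$ (i, k) * A $$ (k, l)) * cnj (V $$ (j, l)))"
      using assms(2) A ij
      by (subst mat_mult_index[of _ m n _ m]) (auto simp: mat_mult_index[OF assms(2) A] simp del: index_mult_mat(1) intro!: sum.cong)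
    then show "cnj (v i) * (V * A * mat_adjoint V) $$ (i, j) * v j = (\<Sum>l<n. \<Sum>k<n. (cnj (cnj (V $$ (i, k)) * v i)) * A $$ (k, l) * (cnj (V $$ (j, l)) * v j))"
      by (simp add: sum_distrib_left sum_distrib_right mult_ac)
  qed
  also have "\<dots> = (\<Sum>l<n. \<Sum>i<m. \<Sum>j<m. \<Sum>k<n. (cnj (cnj (V $$ (i, k)) * v i)) * A $$ (k, l) * (cnj (V $$ (j, l)) * v j))"
    by (rule sum_rotate3)
  also have "\<dots> = (\<Sum>l<n. \<Sum>k<n. \<Sum>i<m. \<Sum>j<m. (cnj (cnj (V $$ (i, k)) * v i)) * A $$ (k, l) * (cnj (V $$ (j, l)) * v j))"
    by (rule sum.cong[OF refl], rule sum_rotate3)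
  also have "\<dots> = qform n A (\<lambda>k. \<Sum>i<m. cnj (V $$ (i, k)) * v i)"
    unfolding qform_def cnj_sum
    by (subst sum.swap) (simp add: sum_distrib_left sum_distrib_right mult_ac)
  finally show "0 \<le> qform m (V * A * mat_adjoint V) v" using assms(1) by (simp add: psd_qform)
qed

section \<open>Linear maps acting on one tensor factor\<close>

lemma mat_sum_carrier[simp]: "mat_sum n I F \<in> carrier_mat n n" by (simp add: mat_sum_def)
lemma mat_sum_dim[simp]: "dim_row (mat_sum n I F) = n" "dim_col (mat_sum n I F) = n" by (simp_all add: mat_sum_def)
lemma mat_sum_index[simp]: "i < n \<Longrightarrow> j < n \<Longrightarrow> mat_sum n I F $$ (i, j) = (\<Sum>k\<in>I. F k $$ (i, j))" by (simp add: mat_sum_def)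

lemma mat_sum_cong: "(\<And>k. k \<in> I \<Longrightarrow> F k = G k) \<Longrightarrow> mat_sum n I F = mat_sum n I G"
  by (simp add: mat_sum_def)

lemma linear_map_mat_sum:
  assumes "linear_map m n \<Lambda>" "finite I" "\<And>k. k \<in> I \<Longrightarrow> F k \<in> carrier_mat m m"
  shows "\<Lambda> (mat_sum m I F) = mat_sum n I (\<lambda>k. \<Lambda> (F k))"
  using assms(2,3)
proof (induction I)
  case empty
  have "\<Lambda> (0 \<cdot>\<^sub>m (0\<^sub>m m m)) = 0 \<cdot>\<^sub>m \<Lambda> (0\<^sub>m m m)"
    using assms(1) zero_carrier_mat unfolding linear_map_def by blast
  moreover have "0 \<cdot>\<^sub>m (0\<^sub>m m m) = (0\<^sub>m m m :: cmat)" by (intro eq_matI) auto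
  moreover have "0 \<cdot>\<^sub>m \<Lambda> (0\<^sub>m m m) = 0\<^sub>m n n"
  proof -
    have "\<Lambda> (0\<^sub>m m m) \<in> carrier_mat n n"
      using assms(1) zero_carrier_mat unfolding linear_map_def by blast
    then show ?thesis by (intro eq_matI) auto
  qed
  moreover have "mat_sum k {} G = 0\<^sub>m k k" for k and G :: "'a \<Rightarrow> cmat" by (intro eq_matI) auto
  ultimately show ?case by simp
next
  case (insert x I)
  have e: "mat_sum k (insert x I) G = G x + mat_sum k I G" if "G x \<in> carrier_mat k k" for k and G :: "'a \<Rightarrow> cmat"
    using insert.hyps that by (intro eq_matI) auto
  have "\<Lambda> (F x + mat_sum m I F) = \<Lambda> (F x) + \<Lambda> (mat_sum m I F)"
    using assms(1) insert.prems by (simp add: linear_map_def)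
  moreover have "\<Lambda> (F x) \<in> carrier_mat n n" using assms(1) insert.prems by (simp add: linear_map_def)
  ultimately show ?case using e[of F m] e[of "\<lambda>k. \<Lambda> (F k)" n] insert by simp
qed

lemma local_map_carrier[simp]: "local_map p m n q \<Lambda> X \<in> carrier_mat (p * n * q) (p * n * q)"
  by (simp add: local_map_def)

lemma local_map_block_add:
  "r < p * n * (q::nat) \<Longrightarrow> i < m \<Longrightarrow> (r div (n * q) * m + i) * q + r mod q < p * m * q"
proof -
  assume r: "r < p * n * q" and i: "i < m"
  then have q: "0 < q" by (cases q) auto
  have "r div (n * q) < p" using r by (simp add: less_mult_imp_div_less mult.assoc)
  then show ?thesis using i q by (intro mult_add_less) auto
qed

lemma linear_local_map:
  assumes l: "linear_map m n \<Lambda>"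
  shows "linear_map (p * m * q) (p * n * q) (local_map p m n q \<Lambda>)"
proof -
  define blk where "blk X r s = mat m m (\<lambda>(i, j). X $$ ((r div (n * q) * m + i) * q + r mod q, (s div (n * q) * m + j) * q + s mod q))"
    for X :: cmat and r s
  have lm: "local_map p m n q \<Lambda> X = mat (p * n * q) (p * n * q) (\<lambda>(r, s). \<Lambda> (blk X r s) $$ (r div q mod n, s div q mod n))" for X
    unfolding local_map_def blk_def by simp
  have bc: "blk X r s \<in> carrier_mat m m" for X r s by (simp add: blk_def)
  have md: "r div q mod n < n" if "r < p * n * q" for r using that by (cases n) auto
  have "local_map p m n q \<Lambda> (X + Y) = local_map p m n q \<Lambda> X + local_map p m n q \<Lambda> Y"
    if X: "X \<in> carrier_mat (p * m * q) (p * m * q)" and Y: "Y \<in> carrier_mat (p * m * q) (p * m * q)" for X Y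
  proof (rule eq_matI)
    fix r s assume "r < dim_row (local_map p m n q \<Lambda> X + local_map p m n q \<Lambda> Y)" "s < dim_col (local_map p m n q \<Lambda> X + local_map p m n q \<Lambda> Y)"
    then have rs: "r < p * n * q" "s < p * n * q" by (auto simp: lm)
    have "blk (X + Y) r s = blk X r s + blk Y r s"
      using X Y rs by (intro eq_matI) (auto simp: blk_def local_map_block_add)
    then have "\<Lambda> (blk (X + Y) r s) = \<Lambda> (blk X r s) + \<Lambda> (blk Y r s)" "\<Lambda> (blk Y r s) \<in> carrier_mat n n"
      using l bc by (auto simp: linear_map_def)
    then show "local_map p m n q \<Lambda> (X + Y) $$ (r, s) = (local_map p m n q \<Lambda> X + local_map p m n q \<Lambda> Y) $$ (r, s)"
      using rs md by (auto simp: lm)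
  qed (auto simp: lm)
  moreover have "local_map p m n q \<Lambda> (c \<cdot>\<^sub>m X) = c \<cdot>\<^sub>m local_map p m n q \<Lambda> X"
    if X: "X \<in> carrier_mat (p * m * q) (p * m * q)" for X c
  proof (rule eq_matI)
    fix r s assume "r < dim_row (c \<cdot>\<^sub>m local_map p m n q \<Lambda> X)" "s < dim_col (c \<cdot>\<^sub>m local_map p m n q \<Lambda> X)"
    then have rs: "r < p * n * q" "s < p * n * q" by (auto simp: lm)
    have "blk (c \<cdot>\<^sub>m X) r s = c \<cdot>\<^sub>m blk X r s"
      using X rs by (intro eq_matI) (auto simp: blk_def local_map_block_add)
    then have "\<Lambda> (blk (c \<cdot>\<^sub>m X) r s) = c \<cdot>\<^sub>m \<Lambda> (blk X r s)" "\<Lambda> (blk X r s) \<in> carrier_mat n n"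
      using l bc by (auto simp: linear_map_def)
    then show "local_map p m n q \<Lambda> (c \<cdot>\<^sub>m X) $$ (r, s) = (c \<cdot>\<^sub>m local_map p m n q \<Lambda> X) $$ (r, s)"
      using rs md by (auto simp: lm)
  qed (auto simp: lm)
  ultimately show ?thesis by (auto simp: linear_map_def)
qed

text \<open>On a product operator every block seen by \<open>local_map\<close> is a scalar multiple
  of B, and linearity takes the scalar out of \<Lambda>. From here on local operations are handled
  through tensor products instead of indices.\<close>

lemma local_map_kron:
  assumes l: "linear_map m n \<Lambda>"
    and A: "A \<in> carrier_mat p p" and B: "B \<in> carrier_mat m m" and C: "C \<in> carrier_mat q q"
  shows "local_map p m n q \<Lambda> (A \<otimes>\<^sub>m B \<otimes>\<^sub>m C) = A \<otimes>\<^sub>m \<Lambda> B \<otimes>\<^sub>m C"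
proof -
  have LB: "\<Lambda> B \<in> carrier_mat n n" using l B by (simp add: linear_map_def)
  have AB: "A \<otimes>\<^sub>m B \<in> carrier_mat (p * m) (p * m)" "A \<otimes>\<^sub>m \<Lambda> B \<in> carrier_mat (p * n) (p * n)"
    using A B LB by auto
  show ?thesis
  proof (rule eq_mat_kronI[where a="p * n" and b=q and a'="p * n" and b'=q])
    fix i k j l' assume i: "i < p * n" and k: "k < q" and j: "j < p * n" and l': "l' < q"
    obtain i1 i2 where i12: "i1 < p" "i2 < n" "i = i1 * n + i2" using i by (rule less_mult_cases)
    obtain j1 j2 where j12: "j1 < p" "j2 < n" "j = j1 * n + j2" using j by (rule less_mult_cases)
    let ?r = "i * q + k" and ?s = "j * q + l'"
    have r: "?r div (n * q) = i1" "?r mod q = k" "?r div q mod n = i2"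
      using i12 k by (simp_all add: div_mult2_eq[of _ q n] mult.commute[of n q])
    have s: "?s div (n * q) = j1" "?s mod q = l'" "?s div q mod n = j2"
      using j12 l' by (simp_all add: div_mult2_eq[of _ q n] mult.commute[of n q])
    have blk: "mat m m (\<lambda>(i, j). (A \<otimes>\<^sub>m B \<otimes>\<^sub>m C) $$ ((?r div (n * q) * m + i) * q + ?r mod q, (?s div (n * q) * m + j) * q + ?s mod q))
      = (A $$ (i1, j1) * C $$ (k, l')) \<cdot>\<^sub>m B" (is "mat m m ?f = _")
    proof (rule eq_matI)
      fix x y assume "x < dim_row ((A $$ (i1, j1) * C $$ (k, l')) \<cdot>\<^sub>m B)" "y < dim_col ((A $$ (i1, j1) * C $$ (k, l')) \<cdot>\<^sub>m B)"
      then have xy: "x < m" "y < m" using B by auto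
      have "(A \<otimes>\<^sub>m B \<otimes>\<^sub>m C) $$ ((i1 * m + x) * q + k, (j1 * m + y) * q + l') = A $$ (i1, j1) * B $$ (x, y) * C $$ (k, l')"
        by (subst kron_index[OF AB(1) C], (use xy i12 j12 k l' in \<open>auto intro!: mult_add_less\<close>)[4],
            subst kron_index[OF A B]) (use xy i12 j12 in auto)
      then show "mat m m ?f $$ (x, y) = ((A $$ (i1, j1) * C $$ (k, l')) \<cdot>\<^sub>m B) $$ (x, y)"
        using xy B unfolding r s by simp
    qed (use B in auto)
    have "local_map p m n q \<Lambda> (A \<otimes>\<^sub>m B \<otimes>\<^sub>m C) $$ (?r, ?s) = \<Lambda> ((A $$ (i1, j1) * C $$ (k, l')) \<cdot>\<^sub>m B) $$ (i2, j2)"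
      using mult_add_less[OF i k] mult_add_less[OF j l'] unfolding local_map_def
      by (simp only: index_mat(1) case_prod_conv) (simp only: blk, simp only: r s)
    also have "\<dots> = A $$ (i1, j1) * C $$ (k, l') * \<Lambda> B $$ (i2, j2)"
      using l B LB i12 j12 by (auto simp: linear_map_def)
    also have "\<dots> = (A \<otimes>\<^sub>m \<Lambda> B \<otimes>\<^sub>m C) $$ (?r, ?s)"
      by (subst kron_index[OF AB(2) C i k j l'], simp only: i12 j12, subst kron_index[OF A LB]) (use i12 j12 in auto)
    finally show "local_map p m n q \<Lambda> (A \<otimes>\<^sub>m B \<otimes>\<^sub>m C) $$ (?r, ?s) = (A \<otimes>\<^sub>m \<Lambda> B \<otimes>\<^sub>m C) $$ (?r, ?s)" .
  qed (rule local_map_carrier, rule kron_carrier[OF AB(2) C])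
qed

section \<open>Registers and communication as sandwich maps\<close>

lemma ketbra_dim[simp]: "dim_row (ketbra v w) = dim_vec v" "dim_col (ketbra v w) = dim_vec w"
  by (simp_all add: ketbra_def)

lemma ketbra_index[simp]: "i < dim_vec v \<Longrightarrow> j < dim_vec w \<Longrightarrow> ketbra v w $$ (i, j) = v $ i * cnj (w $ j)"
  by (simp add: ketbra_def)

lemma ketbra_carrier[simp]: "v \<in> carrier_vec n \<Longrightarrow> w \<in> carrier_vec m \<Longrightarrow> ketbra v w \<in> carrier_mat n m"
  by auto

lemma ket_col_carrier[simp]: "ket_col c i \<in> carrier_mat c 1"
  using mat_of_cols_carrier(1)[of c "[unit_vec c i]"] by (simp add: ket_col_def)

lemma ket_col_index: "k < c \<Longrightarrow> ket_col c i $$ (k, 0) = (if k = i then 1 else 0)"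
  by (simp add: ket_col_def mat_of_cols_index unit_vec_def)

lemma proj_ket_col: "ket_col c i * mat_adjoint (ket_col c i) = proj (unit_vec c i)"
proof (rule eq_matI)
  fix k l assume "k < dim_row (proj (unit_vec c i))" "l < dim_col (proj (unit_vec c i))"
  then have kl: "k < c" "l < c" by auto
  have d: "dim_row (ket_col c i) = c" "dim_col (ket_col c i) = 1" using ket_col_carrier by blast+
  show "(ket_col c i * mat_adjoint (ket_col c i)) $$ (k, l) = proj (unit_vec c i) $$ (k, l)"
    using kl d mat_mult_index[OF ket_col_carrier mat_adjoint_carrier[OF ket_col_carrier] kl]
    by (simp add: ket_col_index unit_vec_def)
qed (use ket_col_carrier[of c i] in auto)

lemma proj_unit_vec_kron:
  assumes "t < c" "i < c'"
  shows "proj (unit_vec c t) \<otimes>\<^sub>m proj (unit_vec c' i) = proj (unit_vec (c * c') (t * c' + i))"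
proof (rule eq_mat_kronI[where a=c and b=c' and a'=c and b'=c'])
  fix k1 k2 l1 l2 assume k: "k1 < c" "k2 < c'" "l1 < c" "l2 < c'"
  have eq: "k * c' + k' = t * c' + i \<longleftrightarrow> k = t \<and> k' = i" if "k' < c'" for k k'
    using that assms by (metis div_mod_add)
  have "(proj (unit_vec c t) \<otimes>\<^sub>m proj (unit_vec c' i)) $$ (k1 * c' + k2, l1 * c' + l2)
     = proj (unit_vec c t) $$ (k1, l1) * proj (unit_vec c' i) $$ (k2, l2)"
    using k by (intro kron_index[of _ c c _ c' c']) auto
  then show "(proj (unit_vec c t) \<otimes>\<^sub>m proj (unit_vec c' i)) $$ (k1 * c' + k2, l1 * c' + l2)
     = proj (unit_vec (c * c') (t * c' + i)) $$ (k1 * c' + k2, l1 * c' + l2)"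
    using k mult_add_less[OF k(1,2)] mult_add_less[OF k(3,4)] by (simp add: unit_vec_def eq)
qed (auto intro!: carrier_matI)

lemma proj_unit_vec_one: "proj (unit_vec 1 0) = 1\<^sub>m 1"
  by (rule eq_matI) auto

lemma linear_map_sandwich_sum:
  assumes "\<And>i. i \<in> I \<Longrightarrow> V i \<in> carrier_mat n m"
  shows "linear_map m n (\<lambda>X. mat_sum n I (\<lambda>i. V i * X * mat_adjoint (V i)))"
proof -
  have "(V i * (X + Y) * mat_adjoint (V i)) $$ (r, s) = (V i * X * mat_adjoint (V i)) $$ (r, s) + (V i * Y * mat_adjoint (V i)) $$ (r, s)"
    if "i \<in> I" "X \<in> carrier_mat m m" "Y \<in> carrier_mat m m" "r < n" "s < n" for i X Y r s
  proof -
    have V: "V i \<in> carrier_mat n m" "mat_adjoint (V i) \<in> carrier_mat m n" using assms that by auto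
    have "V i * (X + Y) * mat_adjoint (V i) = V i * X * mat_adjoint (V i) + V i * Y * mat_adjoint (V i)"
      using that V by (simp add: mult_add_distrib_mat[OF V(1)] add_mult_distrib_mat[OF mult_carrier_mat[OF V(1)] mult_carrier_mat[OF V(1)] V(2)])
    then have "(V i * (X + Y) * mat_adjoint (V i)) $$ (r, s) = (V i * X * mat_adjoint (V i) + V i * Y * mat_adjoint (V i)) $$ (r, s)"
      by (simp only:)
    also have "\<dots> = (V i * X * mat_adjoint (V i)) $$ (r, s) + (V i * Y * mat_adjoint (V i)) $$ (r, s)"
      using that V by (intro index_add_mat(1)) auto
    finally show ?thesis .
  qed
  moreover have "(V i * (c \<cdot>\<^sub>m X) * mat_adjoint (V i)) $$ (r, s) = c * (V i * X * mat_adjoint (V i)) $$ (r, s)"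
    if "i \<in> I" "X \<in> carrier_mat m m" "r < n" "s < n" for i X c r s
  proof -
    have V: "V i \<in> carrier_mat n m" "mat_adjoint (V i) \<in> carrier_mat m n" using assms that by auto
    have "V i * (c \<cdot>\<^sub>m X) * mat_adjoint (V i) = c \<cdot>\<^sub>m (V i * X * mat_adjoint (V i))"
      using that V by (simp add: mult_smult_distrib[OF V(1)] mult_smult_assoc_mat[OF mult_carrier_mat[OF V(1)] V(2)])
    then have "(V i * (c \<cdot>\<^sub>m X) * mat_adjoint (V i)) $$ (r, s) = (c \<cdot>\<^sub>m (V i * X * mat_adjoint (V i))) $$ (r, s)"
      by (simp only:)
    also have "\<dots> = c * (V i * X * mat_adjoint (V i)) $$ (r, s)"
      using that V by (intro index_smult_mat(1)) auto
    finally show ?thesis .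
  qed
  ultimately show ?thesis
    unfolding linear_map_def
    by (auto simp: sum.distrib sum_distrib_left simp del: index_mult_mat(1) intro!: eq_matI sum.cong)
qed

lemma comm_alice_linear: "linear_map (a * c * b * e) (a * c * (b * c) * (e * c)) (comm_alice a c b e)"
proof -
  have "(1\<^sub>m a \<otimes>\<^sub>m proj (unit_vec c i)) \<otimes>\<^sub>m (1\<^sub>m b \<otimes>\<^sub>m ket_col c i) \<otimes>\<^sub>m (1\<^sub>m e \<otimes>\<^sub>m ket_col c i)
     \<in> carrier_mat (a * c * (b * c) * (e * c)) (a * c * b * e)" for i
    using ket_col_carrier[of c i] by auto
  then show ?thesis
    unfolding comm_alice_def[abs_def] Let_def by (intro linear_map_sandwich_sum)
qed

lemma comm_bob_linear: "linear_map (a * (b * c) * e) (a * c * (b * c) * (e * c)) (comm_bob a c b e)"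
proof -
  have "(1\<^sub>m a \<otimes>\<^sub>m ket_col c i) \<otimes>\<^sub>m (1\<^sub>m b \<otimes>\<^sub>m proj (unit_vec c i)) \<otimes>\<^sub>m (1\<^sub>m e \<otimes>\<^sub>m ket_col c i)
     \<in> carrier_mat (a * c * (b * c) * (e * c)) (a * (b * c) * e)" for i
    using ket_col_carrier[of c i] by auto
  then show ?thesis
    unfolding comm_bob_def[abs_def] Let_def by (intro linear_map_sandwich_sum)
qed

lemma lopc_step_linear: "lopc_step D D' \<Phi> \<Longrightarrow> linear_map (total_dim D) (total_dim D') \<Phi>"
proof (induction rule: lopc_step.induct)
  case (local_alice a a' \<Lambda> b e)
  then have "linear_map a a' \<Lambda>" by (simp add: cptp_def)
  from linear_local_map[OF this, of 1 "b * e"] show ?case by (simp add: mult.assoc)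
next
  case (local_bob b b' \<Lambda> a e)
  then have "linear_map b b' \<Lambda>" by (simp add: cptp_def)
  from linear_local_map[OF this, of a e] show ?case by simp
next
  case (alice_to_bob a c b e)
  then show ?case using comm_alice_linear by simp
next
  case (bob_to_alice a b c e)
  then show ?case using comm_bob_linear by simp
qed

lemma lopc_linear: "lopc D D' \<Phi> \<Longrightarrow> linear_map (total_dim D) (total_dim D') \<Phi>"
proof (induction rule: lopc.induct)
  case (lopc_id D)
  then show ?case by (simp add: linear_map_def)
next
  case (lopc_comp D D' \<Phi> D'' \<Psi>)
  then show ?case using lopc_step_linear[OF lopc_comp.hyps(2)] by (simp add: linear_map_def)
qed

text \<open>Complete positivity with a one-dimensional ancilla.\<close>

lemma cptp_psd:
  assumes "cptp m n \<Lambda>" "psd m X"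
  shows "psd n (\<Lambda> X)"
proof -
  have X: "X \<in> carrier_mat m m" using assms by (simp add: psd_def)
  have l: "linear_map m n \<Lambda>" using assms by (simp add: cptp_def)
  have LX: "\<Lambda> X \<in> carrier_mat n n" using l X by (simp add: linear_map_def)
  have "local_map 1 m n 1 \<Lambda> X = \<Lambda> X"
    using local_map_kron[OF l one_carrier_mat[of 1] X one_carrier_mat[of 1]]
    by (simp only: kron_one_left[OF X] kron_one_right[OF X] kron_one_left[OF LX] kron_one_right[OF LX])
  moreover have "psd (1 * n) (local_map 1 m n 1 \<Lambda> X)"
  proof -
    have "\<forall>k X. psd (k * m) X \<longrightarrow> psd (k * n) (local_map k m n 1 \<Lambda> X)" using assms(1) unfolding cptp_def by blast
    then show ?thesis using assms(2) by (metis mult_1)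
  qed
  ultimately show ?thesis by simp
qed

section \<open>Branches of an LOPC operation on product inputs\<close>

text \<open>The index i runs over the public transcripts. A i and B i are unnormalised; for
  normalised inputs the product of their traces is the probability of transcript i. They are chosen
  before \<omega>, which expresses that Eve's system is never touched: she only receives a register
  holding the transcript.\<close>

definition product_form :: "dims \<Rightarrow> dims \<Rightarrow> (cmat \<Rightarrow> cmat) \<Rightarrow> nat \<Rightarrow> bool" where
  "product_form = (\<lambda>(a, b, e) (a', b', e') \<Phi> c. e' = e * c \<and>
     (\<forall>\<alpha> \<beta>. psd a \<alpha> \<longrightarrow> psd b \<beta> \<longrightarrow> (\<exists>A B. (\<forall>i<c. psd a' (A i) \<and> psd b' (B i)) \<and>
        (\<Sum>i<c. mat_trace (A i) * mat_trace (B i)) = mat_trace \<alpha> * mat_trace \<beta> \<and>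
        (\<forall>\<omega>\<in>carrier_mat e e. \<Phi> (\<alpha> \<otimes>\<^sub>m \<beta> \<otimes>\<^sub>m \<omega>) =
            mat_sum (a' * b' * e') {..<c} (\<lambda>i. A i \<otimes>\<^sub>m B i \<otimes>\<^sub>m (\<omega> \<otimes>\<^sub>m proj (unit_vec c i)))))))"

text \<open>A local operation announces nothing, so its transcript register has dimension 1.\<close>

lemma product_form_one:
  assumes "\<And>\<alpha> \<beta>. psd a \<alpha> \<Longrightarrow> psd b \<beta> \<Longrightarrow> psd a' (F \<alpha>) \<and> psd b' (G \<beta>) \<and> mat_trace (F \<alpha>) = mat_trace \<alpha> \<and> mat_trace (G \<beta>) = mat_trace \<beta>
     \<and> (\<forall>\<omega>\<in>carrier_mat e e. \<Phi> (\<alpha> \<otimes>\<^sub>m \<beta> \<otimes>\<^sub>m \<omega>) = F \<alpha> \<otimes>\<^sub>m G \<beta> \<otimes>\<^sub>m \<omega>)"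
  shows "product_form (a, b, e) (a', b', e) \<Phi> 1"
  unfolding product_form_def case_prod_conv
proof (intro conjI allI impI)
  fix \<alpha> \<beta> assume ab: "psd a \<alpha>" "psd b \<beta>"
  note A = assms[OF ab]
  have C: "F \<alpha> \<in> carrier_mat a' a'" "G \<beta> \<in> carrier_mat b' b'" using A by (auto simp: psd_def)
  have "\<Phi> (\<alpha> \<otimes>\<^sub>m \<beta> \<otimes>\<^sub>m \<omega>) = mat_sum (a' * b' * e) {..<1} (\<lambda>i. F \<alpha> \<otimes>\<^sub>m G \<beta> \<otimes>\<^sub>m (\<omega> \<otimes>\<^sub>m proj (unit_vec 1 i)))"
    if w: "\<omega> \<in> carrier_mat e e" for \<omega>
  proof -
    have "mat_sum (a' * b' * e) {..<1} (\<lambda>i. F \<alpha> \<otimes>\<^sub>m G \<beta> \<otimes>\<^sub>m (\<omega> \<otimes>\<^sub>m proj (unit_vec 1 i))) = F \<alpha> \<otimes>\<^sub>m G \<beta> \<otimes>\<^sub>m \<omega>"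
    proof (rule eq_matI)
      fix r s assume "r < dim_row (F \<alpha> \<otimes>\<^sub>m G \<beta> \<otimes>\<^sub>m \<omega>)" "s < dim_col (F \<alpha> \<otimes>\<^sub>m G \<beta> \<otimes>\<^sub>m \<omega>)"
      then have "r < a' * b' * e" "s < a' * b' * e" using C w by auto
      then show "mat_sum (a' * b' * e) {..<1} (\<lambda>i. F \<alpha> \<otimes>\<^sub>m G \<beta> \<otimes>\<^sub>m (\<omega> \<otimes>\<^sub>m proj (unit_vec 1 i))) $$ (r, s) = (F \<alpha> \<otimes>\<^sub>m G \<beta> \<otimes>\<^sub>m \<omega>) $$ (r, s)"
        using proj_unit_vec_one kron_one_right[OF w] by simp
    qed (use C w in auto)
    then show ?thesis using A w by simp
  qed
  then show "\<exists>A B. (\<forall>i<1. psd a' (A i) \<and> psd b' (B i)) \<and>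
        (\<Sum>i<1. mat_trace (A i) * mat_trace (B i)) = mat_trace \<alpha> * mat_trace \<beta> \<and>
        (\<forall>\<omega>\<in>carrier_mat e e. \<Phi> (\<alpha> \<otimes>\<^sub>m \<beta> \<otimes>\<^sub>m \<omega>) =
            mat_sum (a' * b' * e) {..<1} (\<lambda>i. A i \<otimes>\<^sub>m B i \<otimes>\<^sub>m (\<omega> \<otimes>\<^sub>m proj (unit_vec 1 i))))"
    using A by (intro exI[of _ "\<lambda>_. F \<alpha>"] exI[of _ "\<lambda>_. G \<beta>"]) auto
qed simp

lemma sandwich_ket_col:
  assumes "\<omega> \<in> carrier_mat e e"
  shows "(1\<^sub>m e \<otimes>\<^sub>m ket_col c i) * \<omega> * mat_adjoint (1\<^sub>m e \<otimes>\<^sub>m ket_col c i) = \<omega> \<otimes>\<^sub>m proj (unit_vec c i)"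
proof -
  have a: "mat_adjoint (1\<^sub>m e) = (1\<^sub>m e :: cmat)" by (rule eq_matI) auto
  have "(1\<^sub>m e \<otimes>\<^sub>m ket_col c i) * (\<omega> \<otimes>\<^sub>m 1\<^sub>m 1) * mat_adjoint (1\<^sub>m e \<otimes>\<^sub>m ket_col c i)
    = (1\<^sub>m e * \<omega> * mat_adjoint (1\<^sub>m e)) \<otimes>\<^sub>m (ket_col c i * 1\<^sub>m 1 * mat_adjoint (ket_col c i))"
    by (rule kron_sandwich[OF one_carrier_mat ket_col_carrier assms one_carrier_mat])
  then show ?thesis
    by (simp only: kron_one_right[OF assms] a right_mult_one_mat[OF ket_col_carrier] proj_ket_col
        left_mult_one_mat[OF assms] right_mult_one_mat[OF assms])
qed

text \<open>The register projectors resolve the identity, so the branches share the trace of the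
  sender's state. This keeps the total probability of the transcripts when a register is
  announced.\<close>

lemma trace_register_proj:
  assumes A: "\<alpha> \<in> carrier_mat (a * c) (a * c)"
  shows "(\<Sum>i<c. mat_trace ((1\<^sub>m a \<otimes>\<^sub>m proj (unit_vec c i)) * \<alpha> * mat_adjoint (1\<^sub>m a \<otimes>\<^sub>m proj (unit_vec c i)))) = mat_trace \<alpha>"
proof -
  have D: "(1\<^sub>m a \<otimes>\<^sub>m proj (unit_vec c i)) $$ (x * c + k, y * c + l) = (if x = y \<and> k = l \<and> k = i then 1 else 0 :: complex)"
    if "x < a" "k < c" "y < a" "l < c" for x k y l i
    using that by (subst kron_index[of _ a a _ c c]) (auto simp: unit_vec_def)
  have P: "1\<^sub>m a \<otimes>\<^sub>m proj (unit_vec c i) \<in> carrier_mat (a * c) (a * c)" for i by auto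
  have "((1\<^sub>m a \<otimes>\<^sub>m proj (unit_vec c i)) * \<alpha> * mat_adjoint (1\<^sub>m a \<otimes>\<^sub>m proj (unit_vec c i))) $$ (x * c + k, x * c + k)
     = (if k = i then \<alpha> $$ (x * c + k, x * c + k) else 0)" if x: "x < a" and k: "k < c" for x k i
  proof -
    note r = mult_add_less[OF x k]
    have 1: "((1\<^sub>m a \<otimes>\<^sub>m proj (unit_vec c i)) * \<alpha>) $$ (x * c + k, s) = (if k = i then \<alpha> $$ (x * c + k, s) else 0)"
      if s: "s < a * c" for s
      unfolding mat_mult_index[OF P A r s] sum_lessThan_mult
      by (subst sum_one_support[OF x], simp add: D x k, subst sum_one_support[OF k]) (auto simp: D x k)
    have "((1\<^sub>m a \<otimes>\<^sub>m proj (unit_vec c i)) * \<alpha> * mat_adjoint (1\<^sub>m a \<otimes>\<^sub>m proj (unit_vec c i))) $$ (x * c + k, x * c + k)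
      = (\<Sum>s<a * c. (if k = i then \<alpha> $$ (x * c + k, s) else 0) * cnj ((1\<^sub>m a \<otimes>\<^sub>m proj (unit_vec c i)) $$ (x * c + k, s)))"
      using mat_mult_index[OF mult_carrier_mat[OF P A] mat_adjoint_carrier[OF P] r r] r
      by (simp add: 1 del: index_mult_mat(1))
    also have "\<dots> = (if k = i then \<alpha> $$ (x * c + k, x * c + k) else 0)"
      unfolding sum_lessThan_mult
      by (subst sum_one_support[OF x], simp add: D x k, subst sum_one_support[OF k]) (auto simp: D x k)
    finally show ?thesis .
  qed
  then have "(\<Sum>i<c. mat_trace ((1\<^sub>m a \<otimes>\<^sub>m proj (unit_vec c i)) * \<alpha> * mat_adjoint (1\<^sub>m a \<otimes>\<^sub>m proj (unit_vec c i))))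
     = (\<Sum>i<c. \<Sum>x<a. \<Sum>k<c. if k = i then \<alpha> $$ (x * c + k, x * c + k) else 0)"
    by (simp add: mat_trace_def sum_lessThan_mult del: index_mult_mat(1))
  also have "\<dots> = (\<Sum>x<a. \<Sum>i<c. \<Sum>k<c. if k = i then \<alpha> $$ (x * c + k, x * c + k) else 0)"
    by (rule sum.swap)
  also have "\<dots> = mat_trace \<alpha>" using A by (simp add: mat_trace_def sum_lessThan_mult)
  finally show ?thesis .
qed

lemma trace_proj_unit_vec: "i < c \<Longrightarrow> mat_trace (proj (unit_vec c i)) = 1"
  unfolding mat_trace_def by (subst sum_one_support[of i]) (auto simp: unit_vec_def)

text \<open>Each sandwiching operator is itself a tensor product and so acts factorwise: Alice's
  state is projected onto register value i, while Bob and Eve each gain a fresh copy of |i>.\<close>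

lemma comm_alice_product_form: "product_form (a * c, b, e) (a * c, b * c, e * c) (comm_alice a c b e) c"
  unfolding product_form_def case_prod_conv
proof (intro conjI allI impI)
  fix \<alpha> \<beta> assume p: "psd (a * c) \<alpha>" "psd b \<beta>"
  then have C: "\<alpha> \<in> carrier_mat (a * c) (a * c)" "\<beta> \<in> carrier_mat b b" by (auto simp: psd_def)
  define P where "P i = 1\<^sub>m a \<otimes>\<^sub>m proj (unit_vec c i)" for i
  define K where "K n i = 1\<^sub>m n \<otimes>\<^sub>m ket_col c i" for n i
  have Pc: "P i \<in> carrier_mat (a * c) (a * c)" for i by (auto simp: P_def)
  have Kc: "K n i \<in> carrier_mat (n * c) n" for n i using ket_col_carrier[of c i] by (auto simp: K_def)
  define A where "A i = P i * \<alpha> * mat_adjoint (P i)" for i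
  define B where "B i = K b i * \<beta> * mat_adjoint (K b i)" for i
  have "psd (a * c) (A i)" "psd (b * c) (B i)" for i
    using psd_sandwich[OF p(1) Pc] psd_sandwich[OF p(2) Kc] by (auto simp: A_def B_def)
  moreover have "(\<Sum>i<c. mat_trace (A i) * mat_trace (B i)) = mat_trace \<alpha> * mat_trace \<beta>"
  proof -
    have "mat_trace (B i) = mat_trace \<beta>" if "i < c" for i
      using that unfolding B_def K_def sandwich_ket_col[OF C(2)]
      by (subst mat_trace_kron[OF C(2), of _ c]) (auto simp: trace_proj_unit_vec)
    then show ?thesis using trace_register_proj[OF C(1)] by (simp add: sum_distrib_right[symmetric] A_def P_def)
  qed
  moreover have "comm_alice a c b e (\<alpha> \<otimes>\<^sub>m \<beta> \<otimes>\<^sub>m \<omega>) = mat_sum (a * c * (b * c) * (e * c)) {..<c} (\<lambda>i. A i \<otimes>\<^sub>m B i \<otimes>\<^sub>m (\<omega> \<otimes>\<^sub>m proj (unit_vec c i)))"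
    if w: "\<omega> \<in> carrier_mat e e" for \<omega>
    unfolding comm_alice_def Let_def P_def[symmetric] K_def[symmetric]
  proof (rule mat_sum_cong)
    fix i
    show "P i \<otimes>\<^sub>m K b i \<otimes>\<^sub>m K e i * (\<alpha> \<otimes>\<^sub>m \<beta> \<otimes>\<^sub>m \<omega>) * mat_adjoint (P i \<otimes>\<^sub>m K b i \<otimes>\<^sub>m K e i) = A i \<otimes>\<^sub>m B i \<otimes>\<^sub>m (\<omega> \<otimes>\<^sub>m proj (unit_vec c i))"
      using kron_sandwich[OF kron_carrier[OF Pc Kc] Kc kron_carrier[OF C] w] kron_sandwich[OF Pc Kc C] sandwich_ket_col[OF w]
      by (simp add: A_def B_def K_def)
  qed
  ultimately show "\<exists>A B. (\<forall>i<c. psd (a * c) (A i) \<and> psd (b * c) (B i)) \<and>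
        (\<Sum>i<c. mat_trace (A i) * mat_trace (B i)) = mat_trace \<alpha> * mat_trace \<beta> \<and>
        (\<forall>\<omega>\<in>carrier_mat e e. comm_alice a c b e (\<alpha> \<otimes>\<^sub>m \<beta> \<otimes>\<^sub>m \<omega>) =
            mat_sum (a * c * (b * c) * (e * c)) {..<c} (\<lambda>i. A i \<otimes>\<^sub>m B i \<otimes>\<^sub>m (\<omega> \<otimes>\<^sub>m proj (unit_vec c i))))"
    by blast
qed simp

lemma comm_bob_product_form: "product_form (a, b * c, e) (a * c, b * c, e * c) (comm_bob a c b e) c"
  unfolding product_form_def case_prod_conv
proof (intro conjI allI impI)
  fix \<alpha> \<beta> assume p: "psd a \<alpha>" "psd (b * c) \<beta>"
  then have C: "\<alpha> \<in> carrier_mat a a" "\<beta> \<in> carrier_mat (b * c) (b * c)" by (auto simp: psd_def)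
  define P where "P i = 1\<^sub>m b \<otimes>\<^sub>m proj (unit_vec c i)" for i
  define K where "K n i = 1\<^sub>m n \<otimes>\<^sub>m ket_col c i" for n i
  have Pc: "P i \<in> carrier_mat (b * c) (b * c)" for i by (auto simp: P_def)
  have Kc: "K n i \<in> carrier_mat (n * c) n" for n i using ket_col_carrier[of c i] by (auto simp: K_def)
  define A where "A i = K a i * \<alpha> * mat_adjoint (K a i)" for i
  define B where "B i = P i * \<beta> * mat_adjoint (P i)" for i
  have "psd (a * c) (A i)" "psd (b * c) (B i)" for i
    using psd_sandwich[OF p(2) Pc] psd_sandwich[OF p(1) Kc] by (auto simp: A_def B_def)
  moreover have "(\<Sum>i<c. mat_trace (A i) * mat_trace (B i)) = mat_trace \<alpha> * mat_trace \<beta>"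
  proof -
    have "mat_trace (A i) = mat_trace \<alpha>" if "i < c" for i
      using that unfolding A_def K_def sandwich_ket_col[OF C(1)]
      by (subst mat_trace_kron[OF C(1), of _ c]) (auto simp: trace_proj_unit_vec)
    then show ?thesis using trace_register_proj[OF C(2)] by (simp add: sum_distrib_left[symmetric] B_def P_def)
  qed
  moreover have "comm_bob a c b e (\<alpha> \<otimes>\<^sub>m \<beta> \<otimes>\<^sub>m \<omega>) = mat_sum (a * c * (b * c) * (e * c)) {..<c} (\<lambda>i. A i \<otimes>\<^sub>m B i \<otimes>\<^sub>m (\<omega> \<otimes>\<^sub>m proj (unit_vec c i)))"
    if w: "\<omega> \<in> carrier_mat e e" for \<omega>
    unfolding comm_bob_def Let_def P_def[symmetric] K_def[symmetric]
  proof (rule mat_sum_cong)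
    fix i
    show "K a i \<otimes>\<^sub>m P i \<otimes>\<^sub>m K e i * (\<alpha> \<otimes>\<^sub>m \<beta> \<otimes>\<^sub>m \<omega>) * mat_adjoint (K a i \<otimes>\<^sub>m P i \<otimes>\<^sub>m K e i) = A i \<otimes>\<^sub>m B i \<otimes>\<^sub>m (\<omega> \<otimes>\<^sub>m proj (unit_vec c i))"
      using kron_sandwich[OF kron_carrier[OF Kc Pc] Kc kron_carrier[OF C] w] kron_sandwich[OF Kc Pc C] sandwich_ket_col[OF w]
      by (simp add: A_def B_def K_def)
  qed
  ultimately show "\<exists>A B. (\<forall>i<c. psd (a * c) (A i) \<and> psd (b * c) (B i)) \<and>
        (\<Sum>i<c. mat_trace (A i) * mat_trace (B i)) = mat_trace \<alpha> * mat_trace \<beta> \<and>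
        (\<forall>\<omega>\<in>carrier_mat e e. comm_bob a c b e (\<alpha> \<otimes>\<^sub>m \<beta> \<otimes>\<^sub>m \<omega>) =
            mat_sum (a * c * (b * c) * (e * c)) {..<c} (\<lambda>i. A i \<otimes>\<^sub>m B i \<otimes>\<^sub>m (\<omega> \<otimes>\<^sub>m proj (unit_vec c i))))"
    by blast
qed simp

lemma lopc_step_product_form: "lopc_step D D' \<Phi> \<Longrightarrow> \<exists>c. product_form D D' \<Phi> c"
proof (induction rule: lopc_step.induct)
  case (local_alice a a' \<Lambda> b e)
  have "product_form (a, b, e) (a', b, e) (local_map 1 a a' (b * e) \<Lambda>) 1"
  proof (rule product_form_one[where F=\<Lambda> and G="\<lambda>x. x"])
    fix \<alpha> \<beta> assume p: "psd a \<alpha>" "psd b \<beta>"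
    then have C: "\<alpha> \<in> carrier_mat a a" "\<beta> \<in> carrier_mat b b" by (auto simp: psd_def)
    have l: "linear_map a a' \<Lambda>" using local_alice by (simp add: cptp_def)
    have LC: "\<Lambda> \<alpha> \<in> carrier_mat a' a'" using l C by (simp add: linear_map_def)
    have "local_map 1 a a' (b * e) \<Lambda> (\<alpha> \<otimes>\<^sub>m \<beta> \<otimes>\<^sub>m \<omega>) = \<Lambda> \<alpha> \<otimes>\<^sub>m \<beta> \<otimes>\<^sub>m \<omega>" if w: "\<omega> \<in> carrier_mat e e" for \<omega>
      using local_map_kron[OF l one_carrier_mat[of 1] C(1) kron_carrier[OF C(2) w]]
      by (simp only: kron_one_left[OF C(1)] kron_one_left[OF LC] kron_assoc[OF C w] kron_assoc[OF LC C(2) w])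
    moreover have "mat_trace (\<Lambda> \<alpha>) = mat_trace \<alpha>" using local_alice C by (simp add: cptp_def)
    ultimately show "psd a' (\<Lambda> \<alpha>) \<and> psd b \<beta> \<and> mat_trace (\<Lambda> \<alpha>) = mat_trace \<alpha> \<and> mat_trace \<beta> = mat_trace \<beta>
      \<and> (\<forall>\<omega>\<in>carrier_mat e e. local_map 1 a a' (b * e) \<Lambda> (\<alpha> \<otimes>\<^sub>m \<beta> \<otimes>\<^sub>m \<omega>) = \<Lambda> \<alpha> \<otimes>\<^sub>m \<beta> \<otimes>\<^sub>m \<omega>)"
      using cptp_psd[OF local_alice p(1)] p by simp
  qed
  then show ?case by blast
next
  case (local_bob b b' \<Lambda> a e)
  have "product_form (a, b, e) (a, b', e) (local_map a b b' e \<Lambda>) 1"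
  proof (rule product_form_one[where F="\<lambda>x. x" and G=\<Lambda>])
    fix \<alpha> \<beta> assume p: "psd a \<alpha>" "psd b \<beta>"
    then have C: "\<alpha> \<in> carrier_mat a a" "\<beta> \<in> carrier_mat b b" by (auto simp: psd_def)
    have l: "linear_map b b' \<Lambda>" using local_bob by (simp add: cptp_def)
    have "local_map a b b' e \<Lambda> (\<alpha> \<otimes>\<^sub>m \<beta> \<otimes>\<^sub>m \<omega>) = \<alpha> \<otimes>\<^sub>m \<Lambda> \<beta> \<otimes>\<^sub>m \<omega>" if w: "\<omega> \<in> carrier_mat e e" for \<omega>
      by (rule local_map_kron[OF l C w])
    moreover have "mat_trace (\<Lambda> \<beta>) = mat_trace \<beta>" using local_bob C by (simp add: cptp_def)
    ultimately show "psd a \<alpha> \<and> psd b' (\<Lambda> \<beta>) \<and> mat_trace \<alpha> = mat_trace \<alpha> \<and> mat_trace (\<Lambda> \<beta>) = mat_trace \<beta>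
      \<and> (\<forall>\<omega>\<in>carrier_mat e e. local_map a b b' e \<Lambda> (\<alpha> \<otimes>\<^sub>m \<beta> \<otimes>\<^sub>m \<omega>) = \<alpha> \<otimes>\<^sub>m \<Lambda> \<beta> \<otimes>\<^sub>m \<omega>)"
      using cptp_psd[OF local_bob p(2)] p by simp
  qed
  then show ?case by blast
next
  case (alice_to_bob a c b e)
  then show ?case using comm_alice_product_form by blast
next
  case (bob_to_alice a b c e)
  then show ?case using comm_bob_product_form by blast
qed

text \<open>Transcripts are concatenated, the pair (t, i) having index t * c2 + i. Branch t of the
  first operation is again a product for Alice and Bob, and Eve's operator in it, \<omega> with
  |t><t| attached, is covered because the second product form is available for every matrix on her
  side.\<close>

lemma product_form_comp:
  assumes 1: "product_form (a, b, e) (a1, b1, e1) \<Phi> c1" and 2: "product_form (a1, b1, e1) (a2, b2, e2) \<Psi> c2"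
    and lin: "linear_map (a1 * b1 * e1) (a2 * b2 * e2) \<Psi>"
  shows "product_form (a, b, e) (a2, b2, e2) (\<Psi> \<circ> \<Phi>) (c1 * c2)"
proof -
  have e: "e1 = e * c1" "e2 = e * (c1 * c2)" using 1 2 by (auto simp: product_form_def)
  have "\<exists>A B. (\<forall>i<c1 * c2. psd a2 (A i) \<and> psd b2 (B i)) \<and>
        (\<Sum>i<c1 * c2. mat_trace (A i) * mat_trace (B i)) = mat_trace \<alpha> * mat_trace \<beta> \<and>
        (\<forall>\<omega>\<in>carrier_mat e e. (\<Psi> \<circ> \<Phi>) (\<alpha> \<otimes>\<^sub>m \<beta> \<otimes>\<^sub>m \<omega>) =
            mat_sum (a2 * b2 * e2) {..<c1 * c2} (\<lambda>i. A i \<otimes>\<^sub>m B i \<otimes>\<^sub>m (\<omega> \<otimes>\<^sub>m proj (unit_vec (c1 * c2) i))))"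
    if p: "psd a \<alpha>" "psd b \<beta>" for \<alpha> \<beta>
  proof -
    obtain A1 B1 where p1: "\<And>i. i < c1 \<Longrightarrow> psd a1 (A1 i) \<and> psd b1 (B1 i)"
      and t1: "(\<Sum>i<c1. mat_trace (A1 i) * mat_trace (B1 i)) = mat_trace \<alpha> * mat_trace \<beta>"
      and F1: "\<And>\<omega>. \<omega> \<in> carrier_mat e e \<Longrightarrow> \<Phi> (\<alpha> \<otimes>\<^sub>m \<beta> \<otimes>\<^sub>m \<omega>) = mat_sum (a1 * b1 * e1) {..<c1} (\<lambda>i. A1 i \<otimes>\<^sub>m B1 i \<otimes>\<^sub>m (\<omega> \<otimes>\<^sub>m proj (unit_vec c1 i)))"
      using 1 p unfolding product_form_def case_prod_conv by blast
    \<comment> \<open>The guard t < c1 makes the statement total in t, so that branchwise witnesses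
      can be chosen as functions.\<close>
    define G where "G t A B \<longleftrightarrow> (t < c1 \<longrightarrow> (\<forall>i<c2. psd a2 (A i) \<and> psd b2 (B i)) \<and>
        (\<Sum>i<c2. mat_trace (A i) * mat_trace (B i)) = mat_trace (A1 t) * mat_trace (B1 t) \<and>
        (\<forall>\<omega>\<in>carrier_mat e1 e1. \<Psi> (A1 t \<otimes>\<^sub>m B1 t \<otimes>\<^sub>m \<omega>) =
            mat_sum (a2 * b2 * e2) {..<c2} (\<lambda>i. A i \<otimes>\<^sub>m B i \<otimes>\<^sub>m (\<omega> \<otimes>\<^sub>m proj (unit_vec c2 i)))))"
      for t :: nat and A B
    have "\<exists>A B. G t A B" for t
    proof (cases "t < c1")
      case True
      then show ?thesis using 2 p1[OF True] unfolding product_form_def case_prod_conv G_def by blast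
    qed (simp add: G_def)
    then obtain A2 B2 where G: "\<And>t. G t (A2 t) (B2 t)" by metis
    have p2: "psd a2 (A2 t i) \<and> psd b2 (B2 t i)" if "t < c1" "i < c2" for t i
      using G[of t] that unfolding G_def by blast
    have t2: "(\<Sum>i<c2. mat_trace (A2 t i) * mat_trace (B2 t i)) = mat_trace (A1 t) * mat_trace (B1 t)"
      if "t < c1" for t
      using G[of t] that unfolding G_def by blast
    have F2: "\<Psi> (A1 t \<otimes>\<^sub>m B1 t \<otimes>\<^sub>m \<omega>) =
            mat_sum (a2 * b2 * e2) {..<c2} (\<lambda>i. A2 t i \<otimes>\<^sub>m B2 t i \<otimes>\<^sub>m (\<omega> \<otimes>\<^sub>m proj (unit_vec c2 i)))"
      if "t < c1" "\<omega> \<in> carrier_mat e1 e1" for t \<omega>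
      using G[of t] that unfolding G_def by blast
    define A where "A i = A2 (i div c2) (i mod c2)" for i
    define B where "B i = B2 (i div c2) (i mod c2)" for i
    have "\<forall>i<c1 * c2. psd a2 (A i) \<and> psd b2 (B i)"
      unfolding all_less_mult using p2 by (simp add: A_def B_def)
    moreover have "(\<Sum>i<c1 * c2. mat_trace (A i) * mat_trace (B i)) = mat_trace \<alpha> * mat_trace \<beta>"
      unfolding sum_lessThan_mult using t2 t1 by (simp add: A_def B_def)
    moreover have "(\<Psi> \<circ> \<Phi>) (\<alpha> \<otimes>\<^sub>m \<beta> \<otimes>\<^sub>m \<omega>) =
            mat_sum (a2 * b2 * e2) {..<c1 * c2} (\<lambda>i. A i \<otimes>\<^sub>m B i \<otimes>\<^sub>m (\<omega> \<otimes>\<^sub>m proj (unit_vec (c1 * c2) i)))"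
      if w: "\<omega> \<in> carrier_mat e e" for \<omega>
    proof -
      have wP: "\<omega> \<otimes>\<^sub>m proj (unit_vec c1 t) \<in> carrier_mat e1 e1" for t
        using w by (auto simp: e)
      have "(\<Psi> \<circ> \<Phi>) (\<alpha> \<otimes>\<^sub>m \<beta> \<otimes>\<^sub>m \<omega>) = mat_sum (a2 * b2 * e2) {..<c1} (\<lambda>t. \<Psi> (A1 t \<otimes>\<^sub>m B1 t \<otimes>\<^sub>m (\<omega> \<otimes>\<^sub>m proj (unit_vec c1 t))))"
        unfolding o_def F1[OF w]
      proof (rule linear_map_mat_sum[OF lin])
        fix t assume "t \<in> {..<c1}"
        then have "A1 t \<in> carrier_mat a1 a1" "B1 t \<in> carrier_mat b1 b1" using p1 by (auto simp: psd_def)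
        then show "A1 t \<otimes>\<^sub>m B1 t \<otimes>\<^sub>m (\<omega> \<otimes>\<^sub>m proj (unit_vec c1 t)) \<in> carrier_mat (a1 * b1 * e1) (a1 * b1 * e1)"
          using wP by (intro kron_carrier) auto
      qed simp
      also have "\<dots> = mat_sum (a2 * b2 * e2) {..<c1} (\<lambda>t. mat_sum (a2 * b2 * e2) {..<c2} (\<lambda>i. A2 t i \<otimes>\<^sub>m B2 t i \<otimes>\<^sub>m (\<omega> \<otimes>\<^sub>m proj (unit_vec c1 t) \<otimes>\<^sub>m proj (unit_vec c2 i))))"
        by (rule mat_sum_cong) (simp add: F2[OF _ wP])
      also have "\<dots> = mat_sum (a2 * b2 * e2) {..<c1 * c2} (\<lambda>i. A i \<otimes>\<^sub>m B i \<otimes>\<^sub>m (\<omega> \<otimes>\<^sub>m proj (unit_vec (c1 * c2) i)))"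
      proof (rule eq_matI)
        fix r s assume "r < dim_row (mat_sum (a2 * b2 * e2) {..<c1 * c2} (\<lambda>i. A i \<otimes>\<^sub>m B i \<otimes>\<^sub>m (\<omega> \<otimes>\<^sub>m proj (unit_vec (c1 * c2) i))))"
          "s < dim_col (mat_sum (a2 * b2 * e2) {..<c1 * c2} (\<lambda>i. A i \<otimes>\<^sub>m B i \<otimes>\<^sub>m (\<omega> \<otimes>\<^sub>m proj (unit_vec (c1 * c2) i))))"
        then have rs: "r < a2 * b2 * e2" "s < a2 * b2 * e2" by simp_all
        have a: "\<omega> \<otimes>\<^sub>m proj (unit_vec c1 t) \<otimes>\<^sub>m proj (unit_vec c2 i) = \<omega> \<otimes>\<^sub>m proj (unit_vec (c1 * c2) (t * c2 + i))"
          if "t < c1" "i < c2" for t i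
          unfolding proj_unit_vec_kron[OF that, symmetric]
          by (rule kron_assoc[OF w]) auto
        show "mat_sum (a2 * b2 * e2) {..<c1} (\<lambda>t. mat_sum (a2 * b2 * e2) {..<c2} (\<lambda>i. A2 t i \<otimes>\<^sub>m B2 t i \<otimes>\<^sub>m (\<omega> \<otimes>\<^sub>m proj (unit_vec c1 t) \<otimes>\<^sub>m proj (unit_vec c2 i)))) $$ (r, s)
          = mat_sum (a2 * b2 * e2) {..<c1 * c2} (\<lambda>i. A i \<otimes>\<^sub>m B i \<otimes>\<^sub>m (\<omega> \<otimes>\<^sub>m proj (unit_vec (c1 * c2) i))) $$ (r, s)"
          using rs by (simp add: sum_lessThan_mult a A_def B_def)
      qed simp_all
      finally show ?thesis .
    qed
    ultimately show ?thesis by blast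
  qed
  then show ?thesis using e unfolding product_form_def case_prod_conv by blast
qed

theorem lopc_product_form: "lopc D D' \<Phi> \<Longrightarrow> \<exists>c. product_form D D' \<Phi> c"
proof (induction rule: lopc.induct)
  case (lopc_id D)
  obtain a b e where D: "D = (a, b, e)" by (cases D)
  have "product_form (a, b, e) (a, b, e) (\<lambda>X. X) 1"
    by (rule product_form_one[where F="\<lambda>x. x" and G="\<lambda>x. x"]) simp
  then show ?case unfolding D by blast
next
  case (lopc_comp D D' \<Phi> D'' \<Psi>)
  obtain a b e a1 b1 e1 a2 b2 e2 where D: "D = (a, b, e)" "D' = (a1, b1, e1)" "D'' = (a2, b2, e2)"
    by (metis prod_cases3)
  obtain c1 c2 where "product_form D D' \<Phi> c1" "product_form D' D'' \<Psi> c2"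
    using lopc_comp lopc_step_product_form by blast
  moreover have "linear_map (a1 * b1 * e1) (a2 * b2 * e2) \<Psi>"
    using lopc_step_linear[OF lopc_comp.hyps(2)] by (simp add: D)
  ultimately have "product_form D D'' (\<Psi> \<circ> \<Phi>) (c1 * c2)" unfolding D by (rule product_form_comp)
  then show ?case by blast
qed

section \<open>A strong converse for LOPC key distillation\<close>

lemma kron3_index:
  assumes "A \<in> carrier_mat a a" "B \<in> carrier_mat b b" "C \<in> carrier_mat e e"
    "i < a" "j < b" "x < e" "i' < a" "j' < b" "y < e"
  shows "(A \<otimes>\<^sub>m B \<otimes>\<^sub>m C) $$ ((i * b + j) * e + x, (i' * b + j') * e + y) = A $$ (i, i') * B $$ (j, j') * C $$ (x, y)"
  using kron_index[OF kron_carrier[OF assms(1,2)] assms(3) mult_add_less[OF assms(4,5)] assms(6) mult_add_less[OF assms(7,8)] assms(9)]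
    kron_index[OF assms(1,2,4,5,7,8)] by simp

text \<open>The operator with diagonal blocks |ij><ij| \<otimes> F i j: it reads both keys in the
  computational basis and then applies to Eve's system a test selected by them.\<close>

definition block_test :: "nat \<Rightarrow> nat \<Rightarrow> nat \<Rightarrow> (nat \<Rightarrow> nat \<Rightarrow> cmat) \<Rightarrow> cmat" where
  "block_test a b e F = mat (a * b * e) (a * b * e) (\<lambda>(r, s).
     if r div e = s div e then F (r div e div b) (r div e mod b) $$ (r mod e, s mod e) else 0)"

lemma block_test_index:
  assumes "i < a" "j < b" "x < e" "i' < a" "j' < b" "y < e"
  shows "block_test a b e F $$ ((i * b + j) * e + x, (i' * b + j') * e + y) = (if i = i' \<and> j = j' then F i j $$ (x, y) else 0)"
proof -
  have "i * b + j = i' * b + j' \<longleftrightarrow> i = i' \<and> j = j'" using assms by (metis div_mod_add)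
  then show ?thesis
    using assms mult_add_less[OF mult_add_less[OF assms(1,2)] assms(3)] mult_add_less[OF mult_add_less[OF assms(4,5)] assms(6)]
    by (simp add: block_test_def)
qed

lemma qform_block_test:
  "qform (a * b * e) (block_test a b e F) v = (\<Sum>i<a. \<Sum>j<b. qform e (F i j) (\<lambda>x. v ((i * b + j) * e + x)))"
  unfolding qform_def sum_lessThan_mult
proof (rule sum.cong[OF refl], rule sum.cong[OF refl], rule sum.cong[OF refl])
  fix i j x assume "i \<in> {..<a}" "j \<in> {..<b}" "x \<in> {..<e}"
  then have ijx: "i < a" "j < b" "x < e" by auto
  have "(\<Sum>i'<a. \<Sum>j'<b. \<Sum>y<e. cnj (v ((i * b + j) * e + x)) * block_test a b e F $$ ((i * b + j) * e + x, (i' * b + j') * e + y) * v ((i' * b + j') * e + y))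
    = (\<Sum>i'<a. \<Sum>j'<b. \<Sum>y<e. if i' = i then if j' = j then cnj (v ((i * b + j) * e + x)) * F i j $$ (x, y) * v ((i * b + j) * e + y) else 0 else 0)"
    by (intro sum.cong refl) (auto simp: block_test_index ijx)
  also have "\<dots> = (\<Sum>y<e. cnj (v ((i * b + j) * e + x)) * F i j $$ (x, y) * v ((i * b + j) * e + y))"
    by (subst sum_one_support[OF ijx(1)], simp, subst sum_one_support[OF ijx(2)]) simp_all
  finally show "(\<Sum>i'<a. \<Sum>j'<b. \<Sum>y<e. cnj (v ((i * b + j) * e + x)) * block_test a b e F $$ ((i * b + j) * e + x, (i' * b + j') * e + y) * v ((i' * b + j') * e + y))
    = (\<Sum>y<e. cnj (v ((i * b + j) * e + x)) * F i j $$ (x, y) * v ((i * b + j) * e + y))" .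
qed

lemma mtr_block_test:
  assumes "A \<in> carrier_mat a a" "B \<in> carrier_mat b b" "C \<in> carrier_mat e e"
  shows "mtr (a * b * e) (block_test a b e F) (A \<otimes>\<^sub>m B \<otimes>\<^sub>m C) = (\<Sum>i<a. \<Sum>j<b. A $$ (i, i) * B $$ (j, j) * mtr e (F i j) C)"
  unfolding mtr_def sum_lessThan_mult sum_distrib_left
proof (rule sum.cong[OF refl], rule sum.cong[OF refl], rule sum.cong[OF refl])
  fix i j x assume "i \<in> {..<a}" "j \<in> {..<b}" "x \<in> {..<e}"
  then have ijx: "i < a" "j < b" "x < e" by auto
  have "(\<Sum>i'<a. \<Sum>j'<b. \<Sum>y<e. block_test a b e F $$ ((i * b + j) * e + x, (i' * b + j') * e + y) * (A \<otimes>\<^sub>m B \<otimes>\<^sub>m C) $$ ((i' * b + j') * e + y, (i * b + j) * e + x))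
    = (\<Sum>i'<a. \<Sum>j'<b. \<Sum>y<e. if i' = i then if j' = j then F i j $$ (x, y) * (A $$ (i, i) * B $$ (j, j) * C $$ (y, x)) else 0 else 0)"
    by (intro sum.cong refl) (auto simp: block_test_index ijx kron3_index[OF assms])
  also have "\<dots> = (\<Sum>y<e. F i j $$ (x, y) * (A $$ (i, i) * B $$ (j, j) * C $$ (y, x)))"
    by (subst sum_one_support[OF ijx(1)], simp, subst sum_one_support[OF ijx(2)]) simp_all
  finally show "(\<Sum>i'<a. \<Sum>j'<b. \<Sum>y<e. block_test a b e F $$ ((i * b + j) * e + x, (i' * b + j') * e + y) * (A \<otimes>\<^sub>m B \<otimes>\<^sub>m C) $$ ((i' * b + j') * e + y, (i * b + j) * e + x))
    = (\<Sum>y<e. A $$ (i, i) * B $$ (j, j) * (F i j $$ (x, y) * C $$ (y, x)))"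
    by (simp add: mult_ac)
qed

lemma mtr_mat_sum: "mtr n T (mat_sum n I f) = (\<Sum>k\<in>I. mtr n T (f k))"
  unfolding mtr_def by (simp add: sum_distrib_left) (rule sum_rotate3)

lemma mtr_smult: "X \<in> carrier_mat n n \<Longrightarrow> mtr n T (c \<cdot>\<^sub>m X) = c * mtr n T X"
  unfolding mtr_def by (auto simp: sum_distrib_left mult_ac intro!: sum.cong)

lemma mtr_smult_left: "T \<in> carrier_mat n n \<Longrightarrow> mtr n (c \<cdot>\<^sub>m T) X = c * mtr n T X"
  unfolding mtr_def by (auto simp: sum_distrib_left mult_ac intro!: sum.cong)

lemma mtr_minus: "X \<in> carrier_mat n n \<Longrightarrow> Y \<in> carrier_mat n n \<Longrightarrow> mtr n T (X - Y) = mtr n T X - mtr n T Y"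
  unfolding mtr_def by (auto simp: sum_subtractf[symmetric] algebra_simps intro!: sum.cong)

lemma mtr_one: "X \<in> carrier_mat n n \<Longrightarrow> mtr n (1\<^sub>m n) X = mat_trace X"
  unfolding mtr_def mat_trace_def
  by (auto intro!: sum.cong) (subst sum_one_support; auto)

lemma hermitian_mat_sum:
  assumes "\<And>k. k \<in> I \<Longrightarrow> hermitian n (f k)"
  shows "hermitian n (mat_sum n I f)"
  using assms by (auto simp: hermitian_def intro!: sum.cong)

lemma hermitian_smult: "hermitian n X \<Longrightarrow> hermitian n (complex_of_real c \<cdot>\<^sub>m X)"
  by (auto simp: hermitian_def)

lemma hermitian_minus: "hermitian n X \<Longrightarrow> hermitian n Y \<Longrightarrow> hermitian n (X - Y)"
  by (auto simp: hermitian_def)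

lemma psd_diag:
  assumes "psd n A" "i < n"
  shows "A $$ (i, i) = of_real (Re (A $$ (i, i)))" "0 \<le> Re (A $$ (i, i))"
proof -
  have "qform n A (\<lambda>k. if k = i then 1 else 0) = A $$ (i,i)"
    unfolding qform_def by (subst sum_one_support[OF assms(2)], simp, subst sum_one_support[OF assms(2)]) auto
  moreover have "0 \<le> qform n A (\<lambda>k. if k = i then 1 else 0)" using assms(1) by (simp add: psd_qform)
  ultimately have "0 \<le> A $$ (i, i)" by simp
  then show "A $$ (i, i) = of_real (Re (A $$ (i, i)))" "0 \<le> Re (A $$ (i, i))"
    by (auto simp: less_eq_complex_def complex_eq_iff)
qed

lemma psd_trace: "psd n A \<Longrightarrow> mat_trace A = of_real (\<Sum>i<n. Re (A $$ (i, i)))"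
proof -
  assume A: "psd n A"
  have "dim_row A = n" using A by (auto simp: psd_def)
  then show ?thesis unfolding mat_trace_def of_real_sum using psd_diag(1)[OF A] by (auto intro!: sum.cong)
qed

lemma hermitian_proj: "v \<in> carrier_vec n \<Longrightarrow> hermitian n (proj v)"
  by (auto simp: hermitian_def mult_ac)

lemma qform_proj:
  assumes "v \<in> carrier_vec n"
  shows "qform n (proj v) w = of_real ((norm (\<Sum>j<n. cnj (v $ j) * w j))^2)"
proof -
  have "qform n (proj v) w = (\<Sum>j<n. cnj (v $ j) * w j) * cnj (\<Sum>j<n. cnj (v $ j) * w j)"
    unfolding qform_def cnj_sum sum_product using assms by (subst sum.swap) (auto simp: mult_ac intro!: sum.cong)
  then show ?thesis by (simp only: complex_norm_square)
qed

lemma psd_proj: "v \<in> carrier_vec n \<Longrightarrow> psd n (proj v)"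
  by (simp add: psd_qform qform_proj less_eq_complex_def)

lemma proj_unit_vec_index: "k < c \<Longrightarrow> l < c \<Longrightarrow> proj (unit_vec c t) $$ (k, l) = (if k = t \<and> l = t then 1 else 0)"
  by (auto simp: unit_vec_def)

lemma kron_proj_index:
  assumes "Q \<in> carrier_mat e e" "i < e" "j < e" "k < c" "l < c"
  shows "(Q \<otimes>\<^sub>m proj (unit_vec c t)) $$ (i * c + k, j * c + l) = (if k = t \<and> l = t then Q $$ (i, j) else 0)"
  using assms by (subst kron_index[of _ e e _ c c]) (auto simp: proj_unit_vec_index simp del: ketbra_index)

lemma mtr_kron_proj:
  assumes "Q \<in> carrier_mat e e" "w \<in> carrier_mat e e" "t < c"
  shows "mtr (e * c) (Q \<otimes>\<^sub>m proj (unit_vec c t)) (w \<otimes>\<^sub>m proj (unit_vec c t)) = mtr e Q w"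
proof -
  show ?thesis unfolding mtr_def sum_lessThan_mult
  proof (rule sum.cong[OF refl])
    fix i assume "i \<in> {..<e}"
    then have i: "i < e" by simp
    have "(\<Sum>k<c. \<Sum>j<e. \<Sum>l<c. (Q \<otimes>\<^sub>m proj (unit_vec c t)) $$ (i * c + k, j * c + l) * (w \<otimes>\<^sub>m proj (unit_vec c t)) $$ (j * c + l, i * c + k))
       = (\<Sum>k<c. \<Sum>j<e. \<Sum>l<c. if l = t then (if k = t then Q $$ (i, j) * w $$ (j, i) else 0) else 0)"
      using i by (intro sum.cong refl) (auto simp: kron_proj_index[OF assms(1)] kron_proj_index[OF assms(2)])
    also have "\<dots> = (\<Sum>j<e. Q $$ (i, j) * w $$ (j, i))"
      using assms(3) by (simp, subst sum_one_support[of t]) auto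
    finally show "(\<Sum>k<c. \<Sum>j<e. \<Sum>l<c. (Q \<otimes>\<^sub>m proj (unit_vec c t)) $$ (i * c + k, j * c + l) * (w \<otimes>\<^sub>m proj (unit_vec c t)) $$ (j * c + l, i * c + k))
      = (\<Sum>j<e. Q $$ (i, j) * w $$ (j, i))" .
  qed
qed

lemma qform_kron_proj:
  assumes "Q \<in> carrier_mat e e" "t < c"
  shows "qform (e * c) (Q \<otimes>\<^sub>m proj (unit_vec c t)) v = qform e Q (\<lambda>x. v (x * c + t))"
proof -
  show ?thesis unfolding qform_def sum_lessThan_mult
  proof (rule sum.cong[OF refl])
    fix i assume "i \<in> {..<e}"
    then have i: "i < e" by simp
    have "(\<Sum>k<c. \<Sum>j<e. \<Sum>l<c. cnj (v (i * c + k)) * (Q \<otimes>\<^sub>m proj (unit_vec c t)) $$ (i * c + k, j * c + l) * v (j * c + l))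
       = (\<Sum>k<c. \<Sum>j<e. \<Sum>l<c. if l = t then (if k = t then cnj (v (i * c + t)) * Q $$ (i, j) * v (j * c + t) else 0) else 0)"
      using i by (intro sum.cong refl) (auto simp: kron_proj_index[OF assms(1)])
    also have "\<dots> = (\<Sum>j<e. cnj (v (i * c + t)) * Q $$ (i, j) * v (j * c + t))"
      using assms(2) by (simp, subst sum_one_support[of t]) auto
    finally show "(\<Sum>k<c. \<Sum>j<e. \<Sum>l<c. cnj (v (i * c + k)) * (Q \<otimes>\<^sub>m proj (unit_vec c t)) $$ (i * c + k, j * c + l) * v (j * c + l))
       = (\<Sum>j<e. cnj (v (i * c + t)) * Q $$ (i, j) * v (j * c + t))" .
  qed
qed

lemma psd_kron_proj:
  assumes "psd e Q" "t < c"
  shows "psd (e * c) (Q \<otimes>\<^sub>m proj (unit_vec c t))"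
  using assms by (auto simp: psd_qform qform_kron_proj)

lemma qform_smult: "X \<in> carrier_mat n n \<Longrightarrow> qform n (c \<cdot>\<^sub>m X) v = c * qform n X v"
  unfolding qform_def by (auto simp: sum_distrib_left mult_ac intro!: sum.cong)

lemma qform_mat_sum: "qform n (mat_sum n I f) v = (\<Sum>k\<in>I. qform n (f k) v)"
  unfolding qform_def by (simp add: sum_distrib_left sum_distrib_right) (rule sum_rotate3)

lemma qform_one: "qform n (1\<^sub>m n) v = of_real (\<Sum>i<n. (norm (v i))^2)"
  unfolding qform_def of_real_sum complex_norm_square
  by (intro sum.cong refl, subst sum_one_support) (auto simp: mult_ac)

lemma mtr_zero: "mtr n (0\<^sub>m n n) X = 0"
  unfolding mtr_def by simp

lemma qform_zero: "qform n (0\<^sub>m n n) v = 0"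
  unfolding qform_def by simp

lemma key_state_eq:
  "key_state (a, b, e) l \<tau> = complex_of_real (1 / 2 ^ l) \<cdot>\<^sub>m
     mat_sum (a * b * e) {..<2 ^ l} (\<lambda>i. proj (unit_vec a i) \<otimes>\<^sub>m proj (unit_vec b i) \<otimes>\<^sub>m \<tau>)"
  by simp

lemma mtr_block_test_key_state:
  assumes "\<tau> \<in> carrier_mat e e" "2 ^ l \<le> a" "2 ^ l \<le> b"
  shows "mtr (a * b * e) (block_test a b e F) (key_state (a, b, e) l \<tau>) = of_real (1 / 2 ^ l) * (\<Sum>k<2 ^ l. mtr e (F k k) \<tau>)"
proof -
  have "mtr (a * b * e) (block_test a b e F) (proj (unit_vec a k) \<otimes>\<^sub>m proj (unit_vec b k) \<otimes>\<^sub>m \<tau>) = mtr e (F k k) \<tau>"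
    if k: "k < 2 ^ l" for k
  proof -
    have ka: "k < a" "k < b" using k assms by auto
    have "mtr (a * b * e) (block_test a b e F) (proj (unit_vec a k) \<otimes>\<^sub>m proj (unit_vec b k) \<otimes>\<^sub>m \<tau>)
       = (\<Sum>i<a. \<Sum>j<b. proj (unit_vec a k) $$ (i, i) * proj (unit_vec b k) $$ (j, j) * mtr e (F i j) \<tau>)"
      by (rule mtr_block_test) (use assms in auto)
    also have "\<dots> = mtr e (F k k) \<tau>"
      by (subst sum_one_support[OF ka(1)], simp add: unit_vec_def, subst sum_one_support[OF ka(2)]) (auto simp: unit_vec_def ka)
    finally show ?thesis .
  qed
  then show ?thesis unfolding key_state_eq by (simp add: mtr_smult mtr_mat_sum)
qed

lemma hermitian_key_state:
  assumes "hermitian e \<tau>"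
  shows "hermitian (a * b * e) (key_state (a, b, e) l \<tau>)"
  unfolding key_state_eq
  by (intro hermitian_smult hermitian_mat_sum hermitian_kron hermitian_proj assms) auto

lemma block_test_bounds:
  assumes "\<And>i j v. i < a \<Longrightarrow> j < b \<Longrightarrow> 0 \<le> Re (qform e (F i j) v)"
    "\<And>i j v. i < a \<Longrightarrow> j < b \<Longrightarrow> Re (qform e (F i j) v) \<le> c * (\<Sum>x<e. (norm (v x))^2)"
  shows "0 \<le> Re (qform (a * b * e) (block_test a b e F) v)"
    "Re (qform (a * b * e) (block_test a b e F) v) \<le> c * (\<Sum>r<a * b * e. (norm (v r))^2)"
proof -
  show "0 \<le> Re (qform (a * b * e) (block_test a b e F) v)"
    unfolding qform_block_test Re_sum by (rule sum_nonneg, rule sum_nonneg, rule assms(1)) simp_all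
  have "(\<Sum>i<a. \<Sum>j<b. Re (qform e (F i j) (\<lambda>x. v ((i * b + j) * e + x)))) \<le>
     (\<Sum>i<a. \<Sum>j<b. c * (\<Sum>x<e. (norm (v ((i * b + j) * e + x)))^2))"
    by (rule sum_mono, rule sum_mono, rule assms(2)) simp_all
  then show "Re (qform (a * b * e) (block_test a b e F) v) \<le> c * (\<Sum>r<a * b * e. (norm (v r))^2)"
    unfolding qform_block_test Re_sum sum_lessThan_mult sum_distrib_left .
qed

text \<open>Two tests are compared with the ideal key. Agreement of the keys, a test of norm 1,
  costs 2 \<epsilon>; Eve's guess, a test of norm 2, costs 4 \<epsilon>; together these are the 6 in
  the conclusion. Given x, agreement and recognition of x by Eve are independent, and if both
  succeed with high probability then so does Eve's guess, whereas on an ideal key her tests have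
  total weight at most 2 L spread over 2^l values.\<close>

theorem lopc_converse:
  assumes lopc: "lopc (a, b, e) (a', b', e') \<Phi>"
    and fin: "finite X" and p: "\<And>x. x \<in> X \<Longrightarrow> 0 \<le> p x" "(\<Sum>x\<in>X. p x) = 1"
    and \<alpha>: "\<And>x. x \<in> X \<Longrightarrow> density a (\<alpha> x)" and \<beta>: "\<And>x. x \<in> X \<Longrightarrow> density b (\<beta> x)"
    and \<omega>: "\<And>x. x \<in> X \<Longrightarrow> density e (\<omega> x)"
    and Q: "\<And>x. x \<in> X \<Longrightarrow> psd e (Q x)" "\<And>x v. x \<in> X \<Longrightarrow> Re (qform e (Q x) v) \<le> (\<Sum>i<e. (norm (v i))^2)"
      "\<And>v. (\<Sum>x\<in>X. Re (qform e (Q x) v)) \<le> L * (\<Sum>i<e. (norm (v i))^2)"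
    and \<eta>: "1 - \<eta> \<le> (\<Sum>x\<in>X. p x * Re (mtr e (Q x) (\<omega> x)))"
    and K: "2 ^ l \<le> a'" "2 ^ l \<le> b'" and \<tau>: "density e' \<tau>"
  shows "1 - \<eta> \<le> 2 * L / 2 ^ l + 6 * tdist (a' * b' * e')
    (\<Phi> (mat_sum (a * b * e) X (\<lambda>x. complex_of_real (p x) \<cdot>\<^sub>m (\<alpha> x \<otimes>\<^sub>m \<beta> x \<otimes>\<^sub>m \<omega> x)))) (key_state (a', b', e') l \<tau>)"
proof -
  obtain c where "product_form (a, b, e) (a', b', e') \<Phi> c" using lopc_product_form[OF lopc] by blast
  note pf = this[unfolded product_form_def case_prod_conv]
  then have e': "e' = e * c" by blast
  define G where "G x A B \<longleftrightarrow> (\<forall>i<c. psd a' (A i) \<and> psd b' (B i)) \<and> (\<Sum>i<c. mat_trace (A i) * mat_trace (B i)) = 1 \<and>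
    \<Phi> (\<alpha> x \<otimes>\<^sub>m \<beta> x \<otimes>\<^sub>m \<omega> x) = mat_sum (a' * b' * e') {..<c} (\<lambda>i. A i \<otimes>\<^sub>m B i \<otimes>\<^sub>m (\<omega> x \<otimes>\<^sub>m proj (unit_vec c i)))" for x A B
  have "\<exists>A B. x \<in> X \<longrightarrow> G x A B" for x
  proof (cases "x \<in> X")
    case True
    have pp: "psd a (\<alpha> x)" "psd b (\<beta> x)" "\<omega> x \<in> carrier_mat e e" "mat_trace (\<alpha> x) * mat_trace (\<beta> x) = 1"
      using \<alpha>[OF True] \<beta>[OF True] \<omega>[OF True] by (auto simp: density_def psd_def)
    from conjunct2[OF pf, THEN spec, THEN spec, THEN mp, THEN mp, OF pp(1,2)] obtain A B
      where "\<forall>i<c. psd a' (A i) \<and> psd b' (B i)"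
        "(\<Sum>i<c. mat_trace (A i) * mat_trace (B i)) = mat_trace (\<alpha> x) * mat_trace (\<beta> x)"
        "\<forall>\<omega>\<in>carrier_mat e e. \<Phi> (\<alpha> x \<otimes>\<^sub>m \<beta> x \<otimes>\<^sub>m \<omega>) =
            mat_sum (a' * b' * e') {..<c} (\<lambda>i. A i \<otimes>\<^sub>m B i \<otimes>\<^sub>m (\<omega> \<otimes>\<^sub>m proj (unit_vec c i)))"
      by blast
    then have "G x A B" unfolding G_def using pp(3,4) by simp
    then show ?thesis by blast
  qed simp
  then obtain A B where AB: "\<And>x. x \<in> X \<Longrightarrow> G x (A x) (B x)" by metis
  define K where "K = (2::nat) ^ l"
  have Ka: "K \<le> a'" "K \<le> b'" using K by (auto simp: K_def)
  have A: "psd a' (A x t)" and B: "psd b' (B x t)" if "x \<in> X" "t < c" for x t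
    using AB[OF that(1)] that(2) by (auto simp: G_def)
  have \<Phi>: "\<Phi> (\<alpha> x \<otimes>\<^sub>m \<beta> x \<otimes>\<^sub>m \<omega> x) = mat_sum (a' * b' * e') {..<c} (\<lambda>i. A x i \<otimes>\<^sub>m B x i \<otimes>\<^sub>m (\<omega> x \<otimes>\<^sub>m proj (unit_vec c i)))"
    if "x \<in> X" for x using AB[OF that] by (simp add: G_def)
  define ra where "ra x t i = Re (A x t $$ (i, i))" for x t i
  define rb where "rb x t i = Re (B x t $$ (i, i))" for x t i
  have ra: "A x t $$ (i, i) = of_real (ra x t i)" "0 \<le> ra x t i" if "x \<in> X" "t < c" "i < a'" for x t i
    using psd_diag[OF A[OF that(1,2)] that(3)] by (simp_all add: ra_def)
  have rb: "B x t $$ (i, i) = of_real (rb x t i)" "0 \<le> rb x t i" if "x \<in> X" "t < c" "i < b'" for x t i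
    using psd_diag[OF B[OF that(1,2)] that(3)] by (simp_all add: rb_def)
  have tr1: "(\<Sum>t<c. (\<Sum>i<a'. ra x t i) * (\<Sum>j<b'. rb x t j)) = 1" if x: "x \<in> X" for x
  proof -
    have "(\<Sum>t<c. mat_trace (A x t) * mat_trace (B x t)) = of_real (\<Sum>t<c. (\<Sum>i<a'. ra x t i) * (\<Sum>j<b'. rb x t j))"
      unfolding of_real_sum[of _ "{..<c}"] of_real_mult using psd_trace[OF A[OF x]] psd_trace[OF B[OF x]] by (simp add: ra_def rb_def)
    then have "complex_of_real (\<Sum>t<c. (\<Sum>i<a'. ra x t i) * (\<Sum>j<b'. rb x t j)) = 1"
      using AB[OF x] by (simp add: G_def)
    then show ?thesis by (simp only: of_real_eq_1_iff)
  qed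
  \<comment> \<open>Eve's normalised state given the string and the transcript.\<close>
  define w where "w x t = \<omega> x \<otimes>\<^sub>m proj (unit_vec c t)" for x t
  have wp: "psd e' (w x t)" if "x \<in> X" "t < c" for x t
    unfolding w_def e' using \<omega>[OF that(1)] that(2) by (intro psd_kron_proj) (auto simp: density_def)
  have wt: "mat_trace (w x t) = 1" if "x \<in> X" "t < c" for x t
    using \<omega>[OF that(1)] that(2) unfolding w_def
    by (subst mat_trace_kron[of _ e _ c]) (auto simp: density_def psd_def trace_proj_unit_vec)
  define \<rho> where "\<rho> = mat_sum (a * b * e) X (\<lambda>x. complex_of_real (p x) \<cdot>\<^sub>m (\<alpha> x \<otimes>\<^sub>m \<beta> x \<otimes>\<^sub>m \<omega> x))"
  define \<kappa> where "\<kappa> = key_state (a', b', e') l \<tau>"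
  define \<epsilon> where "\<epsilon> = tdist (a' * b' * e') (\<Phi> \<rho>) \<kappa>"
  have lin: "linear_map (a * b * e) (a' * b' * e') \<Phi>" using lopc_linear[OF lopc] by simp
  have C: "\<alpha> x \<otimes>\<^sub>m \<beta> x \<otimes>\<^sub>m \<omega> x \<in> carrier_mat (a * b * e) (a * b * e)" if "x \<in> X" for x
    using \<alpha>[OF that] \<beta>[OF that] \<omega>[OF that] by (intro kron_carrier) (auto simp: density_def psd_def)
  have \<Phi>\<rho>: "\<Phi> \<rho> = mat_sum (a' * b' * e') X (\<lambda>x. complex_of_real (p x) \<cdot>\<^sub>m mat_sum (a' * b' * e') {..<c} (\<lambda>t. A x t \<otimes>\<^sub>m B x t \<otimes>\<^sub>m w x t))"
  proof -
    have "\<Phi> \<rho> = mat_sum (a' * b' * e') X (\<lambda>x. \<Phi> (complex_of_real (p x) \<cdot>\<^sub>m (\<alpha> x \<otimes>\<^sub>m \<beta> x \<otimes>\<^sub>m \<omega> x)))"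
      unfolding \<rho>_def by (rule linear_map_mat_sum[OF lin fin]) (use C in auto)
    also have "\<dots> = mat_sum (a' * b' * e') X (\<lambda>x. complex_of_real (p x) \<cdot>\<^sub>m \<Phi> (\<alpha> x \<otimes>\<^sub>m \<beta> x \<otimes>\<^sub>m \<omega> x))"
      by (rule mat_sum_cong) (use lin C in \<open>simp add: linear_map_def\<close>)
    also have "\<dots> = mat_sum (a' * b' * e') X (\<lambda>x. complex_of_real (p x) \<cdot>\<^sub>m mat_sum (a' * b' * e') {..<c} (\<lambda>t. A x t \<otimes>\<^sub>m B x t \<otimes>\<^sub>m w x t))"
      by (rule mat_sum_cong) (simp add: \<Phi> w_def)
    finally show ?thesis .
  qed
  have h: "hermitian (a' * b' * e') (\<Phi> \<rho> - \<kappa>)"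
  proof (rule hermitian_minus)
    show "hermitian (a' * b' * e') (\<Phi> \<rho>)" unfolding \<Phi>\<rho>
      using A B wp by (intro hermitian_mat_sum hermitian_smult hermitian_kron psd_hermitian) auto
    show "hermitian (a' * b' * e') \<kappa>" unfolding \<kappa>_def
      using \<tau> by (intro hermitian_key_state psd_hermitian) (simp add: density_def)
  qed
  have \<tau>c: "\<tau> \<in> carrier_mat e' e'" using \<tau> by (simp add: density_def psd_def)
  \<comment> \<open>Evaluation of a general controlled test on the output and on the ideal key; B'
    is its operator bound. It is applied once for agreement and once for Eve's guess.\<close>
  have test: "\<bar>(\<Sum>x\<in>X. p x * (\<Sum>t<c. \<Sum>i<a'. \<Sum>j<b'. ra x t i * rb x t j * Re (mtr e' (F i j) (w x t)))) - (\<Sum>k<K. Re (mtr e' (F k k) \<tau>)) / 2 ^ l\<bar> \<le> 2 * B' * \<epsilon>"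
    if F: "\<And>i j v. i < a' \<Longrightarrow> j < b' \<Longrightarrow> 0 \<le> Re (qform e' (F i j) v)"
      "\<And>i j v. i < a' \<Longrightarrow> j < b' \<Longrightarrow> Re (qform e' (F i j) v) \<le> B' * (\<Sum>x<e'. (norm (v x))^2)" for F B'
  proof -
    define T where "T = block_test a' b' e' F"
    have "mtr (a' * b' * e') T (\<Phi> \<rho>) = (\<Sum>x\<in>X. of_real (p x) * (\<Sum>t<c. \<Sum>i<a'. \<Sum>j<b'. A x t $$ (i, i) * B x t $$ (j, j) * mtr e' (F i j) (w x t)))"
      unfolding \<Phi>\<rho> mtr_mat_sum
    proof (intro sum.cong refl)
      fix x assume x: "x \<in> X"
      have "mtr (a' * b' * e') T (A x t \<otimes>\<^sub>m B x t \<otimes>\<^sub>m w x t) = (\<Sum>i<a'. \<Sum>j<b'. A x t $$ (i, i) * B x t $$ (j, j) * mtr e' (F i j) (w x t))"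
        if t: "t < c" for t
        unfolding T_def using A[OF x t] B[OF x t] wp[OF x t] by (intro mtr_block_test) (auto simp: psd_def)
      then show "mtr (a' * b' * e') T (complex_of_real (p x) \<cdot>\<^sub>m mat_sum (a' * b' * e') {..<c} (\<lambda>t. A x t \<otimes>\<^sub>m B x t \<otimes>\<^sub>m w x t))
        = of_real (p x) * (\<Sum>t<c. \<Sum>i<a'. \<Sum>j<b'. A x t $$ (i, i) * B x t $$ (j, j) * mtr e' (F i j) (w x t))"
        by (simp add: mtr_smult mtr_mat_sum)
    qed
    then have 1: "Re (mtr (a' * b' * e') T (\<Phi> \<rho>)) = (\<Sum>x\<in>X. p x * (\<Sum>t<c. \<Sum>i<a'. \<Sum>j<b'. ra x t i * rb x t j * Re (mtr e' (F i j) (w x t))))"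
      by (simp add: ra rb mult.assoc)
    have 2: "Re (mtr (a' * b' * e') T \<kappa>) = (\<Sum>k<K. Re (mtr e' (F k k) \<tau>)) / 2 ^ l"
      unfolding T_def \<kappa>_def mtr_block_test_key_state[OF \<tau>c K] K_def by simp
    have "\<bar>Re (mtr (a' * b' * e') T (\<Phi> \<rho> - \<kappa>))\<bar> \<le> 2 * B' * \<epsilon>"
      unfolding \<epsilon>_def by (rule tdist_test[OF h]) (use block_test_bounds[OF F] in \<open>auto simp: T_def\<close>)
    moreover have "mtr (a' * b' * e') T (\<Phi> \<rho> - \<kappa>) = mtr (a' * b' * e') T (\<Phi> \<rho>) - mtr (a' * b' * e') T \<kappa>"
      by (rule mtr_minus) (auto simp: \<Phi>\<rho> \<kappa>_def)
    ultimately show ?thesis using 1 2 by simp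
  qed
  \<comment> \<open>The probability, given x, that the keys agree and lie among the K admissible
    values.\<close>
  define S where "S x = (\<Sum>t<c. \<Sum>i<K. ra x t i * rb x t i)" for x
  define q where "q x = Re (mtr e (Q x) (\<omega> x))" for x
  have q01: "0 \<le> q x" "q x \<le> 1" if x: "x \<in> X" for x
  proof -
    have w: "psd e (\<omega> x)" "mat_trace (\<omega> x) = 1" using \<omega>[OF x] by (auto simp: density_def)
    show "0 \<le> q x" unfolding q_def
      using mtr_mono[OF w(1), of "0\<^sub>m e e" "Q x"] Q(1)[OF x] by (auto simp: mtr_zero qform_zero psd_qform less_eq_complex_def)
    have "\<omega> x \<in> carrier_mat e e" using w by (simp add: psd_def)
    then show "q x \<le> 1" unfolding q_def
      using mtr_mono[OF w(1), of "Q x" "1\<^sub>m e"] Q(2)[OF x] w(2) by (auto simp: mtr_one qform_one)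
  qed
  have S1: "S x \<le> 1" if x: "x \<in> X" for x
  proof -
    have "(\<Sum>i<K. ra x t i * rb x t i) \<le> (\<Sum>i<a'. ra x t i) * (\<Sum>j<b'. rb x t j)" if t: "t < c" for t
    proof -
      have "(\<Sum>i<K. ra x t i * rb x t i) \<le> (\<Sum>i<K. ra x t i * (\<Sum>j<b'. rb x t j))"
      proof (intro sum_mono mult_left_mono)
        fix i assume "i \<in> {..<K}"
        then have i: "i < a'" "i < b'" using Ka by auto
        show "0 \<le> ra x t i" using ra(2)[OF x t i(1)] .
        show "rb x t i \<le> (\<Sum>j<b'. rb x t j)" using rb(2)[OF x t] i by (intro member_le_sum) auto
      qed
      also have "\<dots> \<le> (\<Sum>i<a'. ra x t i * (\<Sum>j<b'. rb x t j))"
        using ra(2)[OF x t] rb(2)[OF x t] Ka by (intro sum_mono2) (auto intro!: mult_nonneg_nonneg sum_nonneg)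
      finally show ?thesis by (simp add: sum_distrib_right)
    qed
    then have "S x \<le> (\<Sum>t<c. (\<Sum>i<a'. ra x t i) * (\<Sum>j<b'. rb x t j))" unfolding S_def by (intro sum_mono) simp
    then show ?thesis by (simp add: tr1[OF x])
  qed
  have agree: "1 - 2 * \<epsilon> \<le> (\<Sum>x\<in>X. p x * S x)"
  proof -
    define F where "F i j = (if i = j \<and> i < K then 1\<^sub>m e' else 0\<^sub>m e' e' :: cmat)" for i j :: nat
    have "(\<Sum>i<a'. \<Sum>j<b'. ra x t i * rb x t j * Re (mtr e' (F i j) (w x t))) = (\<Sum>i<K. ra x t i * rb x t i)"
      if x: "x \<in> X" and t: "t < c" for x t
    proof -
      have wc: "w x t \<in> carrier_mat e' e'" using wp[OF x t] by (simp add: psd_def)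
      have "(\<Sum>i<a'. \<Sum>j<b'. ra x t i * rb x t j * Re (mtr e' (F i j) (w x t)))
         = (\<Sum>i<a'. if i < K then ra x t i * rb x t i else 0)"
      proof (intro sum.cong refl)
        fix i assume "i \<in> {..<a'}"
        show "(\<Sum>j<b'. ra x t i * rb x t j * Re (mtr e' (F i j) (w x t))) = (if i < K then ra x t i * rb x t i else 0)"
        proof (cases "i < K")
          case True
          then have "i < b'" using Ka by simp
          then show ?thesis using True
            by (subst sum_one_support[of i]) (auto simp: F_def mtr_zero mtr_one[OF wc] wt[OF x t])
        qed (simp add: F_def mtr_zero)
      qed
      also have "\<dots> = (\<Sum>i\<in>{..<K}. ra x t i * rb x t i)"
        by (rule sum.mono_neutral_cong_right) (use Ka in auto)
      finally show ?thesis .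
    qed
    then have "(\<Sum>x\<in>X. p x * (\<Sum>t<c. \<Sum>i<a'. \<Sum>j<b'. ra x t i * rb x t j * Re (mtr e' (F i j) (w x t)))) = (\<Sum>x\<in>X. p x * S x)"
      unfolding S_def by simp
    moreover have "(\<Sum>k<K. Re (mtr e' (F k k) \<tau>)) / 2 ^ l = 1"
      using \<tau> by (simp add: F_def mtr_one[OF \<tau>c] density_def K_def)
    moreover have "\<bar>(\<Sum>x\<in>X. p x * (\<Sum>t<c. \<Sum>i<a'. \<Sum>j<b'. ra x t i * rb x t j * Re (mtr e' (F i j) (w x t)))) - (\<Sum>k<K. Re (mtr e' (F k k) \<tau>)) / 2 ^ l\<bar> \<le> 2 * 1 * \<epsilon>"
      by (rule test) (auto simp: F_def qform_one qform_zero sum_nonneg)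
    ultimately show ?thesis by linarith
  qed
  text \<open>
    Eve guesses the key by sampling from Bob's marginal. Where its total mass vanishes, so does
    \<open>rb x t i\<close>, and the junk value of the quotient does not matter.
  \<close>
  define bt where "bt x t i = rb x t i / (\<Sum>j<b'. rb x t j)" for x t i
  have rs: "0 \<le> (\<Sum>j<b'. rb x t j)" if "x \<in> X" "t < c" for x t using rb(2)[OF that] by (intro sum_nonneg) auto
  have bt0: "0 \<le> bt x t i" if "x \<in> X" "t < c" "i < K" for x t i
    using rb(2)[OF that(1,2), of i] rs[OF that(1,2)] that(3) Ka by (simp add: bt_def)
  have bts: "(\<Sum>i<K. bt x t i) \<le> 1" if "x \<in> X" "t < c" for x t
  proof -
    have "(\<Sum>i<K. rb x t i) \<le> (\<Sum>j<b'. rb x t j)" using rb(2)[OF that] Ka by (intro sum_mono2) auto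
    then show ?thesis using rs[OF that] unfolding bt_def sum_divide_distrib[symmetric]
      by (simp add: divide_le_eq_1) linarith
  qed
  have bt1: "bt x t i \<le> 1" if "x \<in> X" "t < c" "i < K" for x t i
  proof -
    have "bt x t i \<le> (\<Sum>i<K. bt x t i)" using bt0[OF that(1,2)] that(3) by (intro member_le_sum) auto
    then show ?thesis using bts[OF that(1,2)] by simp
  qed
  \<comment> \<open>Eve's test for key value i through one hypothesis: her original system is
    accepted as x, the transcript reads t, and the guess drawn from Bob's marginal is i.\<close>
  define M where "M i x t = complex_of_real (bt x t i) \<cdot>\<^sub>m (Q x \<otimes>\<^sub>m proj (unit_vec c t))" for i x t
  define Y where "Y i = mat_sum e' X (\<lambda>x. mat_sum e' {..<c} (M i x))" for i
  have QP: "psd e' (Q x \<otimes>\<^sub>m proj (unit_vec c t))" "Q x \<otimes>\<^sub>m proj (unit_vec c t) \<in> carrier_mat e' e'" if "x \<in> X" "t < c" for x t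
    unfolding e' using psd_kron_proj[OF Q(1)[OF that(1)] that(2)] by (auto simp: psd_def)
  have qQ0: "0 \<le> Re (qform e (Q x) v)" "Im (qform e (Q x) v) = 0" if "x \<in> X" for x v
    using Q(1)[OF that] by (auto simp: psd_qform less_eq_complex_def)
  have qM: "qform e' (M i x t) v = of_real (bt x t i) * qform e (Q x) (\<lambda>y. v (y * c + t))" if "x \<in> X" "t < c" for i x t v
    unfolding M_def using QP[OF that] Q(1)[OF that(1)] that(2)
    by (simp add: qform_smult) (simp add: e' qform_kron_proj psd_def)
  have Mpsd: "psd e' (M i x t)" if "x \<in> X" "t < c" "i < K" for i x t
  proof -
    have "M i x t \<in> carrier_mat e' e'" using QP[OF that(1,2)] by (simp add: M_def)
    then show ?thesis unfolding psd_qform using qQ0[OF that(1)] bt0[OF that]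
      by (auto simp: qM[OF that(1,2)] less_eq_complex_def)
  qed
  have qY: "Re (qform e' (Y i) v) = (\<Sum>x\<in>X. \<Sum>t<c. bt x t i * Re (qform e (Q x) (\<lambda>y. v (y * c + t))))" for i v
    unfolding Y_def qform_mat_sum by (simp add: qM)
  have vs: "(\<Sum>y<e'. (norm (v y))^2) = (\<Sum>t<c. \<Sum>y<e. (norm (v (y * c + t)))^2)" for v :: "nat \<Rightarrow> complex"
    unfolding e' sum_lessThan_mult by (rule sum.swap)
  have Ypsd: "psd e' (Y i)" if i: "i < K" for i
  proof -
    have "0 \<le> Re (qform e' (Y i) v)" for v
      unfolding qY using qQ0 bt0 i by (intro sum_nonneg mult_nonneg_nonneg) auto
    moreover have "Im (qform e' (Y i) v) = 0" for v
      unfolding Y_def qform_mat_sum by (simp add: qM qQ0)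
    ultimately show ?thesis unfolding psd_qform by (auto simp: Y_def less_eq_complex_def)
  qed
  \<comment> \<open>The guess probabilities sum to at most 1 for each x and t, and the Q x to at
    most L, so the number of candidates bounds all guesses together.\<close>
  have Ysum: "(\<Sum>i<K. Re (qform e' (Y i) v)) \<le> L * (\<Sum>y<e'. (norm (v y))^2)" for v
  proof -
    have "(\<Sum>i<K. Re (qform e' (Y i) v)) = (\<Sum>x\<in>X. \<Sum>t<c. (\<Sum>i<K. bt x t i) * Re (qform e (Q x) (\<lambda>y. v (y * c + t))))"
      unfolding qY sum_distrib_right by (subst sum_rotate3[symmetric]) simp
    also have "\<dots> \<le> (\<Sum>x\<in>X. \<Sum>t<c. 1 * Re (qform e (Q x) (\<lambda>y. v (y * c + t))))"
      using bts qQ0 by (intro sum_mono mult_right_mono) auto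
    also have "\<dots> = (\<Sum>t<c. \<Sum>x\<in>X. Re (qform e (Q x) (\<lambda>y. v (y * c + t))))" by (simp, rule sum.swap)
    also have "\<dots> \<le> (\<Sum>t<c. L * (\<Sum>y<e. (norm (v (y * c + t)))^2))" by (intro sum_mono Q(3))
    finally show ?thesis by (simp add: vs sum_distrib_left)
  qed
  \<comment> \<open>The only norm bound on Y i comes from L, and as a test it would scale the trace
    distance by that amount. The majorant Z i has norm at most 2 and is still at most 2 Y i.\<close>
  have "\<forall>i. \<exists>Z. i < K \<longrightarrow> psd e' Z \<and> (\<forall>v. Re (qform e' Z v) \<le> 2 * (\<Sum>y<e'. (norm (v y))^2)) \<and>
    (\<forall>v. Re (qform e' Z v) \<le> 2 * Re (qform e' (Y i) v)) \<and>
    (\<forall>M. psd e' M \<longrightarrow> (\<forall>v. Re (qform e' M v) \<le> Re (qform e' (Y i) v)) \<longrightarrow>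
      (\<forall>v. Re (qform e' M v) \<le> (\<Sum>y<e'. (norm (v y))^2)) \<longrightarrow> (\<forall>v. Re (qform e' M v) \<le> Re (qform e' Z v)))"
    using bounded_majorant[OF Ypsd] by blast
  from choice[OF this] obtain Z where Z: "\<And>i. i < K \<Longrightarrow> psd e' (Z i)"
    and Z2: "\<And>i v. i < K \<Longrightarrow> Re (qform e' (Z i) v) \<le> 2 * (\<Sum>y<e'. (norm (v y))^2)"
    and ZY: "\<And>i v. i < K \<Longrightarrow> Re (qform e' (Z i) v) \<le> 2 * Re (qform e' (Y i) v)"
    and ZM: "\<And>i M v. i < K \<Longrightarrow> psd e' M \<Longrightarrow> (\<forall>v. Re (qform e' M v) \<le> Re (qform e' (Y i) v)) \<Longrightarrow>
      (\<forall>v. Re (qform e' M v) \<le> (\<Sum>y<e'. (norm (v y))^2)) \<Longrightarrow> Re (qform e' M v) \<le> Re (qform e' (Z i) v)"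
    by blast
  have MZ: "Re (qform e' (M i x t) v) \<le> Re (qform e' (Z i) v)" if x: "x \<in> X" and t: "t < c" and i: "i < K" for i x t v
  proof (rule ZM[OF i Mpsd[OF x t i]]; intro allI)
    fix v
    have "Re (qform e' (M i x t) v) = bt x t i * Re (qform e (Q x) (\<lambda>y. v (y * c + t)))" by (simp add: qM x t)
    also have "\<dots> \<le> (\<Sum>t<c. bt x t i * Re (qform e (Q x) (\<lambda>y. v (y * c + t))))"
      using x t i qQ0 bt0 by (intro member_le_sum) (auto intro!: mult_nonneg_nonneg)
    also have "\<dots> \<le> Re (qform e' (Y i) v)" unfolding qY
      using x t i qQ0 bt0 fin by (intro member_le_sum) (auto intro!: sum_nonneg mult_nonneg_nonneg)
    finally show "Re (qform e' (M i x t) v) \<le> Re (qform e' (Y i) v)" .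
    have "bt x t i * Re (qform e (Q x) (\<lambda>y. v (y * c + t))) \<le> 1 * (\<Sum>y<e. (norm (v (y * c + t)))^2)"
      using Q(2)[OF x] bt1[OF x t i] bt0[OF x t i] qQ0[OF x] by (intro mult_mono) auto
    also have "\<dots> \<le> (\<Sum>y<e'. (norm (v y))^2)" unfolding vs
      using t by (simp, intro member_le_sum) (auto intro!: sum_nonneg)
    finally show "Re (qform e' (M i x t) v) \<le> (\<Sum>y<e'. (norm (v y))^2)" by (simp add: qM x t)
  qed
  have mZ: "bt x t i * q x \<le> Re (mtr e' (Z i) (w x t))" if x: "x \<in> X" and t: "t < c" and i: "i < K" for i x t
  proof -
    have "mtr e' (M i x t) (w x t) = of_real (bt x t i) * mtr e (Q x) (\<omega> x)"
    proof -
      have "mtr e' (M i x t) (w x t) = of_real (bt x t i) * mtr e' (Q x \<otimes>\<^sub>m proj (unit_vec c t)) (w x t)"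
        unfolding M_def by (rule mtr_smult_left[OF QP(2)[OF x t]])
      also have "mtr e' (Q x \<otimes>\<^sub>m proj (unit_vec c t)) (w x t) = mtr e (Q x) (\<omega> x)"
        unfolding w_def e' using Q(1)[OF x] \<omega>[OF x] t by (intro mtr_kron_proj) (auto simp: psd_def density_def)
      finally show ?thesis .
    qed
    then have "Re (mtr e' (M i x t) (w x t)) = bt x t i * q x" by (simp add: q_def)
    then show ?thesis using mtr_mono[OF wp[OF x t] MZ[OF x t i]] by simp
  qed
  define F where "F i j = (if i < K then Z i else 0\<^sub>m e' e')" for i j :: nat
  have up: "(\<Sum>k<K. Re (mtr e' (F k k) \<tau>)) / 2 ^ l \<le> 2 * L / 2 ^ l"
  proof -
    have "(\<Sum>k<K. Re (mtr e' (F k k) \<tau>)) \<le> (2 * L) * Re (mat_trace \<tau>)"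
    proof (rule mtr_sum_le)
      show "psd e' \<tau>" using \<tau> by (simp add: density_def)
      fix v
      have "(\<Sum>i<K. Re (qform e' (F i i) v)) \<le> (\<Sum>i<K. 2 * Re (qform e' (Y i) v))"
        by (intro sum_mono) (simp add: F_def ZY)
      also have "\<dots> \<le> 2 * (L * (\<Sum>y<e'. (norm (v y))^2))" using Ysum[of v] by (simp add: sum_distrib_left[symmetric])
      finally show "(\<Sum>i<K. Re (qform e' (F i i) v)) \<le> 2 * L * (\<Sum>y<e'. (norm (v y))^2)" by simp
    qed
    then show ?thesis using \<tau> by (simp add: density_def divide_right_mono)
  qed
  \<comment> \<open>Within a branch Alice's key is independent of Bob's. Hence a guess drawn from
    Bob's marginal hits Alice's value i with the same weight \<open>ra x t i * rb x t i\<close> with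
    which Bob's own key does.\<close>
  have low: "(\<Sum>x\<in>X. p x * (S x * q x)) \<le> (\<Sum>x\<in>X. p x * (\<Sum>t<c. \<Sum>i<a'. \<Sum>j<b'. ra x t i * rb x t j * Re (mtr e' (F i j) (w x t))))"
  proof (intro sum_mono mult_left_mono)
    fix x assume x: "x \<in> X"
    show "0 \<le> p x" by (rule p(1)[OF x])
    show "S x * q x \<le> (\<Sum>t<c. \<Sum>i<a'. \<Sum>j<b'. ra x t i * rb x t j * Re (mtr e' (F i j) (w x t)))"
      unfolding S_def sum_distrib_right
    proof (intro sum_mono)
      fix t assume "t \<in> {..<c}"
      then have t: "t < c" by simp
      have "(\<Sum>i<K. ra x t i * rb x t i * q x) \<le> (\<Sum>i<K. \<Sum>j<b'. ra x t i * rb x t j * Re (mtr e' (F i j) (w x t)))"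
      proof (intro sum_mono)
        fix i assume "i \<in> {..<K}"
        then have i: "i < K" "i < a'" "i < b'" using Ka by auto
        have "rb x t i = (\<Sum>j<b'. rb x t j) * bt x t i"
        proof (cases "(\<Sum>j<b'. rb x t j) = 0")
          case True
          then have "rb x t i = 0" using rb(2)[OF x t] i by (subst (asm) sum_nonneg_eq_0_iff) auto
          then show ?thesis using True by simp
        qed (simp add: bt_def)
        then have "ra x t i * rb x t i * q x = ra x t i * (\<Sum>j<b'. rb x t j) * (bt x t i * q x)" by simp
        also have "\<dots> \<le> ra x t i * (\<Sum>j<b'. rb x t j) * Re (mtr e' (Z i) (w x t))"
          using mZ[OF x t i(1)] ra(2)[OF x t i(2)] rs[OF x t] by (intro mult_left_mono) auto
        also have "\<dots> = (\<Sum>j<b'. ra x t i * rb x t j * Re (mtr e' (F i j) (w x t)))"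
          using i by (simp add: F_def sum_distrib_left sum_distrib_right mult_ac)
        finally show "ra x t i * rb x t i * q x \<le> (\<Sum>j<b'. ra x t i * rb x t j * Re (mtr e' (F i j) (w x t)))" .
      qed
      also have "\<dots> = (\<Sum>i<a'. \<Sum>j<b'. ra x t i * rb x t j * Re (mtr e' (F i j) (w x t)))"
        by (rule sum.mono_neutral_left) (use Ka in \<open>auto simp: F_def mtr_zero\<close>)
      finally show "(\<Sum>i<K. ra x t i * rb x t i * q x) \<le> (\<Sum>i<a'. \<Sum>j<b'. ra x t i * rb x t j * Re (mtr e' (F i j) (w x t)))" .
    qed
  qed
  have "\<bar>(\<Sum>x\<in>X. p x * (\<Sum>t<c. \<Sum>i<a'. \<Sum>j<b'. ra x t i * rb x t j * Re (mtr e' (F i j) (w x t)))) - (\<Sum>k<K. Re (mtr e' (F k k) \<tau>)) / 2 ^ l\<bar> \<le> 2 * 2 * \<epsilon>"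
  proof (rule test)
    fix i j v
    show "0 \<le> Re (qform e' (F i j) v)" using Z by (auto simp: F_def qform_zero psd_qform less_eq_complex_def)
    show "Re (qform e' (F i j) v) \<le> 2 * (\<Sum>x<e'. (norm (v x))^2)" using Z2 by (auto simp: F_def qform_zero sum_nonneg)
  qed
  \<comment> \<open>The union bound in product form: (1 - S x)(1 - q x) is nonnegative.\<close>
  moreover have "(\<Sum>x\<in>X. p x * S x) + (\<Sum>x\<in>X. p x * q x) - 1 \<le> (\<Sum>x\<in>X. p x * (S x * q x))"
  proof -
    have "(\<Sum>x\<in>X. p x * (S x + q x - 1)) \<le> (\<Sum>x\<in>X. p x * (S x * q x))"
    proof (intro sum_mono mult_left_mono)
      fix x assume x: "x \<in> X"
      have "0 \<le> (1 - S x) * (1 - q x)" using S1[OF x] q01[OF x] by (intro mult_nonneg_nonneg) auto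
      then show "S x + q x - 1 \<le> S x * q x" by (simp add: algebra_simps)
    qed (use p in auto)
    moreover have "(\<Sum>x\<in>X. p x * (S x + q x - 1)) = (\<Sum>x\<in>X. p x * S x) + (\<Sum>x\<in>X. p x * q x) - (\<Sum>x\<in>X. p x)"
      by (simp add: algebra_simps sum.distrib sum_subtractf)
    ultimately show ?thesis using p(2) by simp
  qed
  moreover have "1 - \<eta> \<le> (\<Sum>x\<in>X. p x * q x)" using \<eta> by (simp add: q_def)
  ultimately have "1 - \<eta> \<le> 2 * L / 2 ^ l + 6 * \<epsilon>" using agree up low by linarith
  then show ?thesis unfolding \<epsilon>_def \<kappa>_def \<rho>_def .
qed

section \<open>Tensor powers and local measurements\<close>

definition digit :: "nat \<Rightarrow> nat \<Rightarrow> nat \<Rightarrow> nat" where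
  "digit a i t = i div a ^ t mod a"

lemma digit_less: "i < a ^ n \<Longrightarrow> t < n \<Longrightarrow> digit a i t < a"
  unfolding digit_def by (cases "a = 0") (auto simp: power_0_left)

lemma digit_low:
  assumes "t < n"
  shows "digit a (y * a ^ n + x) t = digit a x t"
proof (cases "a = 0")
  case False
  have n: "n - t - 1 + 1 + t = n" using assms by simp
  have "a ^ (n - t - 1 + 1 + t) = a ^ (n - t - 1) * a * a ^ t" by (simp only: power_add power_one_right)
  then have an: "a ^ n = a ^ (n - t - 1) * a * a ^ t" unfolding n .
  have "y * a ^ n + x = x + (y * a ^ (n - t - 1) * a) * a ^ t"
    by (subst an) (simp only: ac_simps)
  then have "(y * a ^ n + x) div a ^ t = y * a ^ (n - t - 1) * a + x div a ^ t"
    using False by (simp only: div_mult_self1) simp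
  then show ?thesis by (simp add: digit_def)
qed (use assms in \<open>simp add: digit_def power_0_left\<close>)

lemma digit_high:
  assumes "x < a ^ n" "y < a"
  shows "digit a (y * a ^ n + x) n = y"
  using assms by (simp add: digit_def)

lemma sum_digits_Suc:
  fixes g :: "nat \<Rightarrow> 'a :: comm_monoid_add"
  shows "(\<Sum>x<a ^ Suc n. g x) = (\<Sum>y<a. \<Sum>x<a ^ n. g (y * a ^ n + x))"
  unfolding power_Suc by (rule sum_lessThan_mult)

lemma prod_digits_Suc:
  assumes "x < a ^ n" "y < a"
  shows "(\<Prod>t<Suc n. F t (digit a (y * a ^ n + x) t)) = F n y * (\<Prod>t<n. F t (digit a x t))"
  using assms by (simp add: digit_low digit_high mult.commute)

text \<open>The distributive law with the choice functions encoded as numbers. Through it inner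
  products, traces and probabilities of n copies factorise.\<close>

lemma sum_prod_digits:
  fixes F :: "nat \<Rightarrow> nat \<Rightarrow> 'a :: comm_semiring_1"
  shows "(\<Sum>x<a ^ n. \<Prod>t<n. F t (digit a x t)) = (\<Prod>t<n. \<Sum>j<a. F t j)"
proof (induction n)
  case (Suc n)
  have "(\<Sum>x<a ^ Suc n. \<Prod>t<Suc n. F t (digit a x t)) = (\<Sum>y<a. \<Sum>x<a ^ n. F n y * (\<Prod>t<n. F t (digit a x t)))"
    unfolding sum_digits_Suc by (intro sum.cong refl prod_digits_Suc) auto
  also have "\<dots> = (\<Sum>y<a. F n y) * (\<Sum>x<a ^ n. \<Prod>t<n. F t (digit a x t))" by (simp add: sum_product)
  finally show ?case using Suc by (simp add: mult.commute)
qed simp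

lemma digits_eqI:
  "x < a ^ n \<Longrightarrow> y < a ^ n \<Longrightarrow> (\<And>t. t < n \<Longrightarrow> digit a x t = digit a y t) \<Longrightarrow> x = y"
proof (induction n arbitrary: x y)
  case (Suc n)
  obtain x1 x2 where x: "x1 < a" "x2 < a ^ n" "x = x1 * a ^ n + x2" using Suc.prems(1) by (auto elim: less_mult_cases)
  obtain y1 y2 where y: "y1 < a" "y2 < a ^ n" "y = y1 * a ^ n + y2" using Suc.prems(2) by (auto elim: less_mult_cases)
  have "x1 = y1" using Suc.prems(3)[of n] x y by (simp add: digit_high)
  moreover have "x2 = y2"
  proof (rule Suc.IH[OF x(2) y(2)])
    fix t assume "t < n"
    then show "digit a x2 t = digit a y2 t" using Suc.prems(3)[of t] x y by (simp add: digit_low)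
  qed
  ultimately show ?case using x y by simp
qed simp

lemma ex_digits:
  "(\<And>t. t < n \<Longrightarrow> g t < a) \<Longrightarrow> \<exists>x<a ^ n. \<forall>t<n. digit a x t = g t"
proof (induction n)
  case (Suc n)
  then obtain x where x: "x < a ^ n" "\<forall>t<n. digit a x t = g t" by fastforce
  have "g n * a ^ n + x < a ^ Suc n" using mult_add_less[OF Suc.prems[of n] x(1)] by simp
  moreover have "\<forall>t<Suc n. digit a (g n * a ^ n + x) t = g t"
    using x Suc.prems[of n] by (auto simp: less_Suc_eq digit_low digit_high)
  ultimately show ?case by blast
qed simp

lemma prod_digit_delta:
  fixes c :: "'a :: comm_semiring_1"
  assumes "x < a ^ n" "y < a ^ n"
  shows "(\<Prod>t<n. if digit a x t = digit a y t then c else 0) = (if x = y then c ^ n else 0)"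
proof (cases "x = y")
  case False
  then obtain t where "t < n" "digit a x t \<noteq> digit a y t" using digits_eqI[OF assms] by blast
  then have "(\<Prod>t<n. if digit a x t = digit a y t then c else 0) = 0" by (intro prod_zero) auto
  then show ?thesis using False by simp
qed simp

section \<open>Tensor powers of a shared classical letter\<close>

text \<open>A tensor product whose rightmost factor is As 0, since digit 0 is the least significant;
  this matches the order of copies in \<open>copy_index\<close>.\<close>

definition tmat :: "nat \<Rightarrow> nat \<Rightarrow> (nat \<Rightarrow> cmat) \<Rightarrow> cmat" where
  "tmat a n As = mat (a ^ n) (a ^ n) (\<lambda>(i, j). \<Prod>t<n. As t $$ (digit a i t, digit a j t))"

definition tvec :: "nat \<Rightarrow> nat \<Rightarrow> (nat \<Rightarrow> complex vec) \<Rightarrow> complex vec" where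
  "tvec a n vs = vec (a ^ n) (\<lambda>i. \<Prod>t<n. vs t $ digit a i t)"

lemma tmat_carrier[simp]: "tmat a n As \<in> carrier_mat (a ^ n) (a ^ n)" by (simp add: tmat_def)
lemma tvec_carrier[simp]: "tvec a n vs \<in> carrier_vec (a ^ n)" by (simp add: tvec_def)

lemma tmat_proj:
  assumes "\<And>t. t < n \<Longrightarrow> vs t \<in> carrier_vec a"
  shows "tmat a n (\<lambda>t. proj (vs t)) = proj (tvec a n vs)"
proof (rule eq_matI)
  fix i j assume "i < dim_row (proj (tvec a n vs))" "j < dim_col (proj (tvec a n vs))"
  then have ij: "i < a ^ n" "j < a ^ n" by (auto simp: tvec_def)
  have "(\<Prod>t<n. proj (vs t) $$ (digit a i t, digit a j t)) = (\<Prod>t<n. vs t $ digit a i t * cnj (vs t $ digit a j t))"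
  proof (intro prod.cong refl ketbra_index)
    fix t assume "t \<in> {..<n}"
    then have t: "t < n" by simp
    then have d: "dim_vec (vs t) = a" using assms by auto
    show "digit a i t < dim_vec (vs t)" "digit a j t < dim_vec (vs t)" unfolding d using t ij by (auto intro: digit_less)
  qed
  then show "tmat a n (\<lambda>t. proj (vs t)) $$ (i, j) = proj (tvec a n vs) $$ (i, j)"
    using ij by (simp add: tmat_def tvec_def prod.distrib)
qed (auto simp: tmat_def tvec_def)

lemma tvec_inner:
  "(\<Sum>i<a ^ n. cnj (tvec a n vs $ i) * tvec a n ws $ i) = (\<Prod>t<n. \<Sum>j<a. cnj (vs t $ j) * ws t $ j)"
proof -
  have "(\<Sum>i<a ^ n. cnj (tvec a n vs $ i) * tvec a n ws $ i) = (\<Sum>i<a ^ n. \<Prod>t<n. cnj (vs t $ digit a i t) * ws t $ digit a i t)"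
    by (intro sum.cong refl) (simp add: tvec_def prod.distrib)
  then show ?thesis using sum_prod_digits[of "\<lambda>t j. cnj (vs t $ j) * ws t $ j" a n] by simp
qed

definition onb :: "nat \<Rightarrow> (nat \<Rightarrow> complex vec) \<Rightarrow> bool" where
  "onb N v \<longleftrightarrow> (\<forall>x<N. v x \<in> carrier_vec N) \<and> orthonormal N N (\<lambda>s i. v s $ i)"

text \<open>A uniform letter x held by both Alice and Bob in the basis v, with Eve in state \<omega>
  x. The state of the theorem, its AB marginal and the measured state are all of this form.\<close>

definition cq_state :: "nat \<Rightarrow> nat \<Rightarrow> (nat \<Rightarrow> complex vec) \<Rightarrow> (nat \<Rightarrow> cmat) \<Rightarrow> cmat" where
  "cq_state N e v \<omega> = mat_sum (N * N * e) {..<N} (\<lambda>x. complex_of_real (1 / real N) \<cdot>\<^sub>m (proj (v x) \<otimes>\<^sub>m proj (v x) \<otimes>\<^sub>m \<omega> x))"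

lemma onb_tvec:
  assumes "onb N v"
  shows "onb (N ^ n) (\<lambda>x. tvec N n (\<lambda>t. v (digit N x t)))"
  unfolding onb_def orthonormal_def
proof (intro conjI allI impI)
  fix x y assume xy: "x < N ^ n" "y < N ^ n"
  have "(\<Prod>t<n. \<Sum>j<N. cnj (v (digit N x t) $ j) * v (digit N y t) $ j) = (\<Prod>t<n. if digit N x t = digit N y t then 1 else 0 :: complex)"
    using assms xy by (intro prod.cong refl) (auto simp: onb_def orthonormal_def digit_less)
  then show "(\<Sum>k<N ^ n. cnj (tvec N n (\<lambda>t. v (digit N x t)) $ k) * tvec N n (\<lambda>t. v (digit N y t)) $ k) = (if x = y then 1 else 0)"
    unfolding tvec_inner using prod_digit_delta[OF xy, of "1::complex"] by simp
qed simp

lemma copy_index_digits: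
  assumes "i < a ^ n" "j < b ^ n" "u < e ^ n"
  shows "copy_index (a, b, e) n t ((i * b ^ n + j) * e ^ n + u) = (digit a i t * b + digit b j t) * e + digit e u t"
proof -
  have 1: "((i * b ^ n + j) * e ^ n + u) div e ^ n = i * b ^ n + j" by (rule div_mod_add(1)[OF assms(3)])
  have 2: "((i * b ^ n + j) * e ^ n + u) mod e ^ n = u" by (rule div_mod_add(2)[OF assms(3)])
  have 3: "((i * b ^ n + j) * e ^ n + u) div (b ^ n * e ^ n) = i"
    by (subst mult.commute[of "b ^ n"], subst div_mult2_eq, subst 1) (rule div_mod_add(1)[OF assms(2)])
  have 4: "(i * b ^ n + j) mod b ^ n = j" by (rule div_mod_add(2)[OF assms(2)])
  show ?thesis unfolding copy_index.simps Let_def 1 2 3 4 by (simp add: digit_def)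
qed

text \<open>An entry of the power is a product over copies of sums over letters; expanding it gives
  one sum over strings, and the regrouping performed by \<open>copy_index\<close> collects the
  letters of each party.\<close>

theorem tensor_power_cq_state:
  assumes v: "\<And>x. x < N \<Longrightarrow> v x \<in> carrier_vec N" and \<omega>: "\<And>x. x < N \<Longrightarrow> \<omega> x \<in> carrier_mat e e"
  shows "tensor_power (N, N, e) n (cq_state N e v \<omega>) =
    cq_state (N ^ n) (e ^ n) (\<lambda>x. tvec N n (\<lambda>t. v (digit N x t))) (\<lambda>x. tmat e n (\<lambda>t. \<omega> (digit N x t)))"
  (is "_ = ?R")
proof (rule eq_mat_kronI[where a="N ^ n * N ^ n" and b="e ^ n" and a'="N ^ n * N ^ n" and b'="e ^ n"])
  fix ij u ij' u' assume "ij < N ^ n * N ^ n" "u < e ^ n" "ij' < N ^ n * N ^ n" "u' < e ^ n"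
  then obtain i j i' j' where ij: "i < N ^ n" "j < N ^ n" "ij = i * N ^ n + j" "i' < N ^ n" "j' < N ^ n" "ij' = i' * N ^ n + j'"
    and u: "u < e ^ n" "u' < e ^ n" by (metis less_mult_cases)
  let ?r = "(i * N ^ n + j) * e ^ n + u" and ?s = "(i' * N ^ n + j') * e ^ n + u'"
  have rs: "?r < N ^ n * N ^ n * e ^ n" "?s < N ^ n * N ^ n * e ^ n"
    using ij u by (auto intro!: mult_add_less)
  define g where "g t x = complex_of_real (1 / real N) * ((proj (v x) $$ (digit N i t, digit N i' t)) * (proj (v x) $$ (digit N j t, digit N j' t)) * \<omega> x $$ (digit e u t, digit e u' t))" for t x
  have tp: "tensor_power (N, N, e) n (cq_state N e v \<omega>) $$ (?r, ?s) = (\<Prod>t<n. cq_state N e v \<omega> $$ (copy_index (N, N, e) n t ?r, copy_index (N, N, e) n t ?s))"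
    using rs by (simp add: tensor_power_def del: copy_index.simps)
  also have "\<dots> = (\<Prod>t<n. \<Sum>x<N. g t x)"
  proof (intro prod.cong refl)
    fix t assume "t \<in> {..<n}"
    then have t: "t < n" by simp
    have dl: "digit N i t < N" "digit N j t < N" "digit N i' t < N" "digit N j' t < N" "digit e u t < e" "digit e u' t < e"
      using t ij u by (auto intro: digit_less)
    have "(digit N i t * N + digit N j t) * e + digit e u t < N * N * e" "(digit N i' t * N + digit N j' t) * e + digit e u' t < N * N * e"
      using dl by (auto intro!: mult_add_less)
    then have "cq_state N e v \<omega> $$ ((digit N i t * N + digit N j t) * e + digit e u t, (digit N i' t * N + digit N j' t) * e + digit e u' t)
       = (\<Sum>x<N. (complex_of_real (1 / real N) \<cdot>\<^sub>m (proj (v x) \<otimes>\<^sub>m proj (v x) \<otimes>\<^sub>m \<omega> x)) $$ ((digit N i t * N + digit N j t) * e + digit e u t, (digit N i' t * N + digit N j' t) * e + digit e u' t))"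
      unfolding cq_state_def by (rule mat_sum_index)
    also have "\<dots> = (\<Sum>x<N. g t x)"
    proof (intro sum.cong refl)
      fix x assume "x \<in> {..<N}"
      then have x: "v x \<in> carrier_vec N" "\<omega> x \<in> carrier_mat e e" using v \<omega> by auto
      have c: "proj (v x) \<otimes>\<^sub>m proj (v x) \<otimes>\<^sub>m \<omega> x \<in> carrier_mat (N * N * e) (N * N * e)"
        using x by (intro kron_carrier) auto
      have "(complex_of_real (1 / real N) \<cdot>\<^sub>m (proj (v x) \<otimes>\<^sub>m proj (v x) \<otimes>\<^sub>m \<omega> x)) $$ ((digit N i t * N + digit N j t) * e + digit e u t, (digit N i' t * N + digit N j' t) * e + digit e u' t)
        = complex_of_real (1 / real N) * (proj (v x) \<otimes>\<^sub>m proj (v x) \<otimes>\<^sub>m \<omega> x) $$ ((digit N i t * N + digit N j t) * e + digit e u t, (digit N i' t * N + digit N j' t) * e + digit e u' t)"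
        using c dl by (intro index_smult_mat(1)) (auto intro!: mult_add_less)
      also have "\<dots> = g t x" unfolding g_def
        by (subst kron3_index[of _ N _ N _ e]) (use x dl in \<open>auto simp del: ketbra_index\<close>)
      finally show "(complex_of_real (1 / real N) \<cdot>\<^sub>m (proj (v x) \<otimes>\<^sub>m proj (v x) \<otimes>\<^sub>m \<omega> x)) $$ ((digit N i t * N + digit N j t) * e + digit e u t, (digit N i' t * N + digit N j' t) * e + digit e u' t) = g t x" .
    qed
    finally show "cq_state N e v \<omega> $$ (copy_index (N, N, e) n t ?r, copy_index (N, N, e) n t ?s) = (\<Sum>x<N. g t x)"
      using ij u by (simp only: copy_index_digits)
  qed
  also have "\<dots> = (\<Sum>x<N ^ n. \<Prod>t<n. g t (digit N x t))" by (rule sum_prod_digits[symmetric])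
  also have "\<dots> = ?R $$ (?r, ?s)"
  proof -
    have "?R $$ (?r, ?s) = (\<Sum>x<N ^ n. (complex_of_real (1 / real (N ^ n)) \<cdot>\<^sub>m (proj (tvec N n (\<lambda>t. v (digit N x t))) \<otimes>\<^sub>m proj (tvec N n (\<lambda>t. v (digit N x t))) \<otimes>\<^sub>m tmat e n (\<lambda>t. \<omega> (digit N x t)))) $$ (?r, ?s))"
      unfolding cq_state_def by (rule mat_sum_index) (use rs in auto)
    also have "\<dots> = (\<Sum>x<N ^ n. \<Prod>t<n. g t (digit N x t))"
    proof (intro sum.cong refl)
      fix x assume "x \<in> {..<N ^ n}"
      then have x: "x < N ^ n" by simp
      have pr: "proj (tvec N n (\<lambda>t. v (digit N x t))) = tmat N n (\<lambda>t. proj (v (digit N x t)))"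
        using v x by (intro tmat_proj[symmetric]) (auto intro: digit_less)
      let ?T = "tmat N n (\<lambda>t. proj (v (digit N x t)))" and ?E = "tmat e n (\<lambda>t. \<omega> (digit N x t))"
      have c: "?T \<otimes>\<^sub>m ?T \<otimes>\<^sub>m ?E \<in> carrier_mat (N ^ n * N ^ n * e ^ n) (N ^ n * N ^ n * e ^ n)"
        by (intro kron_carrier) auto
      have "(complex_of_real (1 / real (N ^ n)) \<cdot>\<^sub>m (?T \<otimes>\<^sub>m ?T \<otimes>\<^sub>m ?E)) $$ (?r, ?s) = complex_of_real (1 / real (N ^ n)) * (?T \<otimes>\<^sub>m ?T \<otimes>\<^sub>m ?E) $$ (?r, ?s)"
        using c rs by (intro index_smult_mat(1)) auto
      also have "(?T \<otimes>\<^sub>m ?T \<otimes>\<^sub>m ?E) $$ (?r, ?s) = ?T $$ (i, i') * ?T $$ (j, j') * ?E $$ (u, u')"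
        by (rule kron3_index) (use ij u in auto)
      also have "complex_of_real (1 / real (N ^ n)) * \<dots> = (\<Prod>t<n. g t (digit N x t))"
        using ij u by (simp add: tmat_def g_def prod.distrib prod_dividef power_divide)
      finally show "(complex_of_real (1 / real (N ^ n)) \<cdot>\<^sub>m (proj (tvec N n (\<lambda>t. v (digit N x t))) \<otimes>\<^sub>m proj (tvec N n (\<lambda>t. v (digit N x t))) \<otimes>\<^sub>m ?E)) $$ (?r, ?s) = (\<Prod>t<n. g t (digit N x t))"
        unfolding pr .
    qed
    finally show ?thesis by simp
  qed
  finally show "tensor_power (N, N, e) n (cq_state N e v \<omega>) $$ (ij * e ^ n + u, ij' * e ^ n + u') = ?R $$ (ij * e ^ n + u, ij' * e ^ n + u')"
    unfolding ij .
qed (simp_all add: tensor_power_def cq_state_def)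

section \<open>Measuring the shared letter and relabelling the outcome\<close>

text \<open>The measurement in the basis v, after which outcome x is recorded as f x in a register
  of dimension K.\<close>

definition measure_relabel :: "nat \<Rightarrow> nat \<Rightarrow> (nat \<Rightarrow> complex vec) \<Rightarrow> (nat \<Rightarrow> nat) \<Rightarrow> cmat \<Rightarrow> cmat" where
  "measure_relabel N K v f X = mat K K (\<lambda>(i, j). if i = j then \<Sum>x<N. if f x = i then qform N X (\<lambda>k. v x $ k) else 0 else 0)"

lemma qform_add: "X \<in> carrier_mat n n \<Longrightarrow> Y \<in> carrier_mat n n \<Longrightarrow> qform n (X + Y) v = qform n X v + qform n Y v"
  unfolding qform_def sum.distrib[symmetric] by (intro sum.cong refl) (auto simp: algebra_simps)

lemma linear_measure_relabel: "linear_map N K (measure_relabel N K v f)"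
  unfolding linear_map_def
proof (intro conjI ballI allI)
  have s: "(\<Sum>x<N. if f x = i then a x + b x else 0) = (\<Sum>x<N. if f x = i then a x else 0) + (\<Sum>x<N. if f x = i then b x else 0 :: complex)" for a b i
    unfolding sum.distrib[symmetric] by (intro sum.cong refl) simp
  have m: "(\<Sum>x<N. if f x = i then c * a x else 0) = c * (\<Sum>x<N. if f x = i then a x else 0 :: complex)" for a i c
    unfolding sum_distrib_left by (intro sum.cong refl) simp
  fix X :: cmat and Y :: cmat and c :: complex
  assume X: "X \<in> carrier_mat N N"
  show "measure_relabel N K v f X \<in> carrier_mat K K" by (simp add: measure_relabel_def)
  show "measure_relabel N K v f (c \<cdot>\<^sub>m X) = c \<cdot>\<^sub>m measure_relabel N K v f X"
    by (rule eq_matI) (simp_all add: measure_relabel_def qform_smult[OF X] m cong: if_cong)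
  assume Y: "Y \<in> carrier_mat N N"
  show "measure_relabel N K v f (X + Y) = measure_relabel N K v f X + measure_relabel N K v f Y"
    by (rule eq_matI) (simp_all add: measure_relabel_def qform_add[OF X Y] s cong: if_cong)
qed

text \<open>Complete positivity holds because the form of the output at w is a sum over x of forms
  of X at product vectors, formed from v x and the part of w with register value f x. Trace
  preservation is completeness of the basis.\<close>

lemma cptp_measure_relabel:
  assumes v: "onb N v" and f: "\<And>x. x < N \<Longrightarrow> f x < K"
  shows "cptp N K (measure_relabel N K v f)"
  unfolding cptp_def
proof (intro conjI allI impI ballI linear_measure_relabel)
  fix X :: cmat assume X: "X \<in> carrier_mat N N"
  have "mat_trace (measure_relabel N K v f X) = (\<Sum>i<K. \<Sum>x<N. if f x = i then qform N X (\<lambda>k. v x $ k) else 0)"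
    by (simp add: mat_trace_def measure_relabel_def)
  also have "\<dots> = (\<Sum>x<N. qform N X (\<lambda>k. v x $ k))"
    by (subst sum.swap) (use f in \<open>auto intro!: sum.cong\<close>)
  also have "\<dots> = (\<Sum>i<N. \<Sum>j<N. \<Sum>x<N. X $$ (i, j) * (v x $ j * cnj (v x $ i)))"
    unfolding qform_def by (subst sum_rotate3[symmetric]) (simp add: mult_ac)
  also have "\<dots> = (\<Sum>i<N. \<Sum>j<N. X $$ (i, j) * (\<Sum>x<N. v x $ j * cnj (v x $ i)))"
    by (simp add: sum_distrib_left)
  also have "\<dots> = (\<Sum>i<N. \<Sum>j<N. if j = i then X $$ (i, i) else 0)"
  proof (intro sum.cong refl)
    fix i j assume "i \<in> {..<N}" "j \<in> {..<N}"
    then have "(\<Sum>x<N. v x $ j * cnj (v x $ i)) = (if j = i then 1 else 0)"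
      using orthonormal_complete[of N "\<lambda>s i. v s $ i" j i] v by (simp add: onb_def)
    then show "X $$ (i, j) * (\<Sum>x<N. v x $ j * cnj (v x $ i)) = (if j = i then X $$ (i, i) else 0)" by simp
  qed
  also have "\<dots> = mat_trace X" using X by (simp add: mat_trace_def)
  finally show "mat_trace (measure_relabel N K v f X) = mat_trace X" .
next
  fix k X assume X: "psd (k * N) X"
  have "qform (k * K) (local_map k N K 1 (measure_relabel N K v f) X) w
     = (\<Sum>x<N. qform (k * N) X (\<lambda>r. w (r div N * K + f x) * v x $ (r mod N)))" for w
  proof -
    have e: "local_map k N K 1 (measure_relabel N K v f) X $$ (r * K + i, s * K + j)
       = (if i = j then \<Sum>x<N. if f x = i then (\<Sum>p<N. \<Sum>q<N. cnj (v x $ p) * X $$ (r * N + p, s * N + q) * v x $ q) else 0 else 0)"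
      if "r < k" "i < K" "s < k" "j < K" for r i s j
    proof -
      have q: "qform N (mat N N (\<lambda>(p, q). X $$ (r * N + p, s * N + q))) w'
        = (\<Sum>p<N. \<Sum>q<N. cnj (w' p) * X $$ (r * N + p, s * N + q) * w' q)" for w'
        unfolding qform_def by (intro sum.cong refl) simp
      show ?thesis
        using that mult_add_less[OF that(1,2)] mult_add_less[OF that(3,4)]
        by (simp add: local_map_def measure_relabel_def q cong: if_cong)
    qed
    have "qform (k * K) (local_map k N K 1 (measure_relabel N K v f) X) w
      = (\<Sum>r<k. \<Sum>i<K. \<Sum>s<k. \<Sum>j<K. if j = i then \<Sum>x<N. if f x = i then
           (\<Sum>p<N. \<Sum>q<N. cnj (w (r * K + f x) * v x $ p) * X $$ (r * N + p, s * N + q) * (w (s * K + f x) * v x $ q)) else 0 else 0)"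
      unfolding qform_def sum_lessThan_mult
    proof (rule sum.cong[OF refl], rule sum.cong[OF refl], rule sum.cong[OF refl], rule sum.cong[OF refl])
      fix r i s j assume "r \<in> {..<k}" "i \<in> {..<K}" "s \<in> {..<k}" "j \<in> {..<K}"
      then have m: "r < k" "i < K" "s < k" "j < K" by auto
      have "cnj (w (r * K + i)) * (\<Sum>x<N. if f x = i then S x else 0) * w (s * K + i) =
        (\<Sum>x<N. if f x = i then cnj (w (r * K + f x)) * S x * w (s * K + f x) else 0)" for S
        unfolding sum_distrib_left sum_distrib_right by (intro sum.cong refl) simp
      then show "cnj (w (r * K + i)) * local_map k N K 1 (measure_relabel N K v f) X $$ (r * K + i, s * K + j) * w (s * K + j)
        = (if j = i then \<Sum>x<N. if f x = i then
           (\<Sum>p<N. \<Sum>q<N. cnj (w (r * K + f x) * v x $ p) * X $$ (r * N + p, s * N + q) * (w (s * K + f x) * v x $ q)) else 0 else 0)"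
        unfolding e[OF m] by (simp add: sum_distrib_left sum_distrib_right mult_ac cong: if_cong)
    qed
    also have "\<dots> = (\<Sum>r<k. \<Sum>i<K. \<Sum>x<N. if f x = i then
           (\<Sum>s<k. \<Sum>p<N. \<Sum>q<N. cnj (w (r * K + f x) * v x $ p) * X $$ (r * N + p, s * N + q) * (w (s * K + f x) * v x $ q)) else 0)"
    proof (rule sum.cong[OF refl], rule sum.cong[OF refl])
      fix r i assume "i \<in> {..<K}"
      then show "(\<Sum>s<k. \<Sum>j<K. if j = i then \<Sum>x<N. if f x = i then
           (\<Sum>p<N. \<Sum>q<N. cnj (w (r * K + f x) * v x $ p) * X $$ (r * N + p, s * N + q) * (w (s * K + f x) * v x $ q)) else 0 else 0)
        = (\<Sum>x<N. if f x = i then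
           (\<Sum>s<k. \<Sum>p<N. \<Sum>q<N. cnj (w (r * K + f x) * v x $ p) * X $$ (r * N + p, s * N + q) * (w (s * K + f x) * v x $ q)) else 0)"
        by (simp, subst sum.swap) (auto intro!: sum.cong)
    qed
    also have "\<dots> = (\<Sum>r<k. \<Sum>x<N. \<Sum>s<k. \<Sum>p<N. \<Sum>q<N. cnj (w (r * K + f x) * v x $ p) * X $$ (r * N + p, s * N + q) * (w (s * K + f x) * v x $ q))"
      by (rule sum.cong[OF refl], subst sum.swap) (use f in \<open>auto intro!: sum.cong\<close>)
    also have "\<dots> = (\<Sum>x<N. \<Sum>r<k. \<Sum>p<N. \<Sum>s<k. \<Sum>q<N. cnj (w (r * K + f x) * v x $ p) * X $$ (r * N + p, s * N + q) * (w (s * K + f x) * v x $ q))"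
      by (subst sum.swap, rule sum.cong[OF refl], rule sum.cong[OF refl], rule sum.swap)
    also have "\<dots> = (\<Sum>x<N. qform (k * N) X (\<lambda>r. w (r div N * K + f x) * v x $ (r mod N)))"
      unfolding qform_def sum_lessThan_mult by (intro sum.cong refl) auto
    finally show ?thesis .
  qed
  then show "psd (k * K) (local_map k N K 1 (measure_relabel N K v f) X)"
    using X local_map_carrier[of k N K 1] by (auto simp: psd_qform intro!: sum_nonneg)
qed

lemma measure_relabel_proj:
  assumes v: "onb N v" and y: "y < N"
  shows "measure_relabel N K v f (proj (v y)) = proj (unit_vec K (f y))"
proof (rule eq_matI)
  fix i j assume "i < dim_row (proj (unit_vec K (f y)))" "j < dim_col (proj (unit_vec K (f y)))"
  then have ij: "i < K" "j < K" by auto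
  have "qform N (proj (v y)) (\<lambda>k. v x $ k) = (if x = y then 1 else 0)" if "x < N" for x
    using v y that by (subst qform_proj) (auto simp: onb_def orthonormal_def)
  then have "(\<Sum>x<N. if f x = i then qform N (proj (v y)) (\<lambda>k. v x $ k) else 0) = (if f y = i then 1 else 0)"
    using y by (subst sum_one_support[of y]) auto
  then show "measure_relabel N K v f (proj (v y)) $$ (i, j) = proj (unit_vec K (f y)) $$ (i, j)"
    using ij by (auto simp: measure_relabel_def unit_vec_def)
qed (auto simp: measure_relabel_def)

text \<open>Both parties hold the same x; two local measurements with a common f therefore produce
  equal registers.\<close>

theorem lopc_relabel:
  assumes v: "onb N v" and f: "\<And>x. x < N \<Longrightarrow> f x < K" and \<omega>: "\<And>x. x < N \<Longrightarrow> \<omega> x \<in> carrier_mat e e"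
  shows "\<exists>\<Phi>. lopc (N, N, e) (K, K, e) \<Phi> \<and> \<Phi> (cq_state N e v \<omega>) =
    mat_sum (K * K * e) {..<N} (\<lambda>x. complex_of_real (1 / real N) \<cdot>\<^sub>m (proj (unit_vec K (f x)) \<otimes>\<^sub>m proj (unit_vec K (f x)) \<otimes>\<^sub>m \<omega> x))"
proof -
  let ?L = "measure_relabel N K v f"
  define \<Phi>1 where "\<Phi>1 = local_map 1 N K (N * e) ?L"
  define \<Phi>2 where "\<Phi>2 = local_map K N K e ?L"
  have l: "linear_map N K ?L" by (rule linear_measure_relabel)
  have s1: "lopc_step (N, N, e) (K, N, e) \<Phi>1" unfolding \<Phi>1_def by (rule local_alice[OF cptp_measure_relabel[OF v f]])
  have s2: "lopc_step (K, N, e) (K, K, e) \<Phi>2" unfolding \<Phi>2_def by (rule local_bob[OF cptp_measure_relabel[OF v f]])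
  have lo: "lopc (N, N, e) (K, K, e) (\<Phi>2 \<circ> (\<Phi>1 \<circ> (\<lambda>X. X)))"
    by (rule lopc_comp[OF lopc_comp[OF lopc_id s1] s2])
  then have lin: "linear_map (N * N * e) (K * K * e) (\<Phi>2 \<circ> \<Phi>1)" using lopc_linear by (fastforce simp: o_def)
  have prod: "(\<Phi>2 \<circ> \<Phi>1) (proj (v x) \<otimes>\<^sub>m proj (v x) \<otimes>\<^sub>m \<omega> x) = proj (unit_vec K (f x)) \<otimes>\<^sub>m proj (unit_vec K (f x)) \<otimes>\<^sub>m \<omega> x"
    if x: "x < N" for x
  proof -
    have P: "proj (v x) \<in> carrier_mat N N" using v x by (auto simp: onb_def)
    have R: "proj (unit_vec K (f x)) \<in> carrier_mat K K" by auto
    note w = \<omega>[OF x]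
    have "\<Phi>1 (proj (v x) \<otimes>\<^sub>m proj (v x) \<otimes>\<^sub>m \<omega> x) = proj (unit_vec K (f x)) \<otimes>\<^sub>m proj (v x) \<otimes>\<^sub>m \<omega> x"
      using local_map_kron[OF l one_carrier_mat[of 1] P kron_carrier[OF P w]]
      by (simp only: \<Phi>1_def kron_one_left[OF P] kron_one_left[OF R] kron_assoc[OF P P w] kron_assoc[OF R P w] measure_relabel_proj[OF v x])
    then show ?thesis
      using local_map_kron[OF l R P w] by (simp only: \<Phi>2_def o_def measure_relabel_proj[OF v x])
  qed
  have C: "proj (v x) \<otimes>\<^sub>m proj (v x) \<otimes>\<^sub>m \<omega> x \<in> carrier_mat (N * N * e) (N * N * e)" if "x < N" for x
    using v \<omega>[OF that] that by (intro kron_carrier) (auto simp: onb_def)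
  have "(\<Phi>2 \<circ> \<Phi>1) (cq_state N e v \<omega>) = mat_sum (K * K * e) {..<N} (\<lambda>x. (\<Phi>2 \<circ> \<Phi>1) (complex_of_real (1 / real N) \<cdot>\<^sub>m (proj (v x) \<otimes>\<^sub>m proj (v x) \<otimes>\<^sub>m \<omega> x)))"
    unfolding cq_state_def by (rule linear_map_mat_sum[OF lin]) (use C in auto)
  also have "\<dots> = mat_sum (K * K * e) {..<N} (\<lambda>x. complex_of_real (1 / real N) \<cdot>\<^sub>m (proj (unit_vec K (f x)) \<otimes>\<^sub>m proj (unit_vec K (f x)) \<otimes>\<^sub>m \<omega> x))"
  proof (rule mat_sum_cong)
    fix x assume "x \<in> {..<N}"
    then have x: "x < N" by simp
    have "(\<Phi>2 \<circ> \<Phi>1) (complex_of_real (1 / real N) \<cdot>\<^sub>m (proj (v x) \<otimes>\<^sub>m proj (v x) \<otimes>\<^sub>m \<omega> x)) = complex_of_real (1 / real N) \<cdot>\<^sub>m (\<Phi>2 \<circ> \<Phi>1) (proj (v x) \<otimes>\<^sub>m proj (v x) \<otimes>\<^sub>m \<omega> x)"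
      using lin C[OF x] unfolding linear_map_def by blast
    then show "(\<Phi>2 \<circ> \<Phi>1) (complex_of_real (1 / real N) \<cdot>\<^sub>m (proj (v x) \<otimes>\<^sub>m proj (v x) \<otimes>\<^sub>m \<omega> x)) = complex_of_real (1 / real N) \<cdot>\<^sub>m (proj (unit_vec K (f x)) \<otimes>\<^sub>m proj (unit_vec K (f x)) \<otimes>\<^sub>m \<omega> x)"
      unfolding prod[OF x] .
  qed
  finally have "(\<Phi>2 \<circ> \<Phi>1) (cq_state N e v \<omega>) = mat_sum (K * K * e) {..<N} (\<lambda>x. complex_of_real (1 / real N) \<cdot>\<^sub>m (proj (unit_vec K (f x)) \<otimes>\<^sub>m proj (unit_vec K (f x)) \<otimes>\<^sub>m \<omega> x))" .
  moreover have "lopc (N, N, e) (K, K, e) (\<Phi>2 \<circ> \<Phi>1)" using lo by (simp add: o_def)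
  ultimately show ?thesis by blast
qed

section \<open>Bounds on key rates\<close>

lemma density_proj:
  assumes "v \<in> carrier_vec n" "(\<Sum>i<n. cnj (v $ i) * v $ i) = 1"
  shows "density n (proj v)"
  using assms psd_proj[OF assms(1)] by (auto simp: density_def mat_trace_def mult.commute)

text \<open>
  The tests \<open>Q x\<close> recognise \<open>x\<close> on Eve's system, and \<open>L\<close> bounds the number of candidates that
  Eve has to consider.
\<close>

definition guess_bound :: "nat \<Rightarrow> nat \<Rightarrow> (nat \<Rightarrow> cmat) \<Rightarrow> real \<Rightarrow> real \<Rightarrow> bool" where
  "guess_bound N e \<omega> L \<eta> \<longleftrightarrow> (\<exists>Q.
     (\<forall>x<N. psd e (Q x) \<and> (\<forall>v. Re (qform e (Q x) v) \<le> (\<Sum>i<e. (norm (v i))^2))) \<and>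
     (\<forall>v. (\<Sum>x<N. Re (qform e (Q x) v)) \<le> L * (\<Sum>i<e. (norm (v i))^2)) \<and>
     1 - \<eta> \<le> (\<Sum>x<N. Re (mtr e (Q x) (\<omega> x))) / N)"

lemma cq_converse:
  assumes N: "0 < N" and v: "onb N v" and \<omega>: "\<And>x. x < N \<Longrightarrow> density e (\<omega> x)"
    and lopc: "lopc (N, N, e) (a', b', e') \<Phi>" and g: "guess_bound N e \<omega> L \<eta>"
    and K: "2 ^ l \<le> a'" "2 ^ l \<le> b'" and \<tau>: "density e' \<tau>"
  shows "1 - \<eta> \<le> 2 * L / 2 ^ l + 6 * tdist (a' * b' * e') (\<Phi> (cq_state N e v \<omega>)) (key_state (a', b', e') l \<tau>)"
proof -
  obtain Q where Q: "\<And>x. x < N \<Longrightarrow> psd e (Q x)" "\<And>x v. x < N \<Longrightarrow> Re (qform e (Q x) v) \<le> (\<Sum>i<e. (norm (v i))^2)"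
     "\<And>v. (\<Sum>x<N. Re (qform e (Q x) v)) \<le> L * (\<Sum>i<e. (norm (v i))^2)"
     "1 - \<eta> \<le> (\<Sum>x<N. Re (mtr e (Q x) (\<omega> x))) / N"
    using g unfolding guess_bound_def by blast
  have dv: "density N (proj (v x))" if "x < N" for x
    using v that by (intro density_proj) (auto simp: onb_def orthonormal_def)
  have q4: "1 - \<eta> \<le> (\<Sum>x<N. 1 / real N * Re (mtr e (Q x) (\<omega> x)))"
    using Q(4) by (simp add: sum_divide_distrib)
  show ?thesis unfolding cq_state_def
    by (rule lopc_converse[OF lopc, where Q=Q]) (use N dv \<omega> Q(1-3) q4 K \<tau> in auto)
qed

text \<open>The one-shot bound leaves 2^l \<le> 4 L for all large n, so that l exceeds log L by at
  most 2, which disappears after division by n.\<close>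

theorem key_rate_le:
  assumes N: "0 < N" and v: "onb N v" and \<omega>: "\<And>x. x < N \<Longrightarrow> \<omega> x \<in> carrier_mat e e"
    and \<omega>n: "\<And>n x. x < N ^ n \<Longrightarrow> density (e ^ n) (tmat e n (\<lambda>t. \<omega> (digit N x t)))"
    and h: "\<And>\<delta>. 0 < \<delta> \<Longrightarrow> \<forall>\<^sub>F n in sequentially.
      guess_bound (N ^ n) (e ^ n) (\<lambda>x. tmat e n (\<lambda>t. \<omega> (digit N x t))) (2 powr (real n * (h + \<delta>))) (1 / 4)"
  shows "key_rate (N, N, e) (cq_state N e v \<omega>) \<le> ereal h"
  unfolding key_rate_def
proof (rule Sup_least, safe)
  fix R D' \<Lambda>
  assume prot: "lopc_protocol (N, N, e) D' \<Lambda>" and dist: "distills_key (N, N, e) (cq_state N e v \<omega>) D' \<Lambda> R"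
  from dist obtain l \<tau> where lt: "\<forall>n. case D' n of (a, b, e) \<Rightarrow> 2 ^ l n \<le> a \<and> 2 ^ l n \<le> b \<and> density e (\<tau> n)"
    and R: "limsup (\<lambda>n. ereal (real (l n) / real n)) = R"
    and lim: "(\<lambda>n. tdist (total_dim (D' n)) (\<Lambda> n (tensor_power (N, N, e) n (cq_state N e v \<omega>))) (key_state (D' n) (l n) (\<tau> n))) \<longlonglongrightarrow> 0"
    unfolding distills_key_def by blast
  have v': "\<And>x. x < N \<Longrightarrow> v x \<in> carrier_vec N" using v by (simp add: onb_def)
  have tp: "tensor_power (N, N, e) n (cq_state N e v \<omega>) =
    cq_state (N ^ n) (e ^ n) (\<lambda>x. tvec N n (\<lambda>t. v (digit N x t))) (\<lambda>x. tmat e n (\<lambda>t. \<omega> (digit N x t)))" for n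
    by (rule tensor_power_cq_state) (use v' \<omega> in auto)
  have "R \<le> ereal h + ereal \<epsilon>" if \<epsilon>: "0 < \<epsilon>" for \<epsilon> :: real
  proof -
    define \<delta> where "\<delta> = \<epsilon> / 2"
    have \<delta>: "0 < \<delta>" using \<epsilon> by (simp add: \<delta>_def)
    \<comment> \<open>With error 1/4 and 6 * 1/24 = 1/4, half of the success probability
      remains.\<close>
    have "\<forall>\<^sub>F n in sequentially. tdist (total_dim (D' n)) (\<Lambda> n (tensor_power (N, N, e) n (cq_state N e v \<omega>))) (key_state (D' n) (l n) (\<tau> n)) < 1 / 24"
      using lim by (rule order_tendstoD) simp
    \<comment> \<open>From here on n \<delta> \<ge> 2 absorbs the additive constant; the other half
      of \<epsilon> is the slack in L. The summand 1 makes n positive.\<close>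
    moreover have "\<forall>\<^sub>F n in sequentially. nat \<lceil>2 / \<delta>\<rceil> + 1 \<le> n" by (rule eventually_ge_at_top)
    ultimately have "\<forall>\<^sub>F n in sequentially. ereal (real (l n) / real n) \<le> ereal (h + \<epsilon>)"
      using h[OF \<delta>]
    proof eventually_elim
      case (elim n)
      obtain a' b' e' where D: "D' n = (a', b', e')" by (cases "D' n")
      have lo: "lopc (N ^ n, N ^ n, e ^ n) (a', b', e') (\<Lambda> n)"
        using prot unfolding lopc_protocol_def by (metis D pow_dims.simps)
      have "1 - 1 / 4 \<le> 2 * (2 powr (real n * (h + \<delta>))) / 2 ^ l n + 6 * tdist (a' * b' * e') (\<Lambda> n (tensor_power (N, N, e) n (cq_state N e v \<omega>))) (key_state (a', b', e') (l n) (\<tau> n))"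
        unfolding tp
        by (rule cq_converse[OF _ onb_tvec[OF v] \<omega>n lo elim(3)]) (use N lt[rule_format, of n] D in auto)
      moreover have "tdist (a' * b' * e') (\<Lambda> n (tensor_power (N, N, e) n (cq_state N e v \<omega>))) (key_state (a', b', e') (l n) (\<tau> n)) < 1 / 24"
        using elim(1) unfolding D total_dim.simps .
      ultimately have "1 / 2 \<le> 2 * (2 powr (real n * (h + \<delta>))) / 2 ^ l n" by linarith
      then have "2 ^ l n \<le> 4 * 2 powr (real n * (h + \<delta>))" by (simp add: field_simps)
      then have "2 powr real (l n) \<le> 2 powr (2 + real n * (h + \<delta>))" by (simp add: powr_realpow powr_add)
      then have "real (l n) \<le> 2 + real n * (h + \<delta>)" by simp
      moreover have "2 / \<delta> \<le> real n" using elim(2) by linarith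
      then have "2 \<le> real n * \<delta>" using \<delta> by (simp add: field_simps)
      ultimately have "real (l n) \<le> real n * (h + \<epsilon>)" by (simp add: \<delta>_def algebra_simps)
      moreover have "0 < real n" using elim(2) by simp
      ultimately show ?case by (simp add: field_simps)
    qed
    then show ?thesis unfolding R[symmetric] by (simp add: Limsup_bounded)
  qed
  then show "R \<le> ereal h" by (rule ereal_le_epsilon2)
qed

definition relabeled :: "nat \<Rightarrow> nat \<Rightarrow> nat \<Rightarrow> (nat \<Rightarrow> nat) \<Rightarrow> (nat \<Rightarrow> cmat) \<Rightarrow> cmat" where
  "relabeled N K e f \<omega> = mat_sum (K * K * e) {..<N}
     (\<lambda>x. complex_of_real (1 / real N) \<cdot>\<^sub>m (proj (unit_vec K (f x)) \<otimes>\<^sub>m proj (unit_vec K (f x)) \<otimes>\<^sub>m \<omega> x))"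

text \<open>The protocol hashes the common string by f n on both sides. Each output register has
  dimension exactly 2^l, so the ideal key fills the computational basis.\<close>

theorem key_rate_ge:
  assumes v: "onb N v" and \<omega>: "\<And>x. x < N \<Longrightarrow> \<omega> x \<in> carrier_mat e e"
    and f: "\<And>n x. x < N ^ n \<Longrightarrow> f n x < 2 ^ l n" and \<tau>: "\<And>n. density (e ^ n) (\<tau> n)"
    and lim: "(\<lambda>n. tdist (2 ^ l n * 2 ^ l n * e ^ n)
       (relabeled (N ^ n) (2 ^ l n) (e ^ n) (f n) (\<lambda>x. tmat e n (\<lambda>t. \<omega> (digit N x t))))
       (key_state (2 ^ l n, 2 ^ l n, e ^ n) (l n) (\<tau> n))) \<longlonglongrightarrow> 0"
    and r: "(\<lambda>n. real (l n) / real n) \<longlonglongrightarrow> r"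
  shows "ereal r \<le> key_rate (N, N, e) (cq_state N e v \<omega>)"
proof -
  have v': "\<And>x. x < N \<Longrightarrow> v x \<in> carrier_vec N" using v by (simp add: onb_def)
  have tp: "tensor_power (N, N, e) n (cq_state N e v \<omega>) =
    cq_state (N ^ n) (e ^ n) (\<lambda>x. tvec N n (\<lambda>t. v (digit N x t))) (\<lambda>x. tmat e n (\<lambda>t. \<omega> (digit N x t)))" for n
    by (rule tensor_power_cq_state) (use v' \<omega> in auto)
  define D' where "D' n = (2 ^ l n :: nat, 2 ^ l n :: nat, e ^ n)" for n
  have "\<exists>\<Phi>. lopc (N ^ n, N ^ n, e ^ n) (2 ^ l n, 2 ^ l n, e ^ n) \<Phi> \<and>
      \<Phi> (tensor_power (N, N, e) n (cq_state N e v \<omega>)) = relabeled (N ^ n) (2 ^ l n) (e ^ n) (f n) (\<lambda>x. tmat e n (\<lambda>t. \<omega> (digit N x t)))" for n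
    unfolding tp relabeled_def
    by (rule lopc_relabel[OF onb_tvec[OF v] f]) auto
  then obtain \<Lambda> where \<Lambda>: "\<And>n. lopc (N ^ n, N ^ n, e ^ n) (2 ^ l n, 2 ^ l n, e ^ n) (\<Lambda> n)"
    "\<And>n. \<Lambda> n (tensor_power (N, N, e) n (cq_state N e v \<omega>)) = relabeled (N ^ n) (2 ^ l n) (e ^ n) (f n) (\<lambda>x. tmat e n (\<lambda>t. \<omega> (digit N x t)))"
    by metis
  have "lopc_protocol (N, N, e) D' \<Lambda>" unfolding lopc_protocol_def D'_def using \<Lambda>(1) by simp
  moreover have "distills_key (N, N, e) (cq_state N e v \<omega>) D' \<Lambda> (ereal r)"
    unfolding distills_key_def
  proof (intro exI conjI)
    show "\<forall>n. case D' n of (a, b, e) \<Rightarrow> 2 ^ l n \<le> a \<and> 2 ^ l n \<le> b \<and> density e (\<tau> n)"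
      using \<tau> by (simp add: D'_def)
    show "limsup (\<lambda>n. ereal (real (l n) / real n)) = ereal r"
      by (rule lim_imp_Limsup) (use r in auto)
    show "(\<lambda>n. tdist (total_dim (D' n)) (\<Lambda> n (tensor_power (N, N, e) n (cq_state N e v \<omega>))) (key_state (D' n) (l n) (\<tau> n))) \<longlonglongrightarrow> 0"
      using lim by (simp add: D'_def \<Lambda>(2) del: key_state.simps)
  qed
  ultimately show ?thesis unfolding key_rate_def by (intro Sup_upper) blast
qed

lemma relabeled_index:
  assumes \<omega>: "\<And>x. x < N \<Longrightarrow> \<omega> x \<in> carrier_mat e e"
    and "i < K" "j < K" "u < e" "i' < K" "j' < K" "u' < e"
  shows "relabeled N K e f \<omega> $$ ((i * K + j) * e + u, (i' * K + j') * e + u') =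
    (if i = i' \<and> j = j' \<and> i = j then complex_of_real (1 / real N) * (\<Sum>x<N. if f x = i then \<omega> x $$ (u, u') else 0) else 0)"
proof -
  have rs: "(i * K + j) * e + u < K * K * e" "(i' * K + j') * e + u' < K * K * e"
    using assms by (auto intro!: mult_add_less)
  have "relabeled N K e f \<omega> $$ ((i * K + j) * e + u, (i' * K + j') * e + u')
    = (\<Sum>x<N. (complex_of_real (1 / real N) \<cdot>\<^sub>m (proj (unit_vec K (f x)) \<otimes>\<^sub>m proj (unit_vec K (f x)) \<otimes>\<^sub>m \<omega> x)) $$ ((i * K + j) * e + u, (i' * K + j') * e + u'))"
    unfolding relabeled_def by (rule mat_sum_index[OF rs])
  also have "\<dots> = (\<Sum>x<N. if i = i' \<and> j = j' \<and> i = j then complex_of_real (1 / real N) * (if f x = i then \<omega> x $$ (u, u') else 0) else 0)"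
  proof (intro sum.cong refl)
    fix x assume "x \<in> {..<N}"
    then have w: "\<omega> x \<in> carrier_mat e e" using \<omega> by simp
    have P: "proj (unit_vec K (f x)) \<in> carrier_mat K K" by auto
    have c: "proj (unit_vec K (f x)) \<otimes>\<^sub>m proj (unit_vec K (f x)) \<otimes>\<^sub>m \<omega> x \<in> carrier_mat (K * K * e) (K * K * e)"
      by (intro kron_carrier P w)
    have "(complex_of_real (1 / real N) \<cdot>\<^sub>m (proj (unit_vec K (f x)) \<otimes>\<^sub>m proj (unit_vec K (f x)) \<otimes>\<^sub>m \<omega> x)) $$ ((i * K + j) * e + u, (i' * K + j') * e + u')
      = complex_of_real (1 / real N) * (proj (unit_vec K (f x)) \<otimes>\<^sub>m proj (unit_vec K (f x)) \<otimes>\<^sub>m \<omega> x) $$ ((i * K + j) * e + u, (i' * K + j') * e + u')"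
      by (intro index_smult_mat(1)) (simp_all add: carrier_matD[OF w] rs)
    also have "(proj (unit_vec K (f x)) \<otimes>\<^sub>m proj (unit_vec K (f x)) \<otimes>\<^sub>m \<omega> x) $$ ((i * K + j) * e + u, (i' * K + j') * e + u')
      = proj (unit_vec K (f x)) $$ (i, i') * proj (unit_vec K (f x)) $$ (j, j') * \<omega> x $$ (u, u')"
      by (rule kron3_index[OF P P w]) (use assms in auto)
    finally show "(complex_of_real (1 / real N) \<cdot>\<^sub>m (proj (unit_vec K (f x)) \<otimes>\<^sub>m proj (unit_vec K (f x)) \<otimes>\<^sub>m \<omega> x)) $$ ((i * K + j) * e + u, (i' * K + j') * e + u')
      = (if i = i' \<and> j = j' \<and> i = j then complex_of_real (1 / real N) * (if f x = i then \<omega> x $$ (u, u') else 0) else 0)"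
      using assms(2-) by (auto simp: proj_unit_vec_index simp del: ketbra_index)
  qed
  also have "\<dots> = (if i = i' \<and> j = j' \<and> i = j then complex_of_real (1 / real N) * (\<Sum>x<N. if f x = i then \<omega> x $$ (u, u') else 0) else 0)"
  proof (cases "i = i' \<and> j = j' \<and> i = j")
    case True
    then show ?thesis by (simp add: sum_distrib_left)
  next
    case False
    then show ?thesis by (simp only: if_False sum.neutral_const)
  qed
  finally show ?thesis .
qed

lemma key_state_index:
  assumes \<tau>: "\<tau> \<in> carrier_mat e e" and K: "K = 2 ^ l"
    and "i < K" "j < K" "u < e" "i' < K" "j' < K" "u' < e"
  shows "key_state (K, K, e) l \<tau> $$ ((i * K + j) * e + u, (i' * K + j') * e + u') =
    (if i = i' \<and> j = j' \<and> i = j then complex_of_real (1 / real K) * \<tau> $$ (u, u') else 0)"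
proof -
  have rs: "(i * K + j) * e + u < K * K * e" "(i' * K + j') * e + u' < K * K * e"
    using assms by (auto intro!: mult_add_less)
  have "key_state (K, K, e) l \<tau> $$ ((i * K + j) * e + u, (i' * K + j') * e + u')
    = complex_of_real (1 / real K) * (\<Sum>k<K. (proj (unit_vec K k) \<otimes>\<^sub>m proj (unit_vec K k) \<otimes>\<^sub>m \<tau>) $$ ((i * K + j) * e + u, (i' * K + j') * e + u'))"
    unfolding key_state_eq using rs by (simp add: K)
  also have "\<dots> = complex_of_real (1 / real K) * (\<Sum>k<K. if k = i then (if i = i' \<and> j = j' \<and> i = j then \<tau> $$ (u, u') else 0) else 0)"
  proof (intro arg_cong[of _ _ "\<lambda>x. _ * x"] sum.cong refl)
    fix k
    have P: "proj (unit_vec K k) \<in> carrier_mat K K" by auto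
    have "(proj (unit_vec K k) \<otimes>\<^sub>m proj (unit_vec K k) \<otimes>\<^sub>m \<tau>) $$ ((i * K + j) * e + u, (i' * K + j') * e + u')
      = proj (unit_vec K k) $$ (i, i') * proj (unit_vec K k) $$ (j, j') * \<tau> $$ (u, u')"
      by (rule kron3_index[OF P P \<tau>]) (use assms in auto)
    then show "(proj (unit_vec K k) \<otimes>\<^sub>m proj (unit_vec K k) \<otimes>\<^sub>m \<tau>) $$ ((i * K + j) * e + u, (i' * K + j') * e + u')
      = (if k = i then (if i = i' \<and> j = j' \<and> i = j then \<tau> $$ (u, u') else 0) else 0)"
      using assms(3-) by (auto simp: proj_unit_vec_index simp del: ketbra_index)
  qed
  also have "\<dots> = (if i = i' \<and> j = j' \<and> i = j then complex_of_real (1 / real K) * \<tau> $$ (u, u') else 0)"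
    using assms(3) by simp
  finally show ?thesis .
qed

text \<open>Eve's 2 d vectors form two bases, so their projectors sum to twice the identity and
  those of n copies to 2^n times it; each of them accepts its own state with certainty. For the
  lower bound, averaging over either basis gives the maximally mixed state, so Eve's system is
  independent of the bit naming the basis and the bits form an exact key. The case d = 1 is a shared
  bit with a trivial adversary.\<close>

theorem key_rate_two_bases:
  assumes d: "0 < d" and v: "onb (2 * d) v"
    and \<phi>: "\<And>y. y < 2 * d \<Longrightarrow> \<phi> y \<in> carrier_vec d"
    and o0: "orthonormal d d (\<lambda>s i. \<phi> s $ i)" and o1: "orthonormal d d (\<lambda>s i. \<phi> (d + s) $ i)"
  shows "key_rate (2 * d, 2 * d, d) (cq_state (2 * d) d v (\<lambda>y. proj (\<phi> y))) = 1"
proof (rule antisym)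
  define wn where "wn n x = tmat d n (\<lambda>t. proj (\<phi> (digit (2 * d) x t)))" for n x
  define pn where "pn n x = tvec d n (\<lambda>t. \<phi> (digit (2 * d) x t))" for n x
  have \<omega>: "proj (\<phi> y) \<in> carrier_mat d d" if "y < 2 * d" for y using \<phi>[OF that] by simp
  have wp: "wn n x = proj (pn n x)" if "x < (2 * d) ^ n" for n x
    unfolding wn_def pn_def by (rule tmat_proj) (rule \<phi>[OF digit_less[OF that]])
  have p1: "(\<Sum>i<d. cnj (\<phi> y $ i) * \<phi> y $ i) = 1" if "y < 2 * d" for y
  proof (cases "y < d")
    case True
    then show ?thesis using o0 by (simp add: orthonormal_def)
  next
    case False
    then have y: "y - d < d" "d + (y - d) = y" using that by auto
    have "(\<Sum>i<d. cnj (\<phi> (d + (y - d)) $ i) * \<phi> (d + (y - d)) $ i) = 1"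
      using o1 y(1) unfolding orthonormal_def by simp
    then show ?thesis unfolding y(2) .
  qed
  have pn1: "(\<Sum>i<d ^ n. cnj (pn n x $ i) * pn n x $ i) = 1" if "x < (2 * d) ^ n" for n x
    unfolding pn_def tvec_inner by (rule prod.neutral) (use p1 digit_less[OF that] in blast)
  have block: "(\<Sum>k<d. \<phi> (s * d + k) $ u * cnj (\<phi> (s * d + k) $ u')) = (if u = u' then 1 else 0)"
    if "s < 2" "u < d" "u' < d" for s u u'
  proof -
    have "s = 0 \<or> s = 1" using that(1) by auto
    then show ?thesis using orthonormal_complete[OF o0 that(2,3)] orthonormal_complete[OF o1 that(2,3)] by auto
  qed
  have dens: "density (d ^ n) (wn n x)" if "x < (2 * d) ^ n" for n x
    unfolding wp[OF that] by (rule density_proj[OF _ pn1[OF that]]) (simp add: pn_def)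
  \<comment> \<open>Error 0 and constant exactly 2^n; both are relaxed only to match the asymptotic
    form of the rate bound.\<close>
  have gb: "guess_bound ((2 * d) ^ n) (d ^ n) (wn n) (2 ^ n) 0" for n
    unfolding guess_bound_def
  proof (intro exI[of _ "wn n"] conjI allI impI)
    fix x assume x: "x < (2 * d) ^ n"
    show "psd (d ^ n) (wn n x)" using dens[OF x] by (simp add: density_def)
    fix w
    have pnc: "pn n x \<in> carrier_vec (d ^ n)" by (simp add: pn_def)
    have "(norm (\<Sum>j<d ^ n. cnj (pn n x $ j) * w j))^2 \<le> (\<Sum>i<d ^ n. (norm (w i))^2)"
    proof -
      have n1: "(\<Sum>j<d ^ n. (norm (pn n x $ j))^2) = 1"
      proof -
        have "complex_of_real (\<Sum>j<d ^ n. (norm (pn n x $ j))^2) = 1"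
          unfolding of_real_sum complex_norm_square using pn1[OF x] by (simp add: mult.commute)
        then show ?thesis by (simp only: of_real_eq_1_iff)
      qed
      have "norm (\<Sum>j<d ^ n. cnj (pn n x $ j) * w j) \<le> (\<Sum>j<d ^ n. \<bar>norm (pn n x $ j)\<bar> * \<bar>norm (w j)\<bar>)"
        by (intro order.trans[OF norm_sum] sum_mono) (simp add: norm_mult)
      also have "\<dots> \<le> sqrt (\<Sum>i<d ^ n. (norm (w i))^2)"
        using L2_set_mult_ineq[of "\<lambda>j. norm (pn n x $ j)" "\<lambda>j. norm (w j)" "{..<d ^ n}"] by (simp add: L2_set_def n1)
      finally have "norm (\<Sum>j<d ^ n. cnj (pn n x $ j) * w j) \<le> sqrt (\<Sum>i<d ^ n. (norm (w i))^2)" .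
      then have "(norm (\<Sum>j<d ^ n. cnj (pn n x $ j) * w j))^2 \<le> (sqrt (\<Sum>i<d ^ n. (norm (w i))^2))^2"
        by (intro power_mono) auto
      then show ?thesis by (simp add: sum_nonneg)
    qed
    then show "Re (qform (d ^ n) (wn n x) w) \<le> (\<Sum>i<d ^ n. (norm (w i))^2)"
      unfolding wp[OF x] qform_proj[OF pnc] by simp
  next
    fix w
    have "mat_sum (d ^ n) {..<(2 * d) ^ n} (wn n) = complex_of_real (2 ^ n) \<cdot>\<^sub>m 1\<^sub>m (d ^ n)"
    proof (rule eq_matI)
      fix u u' assume "u < dim_row (complex_of_real (2 ^ n) \<cdot>\<^sub>m 1\<^sub>m (d ^ n))" "u' < dim_col (complex_of_real (2 ^ n) \<cdot>\<^sub>m 1\<^sub>m (d ^ n))"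
      then have u: "u < d ^ n" "u' < d ^ n" by auto
      have "mat_sum (d ^ n) {..<(2 * d) ^ n} (wn n) $$ (u, u') = (\<Sum>x<(2 * d) ^ n. \<Prod>t<n. proj (\<phi> (digit (2 * d) x t)) $$ (digit d u t, digit d u' t))"
        using u by (simp add: wn_def tmat_def)
      also have "\<dots> = (\<Prod>t<n. \<Sum>y<2 * d. proj (\<phi> y) $$ (digit d u t, digit d u' t))"
        by (rule sum_prod_digits)
      also have "\<dots> = (\<Prod>t<n. if digit d u t = digit d u' t then 2 else 0)"
      proof (intro prod.cong refl)
        fix t assume "t \<in> {..<n}"
        then have dl: "digit d u t < d" "digit d u' t < d" using u by (auto intro: digit_less)
        have "(\<Sum>y<2 * d. proj (\<phi> y) $$ (digit d u t, digit d u' t)) = (\<Sum>s<2. \<Sum>k<d. proj (\<phi> (s * d + k)) $$ (digit d u t, digit d u' t))"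
          by (rule sum_lessThan_mult)
        also have "\<dots> = (\<Sum>s<(2::nat). \<Sum>k<d. \<phi> (s * d + k) $ digit d u t * cnj (\<phi> (s * d + k) $ digit d u' t))"
        proof (intro sum.cong refl ketbra_index)
          fix s k assume "s \<in> {..<2::nat}" "k \<in> {..<d}"
          then have "dim_vec (\<phi> (s * d + k)) = d" using \<phi>[of "s * d + k"] mult_add_less[of s 2 k d] by auto
          then show "digit d u t < dim_vec (\<phi> (s * d + k))" "digit d u' t < dim_vec (\<phi> (s * d + k))" using dl by auto
        qed
        also have "\<dots> = (\<Sum>s<(2::nat). if digit d u t = digit d u' t then 1 else 0)"
          by (intro sum.cong refl block) (use dl in auto)
        finally show "(\<Sum>y<2 * d. proj (\<phi> y) $$ (digit d u t, digit d u' t)) = (if digit d u t = digit d u' t then 2 else 0)" by simp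
      qed
      also have "\<dots> = (if u = u' then 2 ^ n else 0)" by (rule prod_digit_delta[OF u])
      finally show "mat_sum (d ^ n) {..<(2 * d) ^ n} (wn n) $$ (u, u') = (complex_of_real (2 ^ n) \<cdot>\<^sub>m 1\<^sub>m (d ^ n)) $$ (u, u')"
        using u by simp
    qed auto
    then have "(\<Sum>x<(2 * d) ^ n. qform (d ^ n) (wn n x) w) = qform (d ^ n) (complex_of_real (2 ^ n) \<cdot>\<^sub>m 1\<^sub>m (d ^ n)) w"
      unfolding qform_mat_sum[symmetric] by simp
    also have "\<dots> = of_real (2 ^ n * (\<Sum>i<d ^ n. (norm (w i))^2))"
      by (subst qform_smult) (auto simp: qform_one)
    finally have "Re (\<Sum>x<(2 * d) ^ n. qform (d ^ n) (wn n x) w) = 2 ^ n * (\<Sum>i<d ^ n. (norm (w i))^2)" by simp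
    then show "(\<Sum>x<(2 * d) ^ n. Re (qform (d ^ n) (wn n x) w)) \<le> 2 ^ n * (\<Sum>i<d ^ n. (norm (w i))^2)" by simp
  next
    have "mtr (d ^ n) (wn n x) (wn n x) = 1" if x: "x < (2 * d) ^ n" for x
    proof -
      have "mtr (d ^ n) (wn n x) (wn n x) = (\<Sum>i<d ^ n. \<Sum>j<d ^ n. (cnj (pn n x $ i) * pn n x $ i) * (cnj (pn n x $ j) * pn n x $ j))"
        unfolding wp[OF x] mtr_def by (intro sum.cong refl) (simp add: pn_def tvec_def mult_ac)
      also have "\<dots> = 1" unfolding sum_product[symmetric] pn1[OF x] by simp
      finally show ?thesis .
    qed
    then show "1 - 0 \<le> (\<Sum>x<(2 * d) ^ n. Re (mtr (d ^ n) (wn n x) (wn n x))) / ((2 * d) ^ n)"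
      using d by simp
  qed
  show "key_rate (2 * d, 2 * d, d) (cq_state (2 * d) d v (\<lambda>y. proj (\<phi> y))) \<le> 1"
    unfolding one_ereal_def
  proof (rule key_rate_le[OF _ v \<omega>])
    show "density (d ^ n) (tmat d n (\<lambda>t. proj (\<phi> (digit (2 * d) x t))))" if "x < (2 * d) ^ n" for n x
      using dens[OF that] by (simp add: wn_def)
    fix \<delta> :: real assume \<delta>: "0 < \<delta>"
    have "guess_bound ((2 * d) ^ n) (d ^ n) (wn n) (2 powr (real n * (1 + \<delta>))) (1 / 4)" for n
    proof -
      have le: "2 ^ n \<le> 2 powr (real n * (1 + \<delta>))"
      proof -
        have "(2::real) ^ n = 2 powr real n" by (simp add: powr_realpow)
        also have "\<dots> \<le> 2 powr (real n * (1 + \<delta>))" using \<delta> by (intro powr_mono) (auto simp: mult_le_cancel_left1)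
        finally show ?thesis .
      qed
      obtain Q where Q: "\<forall>x<(2 * d) ^ n. psd (d ^ n) (Q x) \<and> (\<forall>v. Re (qform (d ^ n) (Q x) v) \<le> (\<Sum>i<d ^ n. (norm (v i))^2))"
        "\<forall>v. (\<Sum>x<(2 * d) ^ n. Re (qform (d ^ n) (Q x) v)) \<le> 2 ^ n * (\<Sum>i<d ^ n. (norm (v i))^2)"
        "1 - 0 \<le> (\<Sum>x<(2 * d) ^ n. Re (mtr (d ^ n) (Q x) (wn n x))) / real ((2 * d) ^ n)"
        using gb[of n] unfolding guess_bound_def by blast
      have "(\<Sum>x<(2 * d) ^ n. Re (qform (d ^ n) (Q x) v)) \<le> 2 powr (real n * (1 + \<delta>)) * (\<Sum>i<d ^ n. (norm (v i))^2)" for v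
        using Q(2)[rule_format, of v] mult_right_mono[OF le, of "\<Sum>i<d ^ n. (norm (v i))^2"] by (simp add: sum_nonneg)
      moreover have "1 - 1 / 4 \<le> (\<Sum>x<(2 * d) ^ n. Re (mtr (d ^ n) (Q x) (wn n x))) / real ((2 * d) ^ n)"
        by (rule order.trans[OF _ Q(3)]) simp
      ultimately show ?thesis unfolding guess_bound_def using Q(1) by blast
    qed
    then show "\<forall>\<^sub>F n in sequentially. guess_bound ((2 * d) ^ n) (d ^ n) (\<lambda>x. tmat d n (\<lambda>t. proj (\<phi> (digit (2 * d) x t)))) (2 powr (real n * (1 + \<delta>))) (1 / 4)"
      unfolding wn_def by simp
  qed (use d in auto)
  \<comment> \<open>The string of basis bits y div d, read as a number in base 2, is the
    key.\<close>
  have "\<exists>i. i < 2 ^ n \<and> (\<forall>t<n. digit 2 i t = digit (2 * d) x t div d)" if "x < (2 * d) ^ n" for n x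
  proof -
    have "digit (2 * d) x t div d < 2" if "t < n" for t
      using digit_less[OF \<open>x < (2 * d) ^ n\<close> that] by (simp add: less_mult_imp_div_less)
    from ex_digits[of n _ 2, OF this] show ?thesis by auto
  qed
  note ex = this
  define f where "f n x = (SOME i. i < 2 ^ n \<and> (\<forall>t<n. digit 2 i t = digit (2 * d) x t div d))" for n x
  have ff: "f n x < 2 ^ n \<and> (\<forall>t<n. digit 2 (f n x) t = digit (2 * d) x t div d)" if "x < (2 * d) ^ n" for n x
    unfolding f_def by (rule someI_ex[OF ex[OF that]])
  have f: "f n x < 2 ^ n" if "x < (2 * d) ^ n" for n x
    using ff[OF that] by blast
  have fd: "digit 2 (f n x) t = digit (2 * d) x t div d" if "x < (2 * d) ^ n" "t < n" for n x t
    using ff[OF that(1)] that(2) by blast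
  \<comment> \<open>Maximally mixed, as Eve is left with the average over a basis in every
    copy.\<close>
  define \<tau> where "\<tau> n = complex_of_real (1 / real (d ^ n)) \<cdot>\<^sub>m 1\<^sub>m (d ^ n)" for n
  have \<tau>c: "\<tau> n \<in> carrier_mat (d ^ n) (d ^ n)" for n by (simp add: \<tau>_def)
  have \<tau>: "density (d ^ n) (\<tau> n)" for n
  proof -
    have "qform (d ^ n) (\<tau> n) w = of_real (1 / real (d ^ n) * (\<Sum>i<d ^ n. (norm (w i))^2))" for w
      unfolding \<tau>_def by (subst qform_smult) (auto simp: qform_one)
    then have "psd (d ^ n) (\<tau> n)" using \<tau>c by (auto simp: psd_qform less_eq_complex_def intro!: divide_nonneg_nonneg sum_nonneg)
    moreover have "mat_trace (\<tau> n) = 1" using d by (simp add: \<tau>_def mat_trace_def)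
    ultimately show ?thesis by (simp add: density_def)
  qed
  have eq: "relabeled ((2 * d) ^ n) (2 ^ n) (d ^ n) (f n) (wn n) = key_state (2 ^ n, 2 ^ n, d ^ n) n (\<tau> n)" for n
  proof (rule eq_mat_kronI[where a="2 ^ n * 2 ^ n" and b="d ^ n" and a'="2 ^ n * 2 ^ n" and b'="d ^ n"])
    fix ij u ij' u' :: nat assume "ij < 2 ^ n * 2 ^ n" "u < d ^ n" "ij' < 2 ^ n * 2 ^ n" "u' < d ^ n"
    then obtain i j i' j' where ij: "i < 2 ^ n" "j < 2 ^ n" "ij = i * 2 ^ n + j" "i' < 2 ^ n" "j' < 2 ^ n" "ij' = i' * 2 ^ n + j'"
      and u: "u < d ^ n" "u' < d ^ n" by (metis less_mult_cases)
    have wc: "wn n x \<in> carrier_mat (d ^ n) (d ^ n)" for x by (simp add: wn_def)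
    \<comment> \<open>Fixing the key selects one of the two bases in each copy; the sum over the
      remaining letters is completeness of that basis, copy by copy.\<close>
    have "(\<Sum>x<(2 * d) ^ n. if f n x = i then wn n x $$ (u, u') else 0) = (if u = u' then 1 else 0)"
    proof -
      define F where "F t y = (if y div d = digit 2 i t then proj (\<phi> y) $$ (digit d u t, digit d u' t) else 0)" for t y
      have "(\<Sum>x<(2 * d) ^ n. if f n x = i then wn n x $$ (u, u') else 0) = (\<Sum>x<(2 * d) ^ n. \<Prod>t<n. F t (digit (2 * d) x t))"
      proof (intro sum.cong refl)
        fix x assume "x \<in> {..<(2 * d) ^ n}"
        then have x: "x < (2 * d) ^ n" by simp
        show "(if f n x = i then wn n x $$ (u, u') else 0) = (\<Prod>t<n. F t (digit (2 * d) x t))"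
        proof (cases "f n x = i")
          case True
          then have "F t (digit (2 * d) x t) = proj (\<phi> (digit (2 * d) x t)) $$ (digit d u t, digit d u' t)" if "t < n" for t
            using fd[OF x that] by (simp add: F_def)
          then show ?thesis using True u by (simp add: wn_def tmat_def)
        next
          case False
          then obtain t where "t < n" "digit 2 (f n x) t \<noteq> digit 2 i t" using digits_eqI[OF f[OF x] ij(1)] by blast
          then have "F t (digit (2 * d) x t) = 0" using fd[OF x] by (simp add: F_def)
          then have "(\<Prod>t<n. F t (digit (2 * d) x t)) = 0" using \<open>t < n\<close> by (intro prod_zero) auto
          then show ?thesis using False by simp
        qed
      qed
      also have "\<dots> = (\<Prod>t<n. \<Sum>y<2 * d. F t y)" by (rule sum_prod_digits)
      also have "\<dots> = (\<Prod>t<n. if digit d u t = digit d u' t then 1 else 0)"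
      proof (intro prod.cong refl)
        fix t assume "t \<in> {..<n}"
        then have t: "t < n" by simp
        have dl: "digit d u t < d" "digit d u' t < d" using u t by (auto intro: digit_less)
        have s: "digit 2 i t < 2" using ij(1) t by (rule digit_less)
        have "(\<Sum>y<2 * d. F t y) = (\<Sum>s<2. \<Sum>k<d. F t (s * d + k))" by (rule sum_lessThan_mult)
        also have "\<dots> = (\<Sum>k<d. F t (digit 2 i t * d + k))"
          by (rule sum_one_support[OF s]) (auto simp: F_def)
        also have "\<dots> = (\<Sum>k<d. \<phi> (digit 2 i t * d + k) $ digit d u t * cnj (\<phi> (digit 2 i t * d + k) $ digit d u' t))"
        proof (intro sum.cong refl)
          fix k assume "k \<in> {..<d}"
          then have k: "k < d" by simp
          have "dim_vec (\<phi> (digit 2 i t * d + k)) = d" using \<phi>[OF mult_add_less[OF s k]] by auto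
          then show "F t (digit 2 i t * d + k) = \<phi> (digit 2 i t * d + k) $ digit d u t * cnj (\<phi> (digit 2 i t * d + k) $ digit d u' t)"
            using dl k by (simp add: F_def)
        qed
        also have "\<dots> = (if digit d u t = digit d u' t then 1 else 0)" by (rule block[OF s dl])
        finally show "(\<Sum>y<2 * d. F t y) = (if digit d u t = digit d u' t then 1 else 0)" .
      qed
      also have "\<dots> = (if u = u' then 1 else 0)" using prod_digit_delta[OF u, of "1::complex"] by simp
      finally show ?thesis .
    qed
    note sm = this
    have r1: "relabeled ((2 * d) ^ n) (2 ^ n) (d ^ n) (f n) (wn n) $$ ((i * 2 ^ n + j) * d ^ n + u, (i' * 2 ^ n + j') * d ^ n + u')
      = (if i = i' \<and> j = j' \<and> i = j then complex_of_real (1 / real ((2 * d) ^ n)) * (if u = u' then 1 else 0) else 0)"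
      unfolding sm[symmetric] by (rule relabeled_index[OF wc ij(1,2) u(1) ij(4,5) u(2)])
    have r2: "key_state (2 ^ n, 2 ^ n, d ^ n) n (\<tau> n) $$ ((i * 2 ^ n + j) * d ^ n + u, (i' * 2 ^ n + j') * d ^ n + u')
      = (if i = i' \<and> j = j' \<and> i = j then complex_of_real (1 / real (2 ^ n)) * \<tau> n $$ (u, u') else 0)"
      by (rule key_state_index[OF \<tau>c refl ij(1,2) u(1) ij(4,5) u(2)])
    have "complex_of_real (1 / real ((2 * d) ^ n)) * (if u = u' then 1 else 0) = complex_of_real (1 / real (2 ^ n)) * \<tau> n $$ (u, u')"
      using u by (simp add: \<tau>_def power_mult_distrib)
    then show "relabeled ((2 * d) ^ n) (2 ^ n) (d ^ n) (f n) (wn n) $$ (ij * d ^ n + u, ij' * d ^ n + u')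
      = key_state (2 ^ n, 2 ^ n, d ^ n) n (\<tau> n) $$ (ij * d ^ n + u, ij' * d ^ n + u')"
      unfolding ij r1 r2 by (simp only:)
  qed (simp_all add: relabeled_def)
  have "ereal 1 \<le> key_rate (2 * d, 2 * d, d) (cq_state (2 * d) d v (\<lambda>y. proj (\<phi> y)))"
  proof (rule key_rate_ge[OF v \<omega> f \<tau>])
    have "tdist (2 ^ n * 2 ^ n * d ^ n) (relabeled ((2 * d) ^ n) (2 ^ n) (d ^ n) (f n) (\<lambda>x. tmat d n (\<lambda>t. proj (\<phi> (digit (2 * d) x t))))) (key_state (2 ^ n, 2 ^ n, d ^ n) n (\<tau> n)) = 0" for n
      using tdist_self[of "key_state (2 ^ n, 2 ^ n, d ^ n) n (\<tau> n)" "2 ^ n * 2 ^ n * d ^ n"] eq[of n]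
      by (simp add: wn_def[abs_def])
    then show "(\<lambda>n. tdist (2 ^ n * 2 ^ n * d ^ n) (relabeled ((2 * d) ^ n) (2 ^ n) (d ^ n) (f n) (\<lambda>x. tmat d n (\<lambda>t. proj (\<phi> (digit (2 * d) x t))))) (key_state (2 ^ n, 2 ^ n, d ^ n) n (\<tau> n))) \<longlonglongrightarrow> 0"
      by (simp del: key_state.simps)
    have "\<forall>\<^sub>F n in sequentially. real n / real n = 1" using eventually_gt_at_top[of 0] by eventually_elim simp
    then show "(\<lambda>n. real n / real n) \<longlonglongrightarrow> 1" by (rule tendsto_eventually)
  qed
  then show "1 \<le> key_rate (2 * d, 2 * d, d) (cq_state (2 * d) d v (\<lambda>y. proj (\<phi> y)))" by (simp add: one_ereal_def)
qed

section \<open>Privacy amplification against a classical adversary\<close>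

text \<open>Under a uniformly random f a pair of distinct elements collides with probability 1/K.
  Placing the elements one at a time, each into a bucket of at most average additional cost, is at
  least as good.\<close>

lemma exists_hash:
  fixes k :: "'a \<Rightarrow> 'a \<Rightarrow> real"
  assumes "finite S" and K: "0 < K" and k: "\<And>x y. 0 \<le> k x y"
  shows "\<exists>f. (\<forall>x. f x < K) \<and> (\<Sum>x\<in>S. \<Sum>y\<in>S. if f x = f y then k x y else 0) \<le>
    (\<Sum>x\<in>S. k x x) + (\<Sum>x\<in>S. \<Sum>y\<in>S. k x y) / real K"
  using assms(1)
proof (induction S)
  case empty
  then show ?case using K by (intro exI[of _ "\<lambda>_. 0"]) auto
next
  case (insert a S)
  then obtain f where f: "\<forall>x. f x < K" and le: "(\<Sum>x\<in>S. \<Sum>y\<in>S. if f x = f y then k x y else 0) \<le>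
    (\<Sum>x\<in>S. k x x) + (\<Sum>x\<in>S. \<Sum>y\<in>S. k x y) / real K" by blast
  \<comment> \<open>The collision weight added by putting a into bucket i, with both orders of every
    pair.\<close>
  define c where "c i = (\<Sum>y\<in>S. if f y = i then k a y + k y a else 0)" for i
  have "(\<Sum>i<K. c i) = (\<Sum>y\<in>S. k a y + k y a)"
    unfolding c_def by (subst sum.swap) (use f in \<open>auto intro!: sum.cong\<close>)
  obtain i where i: "i < K" "c i \<le> (\<Sum>y\<in>S. k a y + k y a) / real K"
  proof (rule ccontr)
    assume "\<not> thesis"
    then have "\<And>i. i < K \<Longrightarrow> (\<Sum>y\<in>S. k a y + k y a) / real K < c i" using that by force
    then have "(\<Sum>i<K. (\<Sum>y\<in>S. k a y + k y a) / real K) < (\<Sum>i<K. c i)"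
      using K by (intro sum_strict_mono) auto
    then show False using K \<open>(\<Sum>i<K. c i) = _\<close> by simp
  qed
  define g where "g = f(a := i)"
  have gS: "g y = f y" if "y \<in> S" for y using insert.hyps(2) that by (auto simp: g_def)
  have "(\<Sum>x\<in>insert a S. \<Sum>y\<in>insert a S. if g x = g y then k x y else 0)
    = (k a a + (\<Sum>y\<in>S. if i = f y then k a y else 0)) + (\<Sum>x\<in>S. (if f x = i then k x a else 0) + (\<Sum>y\<in>S. if f x = f y then k x y else 0))"
    using insert.hyps by (simp add: gS) (simp add: g_def)
  also have "\<dots> = k a a + ((\<Sum>y\<in>S. if i = f y then k a y else 0) + (\<Sum>x\<in>S. if f x = i then k x a else 0)) + (\<Sum>x\<in>S. \<Sum>y\<in>S. if f x = f y then k x y else 0)"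
    by (simp add: sum.distrib)
  also have "(\<Sum>y\<in>S. if i = f y then k a y else 0) + (\<Sum>x\<in>S. if f x = i then k x a else 0) = c i"
    unfolding c_def sum.distrib[symmetric] by (intro sum.cong refl) auto
  also have "k a a + c i + (\<Sum>x\<in>S. \<Sum>y\<in>S. if f x = f y then k x y else 0)
    \<le> k a a + (\<Sum>y\<in>S. k a y + k y a) / real K + ((\<Sum>x\<in>S. k x x) + (\<Sum>x\<in>S. \<Sum>y\<in>S. k x y) / real K)"
    using i le by simp
  also have "\<dots> \<le> (\<Sum>x\<in>insert a S. k x x) + (\<Sum>x\<in>insert a S. \<Sum>y\<in>insert a S. k x y) / real K"
    using insert.hyps k[of a a] K by (simp add: sum.distrib add_divide_distrib)
  finally have "(\<Sum>x\<in>insert a S. \<Sum>y\<in>insert a S. if g x = g y then k x y else 0) \<le>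
    (\<Sum>x\<in>insert a S. k x x) + (\<Sum>x\<in>insert a S. \<Sum>y\<in>insert a S. k x y) / real K" .
  moreover have "\<forall>x. g x < K" using f i by (simp add: g_def)
  ultimately show ?case by blast
qed

text \<open>A leftover hash lemma for a fixed f. The deviation of the bucket masses from uniform,
  squared and weighted by 1 / q z, is a collision sum minus its mean, and the choice of f leaves
  only the diagonal, which is at most \<beta> on pairs satisfying T. The excluded mass counts twice:
  in its buckets and in the uniform value compared with.\<close>

lemma hash_distance:
  fixes r :: "nat \<Rightarrow> nat \<Rightarrow> real"
  assumes r: "\<And>x z. 0 \<le> r x z" and q: "\<And>z. q z = (\<Sum>x<M. r x z)" and q1: "(\<Sum>z<E. q z) = 1"
    and T: "\<And>x z. x < M \<Longrightarrow> z < E \<Longrightarrow> T x z \<Longrightarrow> r x z \<le> q z * \<beta>"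
    and K: "0 < K" and \<theta>: "0 < \<theta>" "real K * \<beta> \<le> \<theta>^2" and \<beta>: "0 \<le> \<beta>"
  shows "\<exists>f. (\<forall>x. f x < K) \<and>
    (\<Sum>i<K. \<Sum>z<E. \<bar>(\<Sum>x<M. if f x = i then r x z else 0) - q z / real K\<bar>) \<le> \<theta> + 2 * (\<Sum>x<M. \<Sum>z<E. if T x z then 0 else r x z)"
proof -
  define g where "g x z = (if T x z then r x z else 0)" for x z
  define s where "s x z = (if T x z then 0 else r x z)" for x z
  have rgs: "r x z = g x z + s x z" for x z by (simp add: g_def s_def)
  have g0: "0 \<le> g x z" and s0: "0 \<le> s x z" for x z using r by (auto simp: g_def s_def)
  have q0: "0 \<le> q z" for z unfolding q using r by (intro sum_nonneg)
  \<comment> \<open>Collisions under the same side information are weighted by 1 / q z so that the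
    diagonal is controlled by the conditional probabilities r / q. If q z = 0, all relevant r x z
    vanish, and so does the quotient.\<close>
  define k where "k x y = (\<Sum>z<E. g x z * g y z / q z)" for x y
  have k0: "0 \<le> k x y" for x y unfolding k_def using g0 q0 by (intro sum_nonneg) auto
  obtain f where f: "\<forall>x. f x < K" and coll: "(\<Sum>x<M. \<Sum>y<M. if f x = f y then k x y else 0) \<le>
    (\<Sum>x<M. k x x) + (\<Sum>x<M. \<Sum>y<M. k x y) / real K"
    using exists_hash[OF finite_lessThan K, of k M] k0 by blast
  define A where "A i z = (\<Sum>x<M. if f x = i then g x z else 0)" for i z
  define B where "B i z = (\<Sum>x<M. if f x = i then s x z else 0)" for i z
  define G where "G z = (\<Sum>x<M. g x z)" for z
  define S where "S z = (\<Sum>x<M. s x z)" for z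
  have qGS: "q z = G z + S z" for z unfolding q G_def S_def sum.distrib[symmetric] by (simp add: rgs)
  have sumf: "(\<Sum>i<K. \<Sum>x<M. if f x = i then h x else 0) = (\<Sum>x<M. h x)" for h :: "nat \<Rightarrow> real"
    by (subst sum.swap) (use f in \<open>auto intro!: sum.cong\<close>)
  have SA: "(\<Sum>i<K. A i z) = G z" for z unfolding A_def G_def by (rule sumf)
  have SB: "(\<Sum>i<K. B i z) = S z" for z unfolding B_def S_def by (rule sumf)
  \<comment> \<open>The square of a bucket mass counts pairs in that bucket, and the masses sum to G
    z.\<close>
  have var: "(\<Sum>i<K. (A i z - G z / real K)^2) = (\<Sum>x<M. \<Sum>y<M. if f x = f y then g x z * g y z else 0) - (G z)^2 / real K" for z
  proof -
    have "(\<Sum>i<K. (A i z)^2) = (\<Sum>i<K. \<Sum>x<M. if f x = i then (\<Sum>y<M. if f x = f y then g x z * g y z else 0) else 0)"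
      unfolding A_def power2_eq_square sum_product
      by (intro sum.cong refl) (auto intro!: sum.cong)
    also have "\<dots> = (\<Sum>x<M. \<Sum>y<M. if f x = f y then g x z * g y z else 0)" by (rule sumf)
    finally have 1: "(\<Sum>i<K. (A i z)^2) = (\<Sum>x<M. \<Sum>y<M. if f x = f y then g x z * g y z else 0)" .
    have "(\<Sum>i<K. (A i z - G z / real K)^2) = (\<Sum>i<K. (A i z)^2 - 2 * G z / real K * A i z + (G z / real K)^2)"
      by (intro sum.cong refl) (simp add: power2_diff algebra_simps)
    also have "\<dots> = (\<Sum>i<K. (A i z)^2) - 2 * G z / real K * (\<Sum>i<K. A i z) + real K * (G z / real K)^2"
      by (simp add: sum.distrib sum_subtractf sum_distrib_left)
    also have "\<dots> = (\<Sum>i<K. (A i z)^2) - (G z)^2 / real K"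
      unfolding SA using K by (simp add: power2_eq_square field_simps)
    finally show ?thesis unfolding 1 .
  qed
  have "(\<Sum>z<E. (\<Sum>i<K. (A i z - G z / real K)^2) / q z) = (\<Sum>x<M. \<Sum>y<M. if f x = f y then k x y else 0) - (\<Sum>x<M. \<Sum>y<M. k x y) / real K"
  proof -
    have "(\<Sum>z<E. (\<Sum>x<M. \<Sum>y<M. if f x = f y then g x z * g y z else 0) / q z) = (\<Sum>x<M. \<Sum>y<M. if f x = f y then k x y else 0)"
    proof -
      have "(\<Sum>z<E. (\<Sum>x<M. \<Sum>y<M. if f x = f y then g x z * g y z else 0) / q z) = (\<Sum>z<E. \<Sum>x<M. \<Sum>y<M. if f x = f y then g x z * g y z / q z else 0)"
        unfolding sum_divide_distrib by (intro sum.cong refl) simp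
      also have "\<dots> = (\<Sum>x<M. \<Sum>y<M. \<Sum>z<E. if f x = f y then g x z * g y z / q z else 0)" by (rule sum_rotate3[symmetric])
      also have "\<dots> = (\<Sum>x<M. \<Sum>y<M. if f x = f y then k x y else 0)"
        unfolding k_def by (intro sum.cong refl) simp
      finally show ?thesis .
    qed
    moreover have "(\<Sum>z<E. (G z)^2 / q z) = (\<Sum>x<M. \<Sum>y<M. k x y)"
      unfolding k_def G_def power2_eq_square sum_product sum_divide_distrib by (rule sum_rotate3[symmetric])
    moreover have "(\<Sum>z<E. (G z)^2 / real K / q z) = (\<Sum>z<E. (G z)^2 / q z) / real K"
      unfolding sum_divide_distrib by (intro sum.cong refl) simp
    ultimately show ?thesis
      unfolding var diff_divide_distrib sum_subtractf by (simp only:)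
  qed
  \<comment> \<open>The mean in the bound on collisions cancels against the subtracted term.\<close>
  also have "\<dots> \<le> (\<Sum>x<M. k x x)" using coll by simp
  also have "\<dots> \<le> (\<Sum>x<M. \<Sum>z<E. g x z * \<beta>)" unfolding k_def
  proof (intro sum_mono)
    fix x z assume "x \<in> {..<M}" "z \<in> {..<E}"
    then have xz: "x < M" "z < E" by auto
    show "g x z * g x z / q z \<le> g x z * \<beta>"
    proof (cases "q z = 0")
      case True
      then show ?thesis using g0[of x z] \<beta> by simp
    next
      case False
      then have "0 < q z" using q0[of z] by simp
      moreover have "g x z \<le> \<beta> * q z" using T[OF xz] \<beta> q0[of z] by (auto simp: g_def mult.commute)
      ultimately have "g x z / q z \<le> \<beta>" by (simp add: divide_le_eq)
      then show ?thesis using g0[of x z] by (metis mult_left_mono times_divide_eq_right)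
    qed
  qed
  also have "\<dots> = \<beta> * (\<Sum>z<E. G z)" unfolding G_def
    by (subst sum.swap) (simp add: sum_distrib_left sum_distrib_right mult.commute)
  also have "\<dots> \<le> \<beta> * 1"
  proof (intro mult_left_mono \<beta>)
    have "(\<Sum>z<E. G z) \<le> (\<Sum>z<E. q z)"
      unfolding qGS using s0 by (intro sum_mono) (auto simp: S_def intro!: sum_nonneg)
    then show "(\<Sum>z<E. G z) \<le> 1" by (simp add: q1)
  qed
  finally have V: "(\<Sum>z<E. (\<Sum>i<K. (A i z - G z / real K)^2) / q z) \<le> \<beta>" by simp
  text \<open>AM-GM with the weights \<open>q z / K\<close>, in place of the Cauchy-Schwarz inequality\<close>
  have amgm: "\<bar>A i z - G z / real K\<bar> \<le> \<theta> / 2 * (q z / real K) + real K / (2 * \<theta>) * ((A i z - G z / real K)^2 / q z)"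
    for i z
  proof (cases "q z = 0")
    case True
    then have "\<forall>x<M. r x z = 0" unfolding q using r by (subst (asm) sum_nonneg_eq_0_iff) auto
    then have "g x z = 0" if "x < M" for x using that by (simp add: g_def)
    then have "A i z = 0" "G z = 0" by (auto simp: A_def G_def intro!: sum.neutral)
    then show ?thesis using True by simp
  next
    case False
    define w where "w = q z / real K"
    have "0 < q z" using False q0[of z] by simp
    then have w: "0 < w" using K by (simp add: w_def)
    define a where "a = \<bar>A i z - G z / real K\<bar>"
    have "0 \<le> (a - \<theta> * w)^2" by simp
    then have "2 * a * (\<theta> * w) \<le> (\<theta> * w)^2 + a^2" by (simp add: power2_diff)
    then have "a \<le> ((\<theta> * w)^2 + a^2) / (2 * (\<theta> * w))" using w \<theta> by (simp add: field_simps)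
    also have "\<dots> = \<theta> / 2 * w + 1 / (2 * \<theta>) * (a^2 / w)" using w \<theta> by (simp add: field_simps power2_eq_square)
    finally show ?thesis using K by (simp add: a_def w_def mult_ac)
  qed
  have D: "(\<Sum>i<K. \<Sum>z<E. \<bar>A i z - G z / real K\<bar>) \<le> \<theta>"
  proof -
    have "(\<Sum>i<K. \<Sum>z<E. \<bar>A i z - G z / real K\<bar>) \<le> (\<Sum>i<K. \<Sum>z<E. \<theta> / 2 * (q z / real K) + real K / (2 * \<theta>) * ((A i z - G z / real K)^2 / q z))"
      by (intro sum_mono amgm)
    also have "\<dots> = (\<Sum>i<K. \<theta> / 2 * ((\<Sum>z<E. q z) / real K)) + real K / (2 * \<theta>) * (\<Sum>i<K. \<Sum>z<E. (A i z - G z / real K)^2 / q z)"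
      by (simp only: sum.distrib sum_distrib_left sum_divide_distrib)
    also have "(\<Sum>i<K. \<theta> / 2 * ((\<Sum>z<E. q z) / real K)) = \<theta> / 2" using K by (simp add: q1)
    also have "(\<Sum>i<K. \<Sum>z<E. (A i z - G z / real K)^2 / q z) = (\<Sum>z<E. (\<Sum>i<K. (A i z - G z / real K)^2) / q z)"
      by (subst sum.swap) (simp add: sum_divide_distrib)
    also have "\<theta> / 2 + real K / (2 * \<theta>) * (\<Sum>z<E. (\<Sum>i<K. (A i z - G z / real K)^2) / q z) \<le> \<theta> / 2 + real K / (2 * \<theta>) * \<beta>"
      using V \<theta> by (intro add_left_mono mult_left_mono) auto
    \<comment> \<open>Here K \<beta> \<le> \<theta>^2 enters; it balances the two halves of the
      AM-GM bound.\<close>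
    also have "real K / (2 * \<theta>) * \<beta> \<le> \<theta> / 2"
      using \<theta> by (simp add: field_simps power2_eq_square)
    finally show ?thesis by simp
  qed
  have "(\<Sum>i<K. \<Sum>z<E. \<bar>(\<Sum>x<M. if f x = i then r x z else 0) - q z / real K\<bar>) \<le>
    (\<Sum>i<K. \<Sum>z<E. \<bar>A i z - G z / real K\<bar> + B i z + S z / real K)"
  proof (intro sum_mono)
    fix i z
    have "(\<Sum>x<M. if f x = i then r x z else 0) = A i z + B i z"
      unfolding A_def B_def sum.distrib[symmetric] by (intro sum.cong refl) (simp add: rgs)
    moreover have "0 \<le> B i z" "0 \<le> S z / real K" using s0 by (auto simp: B_def S_def intro!: sum_nonneg divide_nonneg_nonneg)
    ultimately show "\<bar>(\<Sum>x<M. if f x = i then r x z else 0) - q z / real K\<bar> \<le> \<bar>A i z - G z / real K\<bar> + B i z + S z / real K"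
      unfolding qGS add_divide_distrib by linarith
  qed
  also have "\<dots> = (\<Sum>i<K. \<Sum>z<E. \<bar>A i z - G z / real K\<bar>) + (\<Sum>z<E. S z) + (\<Sum>z<E. S z)"
  proof -
    have "(\<Sum>i<K. \<Sum>z<E. B i z) = (\<Sum>z<E. S z)" by (subst sum.swap) (simp add: SB)
    moreover have "(\<Sum>i<K. \<Sum>z<E. S z / real K) = (\<Sum>z<E. S z)" using K by (simp add: sum_divide_distrib[symmetric])
    ultimately show ?thesis by (simp add: sum.distrib)
  qed
  also have "\<dots> \<le> \<theta> + 2 * (\<Sum>z<E. S z)" using D by simp
  also have "(\<Sum>z<E. S z) = (\<Sum>x<M. \<Sum>z<E. s x z)" unfolding S_def by (rule sum.swap)
  finally show ?thesis using f unfolding s_def by blast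
qed

section \<open>Independent pairs of letters and their deviations\<close>

lemma sum2_digits_Suc:
  fixes g :: "nat \<Rightarrow> nat \<Rightarrow> 'a :: comm_monoid_add"
  shows "(\<Sum>x<N ^ Suc n. \<Sum>z<m ^ Suc n. g x z) = (\<Sum>y<N. \<Sum>w<m. \<Sum>x<N ^ n. \<Sum>z<m ^ n. g (y * N ^ n + x) (w * m ^ n + z))"
  unfolding sum_digits_Suc by (rule sum.cong[OF refl], rule sum.swap)

lemma sum2_prod_digits:
  fixes F :: "nat \<Rightarrow> nat \<Rightarrow> nat \<Rightarrow> 'a :: comm_semiring_1"
  shows "(\<Sum>x<N ^ n. \<Sum>z<m ^ n. \<Prod>t<n. F t (digit N x t) (digit m z t)) = (\<Prod>t<n. \<Sum>y<N. \<Sum>w<m. F t y w)"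
proof -
  have "(\<Sum>z<m ^ n. \<Prod>t<n. F t (digit N x t) (digit m z t)) = (\<Prod>t<n. \<Sum>w<m. F t (digit N x t) w)" for x
    by (rule sum_prod_digits)
  then show ?thesis using sum_prod_digits[of "\<lambda>t y. \<Sum>w<m. F t y w" N n] by simp
qed

text \<open>Variances of independent centred variables add: when a letter is appended, the cross
  term contains the mean of Y and vanishes.\<close>

lemma second_moment_digits:
  fixes w Y :: "nat \<Rightarrow> nat \<Rightarrow> real"
  assumes w1: "(\<Sum>y<N. \<Sum>z<m. w y z) = 1" and Y0: "(\<Sum>y<N. \<Sum>z<m. w y z * Y y z) = 0"
  shows "(\<Sum>x<N ^ n. \<Sum>z<m ^ n. (\<Prod>t<n. w (digit N x t) (digit m z t)) * (\<Sum>t<n. Y (digit N x t) (digit m z t))^2)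
    = real n * (\<Sum>y<N. \<Sum>z<m. w y z * (Y y z)^2)"
proof (induction n)
  case (Suc n)
  define W where "W x z = (\<Prod>t<n. w (digit N x t) (digit m z t))" for x z
  define Z where "Z x z = (\<Sum>t<n. Y (digit N x t) (digit m z t))" for x z
  have W1: "(\<Sum>x<N ^ n. \<Sum>z<m ^ n. W x z) = 1"
    unfolding W_def using sum2_prod_digits[where F="\<lambda>_. w" and N=N and n=n and m=m] w1 by simp
  have "(\<Sum>x<N ^ Suc n. \<Sum>z<m ^ Suc n. (\<Prod>t<Suc n. w (digit N x t) (digit m z t)) * (\<Sum>t<Suc n. Y (digit N x t) (digit m z t))^2)
    = (\<Sum>y<N. \<Sum>u<m. \<Sum>x<N ^ n. \<Sum>z<m ^ n. (W x z * w y u) * (Z x z + Y y u)^2)"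
    unfolding sum2_digits_Suc
  proof (intro sum.cong refl)
    fix y u x z assume "y \<in> {..<N}" "u \<in> {..<m}" "x \<in> {..<N ^ n}" "z \<in> {..<m ^ n}"
    then show "(\<Prod>t<Suc n. w (digit N (y * N ^ n + x) t) (digit m (u * m ^ n + z) t)) * (\<Sum>t<Suc n. Y (digit N (y * N ^ n + x) t) (digit m (u * m ^ n + z) t))^2
      = (W x z * w y u) * (Z x z + Y y u)^2"
      by (simp add: W_def Z_def digit_low digit_high)
  qed
  also have "\<dots> = (\<Sum>y<N. \<Sum>u<m. w y u * (\<Sum>x<N ^ n. \<Sum>z<m ^ n. W x z * (Z x z)^2) + (w y u * Y y u) * (2 * (\<Sum>x<N ^ n. \<Sum>z<m ^ n. W x z * Z x z))
      + (w y u * (Y y u)^2) * (\<Sum>x<N ^ n. \<Sum>z<m ^ n. W x z))"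
    unfolding sum_distrib_left sum.distrib[symmetric]
    by (intro sum.cong refl) (simp add: power2_sum algebra_simps)
  also have "\<dots> = (\<Sum>y<N. \<Sum>u<m. w y u) * (\<Sum>x<N ^ n. \<Sum>z<m ^ n. W x z * (Z x z)^2)
      + (\<Sum>y<N. \<Sum>u<m. w y u * Y y u) * (2 * (\<Sum>x<N ^ n. \<Sum>z<m ^ n. W x z * Z x z))
      + (\<Sum>y<N. \<Sum>u<m. w y u * (Y y u)^2) * (\<Sum>x<N ^ n. \<Sum>z<m ^ n. W x z)"
    by (simp only: sum.distrib sum_distrib_right)
  also have "\<dots> = real n * (\<Sum>y<N. \<Sum>z<m. w y z * (Y y z)^2) + (\<Sum>y<N. \<Sum>z<m. w y z * (Y y z)^2)"
    using Suc by (simp add: w1 Y0 W1) (simp add: W_def Z_def)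
  finally show ?case by (simp add: algebra_simps)
qed simp

lemma chebyshev_digits:
  fixes w Y :: "nat \<Rightarrow> nat \<Rightarrow> real"
  assumes w0: "\<And>y z. 0 \<le> w y z" and w1: "(\<Sum>y<N. \<Sum>z<m. w y z) = 1" and Y0: "(\<Sum>y<N. \<Sum>z<m. w y z * Y y z) = 0"
    and \<delta>: "0 < \<delta>" and n: "0 < n"
  shows "(\<Sum>x<N ^ n. \<Sum>z<m ^ n. if \<bar>\<Sum>t<n. Y (digit N x t) (digit m z t)\<bar> \<le> real n * \<delta> then 0 else (\<Prod>t<n. w (digit N x t) (digit m z t)))
    \<le> (\<Sum>y<N. \<Sum>z<m. w y z * (Y y z)^2) / (real n * \<delta>^2)"
proof -
  define W where "W x z = (\<Prod>t<n. w (digit N x t) (digit m z t))" for x z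
  define Z where "Z x z = (\<Sum>t<n. Y (digit N x t) (digit m z t))" for x z
  have W0: "0 \<le> W x z" for x z unfolding W_def using w0 by (intro prod_nonneg) auto
  have nd: "0 < (real n * \<delta>)^2" using \<delta> n by simp
  have "(\<Sum>x<N ^ n. \<Sum>z<m ^ n. if \<bar>Z x z\<bar> \<le> real n * \<delta> then 0 else W x z) \<le> (\<Sum>x<N ^ n. \<Sum>z<m ^ n. W x z * (Z x z)^2 / (real n * \<delta>)^2)"
  proof (intro sum_mono)
    fix x z
    show "(if \<bar>Z x z\<bar> \<le> real n * \<delta> then 0 else W x z) \<le> W x z * (Z x z)^2 / (real n * \<delta>)^2"
    proof (cases "\<bar>Z x z\<bar> \<le> real n * \<delta>")
      case True
      then show ?thesis using W0[of x z] by simp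
    next
      case False
      then have "(real n * \<delta>)^2 \<le> \<bar>Z x z\<bar>^2" using \<delta> by (intro power_mono) auto
      then have "W x z * (real n * \<delta>)^2 \<le> W x z * (Z x z)^2" using W0 by (intro mult_left_mono) auto
      then show ?thesis using False nd by (simp add: le_divide_eq)
    qed
  qed
  also have "\<dots> = (\<Sum>x<N ^ n. \<Sum>z<m ^ n. W x z * (Z x z)^2) / (real n * \<delta>)^2" by (simp add: sum_divide_distrib)
  also have "\<dots> = real n * (\<Sum>y<N. \<Sum>z<m. w y z * (Y y z)^2) / (real n * \<delta>)^2"
    unfolding W_def Z_def second_moment_digits[OF w1 Y0] ..
  also have "\<dots> = (\<Sum>y<N. \<Sum>z<m. w y z * (Y y z)^2) / (real n * \<delta>^2)"
    using n by (simp add: power2_eq_square)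
  finally show ?thesis unfolding W_def Z_def .
qed

section \<open>Classical states of Eve as diagonal matrices\<close>

definition cdiag :: "nat \<Rightarrow> (nat \<Rightarrow> real) \<Rightarrow> cmat" where
  "cdiag m p = mat m m (\<lambda>(z, z'). if z = z' then complex_of_real (p z) else 0)"

lemma cdiag_carrier[simp]: "cdiag m p \<in> carrier_mat m m" by (simp add: cdiag_def)

lemma cdiag_index: "z < m \<Longrightarrow> z' < m \<Longrightarrow> cdiag m p $$ (z, z') = (if z = z' then complex_of_real (p z) else 0)"
  by (simp add: cdiag_def)

lemma qform_cdiag: "qform m (cdiag m p) v = of_real (\<Sum>z<m. p z * (norm (v z))^2)"
proof -
  have "qform m (cdiag m p) v = (\<Sum>z<m. of_real (p z) * (v z * cnj (v z)))"
    unfolding qform_def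
    by (rule sum.cong[OF refl], subst sum_one_support) (auto simp: cdiag_index mult_ac)
  then show ?thesis unfolding of_real_sum of_real_mult complex_norm_square .
qed

lemma psd_cdiag: "(\<And>z. z < m \<Longrightarrow> 0 \<le> p z) \<Longrightarrow> psd m (cdiag m p)"
  by (auto simp: psd_qform qform_cdiag less_eq_complex_def intro!: sum_nonneg)

lemma trace_cdiag: "mat_trace (cdiag m p) = of_real (\<Sum>z<m. p z)"
  by (simp add: mat_trace_def cdiag_def)

lemma mtr_cdiag: "mtr m (cdiag m p) (cdiag m p') = of_real (\<Sum>z<m. p z * p' z)"
proof -
  have "mtr m (cdiag m p) (cdiag m p') = (\<Sum>z<m. of_real (p z * p' z))"
    unfolding mtr_def
    by (rule sum.cong[OF refl], subst sum_one_support) (auto simp: cdiag_index)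
  then show ?thesis by simp
qed

lemma density_cdiag: "(\<And>z. z < m \<Longrightarrow> 0 \<le> p z) \<Longrightarrow> (\<Sum>z<m. p z) = 1 \<Longrightarrow> density m (cdiag m p)"
  by (simp add: density_def psd_cdiag trace_cdiag)

lemma tmat_cdiag: "tmat m n (\<lambda>t. cdiag m (p t)) = cdiag (m ^ n) (\<lambda>z. \<Prod>t<n. p t (digit m z t))"
proof (rule eq_matI)
  fix z z' assume "z < dim_row (cdiag (m ^ n) (\<lambda>z. \<Prod>t<n. p t (digit m z t)))" "z' < dim_col (cdiag (m ^ n) (\<lambda>z. \<Prod>t<n. p t (digit m z t)))"
  then have z: "z < m ^ n" "z' < m ^ n" by (auto simp: cdiag_def)
  have "tmat m n (\<lambda>t. cdiag m (p t)) $$ (z, z') = (\<Prod>t<n. if digit m z t = digit m z' t then complex_of_real (p t (digit m z t)) else 0)"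
    unfolding tmat_def using z by (simp, intro prod.cong refl) (simp add: cdiag_index digit_less)
  also have "\<dots> = (if z = z' then complex_of_real (\<Prod>t<n. p t (digit m z t)) else 0)"
  proof (cases "z = z'")
    case False
    then obtain t where "t < n" "digit m z t \<noteq> digit m z' t" using digits_eqI[OF z] by blast
    then have "(\<Prod>t<n. if digit m z t = digit m z' t then complex_of_real (p t (digit m z t)) else 0) = 0"
      by (intro prod_zero) auto
    then show ?thesis using False by simp
  qed simp
  finally show "tmat m n (\<lambda>t. cdiag m (p t)) $$ (z, z') = cdiag (m ^ n) (\<lambda>z. \<Prod>t<n. p t (digit m z t)) $$ (z, z')"
    using z by (simp add: cdiag_index)
qed (simp_all add: tmat_def cdiag_def)

text \<open>Both states are diagonal and supported on equal key values, so the trace distance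
  becomes a variation distance over key and side information.\<close>

lemma tdist_relabeled_cdiag:
  assumes K: "K = 2 ^ l" and N: "0 < N"
  shows "tdist (K * K * e) (relabeled N K e f (\<lambda>x. cdiag e (p x))) (key_state (K, K, e) l (cdiag e q))
    = (\<Sum>i<K. \<Sum>z<e. \<bar>(\<Sum>x<N. if f x = i then p x z / real N else 0) - q z / real K\<bar>) / 2"
proof -
  define g where "g i z = (\<Sum>x<N. if f x = i then p x z / real N else 0) - q z / real K" for i z
  define h where "h s = (if s div e div K = s div e mod K then g (s div e div K) (s mod e) else 0)" for s
  have kc: "key_state (K, K, e) l (cdiag e q) \<in> carrier_mat (K * K * e) (K * K * e)"
    unfolding key_state_eq by simp
  have hi: "h ((i * K + j) * e + u) = (if i = j then g i u else 0)" if "i < K" "j < K" "u < e" for i j u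
    using that by (simp add: h_def)
  have "relabeled N K e f (\<lambda>x. cdiag e (p x)) - key_state (K, K, e) l (cdiag e q)
    = mat (K * K * e) (K * K * e) (\<lambda>(s, s'). if s = s' then complex_of_real (h s) else 0)" (is "_ = ?M")
  proof (rule eq_mat_kronI[where a="K * K" and b=e and a'="K * K" and b'=e])
    fix ij u ij' u' assume a: "ij < K * K" "u < e" "ij' < K * K" "u' < e"
    then obtain i j i' j' where ij: "i < K" "j < K" "ij = i * K + j" "i' < K" "j' < K" "ij' = i' * K + j'"
      by (metis less_mult_cases)
    note u = a(2,4)
    let ?r = "(i * K + j) * e + u" and ?s = "(i' * K + j') * e + u'"
    have rs: "?r < K * K * e" "?s < K * K * e" using ij u by (auto intro!: mult_add_less)
    have eq: "?r = ?s \<longleftrightarrow> i = i' \<and> j = j' \<and> u = u'" using ij u by (metis div_mod_add)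
    have r1: "relabeled N K e f (\<lambda>x. cdiag e (p x)) $$ (?r, ?s) = (if i = i' \<and> j = j' \<and> i = j then complex_of_real (1 / real N) * (\<Sum>x<N. if f x = i then cdiag e (p x) $$ (u, u') else 0) else 0)"
      by (rule relabeled_index) (use ij u in auto)
    have r2: "key_state (K, K, e) l (cdiag e q) $$ (?r, ?s) = (if i = i' \<and> j = j' \<and> i = j then complex_of_real (1 / real K) * cdiag e q $$ (u, u') else 0)"
      by (rule key_state_index[OF _ K]) (use ij u in auto)
    have s1: "complex_of_real (1 / real N) * (\<Sum>x<N. if f x = i then cdiag e (p x) $$ (u, u') else 0) = (if u = u' then complex_of_real (\<Sum>x<N. if f x = i then p x u / real N else 0) else 0)"
      unfolding sum_distrib_left of_real_sum using u
      by (auto simp: cdiag_index intro!: sum.cong sum.neutral)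
    have s2: "complex_of_real (1 / real K) * cdiag e q $$ (u, u') = (if u = u' then complex_of_real (q u / real K) else 0)"
      using u by (simp add: cdiag_index)
    have "(relabeled N K e f (\<lambda>x. cdiag e (p x)) - key_state (K, K, e) l (cdiag e q)) $$ (?r, ?s)
      = relabeled N K e f (\<lambda>x. cdiag e (p x)) $$ (?r, ?s) - key_state (K, K, e) l (cdiag e q) $$ (?r, ?s)"
      using rs carrier_matD[OF kc] by (intro index_minus_mat(1)) (simp_all del: key_state.simps)
    also have "\<dots> = (if ?r = ?s then complex_of_real (h ?r) else 0)"
      unfolding r1 r2 s1 s2 eq hi[OF ij(1,2) u(1)] g_def by auto
    finally show "(relabeled N K e f (\<lambda>x. cdiag e (p x)) - key_state (K, K, e) l (cdiag e q)) $$ (ij * e + u, ij' * e + u') = ?M $$ (ij * e + u, ij' * e + u')"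
      unfolding ij using rs by simp
  qed (use kc in auto)
  then have "tdist (K * K * e) (relabeled N K e f (\<lambda>x. cdiag e (p x))) (key_state (K, K, e) l (cdiag e q)) = (\<Sum>s<K * K * e. \<bar>h s\<bar>) / 2"
    by (rule tdist_diag)
  also have "(\<Sum>s<K * K * e. \<bar>h s\<bar>) = (\<Sum>i<K. \<Sum>j<K. \<Sum>u<e. if j = i then \<bar>g i u\<bar> else 0)"
    unfolding sum_lessThan_mult by (intro sum.cong refl) (auto simp: hi)
  also have "\<dots> = (\<Sum>i<K. \<Sum>u<e. \<bar>g i u\<bar>)"
    by (rule sum.cong[OF refl], subst sum_one_support) auto
  finally show ?thesis unfolding g_def .
qed

text \<open>r is the joint distribution and q that of Eve's outcome, so H is H(X|Z). A string
  typical with Eve's data has conditional probability close to 2^(-n H). For the converse this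
  bounds the number of candidates she must consider; for the hash lemma it bounds each single one of
  them.\<close>

theorem key_rate_classical:
  fixes P :: "nat \<Rightarrow> nat \<Rightarrow> real"
  assumes N: "0 < N" and v: "onb N v" and P0: "\<And>y z. 0 \<le> P y z" and P1: "\<And>y. y < N \<Longrightarrow> (\<Sum>z<m. P y z) = 1"
    and r: "\<And>y z. r y z = P y z / real N" and q: "\<And>z. q z = (\<Sum>y<N. r y z)"
    and H: "H = (\<Sum>y<N. \<Sum>z<m. r y z * log 2 (q z / r y z))" and Hpos: "0 < H"
  shows "key_rate (N, N, m) (cq_state N m v (\<lambda>y. cdiag m (P y))) = ereal H"
proof (rule antisym)
  have r0: "0 \<le> r y z" for y z using P0 by (simp add: r)
  have r1: "(\<Sum>y<N. \<Sum>z<m. r y z) = 1"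
    using P1 N by (simp add: r sum_divide_distrib[symmetric])
  have qpos: "0 < q z" if "0 < r y z" "y < N" for y z
  proof -
    have "r y z \<le> q z" unfolding q using r0 that by (intro member_le_sum) auto
    then show ?thesis using that by simp
  qed
  \<comment> \<open>The centred conditional surprisal. At r y z = 0 it has the junk value -H, since
    division by 0 and log of 0 both give 0; such pairs have weight 0 in every moment.\<close>
  define Y where "Y y z = log 2 (q z / r y z) - H" for y z
  have Y0: "(\<Sum>y<N. \<Sum>z<m. r y z * Y y z) = 0"
    by (simp add: Y_def right_diff_distrib sum_subtractf H[symmetric] sum_distrib_right[symmetric] r1)
  define V where "V = (\<Sum>y<N. \<Sum>z<m. r y z * (Y y z)^2)"
  have V0: "0 \<le> V" unfolding V_def using r0 by (intro sum_nonneg mult_nonneg_nonneg) auto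
  define rn where "rn n x z = (\<Prod>t<n. r (digit N x t) (digit m z t))" for n x z
  define qn where "qn n z = (\<Prod>t<n. q (digit m z t))" for n z
  define Z where "Z n x z = (\<Sum>t<n. Y (digit N x t) (digit m z t))" for n x z
  have rn0: "0 \<le> rn n x z" for n x z unfolding rn_def using r0 by (intro prod_nonneg) auto
  have qn_sum: "qn n z = (\<Sum>x<N ^ n. rn n x z)" for n z
    unfolding qn_def rn_def q using sum_prod_digits[of "\<lambda>t y. r y (digit m z t)" N n] by simp
  have rn1: "(\<Sum>x<N ^ n. \<Sum>z<m ^ n. rn n x z) = 1" for n
    unfolding rn_def using sum2_prod_digits[where F="\<lambda>_. r" and N=N and n=n and m=m] r1 by simp
  have qn1: "(\<Sum>z<m ^ n. qn n z) = 1" for n unfolding qn_sum by (subst sum.swap) (rule rn1)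
  have qn0: "0 \<le> qn n z" for n z unfolding qn_sum using rn0 by (intro sum_nonneg)
  have tmat: "tmat m n (\<lambda>t. cdiag m (P (digit N x t))) = cdiag (m ^ n) (\<lambda>z. \<Prod>t<n. P (digit N x t) (digit m z t))" for n x
    by (rule tmat_cdiag)
  have rnP: "(\<Prod>t<n. P (digit N x t) (digit m z t)) / real (N ^ n) = rn n x z" for n x z
    unfolding rn_def r prod_dividef by simp
  \<comment> \<open>A string pair of positive probability consists of letter pairs with r > 0, for
    which Y has its genuine value.\<close>
  have ratio: "qn n z = rn n x z * 2 powr (real n * H + Z n x z)" if x: "x < N ^ n" and pos: "0 < rn n x z" for n x z
  proof -
    have f: "q (digit m z t) = r (digit N x t) (digit m z t) * 2 powr (H + Y (digit N x t) (digit m z t))" if t: "t < n" for t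
    proof -
      have "r (digit N x t) (digit m z t) \<noteq> 0" using pos t unfolding rn_def by (metis finite_lessThan lessThan_iff less_irrefl prod_zero)
      then have rp: "0 < r (digit N x t) (digit m z t)" using r0[of "digit N x t" "digit m z t"] by simp
      have "digit N x t < N" by (rule digit_less[OF x t])
      then have "0 < q (digit m z t)" using qpos[OF rp] by simp
      then show ?thesis using rp by (simp add: Y_def)
    qed
    have "qn n z = (\<Prod>t<n. r (digit N x t) (digit m z t) * 2 powr (H + Y (digit N x t) (digit m z t)))"
      unfolding qn_def by (intro prod.cong refl f) simp
    also have "\<dots> = rn n x z * (\<Prod>t<n. 2 powr (H + Y (digit N x t) (digit m z t)))" by (simp add: rn_def prod.distrib)
    also have "(\<Prod>t<n. 2 powr (H + Y (digit N x t) (digit m z t))) = 2 powr (\<Sum>t<n. H + Y (digit N x t) (digit m z t))"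
      by (rule powr_sum[symmetric]) auto
    finally show ?thesis by (simp add: Z_def sum.distrib)
  qed
  have cheb: "(\<Sum>x<N ^ n. \<Sum>z<m ^ n. if \<bar>Z n x z\<bar> \<le> real n * \<delta> then 0 else rn n x z) \<le> V / (real n * \<delta>^2)"
    if "0 < \<delta>" "0 < n" for n \<delta>
    unfolding Z_def rn_def V_def by (rule chebyshev_digits[OF r0 r1 Y0 that])
  have \<omega>: "cdiag m (P y) \<in> carrier_mat m m" for y by simp
  have Vlim: "(\<lambda>n. V / (real n * \<delta>^2)) \<longlonglongrightarrow> 0" if "0 < \<delta>" for \<delta>
    using that by real_asymp
  show "key_rate (N, N, m) (cq_state N m v (\<lambda>y. cdiag m (P y))) \<le> ereal H"
  proof (rule key_rate_le[OF N v \<omega>])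
    fix n x assume x: "x < N ^ n"
    show "density (m ^ n) (tmat m n (\<lambda>t. cdiag m (P (digit N x t))))" unfolding tmat
    proof (rule density_cdiag)
      show "0 \<le> (\<Prod>t<n. P (digit N x t) (digit m z t))" for z using P0 by (intro prod_nonneg) auto
      have "(\<Sum>z<m ^ n. \<Prod>t<n. P (digit N x t) (digit m z t)) = (\<Prod>t<n. \<Sum>w<m. P (digit N x t) w)"
        by (rule sum_prod_digits)
      also have "\<dots> = 1" by (rule prod.neutral) (use P1 digit_less[OF x] in auto)
      finally show "(\<Sum>z<m ^ n. \<Prod>t<n. P (digit N x t) (digit m z t)) = 1" .
    qed
  next
    fix \<delta> :: real assume \<delta>: "0 < \<delta>"
    have "\<forall>\<^sub>F n in sequentially. V / (real n * \<delta>^2) < 1 / 4" using Vlim[OF \<delta>] by (rule order_tendstoD) simp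
    moreover have "\<forall>\<^sub>F n in sequentially. 0 < (n::nat)" by (rule eventually_gt_at_top)
    ultimately show "\<forall>\<^sub>F n in sequentially. guess_bound (N ^ n) (m ^ n) (\<lambda>x. tmat m n (\<lambda>t. cdiag m (P (digit N x t)))) (2 powr (real n * (H + \<delta>))) (1 / 4)"
    proof eventually_elim
      case (elim n)
      \<comment> \<open>Positivity is part of typicality: the junk value of Y could otherwise admit
        pairs of probability 0, which escape the count below.\<close>
      define T where "T x z \<longleftrightarrow> \<bar>Z n x z\<bar> \<le> real n * \<delta> \<and> 0 < rn n x z" for x z
      define Q where "Q x = cdiag (m ^ n) (\<lambda>z. if T x z then 1 else 0)" for x
      show ?case unfolding guess_bound_def tmat
      proof (intro exI[of _ Q] conjI allI impI)
        fix x
        show "psd (m ^ n) (Q x)" unfolding Q_def by (rule psd_cdiag) simp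
        fix w
        show "Re (qform (m ^ n) (Q x) w) \<le> (\<Sum>i<m ^ n. (norm (w i))^2)"
          unfolding Q_def qform_cdiag by (simp, intro sum_mono) simp
      next
        fix w
        \<comment> \<open>Given z, each typical x has conditional probability at least 2^(-n (H +
          \<delta>)), and these probabilities sum to at most 1.\<close>
        have cnt: "(\<Sum>x<N ^ n. if T x z then 1 else 0) \<le> 2 powr (real n * (H + \<delta>))" for z
        proof (cases "qn n z = 0")
          case True
          then have "\<forall>x<N ^ n. rn n x z = 0" unfolding qn_sum using rn0 by (subst (asm) sum_nonneg_eq_0_iff) auto
          then have "(\<Sum>x<N ^ n. if T x z then 1 else 0 :: real) = 0" by (intro sum.neutral) (auto simp: T_def)
          then show ?thesis by simp
        next
          case False
          then have qp: "0 < qn n z" using qn0[of n z] by simp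
          have "(\<Sum>x<N ^ n. if T x z then 1 else 0) \<le> (\<Sum>x<N ^ n. rn n x z * 2 powr (real n * (H + \<delta>)) / qn n z)"
          proof (intro sum_mono)
            fix x assume "x \<in> {..<N ^ n}"
            then have x: "x < N ^ n" by simp
            show "(if T x z then 1 else 0) \<le> rn n x z * 2 powr (real n * (H + \<delta>)) / qn n z"
            proof (cases "T x z")
              case True
              then have "Z n x z \<le> real n * \<delta>" unfolding T_def by linarith
              then have "real n * H + Z n x z \<le> real n * (H + \<delta>)" by (simp add: algebra_simps)
              then have "qn n z \<le> rn n x z * 2 powr (real n * (H + \<delta>))"
                using ratio[OF x, of z] True rn0[of n x z] by (auto simp: T_def intro!: mult_left_mono)
              then show ?thesis using True qp by (simp add: le_divide_eq)
            qed (use rn0 qp in \<open>simp add: divide_nonneg_nonneg\<close>)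
          qed
          also have "\<dots> = (\<Sum>x<N ^ n. rn n x z) * 2 powr (real n * (H + \<delta>)) / qn n z"
            by (simp add: sum_distrib_right sum_divide_distrib)
          also have "\<dots> = 2 powr (real n * (H + \<delta>))" using qp by (simp add: qn_sum[symmetric])
          finally show ?thesis .
        qed
        have "(\<Sum>x<N ^ n. Re (qform (m ^ n) (Q x) w)) = (\<Sum>z<m ^ n. (\<Sum>x<N ^ n. if T x z then 1 else 0) * (norm (w z))^2)"
          unfolding Q_def qform_cdiag sum_distrib_right by (subst sum.swap) simp
        also have "\<dots> \<le> (\<Sum>z<m ^ n. 2 powr (real n * (H + \<delta>)) * (norm (w z))^2)"
          by (intro sum_mono mult_right_mono cnt) simp
        finally show "(\<Sum>x<N ^ n. Re (qform (m ^ n) (Q x) w)) \<le> 2 powr (real n * (H + \<delta>)) * (\<Sum>i<m ^ n. (norm (w i))^2)"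
          by (simp add: sum_distrib_left)
      next
        have "(\<Sum>x<N ^ n. Re (mtr (m ^ n) (Q x) (cdiag (m ^ n) (\<lambda>z. \<Prod>t<n. P (digit N x t) (digit m z t))))) / real (N ^ n)
          = (\<Sum>x<N ^ n. \<Sum>z<m ^ n. if T x z then rn n x z else 0)"
          unfolding Q_def mtr_cdiag sum_divide_distrib Re_complex_of_real
          by (intro sum.cong refl) (simp only: rnP[symmetric] times_divide_eq_right[symmetric], auto)
        also have "\<dots> \<ge> 1 - 1 / 4"
        proof -
          have "(\<Sum>x<N ^ n. \<Sum>z<m ^ n. if T x z then rn n x z else 0) + (\<Sum>x<N ^ n. \<Sum>z<m ^ n. if \<bar>Z n x z\<bar> \<le> real n * \<delta> then 0 else rn n x z)
            = (\<Sum>x<N ^ n. \<Sum>z<m ^ n. rn n x z)"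
            unfolding sum.distrib[symmetric]
          proof (intro sum.cong refl)
            fix x z
            have "rn n x z = 0" if "\<not> 0 < rn n x z" using rn0[of n x z] that by simp
            then show "(if T x z then rn n x z else 0) + (if \<bar>Z n x z\<bar> \<le> real n * \<delta> then 0 else rn n x z) = rn n x z"
              by (auto simp: T_def)
          qed
          then show ?thesis using cheb[OF \<delta> elim(2)] elim(1) unfolding rn1 by linarith
        qed
        finally show "1 - 1 / 4 \<le> (\<Sum>x<N ^ n. Re (mtr (m ^ n) (Q x) (cdiag (m ^ n) (\<lambda>z. \<Prod>t<n. P (digit N x t) (digit m z t))))) / real (N ^ n)" .
      qed
    qed
  qed
  have lower: "ereal (H - 2 * \<delta>) \<le> key_rate (N, N, m) (cq_state N m v (\<lambda>y. cdiag m (P y)))" if \<delta>: "0 < \<delta>" "2 * \<delta> < H" for \<delta>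
  proof -
    \<comment> \<open>As 2 \<delta> < H the argument is nonnegative, so \<open>nat\<close> truncates
      nothing.\<close>
    define l where "l n = nat \<lfloor>real n * (H - 2 * \<delta>)\<rfloor>" for n :: nat
    have lle: "real (l n) \<le> real n * (H - 2 * \<delta>)" and lge: "real n * (H - 2 * \<delta>) - 1 \<le> real (l n)" for n
      using \<delta> by (auto simp: l_def)
    \<comment> \<open>Of the 2 \<delta> given up in the rate, typicality takes one: it lets \<beta>
      be 2^(-n (H - \<delta>)). The other makes K \<beta> at most 2^(-n \<delta>), the square of
      this \<theta>.\<close>
    define \<theta> where "\<theta> n = 2 powr (- (real n * \<delta> / 2))" for n :: nat
    have "\<exists>f. (\<forall>x. f x < (2::nat) ^ l n) \<and>
      (\<Sum>i<2 ^ l n. \<Sum>z<m ^ n. \<bar>(\<Sum>x<N ^ n. if f x = i then rn n x z else 0) - qn n z / real (2 ^ l n)\<bar>)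
        \<le> \<theta> n + 2 * (\<Sum>x<N ^ n. \<Sum>z<m ^ n. if \<bar>Z n x z\<bar> \<le> real n * \<delta> then 0 else rn n x z)" for n
    proof (rule hash_distance[OF rn0 qn_sum qn1, where \<beta>="2 powr (- (real n * (H - \<delta>)))" and T="\<lambda>x z. \<bar>Z n x z\<bar> \<le> real n * \<delta>"])
      fix x z assume x: "x < N ^ n" and T: "\<bar>Z n x z\<bar> \<le> real n * \<delta>"
      show "rn n x z \<le> qn n z * 2 powr (- (real n * (H - \<delta>)))"
      proof (cases "rn n x z = 0")
        case False
        then have pos: "0 < rn n x z" using rn0[of n x z] by simp
        have "rn n x z * 1 \<le> rn n x z * 2 powr (real n * H + Z n x z + - (real n * (H - \<delta>)))"
          using T rn0 by (intro mult_left_mono ge_one_powr_ge_zero) (auto simp: algebra_simps)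
        then show ?thesis unfolding ratio[OF x pos] by (simp add: powr_add[symmetric] mult.assoc)
      qed (use qn0 in simp)
    next
      have "real (2 ^ l n) = 2 powr real (l n)" by (simp add: powr_realpow)
      then have "real (2 ^ l n) * 2 powr (- (real n * (H - \<delta>))) = 2 powr (real (l n) + - (real n * (H - \<delta>)))"
        by (simp only: powr_add)
      also have "\<dots> \<le> 2 powr (- (real n * \<delta>))" using lle[of n] by (intro powr_mono) (auto simp: algebra_simps)
      also have "\<dots> = (\<theta> n)^2" unfolding \<theta>_def power2_eq_square by (simp add: powr_add[symmetric] mult.commute)
      finally show "real (2 ^ l n) * 2 powr (- (real n * (H - \<delta>))) \<le> (\<theta> n)^2" .
    qed (simp_all add: \<theta>_def)
    note exf = this
    obtain f where ff: "\<forall>n. (\<forall>x. f n x < (2::nat) ^ l n) \<and>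
      (\<Sum>i<2 ^ l n. \<Sum>z<m ^ n. \<bar>(\<Sum>x<N ^ n. if f n x = i then rn n x z else 0) - qn n z / real (2 ^ l n)\<bar>)
        \<le> \<theta> n + 2 * (\<Sum>x<N ^ n. \<Sum>z<m ^ n. if \<bar>Z n x z\<bar> \<le> real n * \<delta> then 0 else rn n x z)"
      using choice[OF allI[OF exf]] ..
    have f: "f n x < 2 ^ l n" for n x
      by (rule conjunct1[OF ff[THEN spec], THEN spec])
    have fd: "(\<Sum>i<2 ^ l n. \<Sum>z<m ^ n. \<bar>(\<Sum>x<N ^ n. if f n x = i then rn n x z else 0) - qn n z / real (2 ^ l n)\<bar>)
        \<le> \<theta> n + 2 * (\<Sum>x<N ^ n. \<Sum>z<m ^ n. if \<bar>Z n x z\<bar> \<le> real n * \<delta> then 0 else rn n x z)" for n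
      by (rule conjunct2[OF ff[THEN spec]])
    define td where "td n = tdist (2 ^ l n * 2 ^ l n * m ^ n)
       (relabeled (N ^ n) (2 ^ l n) (m ^ n) (f n) (\<lambda>x. tmat m n (\<lambda>t. cdiag m (P (digit N x t)))))
       (key_state (2 ^ l n, 2 ^ l n, m ^ n) (l n) (cdiag (m ^ n) (qn n)))" for n
    have td: "td n = (\<Sum>i<2 ^ l n. \<Sum>z<m ^ n. \<bar>(\<Sum>x<N ^ n. if f n x = i then rn n x z else 0) - qn n z / real (2 ^ l n)\<bar>) / 2" for n
      unfolding td_def tmat using N by (subst tdist_relabeled_cdiag[OF refl]) (simp_all only: rnP zero_less_power)
    have "td \<longlonglongrightarrow> 0"
    proof (rule tendsto_sandwich)
      show "\<forall>\<^sub>F n in sequentially. 0 \<le> td n" unfolding td by (intro always_eventually allI) (simp add: sum_nonneg)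
      show "\<forall>\<^sub>F n in sequentially. td n \<le> \<theta> n / 2 + V / (real n * \<delta>^2)"
        using eventually_gt_at_top[of 0]
      proof eventually_elim
        case (elim n)
        show ?case using fd[of n] cheb[OF \<delta>(1) elim] unfolding td by linarith
      qed
      have "\<theta> \<longlonglongrightarrow> 0" unfolding \<theta>_def using \<delta>(1) by real_asymp
      then have "(\<lambda>n. \<theta> n / 2 + V / (real n * \<delta>^2)) \<longlonglongrightarrow> 0 / 2 + 0" by (intro tendsto_intros Vlim \<delta>(1)) auto
      then show "(\<lambda>n. \<theta> n / 2 + V / (real n * \<delta>^2)) \<longlonglongrightarrow> 0" by simp
    qed simp
    moreover have "(\<lambda>n. real (l n) / real n) \<longlonglongrightarrow> H - 2 * \<delta>"
    proof (rule tendsto_sandwich)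
      show "\<forall>\<^sub>F n in sequentially. H - 2 * \<delta> - 1 / real n \<le> real (l n) / real n"
        using eventually_gt_at_top[of 0]
      proof eventually_elim
        case (elim n)
        have "H - 2 * \<delta> - 1 / real n = (real n * (H - 2 * \<delta>) - 1) / real n" using elim by (simp add: field_simps)
        also have "\<dots> \<le> real (l n) / real n" by (rule divide_right_mono[OF lge]) simp
        finally show ?case .
      qed
      show "\<forall>\<^sub>F n in sequentially. real (l n) / real n \<le> H - 2 * \<delta>"
        using eventually_gt_at_top[of 0]
      proof eventually_elim
        case (elim n)
        have "real (l n) / real n \<le> real n * (H - 2 * \<delta>) / real n" by (rule divide_right_mono[OF lle]) simp
        then show ?case using elim by simp
      qed
      show "(\<lambda>n. H - 2 * \<delta> - 1 / real n) \<longlonglongrightarrow> H - 2 * \<delta>" by real_asymp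
    qed simp
    ultimately show ?thesis unfolding td_def[abs_def]
      by (intro key_rate_ge[OF v \<omega>, where f=f and \<tau>="\<lambda>n. cdiag (m ^ n) (qn n)"]) (use f qn0 qn1 in \<open>auto intro!: density_cdiag simp del: key_state.simps\<close>)
  qed
  show "ereal H \<le> key_rate (N, N, m) (cq_state N m v (\<lambda>y. cdiag m (P y)))"
  proof (rule ereal_le_epsilon2)
    fix \<epsilon> :: real assume \<epsilon>: "0 < \<epsilon>"
    \<comment> \<open>The first entry keeps the loss 2 \<delta> within \<epsilon>, the second keeps
      2 \<delta> below H.\<close>
    define \<delta> where "\<delta> = min (\<epsilon> / 2) (H / 4)"
    have "0 < \<delta>" "2 * \<delta> < H" "2 * \<delta> \<le> \<epsilon>" using \<epsilon> Hpos by (auto simp: \<delta>_def)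
    have "ereal H \<le> ereal (H - 2 * \<delta>) + ereal \<epsilon>" using \<open>2 * \<delta> \<le> \<epsilon>\<close> by simp
    also have "\<dots> \<le> key_rate (N, N, m) (cq_state N m v (\<lambda>y. cdiag m (P y))) + ereal \<epsilon>"
      by (intro add_right_mono lower) fact+
    finally show "ereal H \<le> key_rate (N, N, m) (cq_state N m v (\<lambda>y. cdiag m (P y))) + ereal \<epsilon>" .
  qed
qed

section \<open>Entropy of classical-classical states\<close>

lemma linear_ptrace: "linear_map (p * m * q) (p * q) (ptrace p m q)"
proof -
  have "linear_map m 1 (\<lambda>Y. mat 1 1 (\<lambda>_. mat_trace Y))"
    unfolding linear_map_def mat_trace_def
    by (auto simp: sum.distrib sum_distrib_left intro!: eq_matI)
  from linear_local_map[OF this, of p q] show ?thesis by (simp add: ptrace_def[abs_def])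
qed

lemma ptrace_kron:
  assumes A: "A \<in> carrier_mat p p" and B: "B \<in> carrier_mat m m" and C: "C \<in> carrier_mat q q" and t: "mat_trace B = 1"
  shows "ptrace p m q (A \<otimes>\<^sub>m B \<otimes>\<^sub>m C) = A \<otimes>\<^sub>m C"
proof -
  have l: "linear_map m 1 (\<lambda>Y. mat 1 1 (\<lambda>_. mat_trace Y))"
    unfolding linear_map_def mat_trace_def
    by (auto simp: sum.distrib sum_distrib_left intro!: eq_matI)
  have "mat 1 1 (\<lambda>_. mat_trace B) = 1\<^sub>m 1" by (intro eq_matI) (auto simp: t)
  then show ?thesis unfolding ptrace_def local_map_kron[OF l A B C] by (simp only: kron_one_right[OF A])
qed

lemma linear_map_weighted_sum:
  assumes l: "linear_map m n \<Lambda>" and "finite I" and c: "\<And>k. k \<in> I \<Longrightarrow> F k \<in> carrier_mat m m"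
    and F: "\<And>k. k \<in> I \<Longrightarrow> \<Lambda> (F k) = G k"
  shows "\<Lambda> (mat_sum m I (\<lambda>k. c \<cdot>\<^sub>m F k)) = mat_sum n I (\<lambda>k. c \<cdot>\<^sub>m G k)"
proof -
  have "\<Lambda> (mat_sum m I (\<lambda>k. c \<cdot>\<^sub>m F k)) = mat_sum n I (\<lambda>k. \<Lambda> (c \<cdot>\<^sub>m F k))"
    by (rule linear_map_mat_sum[OF l assms(2)]) (use c in auto)
  also have "\<dots> = mat_sum n I (\<lambda>k. c \<cdot>\<^sub>m G k)"
  proof (rule mat_sum_cong)
    fix k assume k: "k \<in> I"
    then have "\<Lambda> (c \<cdot>\<^sub>m F k) = c \<cdot>\<^sub>m \<Lambda> (F k)" using l c[OF k] unfolding linear_map_def by blast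
    then show "\<Lambda> (c \<cdot>\<^sub>m F k) = c \<cdot>\<^sub>m G k" by (simp only: F[OF k])
  qed
  finally show ?thesis .
qed

section \<open>Eigenvalue multiplicities and the von Neumann entropy\<close>

lemma order_prod_linear:
  fixes L :: "nat \<Rightarrow> complex"
  shows "Polynomial.order x (\<Prod>s<n. [:- L s, 1:]) = card {s. s < n \<and> L s = x}"
proof (induction n)
  case (Suc n)
  have nz: "(\<Prod>s<Suc n. [:- L s, 1:]) \<noteq> 0" unfolding prod_zero_iff[OF finite_lessThan] by simp
  have "Polynomial.order x (\<Prod>s<Suc n. [:- L s, 1:]) = Polynomial.order x (\<Prod>s<n. [:- L s, 1:]) + Polynomial.order x [:- L n, 1:]"
    using nz unfolding prod.lessThan_Suc by (rule order_mult)
  also have "Polynomial.order x [:- L n, 1:] = (if L n = x then 1 else 0)"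
  proof (cases "L n = x")
    case True
    then show ?thesis using order_power_n_n[of x 1] by simp
  next
    case False
    then show ?thesis by (simp add: order_0I)
  qed
  also note Suc
  also have "card {s. s < n \<and> L s = x} + (if L n = x then 1 else 0) = card {s. s < Suc n \<and> L s = x}"
  proof -
    have "{s. s < Suc n \<and> L s = x} = (if L n = x then insert n {s. s < n \<and> L s = x} else {s. s < n \<and> L s = x})"
      by (auto simp: less_Suc_eq)
    then show ?thesis by simp
  qed
  finally show ?case .
qed simp

text \<open>The matrix of eigenvectors is unitary, so the operator is similar to a diagonal matrix
  carrying the eigenvalues.\<close>

lemma char_poly_sdiag:
  assumes u: "orthonormal n n u"
  shows "char_poly (sdiag n u l) = (\<Prod>s<n. [:- complex_of_real (l s), 1:])"
proof -
  define U where "U = mat n n (\<lambda>(i, s). u s i)"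
  define W where "W = mat n n (\<lambda>(s, i). cnj (u s i))"
  define D where "D = mat n n (\<lambda>(s, t). if s = t then complex_of_real (l s) else 0)"
  have c: "U \<in> carrier_mat n n" "W \<in> carrier_mat n n" "D \<in> carrier_mat n n" by (auto simp: U_def W_def D_def)
  have "W * U = 1\<^sub>m n"
  proof (rule eq_matI)
    fix s t assume "s < dim_row (1\<^sub>m n :: cmat)" "t < dim_col (1\<^sub>m n :: cmat)"
    then have s: "s < n" "t < n" by auto
    have "(W * U) $$ (s, t) = (\<Sum>k<n. cnj (u s k) * u t k)"
      using s by (subst mat_mult_index[OF c(2,1)]) (auto simp: U_def W_def)
    then show "(W * U) $$ (s, t) = 1\<^sub>m n $$ (s, t)" using u s by (auto simp: orthonormal_def)
  qed (use c in auto)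
  then have UW: "U * W = 1\<^sub>m n" by (rule mat_mult_left_right_inverse[OF c(2,1)])
  have "sdiag n u l = U * D * W"
  proof (rule eq_matI)
    fix i j assume "i < dim_row (U * D * W)" "j < dim_col (U * D * W)"
    then have ij: "i < n" "j < n" using c by auto
    have "(U * D) $$ (i, s) = u s i * of_real (l s)" if "s < n" for s
      unfolding mat_mult_index[OF c(1,3) ij(1) that]
      using ij that by (subst sum_one_support[OF that]) (auto simp: U_def D_def)
    then have "(U * D * W) $$ (i, j) = (\<Sum>s<n. u s i * of_real (l s) * cnj (u s j))"
      unfolding mat_mult_index[OF mult_carrier_mat[OF c(1,3)] c(2) ij]
      using ij by (intro sum.cong refl) (auto simp: W_def simp del: index_mult_mat(1))
    then show "sdiag n u l $$ (i, j) = (U * D * W) $$ (i, j)" using ij by (simp add: sdiag_index mult_ac del: index_mult_mat(1))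
  qed (use c in auto)
  then have "similar_mat_wit (sdiag n u l) D U W"
    unfolding similar_mat_wit_def using c UW \<open>W * U = 1\<^sub>m n\<close> by (auto simp: Let_def)
  then have "similar_mat (sdiag n u l) D" unfolding similar_mat_def by blast
  then have "char_poly (sdiag n u l) = char_poly D" by (rule char_poly_similar)
  also have "\<dots> = (\<Prod>a\<leftarrow>diag_mat D. [:- a, 1:])"
    by (rule char_poly_upper_triangular[OF c(3)]) (auto simp: D_def upper_triangular_def)
  also have "diag_mat D = map (\<lambda>s. complex_of_real (l s)) [0..<n]"
    by (auto simp: diag_mat_def D_def intro!: nth_equalityI)
  also have "(\<Prod>a\<leftarrow>map (\<lambda>s. complex_of_real (l s)) [0..<n]. [:- a, 1:]) = (\<Prod>s<n. [:- complex_of_real (l s), 1:])"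
    by (simp add: prod.distinct_set_conv_list[symmetric] atLeast0LessThan o_def)
  finally show ?thesis .
qed

text \<open>The definition runs over distinct eigenvalues with their multiplicities; counting the
  indices s at which each value occurs turns this into a sum over the eigenbasis.\<close>

lemma vn_entropy_sdiag:
  assumes u: "orthonormal n n u"
  shows "vn_entropy (sdiag n u l) = - (\<Sum>s<n. l s * log 2 (l s))"
proof -
  define L where "L s = complex_of_real (l s)" for s
  have cp: "char_poly (sdiag n u l) = (\<Prod>s<n. [:- L s, 1:])" unfolding L_def by (rule char_poly_sdiag[OF u])
  have sp: "spectrum (sdiag n u l) = L ` {..<n}"
    unfolding spectrum_root_char_poly[OF sdiag_carrier] cp by (auto simp: poly_prod)
  have "(\<Sum>x\<in>spectrum (sdiag n u l). real (Polynomial.order x (char_poly (sdiag n u l))) * (Re x * log 2 (Re x)))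
    = (\<Sum>x\<in>L ` {..<n}. \<Sum>s<n. if L s = x then l s * log 2 (l s) else 0)"
    unfolding sp cp order_prod_linear
  proof (intro sum.cong refl)
    fix x assume "x \<in> L ` {..<n}"
    have "(\<Sum>s<n. if L s = x then l s * log 2 (l s) else 0) = (\<Sum>s<n. if L s = x then Re x * log 2 (Re x) else 0)"
      by (intro sum.cong refl) (auto simp: L_def)
    also have "\<dots> = (\<Sum>s\<in>{s. s < n \<and> L s = x}. Re x * log 2 (Re x))"
      by (rule sum.mono_neutral_cong_right) auto
    finally show "real (card {s. s < n \<and> L s = x}) * (Re x * log 2 (Re x)) = (\<Sum>s<n. if L s = x then l s * log 2 (l s) else 0)"
      by simp
  qed
  also have "\<dots> = (\<Sum>s<n. \<Sum>x\<in>L ` {..<n}. if L s = x then l s * log 2 (l s) else 0)" by (rule sum.swap)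
  also have "\<dots> = (\<Sum>s<n. l s * log 2 (l s))" by (intro sum.cong refl) simp
  finally show ?thesis unfolding vn_entropy_def by simp
qed

lemma sdiag_proj:
  assumes "\<And>s. s < n \<Longrightarrow> v s \<in> carrier_vec n"
  shows "mat_sum n {..<n} (\<lambda>s. complex_of_real (l s) \<cdot>\<^sub>m proj (v s)) = sdiag n (\<lambda>s i. v s $ i) l"
proof (rule eq_matI)
  fix i j assume "i < dim_row (sdiag n (\<lambda>s i. v s $ i) l)" "j < dim_col (sdiag n (\<lambda>s i. v s $ i) l)"
  then have ij: "i < n" "j < n" by auto
  have "dim_vec (v s) = n" if "s < n" for s using assms[OF that] by auto
  then show "mat_sum n {..<n} (\<lambda>s. complex_of_real (l s) \<cdot>\<^sub>m proj (v s)) $$ (i, j) = sdiag n (\<lambda>s i. v s $ i) l $$ (i, j)"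
    using ij by (simp add: sdiag_index mult.assoc)
qed auto

lemma orthonormal_std: "orthonormal n n (\<lambda>s i. if s = i then 1 else 0)"
  unfolding orthonormal_def
proof (intro allI impI)
  fix s s' assume "s < n" "s' < n"
  then show "(\<Sum>k<n. cnj (if s = k then 1 else 0) * (if s' = k then 1 else 0)) = (if s = s' then 1 else 0 :: complex)"
    by (subst sum_one_support[of s]) auto
qed

lemma cdiag_sdiag: "cdiag n p = sdiag n (\<lambda>s i. if s = i then 1 else 0) p"
proof (rule eq_matI)
  fix i j assume "i < dim_row (sdiag n (\<lambda>s i. if s = i then 1 else 0) p)" "j < dim_col (sdiag n (\<lambda>s i. if s = i then 1 else 0) p)"
  then have ij: "i < n" "j < n" by auto
  then show "cdiag n p $$ (i, j) = sdiag n (\<lambda>s i. if s = i then 1 else 0) p $$ (i, j)"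
    unfolding sdiag_index[OF ij] by (subst sum_one_support[OF ij(1)]) (auto simp: cdiag_index)
qed (auto simp: cdiag_def)

lemma densityD: "density n X \<Longrightarrow> X \<in> carrier_mat n n \<and> mat_trace X = 1"
  by (simp add: density_def psd_def)

text \<open>Tracing out Bob leaves an operator diagonal in the product of v and the standard basis.
  Alice's marginal is uniform, with entropy log N, and S(AZ) - S(Z) is the conditional entropy of
  the letter given the outcome.\<close>

lemma mutual_info_cq_state:
  assumes N: "0 < N" and v: "onb N v" and P1: "\<And>y. y < N \<Longrightarrow> (\<Sum>z<m. P y z) = 1" and P0: "\<And>y z. 0 \<le> P y z"
    and r: "\<And>y z. r y z = P y z / real N" and q: "\<And>z. q z = (\<Sum>y<N. r y z)"
  shows "mutual_info N m (ptrace N N m (cq_state N m v (\<lambda>y. cdiag m (P y)))) =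
    log 2 N - (\<Sum>y<N. \<Sum>z<m. r y z * log 2 (q z / r y z))"
proof -
  let ?c = "complex_of_real (1 / real N)"
  have pv: "proj (v y) \<in> carrier_mat N N" "mat_trace (proj (v y)) = 1" if "y < N" for y
    using densityD[OF density_proj[of "v y" N]] v that by (auto simp: onb_def orthonormal_def)
  have cd: "cdiag m (P y) \<in> carrier_mat m m" "mat_trace (cdiag m (P y)) = 1" if "y < N" for y
    using P1[OF that] by (auto simp: trace_cdiag)
  define \<sigma> where "\<sigma> = mat_sum (N * m) {..<N} (\<lambda>y. ?c \<cdot>\<^sub>m (proj (v y) \<otimes>\<^sub>m cdiag m (P y)))"
  have 1: "ptrace N N m (cq_state N m v (\<lambda>y. cdiag m (P y))) = \<sigma>"
    unfolding cq_state_def \<sigma>_def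
  proof (rule linear_map_weighted_sum[OF linear_ptrace])
    fix y assume "y \<in> {..<N}"
    then have y: "y < N" by simp
    show "proj (v y) \<otimes>\<^sub>m proj (v y) \<otimes>\<^sub>m cdiag m (P y) \<in> carrier_mat (N * N * m) (N * N * m)"
      by (intro kron_carrier pv y cd)
    show "ptrace N N m (proj (v y) \<otimes>\<^sub>m proj (v y) \<otimes>\<^sub>m cdiag m (P y)) = proj (v y) \<otimes>\<^sub>m cdiag m (P y)"
      by (intro ptrace_kron pv y cd)
  qed simp
  have 2: "ptrace N m 1 \<sigma> = mat_sum N {..<N} (\<lambda>y. ?c \<cdot>\<^sub>m proj (v y))"
  proof -
    have "linear_map (N * m) N (ptrace N m 1)" using linear_ptrace[of N m 1] by simp
    then show ?thesis unfolding \<sigma>_def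
    proof (rule linear_map_weighted_sum)
      fix y assume "y \<in> {..<N}"
      then have y: "y < N" by simp
      show k: "proj (v y) \<otimes>\<^sub>m cdiag m (P y) \<in> carrier_mat (N * m) (N * m)" by (intro kron_carrier pv y cd)
      show "ptrace N m 1 (proj (v y) \<otimes>\<^sub>m cdiag m (P y)) = proj (v y)"
        using ptrace_kron[OF pv(1)[OF y] cd(1)[OF y] one_carrier_mat[of 1] cd(2)[OF y]]
        by (simp only: kron_one_right[OF k] kron_one_right[OF pv(1)[OF y]])
    qed simp
  qed
  have 3: "ptrace 1 N m \<sigma> = cdiag m q"
  proof -
    have "linear_map (N * m) m (ptrace 1 N m)" using linear_ptrace[of 1 N m] by simp
    then have "ptrace 1 N m \<sigma> = mat_sum m {..<N} (\<lambda>y. ?c \<cdot>\<^sub>m cdiag m (P y))" unfolding \<sigma>_def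
    proof (rule linear_map_weighted_sum)
      fix y assume "y \<in> {..<N}"
      then have y: "y < N" by simp
      show k: "proj (v y) \<otimes>\<^sub>m cdiag m (P y) \<in> carrier_mat (N * m) (N * m)" by (intro kron_carrier pv y cd)
      show "ptrace 1 N m (proj (v y) \<otimes>\<^sub>m cdiag m (P y)) = cdiag m (P y)"
        using ptrace_kron[OF one_carrier_mat[of 1] pv(1)[OF y] cd(1)[OF y] pv(2)[OF y]]
        by (simp only: kron_one_left[OF pv(1)[OF y]] kron_one_left[OF cd(1)[OF y]])
    qed simp
    also have "\<dots> = cdiag m q"
    proof (rule eq_matI)
      fix i j assume "i < dim_row (cdiag m q)" "j < dim_col (cdiag m q)"
      then have ij: "i < m" "j < m" by (auto simp: cdiag_def)
      have "(?c \<cdot>\<^sub>m cdiag m (P y)) $$ (i, j) = (if i = j then complex_of_real (r y i) else 0)" for y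
        using ij by (simp add: cdiag_def r)
      then show "mat_sum m {..<N} (\<lambda>y. ?c \<cdot>\<^sub>m cdiag m (P y)) $$ (i, j) = cdiag m q $$ (i, j)"
        using ij by (simp add: cdiag_index q del: index_smult_mat)
    qed (auto simp: cdiag_def)
    finally show ?thesis .
  qed
  have SA: "vn_entropy (ptrace N m 1 \<sigma>) = log 2 N"
  proof -
    have "ptrace N m 1 \<sigma> = sdiag N (\<lambda>s i. v s $ i) (\<lambda>_. 1 / real N)"
      unfolding 2 by (rule sdiag_proj[of N v "\<lambda>_. 1 / real N"]) (use v in \<open>auto simp: onb_def\<close>)
    then have "vn_entropy (ptrace N m 1 \<sigma>) = - (\<Sum>s<N. 1 / real N * log 2 (1 / real N))"
      using vn_entropy_sdiag v by (simp add: onb_def)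
    also have "\<dots> = log 2 N" using N by (simp add: log_divide)
    finally show ?thesis .
  qed
  have SZ: "vn_entropy (ptrace 1 N m \<sigma>) = - (\<Sum>z<m. q z * log 2 (q z))"
    unfolding 3 cdiag_sdiag by (rule vn_entropy_sdiag[OF orthonormal_std])
  have SAZ: "vn_entropy \<sigma> = - (\<Sum>y<N. \<Sum>z<m. r y z * log 2 (r y z))"
  proof -
    \<comment> \<open>The product eigenbasis: s = y m + z stands for v y tensored with the z-th
      standard vector, with eigenvalue r y z.\<close>
    define u where "u s i = v (s div m) $ (i div m) * (if s mod m = i mod m then 1 else 0)" for s i
    define l where "l s = r (s div m) (s mod m)" for s
    have uo: "orthonormal (N * m) (N * m) u" unfolding orthonormal_def
    proof (intro allI impI)
      fix s s' assume s: "s < N * m" "s' < N * m"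
      have sd: "s div m < N" "s' div m < N" "s mod m < m" "s' mod m < m"
        using s by (auto simp: less_mult_imp_div_less) (metis mod_less_divisor mult_is_0 not_less_zero gr0I)+
      have "(\<Sum>k<N * m. cnj (u s k) * u s' k) = (\<Sum>i<N. \<Sum>z<m. (if z = s mod m then (if s' mod m = z then cnj (v (s div m) $ i) * v (s' div m) $ i else 0) else 0))"
        unfolding sum_lessThan_mult u_def by (intro sum.cong refl) auto
      also have "\<dots> = (\<Sum>i<N. if s' mod m = s mod m then cnj (v (s div m) $ i) * v (s' div m) $ i else 0)"
        using sd by simp
      also have "\<dots> = (if s' mod m = s mod m \<and> s div m = s' div m then 1 else 0)"
        using v sd by (cases "s' mod m = s mod m") (auto simp: onb_def orthonormal_def)
      also have "\<dots> = (if s = s' then 1 else 0)" by (metis div_mult_mod_eq)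
      finally show "(\<Sum>k<N * m. cnj (u s k) * u s' k) = (if s = s' then 1 else 0)" .
    qed
    have "\<sigma> = sdiag (N * m) u l"
    proof (rule eq_mat_kronI[where a=N and b=m and a'=N and b'=m])
      fix i z j w assume i: "i < N" and z: "z < m" and j: "j < N" and w: "w < m"
      have "\<sigma> $$ (i * m + z, j * m + w) = (\<Sum>y<N. (?c \<cdot>\<^sub>m (proj (v y) \<otimes>\<^sub>m cdiag m (P y))) $$ (i * m + z, j * m + w))"
        unfolding \<sigma>_def by (rule mat_sum_index) (use i z j w in \<open>auto intro: mult_add_less\<close>)
      also have "\<dots> = (\<Sum>y<N. if z = w then of_real (r y z) * (v y $ i * cnj (v y $ j)) else 0)"
      proof (intro sum.cong refl)
        fix y assume "y \<in> {..<N}"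
        then have y: "y < N" by simp
        then have dv: "dim_vec (v y) = N" using v by (auto simp: onb_def)
        have "(?c \<cdot>\<^sub>m (proj (v y) \<otimes>\<^sub>m cdiag m (P y))) $$ (i * m + z, j * m + w) = ?c * (proj (v y) \<otimes>\<^sub>m cdiag m (P y)) $$ (i * m + z, j * m + w)"
          by (rule index_smult_mat(1)) (use i z j w dv in \<open>auto simp: cdiag_def intro: mult_add_less\<close>)
        also have "(proj (v y) \<otimes>\<^sub>m cdiag m (P y)) $$ (i * m + z, j * m + w) = proj (v y) $$ (i, j) * cdiag m (P y) $$ (z, w)"
          by (rule kron_index[OF pv(1)[OF y] cd(1)[OF y] i z j w])
        finally show "(?c \<cdot>\<^sub>m (proj (v y) \<otimes>\<^sub>m cdiag m (P y))) $$ (i * m + z, j * m + w) = (if z = w then of_real (r y z) * (v y $ i * cnj (v y $ j)) else 0)"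
          using i j z w dv by (simp add: cdiag_index r)
      qed
      also have "\<dots> = sdiag (N * m) u l $$ (i * m + z, j * m + w)"
      proof -
        have "sdiag (N * m) u l $$ (i * m + z, j * m + w) = (\<Sum>y<N. \<Sum>x<m. if x = z then (if z = w then of_real (r y z) * (v y $ i * cnj (v y $ j)) else 0) else 0)"
          unfolding sdiag_index[OF mult_add_less[OF i z] mult_add_less[OF j w]] sum_lessThan_mult u_def l_def
          using z w by (intro sum.cong refl) auto
        then show ?thesis using z by simp
      qed
      finally show "\<sigma> $$ (i * m + z, j * m + w) = sdiag (N * m) u l $$ (i * m + z, j * m + w)" .
    qed (auto simp: \<sigma>_def)
    then have "vn_entropy \<sigma> = - (\<Sum>s<N * m. l s * log 2 (l s))" using vn_entropy_sdiag[OF uo] by simp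
    also have "(\<Sum>s<N * m. l s * log 2 (l s)) = (\<Sum>y<N. \<Sum>z<m. r y z * log 2 (r y z))"
      unfolding sum_lessThan_mult l_def by (intro sum.cong refl) simp
    finally show ?thesis .
  qed
  \<comment> \<open>The logarithm of the quotient splits where r y z > 0, because then q z > 0 too;
    the other terms carry the factor 0.\<close>
  have "(\<Sum>y<N. \<Sum>z<m. r y z * log 2 (q z / r y z)) = (\<Sum>y<N. \<Sum>z<m. r y z * log 2 (q z) - r y z * log 2 (r y z))"
  proof (intro sum.cong refl)
    fix y z assume "y \<in> {..<N}"
    then have y: "y < N" by simp
    show "r y z * log 2 (q z / r y z) = r y z * log 2 (q z) - r y z * log 2 (r y z)"
    proof (cases "r y z = 0")
      case False
      then have rp: "0 < r y z" using P0[of y z] N by (simp add: r)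
      have "r y z \<le> q z" unfolding q using y P0 by (intro member_le_sum) (auto simp: r)
      then have "0 < q z" using rp by simp
      then show ?thesis using rp by (simp add: log_divide right_diff_distrib)
    qed simp
  qed
  also have "\<dots> = (\<Sum>z<m. q z * log 2 (q z)) - (\<Sum>y<N. \<Sum>z<m. r y z * log 2 (r y z))"
    unfolding sum_subtractf q sum_distrib_right by (subst sum.swap) simp
  finally show ?thesis unfolding 1 mutual_info_def SA SZ SAZ by simp
qed

section \<open>The locking state\<close>

text \<open>The letter y = s d + k encodes bit s and the basis vector number k + 1; the shift is due
  to \<open>ket\<close> being numbered from 1.\<close>

definition alice_ket :: "nat \<Rightarrow> (nat \<Rightarrow> complex vec) \<Rightarrow> nat \<Rightarrow> complex vec" where
  "alice_ket d ket y = vec (2 * d) (\<lambda>i. if i div d = y div d then ket (Suc (y mod d)) $ (i mod d) else 0)"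

definition eve_ket :: "nat \<Rightarrow> (nat \<Rightarrow> complex vec) \<Rightarrow> nat \<Rightarrow> complex vec" where
  "eve_ket d ket y = (if y < d then ket (Suc y) else qft d ket *\<^sub>v ket (Suc (y - d)))"

definition fourier :: "nat \<Rightarrow> nat \<Rightarrow> nat \<Rightarrow> complex" where
  "fourier d j k = 1 / complex_of_real (sqrt (real d)) * exp (2 * complex_of_real pi * \<i> * of_nat j * of_nat k / of_nat d)"

lemma norm_fourier: "norm (fourier d j k) = 1 / sqrt (real d)"
proof -
  have "exp (2 * complex_of_real pi * \<i> * of_nat j * of_nat k / of_nat d) = cis (2 * pi * real j * real k / real d)"
    unfolding cis_conv_exp by (simp add: mult_ac)
  then show ?thesis by (simp add: fourier_def norm_mult norm_divide)
qed

text \<open>The terms are powers of a d-th root of unity w, and w = 1 only if d divides k' - k, that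
  is if k = k'. The sum starts at the first power, which multiplies the vanishing geometric sum by
  w.\<close>

lemma fourier_orthonormal:
  assumes d: "0 < d" and k: "k < d" "k' < d"
  shows "(\<Sum>j<d. cnj (fourier d (Suc j) (Suc k)) * fourier d (Suc j) (Suc k')) = (if k = k' then 1 else 0)"
proof -
  define w where "w = cis (2 * pi * (real k' - real k) / real d)"
  have f: "cnj (fourier d (Suc j) (Suc k)) * fourier d (Suc j) (Suc k') = 1 / of_nat d * (w ^ Suc j)" for j
  proof -
    have e: "exp (2 * complex_of_real pi * \<i> * of_nat (Suc j) * of_nat l / of_nat d) = cis (2 * pi * real (Suc j) * real l / real d)" for l
      unfolding cis_conv_exp by (simp add: mult_ac)
    have "complex_of_real (sqrt (real d) * sqrt (real d)) = of_nat d" by simp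
    then have ss: "complex_of_real (sqrt (real d)) * complex_of_real (sqrt (real d)) = of_nat d"
      by (simp only: of_real_mult)
    have "cnj (fourier d (Suc j) (Suc k)) * fourier d (Suc j) (Suc k')
      = 1 / complex_of_real (sqrt (real d) * sqrt (real d)) * (cis (- (2 * pi * real (Suc j) * real (Suc k) / real d)) * cis (2 * pi * real (Suc j) * real (Suc k') / real d))"
      unfolding fourier_def e by (simp add: cis_cnj ss)
    also have "sqrt (real d) * sqrt (real d) = real d" by simp
    also have "cis (- (2 * pi * real (Suc j) * real (Suc k) / real d)) * cis (2 * pi * real (Suc j) * real (Suc k') / real d)
      = cis (real (Suc j) * (2 * pi * (real k' - real k) / real d))"
      unfolding cis_mult by (rule arg_cong[of _ _ cis]) (use d in \<open>simp add: field_simps\<close>)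
    also have "\<dots> = w ^ Suc j" unfolding w_def by (rule Complex.DeMoivre[symmetric])
    finally show ?thesis by simp
  qed
  show ?thesis
  proof (cases "k = k'")
    case True
    then have "w = 1" by (simp add: w_def)
    then show ?thesis unfolding f using True d by simp
  next
    case False
    have "w \<noteq> 1"
    proof
      assume "w = 1"
      then have "cos (2 * pi * (real k' - real k) / real d) = 1" by (simp add: w_def complex_eq_iff)
      then obtain n :: int where "2 * pi * (real k' - real k) / real d = of_int n * 2 * pi"
        unfolding cos_one_2pi_int by auto
      then have "2 * pi * (real k' - real k) = 2 * pi * (of_int n * real d)" using d by (simp add: field_simps)
      then have "real k' - real k = of_int n * real d" by (subst (asm) mult_left_cancel) simp_all
      then have "real_of_int (int k' - int k) = real_of_int (n * int d)" by simp
      then have n: "int k' - int k = n * int d" by (simp only: of_int_eq_iff)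
      have "\<bar>int k' - int k\<bar> < int d" using k by linarith
      then have "\<bar>n\<bar> * int d < 1 * int d" unfolding n abs_mult by simp
      then have "n = 0" by (simp only: mult_less_cancel_right) linarith
      then show False using n False by simp
    qed
    moreover have "w ^ d = 1"
    proof -
      have "w ^ d = cis (2 * pi * (real k' - real k))"
        unfolding w_def Complex.DeMoivre using d by simp
      also have "\<dots> = cis (2 * pi * real k') / cis (2 * pi * real k)"
        unfolding cis_divide by (simp add: algebra_simps)
      finally show ?thesis by simp
    qed
    ultimately have "(\<Sum>j<d. w ^ j) = 0" using geometric_sum[of w d] by simp
    then have "(\<Sum>j<d. w ^ Suc j) = 0" by (simp add: sum_distrib_left[symmetric])
    then show ?thesis unfolding f sum_distrib_left[symmetric] using False by simp
  qed
qed

section \<open>The locking state as a letter shared over two unbiased bases\<close>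

context
  fixes d :: nat and ket :: "nat \<Rightarrow> complex vec"
  assumes d: "0 < d" and ket: "orthonormal_basis d ket"
begin

lemma ket_carrier: "k < d \<Longrightarrow> ket (Suc k) \<in> carrier_vec d"
  using ket by (auto simp: orthonormal_basis_def)

lemma ket_orthonormal: "orthonormal d d (\<lambda>s i. ket (Suc s) $ i)"
  unfolding orthonormal_def
proof (intro allI impI)
  fix s s' assume s: "s < d" "s' < d"
  have "ket (Suc s') \<bullet>c ket (Suc s) = (if s = s' then 1 else 0)"
    using ket s by (auto simp: orthonormal_basis_def)
  moreover have "ket (Suc s') \<bullet>c ket (Suc s) = (\<Sum>k<d. ket (Suc s') $ k * cnj (ket (Suc s) $ k))"
    using ket_carrier[OF s(1)] ket_carrier[OF s(2)] by (simp add: scalar_prod_def atLeast0LessThan)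
  ultimately show "(\<Sum>k<d. cnj (ket (Suc s) $ k) * ket (Suc s') $ k) = (if s = s' then 1 else 0)"
    by (simp add: mult.commute)
qed

lemma qft_carrier: "qft d ket \<in> carrier_mat d d"
  by (simp add: qft_def)

lemma qft_ket_index:
  assumes "k < d" "i < d"
  shows "(qft d ket *\<^sub>v ket (Suc k)) $ i = (\<Sum>j<d. fourier d (Suc j) (Suc k) * ket (Suc j) $ i)"
proof -
  have dk: "dim_vec (ket (Suc j)) = d" if "j < d" for j using ket_carrier[OF that] by auto
  have q: "qft d ket $$ (i, l) = (\<Sum>j<d. \<Sum>k'<d. fourier d (Suc j) (Suc k') * (ket (Suc j) $ i * cnj (ket (Suc k') $ l)))"
    if l: "l < d" for l
  proof -
    have "qft d ket $$ (i, l) = (\<Sum>(j, k')\<in>{1..d} \<times> {1..d}. fourier d j k' * (ket j $ i * cnj (ket k' $ l)))"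
      unfolding qft_def using assms l
    proof (subst mat_sum_index, simp, simp, intro sum.cong refl, clarify)
      fix j k' assume jk: "j \<in> {1..d}" "k' \<in> {1..d}"
      then have "dim_vec (ket j) = d" "dim_vec (ket k') = d" using ket by (auto simp: orthonormal_basis_def)
      then show "((1 / complex_of_real (sqrt (real d)) * exp (2 * complex_of_real pi * \<i> * of_nat j * of_nat k' / of_nat d)) \<cdot>\<^sub>m ketbra (ket j) (ket k')) $$ (i, l)
        = fourier d j k' * (ket j $ i * cnj (ket k' $ l))"
        using assms l by (simp add: fourier_def)
    qed
    also have "\<dots> = (\<Sum>j\<in>{1..d}. \<Sum>k'\<in>{1..d}. fourier d j k' * (ket j $ i * cnj (ket k' $ l)))"
      by (rule sum.cartesian_product[symmetric])
    finally show ?thesis by (simp add: sum.atLeast1_atMost_eq)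
  qed
  have "(qft d ket *\<^sub>v ket (Suc k)) $ i = (\<Sum>l<d. qft d ket $$ (i, l) * ket (Suc k) $ l)"
    using assms qft_carrier ket_carrier[OF assms(1)] by (auto simp: scalar_prod_def atLeast0LessThan)
  also have "\<dots> = (\<Sum>l<d. \<Sum>j<d. \<Sum>k'<d. fourier d (Suc j) (Suc k') * ket (Suc j) $ i * (cnj (ket (Suc k') $ l) * ket (Suc k) $ l))"
    by (intro sum.cong refl) (simp add: q sum_distrib_left sum_distrib_right mult_ac)
  also have "\<dots> = (\<Sum>j<d. \<Sum>k'<d. \<Sum>l<d. fourier d (Suc j) (Suc k') * ket (Suc j) $ i * (cnj (ket (Suc k') $ l) * ket (Suc k) $ l))"
    by (rule sum_rotate3[symmetric])
  also have "\<dots> = (\<Sum>j<d. \<Sum>k'<d. if k' = k then fourier d (Suc j) (Suc k) * ket (Suc j) $ i else 0)"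
    using ket_orthonormal assms(1) by (intro sum.cong refl) (simp add: sum_distrib_left[symmetric] orthonormal_def)
  also have "\<dots> = (\<Sum>j<d. fourier d (Suc j) (Suc k) * ket (Suc j) $ i)" using assms(1) by simp
  finally show ?thesis .
qed

lemma qft_orthonormal: "orthonormal d d (\<lambda>s i. (qft d ket *\<^sub>v ket (Suc s)) $ i)"
  unfolding orthonormal_def
proof (intro allI impI)
  fix s s' assume s: "s < d" "s' < d"
  have "(\<Sum>i<d. cnj ((qft d ket *\<^sub>v ket (Suc s)) $ i) * (qft d ket *\<^sub>v ket (Suc s')) $ i)
    = (\<Sum>i<d. \<Sum>j<d. \<Sum>j'<d. cnj (fourier d (Suc j) (Suc s)) * fourier d (Suc j') (Suc s') * (cnj (ket (Suc j) $ i) * ket (Suc j') $ i))"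
    by (intro sum.cong refl) (simp add: qft_ket_index s sum_product mult_ac, rule sum.swap)
  also have "\<dots> = (\<Sum>j<d. \<Sum>j'<d. \<Sum>i<d. cnj (fourier d (Suc j) (Suc s)) * fourier d (Suc j') (Suc s') * (cnj (ket (Suc j) $ i) * ket (Suc j') $ i))"
    by (rule sum_rotate3[symmetric])
  also have "\<dots> = (\<Sum>j<d. \<Sum>j'<d. if j' = j then cnj (fourier d (Suc j) (Suc s)) * fourier d (Suc j) (Suc s') else 0)"
    using ket_orthonormal by (intro sum.cong refl) (auto simp: sum_distrib_left[symmetric] orthonormal_def)
  also have "\<dots> = (if s = s' then 1 else 0)" using fourier_orthonormal[OF d s] by simp
  finally show "(\<Sum>i<d. cnj ((qft d ket *\<^sub>v ket (Suc s)) $ i) * (qft d ket *\<^sub>v ket (Suc s')) $ i) = (if s = s' then 1 else 0)" .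
qed

lemma eve_ket_carrier: "y < 2 * d \<Longrightarrow> eve_ket d ket y \<in> carrier_vec d"
  using qft_carrier ket_carrier[of y] ket_carrier[of "y - d"] by (auto simp: eve_ket_def intro!: mult_mat_vec_carrier)

lemma eve_ket_orthonormal: "orthonormal d d (\<lambda>s i. eve_ket d ket s $ i)" "orthonormal d d (\<lambda>s i. eve_ket d ket (d + s) $ i)"
  using ket_orthonormal qft_orthonormal by (simp_all add: orthonormal_def eve_ket_def)

lemma eve_ket_normalized:
  assumes y: "y < 2 * d"
  shows "(\<Sum>i<d. cnj (eve_ket d ket y $ i) * eve_ket d ket y $ i) = 1"
proof (cases "y < d")
  case True
  then show ?thesis using eve_ket_orthonormal(1) by (simp add: orthonormal_def)
next
  case False
  then have yd: "y - d < d" "d + (y - d) = y" using y by auto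
  have "(\<Sum>i<d. cnj (eve_ket d ket (d + (y - d)) $ i) * eve_ket d ket (d + (y - d)) $ i) = 1"
    using eve_ket_orthonormal(2) yd(1) unfolding orthonormal_def by simp
  then show ?thesis unfolding yd(2) .
qed

text \<open>Expanding a Fourier vector in the first basis leaves a single conjugated matrix entry.
  The bases are thus mutually unbiased, and this overlap is the constant r of the uncertainty
  relation.\<close>

lemma eve_ket_overlap:
  assumes "j < d" "k < d"
  shows "norm (\<Sum>i<d. cnj (eve_ket d ket (d + k) $ i) * eve_ket d ket j $ i) = 1 / sqrt (real d)"
proof -
  have "(\<Sum>i<d. cnj (eve_ket d ket (d + k) $ i) * eve_ket d ket j $ i)
     = (\<Sum>i<d. \<Sum>l<d. cnj (fourier d (Suc l) (Suc k)) * (cnj (ket (Suc l) $ i) * ket (Suc j) $ i))"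
    using assms by (intro sum.cong refl) (simp add: eve_ket_def qft_ket_index sum_distrib_left sum_distrib_right mult_ac)
  also have "\<dots> = (\<Sum>l<d. cnj (fourier d (Suc l) (Suc k)) * (\<Sum>i<d. cnj (ket (Suc l) $ i) * ket (Suc j) $ i))"
    by (subst sum.swap) (simp add: sum_distrib_left)
  also have "\<dots> = (\<Sum>l<d. if l = j then cnj (fourier d (Suc j) (Suc k)) else 0)"
    using ket_orthonormal assms by (intro sum.cong refl) (auto simp: orthonormal_def)
  finally show ?thesis using assms by (simp add: norm_fourier)
qed

lemma alice_ket_onb: "onb (2 * d) (alice_ket d ket)"
  unfolding onb_def orthonormal_def
proof (intro conjI allI impI)
  fix s s' assume s: "s < 2 * d" "s' < 2 * d"
  have sd: "s div d < 2" "s' div d < 2" "s mod d < d" "s' mod d < d"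
    using s d by (auto simp: less_mult_imp_div_less)
  have "(\<Sum>i<2 * d. cnj (alice_ket d ket s $ i) * alice_ket d ket s' $ i)
    = (\<Sum>i<2. \<Sum>j<d. if i = s div d then (if s' div d = s div d then cnj (ket (Suc (s mod d)) $ j) * ket (Suc (s' mod d)) $ j else 0) else 0)"
    unfolding sum_lessThan_mult by (intro sum.cong refl) (auto simp: alice_ket_def mult_add_less)
  also have "\<dots> = (\<Sum>j<d. if s' div d = s div d then cnj (ket (Suc (s mod d)) $ j) * ket (Suc (s' mod d)) $ j else 0)"
    by (subst sum_one_support[OF sd(1)]) auto
  also have "\<dots> = (if s' div d = s div d \<and> s mod d = s' mod d then 1 else 0)"
    using ket_orthonormal sd by (cases "s' div d = s div d") (auto simp: orthonormal_def)
  also have "\<dots> = (if s = s' then 1 else 0)" by (metis div_mult_mod_eq)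
  finally show "(\<Sum>k<2 * d. cnj (alice_ket d ket s $ k) * alice_ket d ket s' $ k) = (if s = s' then 1 else 0)" .
qed (simp add: alice_ket_def)

lemma proj_alice_ket:
  assumes "s < 2" "k < d"
  shows "proj (unit_vec 2 s) \<otimes>\<^sub>m proj (ket (Suc k)) = proj (alice_ket d ket (s * d + k))"
proof (rule eq_mat_kronI[where a=2 and b=d and a'=2 and b'=d])
  fix i x j y :: nat assume i: "i < 2" and x: "x < d" and j: "j < 2" and y: "y < d"
  have dk: "dim_vec (ket (Suc k)) = d" using ket_carrier[OF assms(2)] by auto
  have P: "proj (unit_vec 2 s) \<in> carrier_mat 2 2" "proj (ket (Suc k)) \<in> carrier_mat d d" using dk by auto
  have a: "alice_ket d ket (s * d + k) $ (i * d + x) = (if i = s then ket (Suc k) $ x else 0)" if "i < 2" "x < d" for i x :: nat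
    using that assms mult_add_less[OF that] by (simp add: alice_ket_def)
  have da: "dim_vec (alice_ket d ket (s * d + k)) = 2 * d" by (simp add: alice_ket_def)
  have "(proj (unit_vec 2 s) \<otimes>\<^sub>m proj (ket (Suc k))) $$ (i * d + x, j * d + y) = proj (unit_vec 2 s) $$ (i, j) * proj (ket (Suc k)) $$ (x, y)"
    by (rule kron_index[OF P i x j y])
  also have "\<dots> = (if i = s \<and> j = s then ket (Suc k) $ x * cnj (ket (Suc k) $ y) else 0)"
    using i j x y dk by (subst proj_unit_vec_index) auto
  also have "\<dots> = proj (alice_ket d ket (s * d + k)) $$ (i * d + x, j * d + y)"
    using mult_add_less[OF i x] mult_add_less[OF j y] by (simp add: da a i x j y)
  finally show "(proj (unit_vec 2 s) \<otimes>\<^sub>m proj (ket (Suc k))) $$ (i * d + x, j * d + y) = proj (alice_ket d ket (s * d + k)) $$ (i * d + x, j * d + y)" .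
next
  have "dim_vec (ket (Suc k)) = d" using ket_carrier[OF assms(2)] by auto
  then show "proj (unit_vec 2 s) \<otimes>\<^sub>m proj (ket (Suc k)) \<in> carrier_mat (2 * d) (2 * d)" by auto
  show "proj (alice_ket d ket (s * d + k)) \<in> carrier_mat (2 * d) (2 * d)" by (auto simp: alice_ket_def)
qed

lemma proj_sandwich:
  assumes "U \<in> carrier_mat n n" "v \<in> carrier_vec n"
  shows "U * proj v * mat_adjoint U = proj (U *\<^sub>v v)"
proof (rule eq_matI)
  fix i j assume "i < dim_row (proj (U *\<^sub>v v))" "j < dim_col (proj (U *\<^sub>v v))"
  then have ij: "i < n" "j < n" using assms by auto
  have P: "proj v \<in> carrier_mat n n" using assms by simp
  have dv: "dim_vec v = n" using assms by auto
  have "(U * proj v * mat_adjoint U) $$ (i, j) = (\<Sum>l<n. (\<Sum>k<n. U $$ (i, k) * proj v $$ (k, l)) * mat_adjoint U $$ (l, j))"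
    unfolding mat_mult_index[OF mult_carrier_mat[OF assms(1) P] mat_adjoint_carrier[OF assms(1)] ij]
    by (intro sum.cong refl) (simp add: mat_mult_index[OF assms(1) P ij(1)] del: index_mult_mat(1))
  also have "\<dots> = (\<Sum>k<n. U $$ (i, k) * v $ k) * cnj (\<Sum>l<n. U $$ (j, l) * v $ l)"
    using ij assms dv unfolding cnj_sum sum_product
    by (subst sum.swap) (auto simp: sum_distrib_left sum_distrib_right mult_ac intro!: sum.cong)
  also have "\<dots> = proj (U *\<^sub>v v) $$ (i, j)"
    using ij assms dv by (simp add: scalar_prod_def atLeast0LessThan)
  finally show "(U * proj v * mat_adjoint U) $$ (i, j) = proj (U *\<^sub>v v) $$ (i, j)" .
qed (use assms in auto)

text \<open>The two terms for each k are the letters k and d + k, so the sum over k becomes one over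
  all 2 d letters.\<close>

lemma rho_cq_state: "rho_AABBE d ket = cq_state (2 * d) d (alice_ket d ket) (\<lambda>y. proj (eve_ket d ket y))"
proof -
  define X where "X y = proj (alice_ket d ket y) \<otimes>\<^sub>m proj (alice_ket d ket y) \<otimes>\<^sub>m proj (eve_ket d ket y)" for y
  let ?n = "2 * d * (2 * d) * d"
  have Xc: "X y \<in> carrier_mat ?n ?n" if "y < 2 * d" for y
    unfolding X_def using eve_ket_carrier[OF that] alice_ket_onb that by (intro kron_carrier ketbra_carrier) (auto simp: onb_def)
  have t0: "(proj (unit_vec 2 0) \<otimes>\<^sub>m proj (ket (Suc k))) \<otimes>\<^sub>m (proj (unit_vec 2 0) \<otimes>\<^sub>m proj (ket (Suc k))) \<otimes>\<^sub>m proj (ket (Suc k)) = X k"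
    if k: "k < d" for k
    using proj_alice_ket[of 0 k] k by (simp add: X_def eve_ket_def)
  have t1: "(proj (unit_vec 2 1) \<otimes>\<^sub>m proj (ket (Suc k))) \<otimes>\<^sub>m (proj (unit_vec 2 1) \<otimes>\<^sub>m proj (ket (Suc k)))
      \<otimes>\<^sub>m (qft d ket * proj (ket (Suc k)) * mat_adjoint (qft d ket)) = X (d + k)"
    if k: "k < d" for k
    using proj_alice_ket[of 1 k] k proj_sandwich[OF qft_carrier ket_carrier[OF k]] by (simp add: X_def eve_ket_def)
  have c: "1 / (2 * of_nat d) = complex_of_real (1 / real (2 * d))" by simp
  show ?thesis
  proof (rule eq_matI)
    fix r s assume "r < dim_row (cq_state (2 * d) d (alice_ket d ket) (\<lambda>y. proj (eve_ket d ket y)))"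
      "s < dim_col (cq_state (2 * d) d (alice_ket d ket) (\<lambda>y. proj (eve_ket d ket y)))"
    then have rs: "r < ?n" "s < ?n" by (auto simp: cq_state_def)
    have "rho_AABBE d ket $$ (r, s) = complex_of_real (1 / real (2 * d)) * (\<Sum>k<d. (X k + X (d + k)) $$ (r, s))"
      unfolding rho_AABBE_def c using rs by (simp add: sum.atLeast1_atMost_eq t0 t1[simplified])
    also have "\<dots> = complex_of_real (1 / real (2 * d)) * (\<Sum>k<d. X k $$ (r, s) + X (d + k) $$ (r, s))"
    proof (intro arg_cong[of _ _ "\<lambda>x. _ * x"] sum.cong refl)
      fix k assume "k \<in> {..<d}"
      then have k: "k < 2 * d" "d + k < 2 * d" by auto
      show "(X k + X (d + k)) $$ (r, s) = X k $$ (r, s) + X (d + k) $$ (r, s)"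
        using rs carrier_matD[OF Xc[OF k(2)]] by (intro index_add_mat(1)) auto
    qed
    also have "(\<Sum>k<d. X k $$ (r, s) + X (d + k) $$ (r, s)) = (\<Sum>y<2 * d. X y $$ (r, s))"
      unfolding sum_lessThan_mult by (simp add: sum.distrib numeral_2_eq_2)
    also have "complex_of_real (1 / real (2 * d)) * \<dots> = (\<Sum>y<2 * d. (complex_of_real (1 / real (2 * d)) \<cdot>\<^sub>m X y) $$ (r, s))"
      unfolding sum_distrib_left
    proof (intro sum.cong refl)
      fix y assume "y \<in> {..<2 * d}"
      then have y: "y < 2 * d" by simp
      show "complex_of_real (1 / real (2 * d)) * X y $$ (r, s) = (complex_of_real (1 / real (2 * d)) \<cdot>\<^sub>m X y) $$ (r, s)"
        using rs carrier_matD[OF Xc[OF y]] by (intro index_smult_mat(1)[symmetric]) auto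
    qed
    also have "\<dots> = cq_state (2 * d) d (alice_ket d ket) (\<lambda>y. proj (eve_ket d ket y)) $$ (r, s)"
      unfolding cq_state_def X_def[symmetric] by (rule mat_sum_index[OF rs, symmetric])
    finally show "rho_AABBE d ket $$ (r, s) = cq_state (2 * d) d (alice_ket d ket) (\<lambda>y. proj (eve_ket d ket y)) $$ (r, s)" .
  qed (simp_all add: rho_AABBE_def cq_state_def)
qed

lemma key_rate_rho: "key_rate (2 * d, 2 * d, d) (rho_AABBE d ket) = 1"
  unfolding rho_cq_state
  by (rule key_rate_two_bases[OF d alice_ket_onb eve_ket_carrier eve_ket_orthonormal])

text \<open>E, B' and A' are traced out one at a time. The d letters with the same bit then
  coincide, and their weights 1/(2 d) add up to 1/2. The trivial Eve is a system of dimension 1; the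
  form \<open>2 * 1\<close> presents this as the two-bases state with d = 1.\<close>

lemma rho_AB_cq_state: "rho_AB d ket = cq_state (2 * 1) 1 (\<lambda>y. unit_vec 2 y) (\<lambda>y. proj (unit_vec 1 0))"
proof -
  let ?c = "complex_of_real (1 / real (2 * d))"
  define a where "a y = proj (unit_vec 2 (y div d))" for y
  define k where "k y = proj (ket (Suc (y mod d)))" for y
  define \<phi> where "\<phi> y = proj (eve_ket d ket y)" for y
  have a: "a y \<in> carrier_mat 2 2" for y by (auto simp: a_def)
  have k: "k y \<in> carrier_mat d d" "mat_trace (k y) = 1" for y
  proof -
    have "y mod d < d" using d by simp
    then have "density d (k y)"
      unfolding k_def using ket_carrier ket_orthonormal by (intro density_proj) (auto simp: orthonormal_def)
    then show "k y \<in> carrier_mat d d" "mat_trace (k y) = 1" using densityD by blast+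
  qed
  have \<phi>: "\<phi> y \<in> carrier_mat d d" "mat_trace (\<phi> y) = 1" if y: "y < 2 * d" for y
  proof -
    have "density d (\<phi> y)" unfolding \<phi>_def by (rule density_proj[OF eve_ket_carrier[OF y] eve_ket_normalized[OF y]])
    then show "\<phi> y \<in> carrier_mat d d" "mat_trace (\<phi> y) = 1" using densityD by blast+
  qed
  have pa: "proj (alice_ket d ket y) = a y \<otimes>\<^sub>m k y" if "y < 2 * d" for y
    using proj_alice_ket[of "y div d" "y mod d"] that d by (simp add: a_def k_def less_mult_imp_div_less)
  have 0: "rho_AABBE d ket = mat_sum (2 * d * 2 * d * d * 1) {..<2 * d} (\<lambda>y. ?c \<cdot>\<^sub>m (a y \<otimes>\<^sub>m k y \<otimes>\<^sub>m (a y \<otimes>\<^sub>m k y) \<otimes>\<^sub>m \<phi> y))"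
    unfolding rho_cq_state cq_state_def \<phi>_def by (simp add: mult.assoc, rule mat_sum_cong) (simp add: pa)
  have 1: "ptrace (2 * d * 2 * d) d 1 (rho_AABBE d ket) = mat_sum (2 * d * 2 * d * 1) {..<2 * d} (\<lambda>y. ?c \<cdot>\<^sub>m (a y \<otimes>\<^sub>m k y \<otimes>\<^sub>m (a y \<otimes>\<^sub>m k y)))"
    unfolding 0
  proof (rule linear_map_weighted_sum[OF linear_ptrace])
    fix y assume "y \<in> {..<2 * d}"
    then have y: "y < 2 * d" by simp
    have c4: "a y \<otimes>\<^sub>m k y \<otimes>\<^sub>m (a y \<otimes>\<^sub>m k y) \<in> carrier_mat (2 * d * 2 * d) (2 * d * 2 * d)"
      using kron_carrier[OF kron_carrier[OF a k(1)] kron_carrier[OF a k(1)], of y y y y] by (simp add: mult.assoc)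
    have c5: "a y \<otimes>\<^sub>m k y \<otimes>\<^sub>m (a y \<otimes>\<^sub>m k y) \<otimes>\<^sub>m \<phi> y \<in> carrier_mat (2 * d * 2 * d * d) (2 * d * 2 * d * d)"
      by (rule kron_carrier[OF c4 \<phi>(1)[OF y]])
    then show "a y \<otimes>\<^sub>m k y \<otimes>\<^sub>m (a y \<otimes>\<^sub>m k y) \<otimes>\<^sub>m \<phi> y \<in> carrier_mat (2 * d * 2 * d * d * 1) (2 * d * 2 * d * d * 1)" by simp
    show "ptrace (2 * d * 2 * d) d 1 (a y \<otimes>\<^sub>m k y \<otimes>\<^sub>m (a y \<otimes>\<^sub>m k y) \<otimes>\<^sub>m \<phi> y) = a y \<otimes>\<^sub>m k y \<otimes>\<^sub>m (a y \<otimes>\<^sub>m k y)"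
      using ptrace_kron[OF c4 \<phi>(1)[OF y] one_carrier_mat[of 1] \<phi>(2)[OF y]]
      by (simp only: kron_one_right[OF c5] kron_one_right[OF c4])
  qed simp
  have 2: "ptrace (2 * d * 2) d 1 (ptrace (2 * d * 2 * d) d 1 (rho_AABBE d ket)) = mat_sum (2 * d * 2 * 1) {..<2 * d} (\<lambda>y. ?c \<cdot>\<^sub>m (a y \<otimes>\<^sub>m k y \<otimes>\<^sub>m a y))"
    unfolding 1
  proof (rule linear_map_weighted_sum[OF linear_ptrace])
    fix y
    have c3: "a y \<otimes>\<^sub>m k y \<otimes>\<^sub>m a y \<in> carrier_mat (2 * d * 2) (2 * d * 2)"
      by (rule kron_carrier[OF kron_carrier[OF a k(1)] a])
    have as: "a y \<otimes>\<^sub>m k y \<otimes>\<^sub>m (a y \<otimes>\<^sub>m k y) = a y \<otimes>\<^sub>m k y \<otimes>\<^sub>m a y \<otimes>\<^sub>m k y"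
      by (rule kron_assoc[OF kron_carrier[OF a k(1)] a k(1), symmetric])
    have c4: "a y \<otimes>\<^sub>m k y \<otimes>\<^sub>m a y \<otimes>\<^sub>m k y \<in> carrier_mat (2 * d * 2 * d) (2 * d * 2 * d)"
      by (rule kron_carrier[OF c3 k(1)])
    then show "a y \<otimes>\<^sub>m k y \<otimes>\<^sub>m (a y \<otimes>\<^sub>m k y) \<in> carrier_mat (2 * d * 2 * d * 1) (2 * d * 2 * d * 1)" unfolding as by simp
    show "ptrace (2 * d * 2) d 1 (a y \<otimes>\<^sub>m k y \<otimes>\<^sub>m (a y \<otimes>\<^sub>m k y)) = a y \<otimes>\<^sub>m k y \<otimes>\<^sub>m a y"
      using ptrace_kron[OF c3 k(1)[of y] one_carrier_mat[of 1] k(2)[of y]] unfolding as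
      by (simp only: kron_one_right[OF c4] kron_one_right[OF c3])
  qed simp
  have 3: "rho_AB d ket = mat_sum (2 * 2) {..<2 * d} (\<lambda>y. ?c \<cdot>\<^sub>m (a y \<otimes>\<^sub>m a y))"
    unfolding rho_AB_def 2 mult_1_right
  proof (rule linear_map_weighted_sum[OF linear_ptrace])
    fix y
    show "a y \<otimes>\<^sub>m k y \<otimes>\<^sub>m a y \<in> carrier_mat (2 * d * 2) (2 * d * 2)"
      by (rule kron_carrier[OF kron_carrier[OF a k(1)] a])
    show "ptrace 2 d 2 (a y \<otimes>\<^sub>m k y \<otimes>\<^sub>m a y) = a y \<otimes>\<^sub>m a y" by (rule ptrace_kron[OF a k(1) a k(2)])
  qed simp
  show ?thesis
  proof (rule eq_matI)
    fix r s assume "r < dim_row (cq_state (2 * 1) 1 (\<lambda>y. unit_vec 2 y) (\<lambda>y. proj (unit_vec 1 0)))"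
      "s < dim_col (cq_state (2 * 1) 1 (\<lambda>y. unit_vec 2 y) (\<lambda>y. proj (unit_vec 1 0)))"
    then have rs: "r < 2 * 2" "s < 2 * 2" by (auto simp: cq_state_def)
    define b where "b x = proj (unit_vec 2 x) \<otimes>\<^sub>m proj (unit_vec 2 x)" for x
    have bc: "b x \<in> carrier_mat (2 * 2) (2 * 2)" for x unfolding b_def by (intro kron_carrier) auto
    have bi: "(c \<cdot>\<^sub>m b x) $$ (r, s) = c * b x $$ (r, s)" for c x
      using rs carrier_matD[OF bc[of x]] by (intro index_smult_mat(1)) auto
    have "rho_AB d ket $$ (r, s) = (\<Sum>y<2 * d. (?c \<cdot>\<^sub>m (a y \<otimes>\<^sub>m a y)) $$ (r, s))"
      unfolding 3 by (rule mat_sum_index[OF rs])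
    also have "\<dots> = (\<Sum>x<2. \<Sum>j<d. ?c * b x $$ (r, s))"
      unfolding sum_lessThan_mult using d by (intro sum.cong refl) (simp add: a_def b_def[symmetric] bi)
    also have "\<dots> = (\<Sum>x<2. (complex_of_real (1 / real 2) \<cdot>\<^sub>m b x) $$ (r, s))"
      unfolding bi using d by (intro sum.cong refl) simp
    also have "\<dots> = cq_state (2 * 1) 1 (\<lambda>y. unit_vec 2 y) (\<lambda>y. proj (unit_vec 1 0)) $$ (r, s)"
      unfolding cq_state_def proj_unit_vec_one using rs by (simp add: b_def kron_one_right[OF bc[unfolded b_def], simplified])
    finally show "rho_AB d ket $$ (r, s) = cq_state (2 * 1) 1 (\<lambda>y. unit_vec 2 y) (\<lambda>y. proj (unit_vec 1 0)) $$ (r, s)" .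
  qed (simp_all add: 3 cq_state_def)
qed

end

lemma onb_unit_vec: "onb n (unit_vec n)"
  unfolding onb_def orthonormal_def
proof (intro conjI allI impI)
  fix s s' assume "s < n" "s' < n"
  then show "(\<Sum>k<n. cnj (unit_vec n s $ k) * unit_vec n s' $ k) = (if s = s' then 1 else 0 :: complex)"
    by (subst sum_one_support[of s]) auto
qed simp

text \<open>In dimension 1 both of Eve's bases consist of the same single vector, so the two-bases
  theorem applies.\<close>

lemma key_rate_rho_AB:
  assumes "0 < d" "orthonormal_basis d ket"
  shows "key_rate (2, 2, 1) (rho_AB d ket) = 1"
proof -
  have "key_rate (2 * 1, 2 * 1, 1) (cq_state (2 * 1) 1 (\<lambda>y. unit_vec 2 y) (\<lambda>y. proj ((\<lambda>_. unit_vec 1 0) y))) = 1"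
  proof (rule key_rate_two_bases)
    show "onb (2 * 1) (\<lambda>y. unit_vec 2 y)" using onb_unit_vec[of 2] by simp
  qed (auto simp: orthonormal_def)
  then show ?thesis unfolding rho_AB_cq_state[OF assms] by simp
qed

section \<open>Measurements by Eve\<close>

lemma mtr_add: "X \<in> carrier_mat n n \<Longrightarrow> Y \<in> carrier_mat n n \<Longrightarrow> mtr n T (X + Y) = mtr n T X + mtr n T Y"
  unfolding mtr_def sum.distrib[symmetric] by (intro sum.cong refl) (auto simp: algebra_simps)

lemma mat_trace_mult: "A \<in> carrier_mat n n \<Longrightarrow> B \<in> carrier_mat n n \<Longrightarrow> mat_trace (A * B) = mtr n A B"
  unfolding mat_trace_def mtr_def by (auto simp: scalar_prod_def atLeast0LessThan intro!: sum.cong)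

lemma mtr_proj: "v \<in> carrier_vec n \<Longrightarrow> mtr n T (proj v) = qform n T (\<lambda>i. v $ i)"
  unfolding mtr_def qform_def by (auto simp: mult_ac intro!: sum.cong)

text \<open>Insertion of a resolution of the identity between g and h.\<close>

lemma orthonormal_expand:
  assumes "orthonormal n n f"
  shows "(\<Sum>j<n. (\<Sum>x<n. g x * f j x) * (\<Sum>x<n. cnj (f j x) * h x)) = (\<Sum>x<n. g x * h x)"
proof -
  have "(\<Sum>j<n. (\<Sum>x<n. g x * f j x) * (\<Sum>x<n. cnj (f j x) * h x)) = (\<Sum>j<n. \<Sum>x<n. \<Sum>x'<n. g x * h x' * (f j x * cnj (f j x')))"
    unfolding sum_product by (simp add: mult_ac)
  also have "\<dots> = (\<Sum>x<n. \<Sum>x'<n. \<Sum>j<n. g x * h x' * (f j x * cnj (f j x')))" by (rule sum_rotate3[symmetric])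
  also have "\<dots> = (\<Sum>x<n. \<Sum>x'<n. if x' = x then g x * h x else 0)"
    by (intro sum.cong refl) (auto simp: sum_distrib_left[symmetric] orthonormal_complete[OF assms])
  finally show ?thesis by simp
qed

lemma sum_qform_orthonormal:
  assumes "orthonormal n n f" "A \<in> carrier_mat n n"
  shows "(\<Sum>s<n. qform n A (f s)) = mat_trace A"
proof -
  have "(\<Sum>s<n. qform n A (f s)) = (\<Sum>i<n. \<Sum>j<n. \<Sum>s<n. A $$ (i, j) * (f s j * cnj (f s i)))"
    unfolding qform_def by (subst sum_rotate3[symmetric]) (simp add: mult_ac)
  also have "\<dots> = (\<Sum>i<n. \<Sum>j<n. if j = i then A $$ (i, i) else 0)"
    by (intro sum.cong refl) (auto simp: sum_distrib_left[symmetric] orthonormal_complete[OF assms(1)])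
  finally show ?thesis using assms(2) by (simp add: mat_trace_def)
qed

text \<open>Extended by 0 outside the range, since the results on classical adversaries ask for
  nonnegativity at all arguments.\<close>

definition outcome_prob :: "nat \<Rightarrow> (nat \<Rightarrow> complex vec) \<Rightarrow> nat \<Rightarrow> (nat \<Rightarrow> cmat) \<Rightarrow> nat \<Rightarrow> nat \<Rightarrow> real" where
  "outcome_prob d ket m M y z = (if y < 2 * d \<and> z < m then Re (qform d (M z) (\<lambda>i. eve_ket d ket y $ i)) else 0)"

text \<open>H(X|Z) for uniform X and transition probabilities P: the mean of the logarithm of
  P(z)/P(x, z).\<close>

definition cond_entropy :: "nat \<Rightarrow> nat \<Rightarrow> (nat \<Rightarrow> nat \<Rightarrow> real) \<Rightarrow> real" where
  "cond_entropy N m P = (\<Sum>y<N. \<Sum>z<m. P y z / real N * log 2 ((\<Sum>y<N. P y z / real N) / (P y z / real N)))"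

context
  fixes d :: nat and ket :: "nat \<Rightarrow> complex vec"
  assumes d: "0 < d" and ket: "orthonormal_basis d ket"
begin

lemmas ek = eve_ket_carrier[OF d ket] eve_ket_orthonormal[OF d ket]

lemma outcome_prob_nonneg:
  assumes "povm d m M"
  shows "0 \<le> outcome_prob d ket m M y z"
  using assms by (auto simp: outcome_prob_def povm_def psd_qform less_eq_complex_def)

lemma outcome_prob_sum:
  assumes M: "povm d m M" and y: "y < 2 * d"
  shows "(\<Sum>z<m. outcome_prob d ket m M y z) = 1"
proof -
  have "(\<Sum>z<m. outcome_prob d ket m M y z) = Re (qform d (mat_sum d {..<m} M) (\<lambda>i. eve_ket d ket y $ i))"
    unfolding qform_mat_sum using y by (simp add: outcome_prob_def)
  also have "mat_sum d {..<m} M = 1\<^sub>m d" using M by (simp add: povm_def)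
  also have "qform d (1\<^sub>m d) (\<lambda>i. eve_ket d ket y $ i) = (\<Sum>i<d. cnj (eve_ket d ket y $ i) * eve_ket d ket y $ i)"
    unfolding qform_one of_real_sum complex_norm_square by (simp add: mult.commute)
  finally show ?thesis unfolding eve_ket_normalized[OF d ket y] by simp
qed

lemma measured_cq_state:
  assumes M: "povm d m M"
  shows "measure_eve (2 * d, 2 * d, d) m M (rho_AABBE d ket) =
    cq_state (2 * d) m (alice_ket d ket) (\<lambda>y. cdiag m (outcome_prob d ket m M y))"
proof -
  define \<Lambda> where "\<Lambda> Y = mat m m (\<lambda>(z, z'). if z = z' then mat_trace (M z * Y) else 0)" for Y
  have Mc: "M z \<in> carrier_mat d d" if "z < m" for z using M that by (auto simp: povm_def psd_def)
  have l: "linear_map d m \<Lambda>" unfolding linear_map_def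
  proof (intro conjI ballI allI)
    fix X :: cmat and Y :: cmat and c :: complex assume X: "X \<in> carrier_mat d d"
    show "\<Lambda> X \<in> carrier_mat m m" by (simp add: \<Lambda>_def)
    show "\<Lambda> (c \<cdot>\<^sub>m X) = c \<cdot>\<^sub>m \<Lambda> X"
    proof (rule eq_matI)
      fix i j assume "i < dim_row (c \<cdot>\<^sub>m \<Lambda> X)" "j < dim_col (c \<cdot>\<^sub>m \<Lambda> X)"
      then have ij: "i < m" "j < m" by (auto simp: \<Lambda>_def)
      have "mat_trace (M i * (c \<cdot>\<^sub>m X)) = c * mat_trace (M i * X)"
        using mat_trace_mult[OF Mc[OF ij(1)] X] mat_trace_mult[OF Mc[OF ij(1)] smult_carrier_mat[OF X, of c]] mtr_smult[OF X] by simp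
      then show "\<Lambda> (c \<cdot>\<^sub>m X) $$ (i, j) = (c \<cdot>\<^sub>m \<Lambda> X) $$ (i, j)" using ij by (auto simp: \<Lambda>_def)
    qed (auto simp: \<Lambda>_def)
    assume Y: "Y \<in> carrier_mat d d"
    show "\<Lambda> (X + Y) = \<Lambda> X + \<Lambda> Y"
    proof (rule eq_matI)
      fix i j assume "i < dim_row (\<Lambda> X + \<Lambda> Y)" "j < dim_col (\<Lambda> X + \<Lambda> Y)"
      then have ij: "i < m" "j < m" by (auto simp: \<Lambda>_def)
      have "mat_trace (M i * (X + Y)) = mat_trace (M i * X) + mat_trace (M i * Y)"
        using mat_trace_mult[OF Mc[OF ij(1)]] X Y mtr_add[OF X Y] by simp
      then show "\<Lambda> (X + Y) $$ (i, j) = (\<Lambda> X + \<Lambda> Y) $$ (i, j)" using ij by (auto simp: \<Lambda>_def)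
    qed (auto simp: \<Lambda>_def)
  qed
  have \<Lambda>: "\<Lambda> (proj (eve_ket d ket y)) = cdiag m (outcome_prob d ket m M y)" if y: "y < 2 * d" for y
  proof (rule eq_matI)
    fix i j assume "i < dim_row (cdiag m (outcome_prob d ket m M y))" "j < dim_col (cdiag m (outcome_prob d ket m M y))"
    then have ij: "i < m" "j < m" by (auto simp: cdiag_def)
    have "mat_trace (M i * proj (eve_ket d ket y)) = qform d (M i) (\<lambda>k. eve_ket d ket y $ k)"
      using mat_trace_mult[OF Mc[OF ij(1)] ketbra_carrier[OF ek(1)[OF y] ek(1)[OF y]]] mtr_proj[OF ek(1)[OF y]] by simp
    also have "\<dots> = complex_of_real (outcome_prob d ket m M y i)"
      using M y ij by (auto simp: outcome_prob_def povm_def psd_qform less_eq_complex_def complex_eq_iff)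
    finally show "\<Lambda> (proj (eve_ket d ket y)) $$ (i, j) = cdiag m (outcome_prob d ket m M y) $$ (i, j)"
      using ij by (auto simp: \<Lambda>_def cdiag_index)
  qed (auto simp: \<Lambda>_def cdiag_def)
  have me: "measure_eve (2 * d, 2 * d, d) m M = local_map (2 * d * (2 * d)) d m 1 \<Lambda>"
    unfolding measure_eve_def \<Lambda>_def[abs_def] by simp
  have ll: "linear_map (2 * d * (2 * d) * d) (2 * d * (2 * d) * m) (local_map (2 * d * (2 * d)) d m 1 \<Lambda>)"
    using linear_local_map[OF l, of "2 * d * (2 * d)" 1] unfolding mult_1_right .
  show ?thesis unfolding me rho_cq_state[OF d ket] cq_state_def
  proof (rule linear_map_weighted_sum[OF ll])
    fix y assume "y \<in> {..<2 * d}"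
    then have y: "y < 2 * d" by simp
    have A: "proj (alice_ket d ket y) \<in> carrier_mat (2 * d) (2 * d)" by (auto simp: alice_ket_def)
    have E: "proj (eve_ket d ket y) \<in> carrier_mat d d" using ek(1)[OF y] by simp
    note c = kron_carrier[OF kron_carrier[OF A A] E]
    show "proj (alice_ket d ket y) \<otimes>\<^sub>m proj (alice_ket d ket y) \<otimes>\<^sub>m proj (eve_ket d ket y) \<in> carrier_mat (2 * d * (2 * d) * d) (2 * d * (2 * d) * d)"
      by (rule c)
    show "local_map (2 * d * (2 * d)) d m 1 \<Lambda> (proj (alice_ket d ket y) \<otimes>\<^sub>m proj (alice_ket d ket y) \<otimes>\<^sub>m proj (eve_ket d ket y))
      = proj (alice_ket d ket y) \<otimes>\<^sub>m proj (alice_ket d ket y) \<otimes>\<^sub>m cdiag m (outcome_prob d ket m M y)"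
      using local_map_kron[OF l kron_carrier[OF A A] E one_carrier_mat[of 1]]
      unfolding \<Lambda>[OF y] by (simp only: kron_one_right[OF c] kron_one_right[OF kron_carrier[OF kron_carrier[OF A A] cdiag_carrier]])
  qed simp
qed

lemma outcome_info_rho:
  assumes M: "povm d m M"
  shows "outcome_info (2 * d, 2 * d, d) (rho_AABBE d ket) m M = log 2 (2 * real d) - cond_entropy (2 * d) m (outcome_prob d ket m M)"
proof -
  have "mutual_info (2 * d) m (ptrace (2 * d) (2 * d) m (cq_state (2 * d) m (alice_ket d ket) (\<lambda>y. cdiag m (outcome_prob d ket m M y))))
    = log 2 (real (2 * d)) - cond_entropy (2 * d) m (outcome_prob d ket m M)"
    unfolding cond_entropy_def
    by (rule mutual_info_cq_state[OF _ alice_ket_onb[OF d ket] outcome_prob_sum[OF M] outcome_prob_nonneg[OF M]]) (use d in auto)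
  then show ?thesis unfolding outcome_info_def case_prod_conv measured_cq_state[OF M] by simp
qed

text \<open>Given an outcome z, the bit is still uniform, because both bases assign M z the same
  total weight, its trace T. So the posterior entropy is 1 plus the mean of the entropies of the
  density operator M z / T in the two bases, and the uncertainty relation bounds the sum of these
  two by log d.\<close>

lemma cond_entropy_lower:
  assumes M: "povm d m M"
  shows "1 + 1 / 2 * log 2 (real d) \<le> cond_entropy (2 * d) m (outcome_prob d ket m M)"
proof -
  define P where "P = outcome_prob d ket m M"
  define \<phi> where "\<phi> y i = eve_ket d ket y $ i" for y i
  have o0: "orthonormal d d (\<lambda>s. \<phi> s)" and o1: "orthonormal d d (\<lambda>s. \<phi> (d + s))"
    using ek(2,3) by (simp_all add: \<phi>_def[abs_def])
  have P0: "0 \<le> P y z" for y z unfolding P_def by (rule outcome_prob_nonneg[OF M])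
  have split: "(\<Sum>y<2 * d. f y) = (\<Sum>j<d. f j) + (\<Sum>k<d. f (d + k))" for f :: "nat \<Rightarrow> real"
    unfolding sum_lessThan_mult by (simp add: numeral_2_eq_2)
  \<comment> \<open>The share of outcome z: its probability T / d times 1 + 1/2 log d.\<close>
  have z: "(\<Sum>j<d. P j z) / (2 * real d) * (2 + log 2 (real d)) \<le> (\<Sum>y<2 * d. P y z / real (2 * d) * log 2 ((\<Sum>y<2 * d. P y z / real (2 * d)) / (P y z / real (2 * d))))"
    if z: "z < m" for z
  proof -
    have Mz: "psd d (M z)" "M z \<in> carrier_mat d d" using M z by (auto simp: povm_def psd_def)
    have Pq: "P y z = Re (qform d (M z) (\<phi> y))" if "y < 2 * d" for y
      using that z by (simp add: P_def outcome_prob_def \<phi>_def[abs_def])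
    define T where "T = (\<Sum>j<d. P j z)"
    have T0: "0 \<le> T" unfolding T_def using P0 by (intro sum_nonneg) auto
    have T1: "T = Re (mat_trace (M z))" unfolding T_def sum_qform_orthonormal[OF o0 Mz(2), symmetric] by (simp add: Pq)
    have T2: "(\<Sum>k<d. P (d + k) z) = T" unfolding T1 sum_qform_orthonormal[OF o1 Mz(2), symmetric] by (simp add: Pq)
    have qz: "(\<Sum>y<2 * d. P y z / real (2 * d)) = T / real d"
      unfolding sum_divide_distrib[symmetric] split T2 T_def[symmetric] using d by (simp add: field_simps)
    show ?thesis
    proof (cases "T = 0")
      case True
      have "P y z = 0" if y: "y < 2 * d" for y
      proof -
        have "(\<Sum>y<2 * d. P y z) = 0" unfolding split T2 T_def[symmetric] True by simp
        then show ?thesis using y P0 by (subst (asm) sum_nonneg_eq_0_iff) auto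
      qed
      then show ?thesis unfolding T_def[symmetric] True by simp
    next
      case False
      then have Tp: "0 < T" using T0 by simp
      obtain u l where u: "orthonormal d d u" "M z = sdiag d u l" "\<forall>s<d. 0 \<le> l s" using psd_spectral[OF Mz(1)] by blast
      \<comment> \<open>The eigenvectors of M z / T, weighted by the roots of their eigenvalues and
        expanded in the first basis, form the ensemble of the uncertainty relation; c below is the
        matrix of overlaps that passes to the second basis.\<close>
      define a where "a i j = complex_of_real (sqrt (l i / T)) * (\<Sum>x<d. cnj (\<phi> j x) * u i x)" for i j
      define c where "c k j = (\<Sum>x<d. cnj (\<phi> (d + k) x) * \<phi> j x)" for k j
      have sq: "(norm (complex_of_real (sqrt (l i / T)) * (\<Sum>x<d. cnj (\<phi> y x) * u i x)))^2 = l i * (norm (\<Sum>x<d. cnj (u i x) * \<phi> y x))^2 / T"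
        if "i < d" for i y
      proof -
        have "(\<Sum>x<d. cnj (\<phi> y x) * u i x) = cnj (\<Sum>x<d. cnj (u i x) * \<phi> y x)" by (simp add: mult.commute)
        then have "norm (\<Sum>x<d. cnj (\<phi> y x) * u i x) = norm (\<Sum>x<d. cnj (u i x) * \<phi> y x)" by (simp only: complex_mod_cnj)
        moreover have "0 \<le> l i / T" using u(3) that Tp by simp
        ultimately show ?thesis by (simp add: norm_mult power_mult_distrib)
      qed
      have Ps: "(\<Sum>i<d. l i * (norm (\<Sum>x<d. cnj (u i x) * \<phi> y x))^2 / T) = P y z / T" if "y < 2 * d" for y
        unfolding Pq[OF that] u(2) qform_sdiag by (simp add: sum_divide_distrib)
      define p where "p j = (\<Sum>i<d. (norm (a i j))^2)" for j
      define q where "q k = (\<Sum>i<d. (norm (\<Sum>j<d. c k j * a i j))^2)" for k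
      have pj: "p j = P j z / T" if "j < d" for j
        using Ps[of j] that unfolding p_def a_def by (simp add: sq)
      have qk: "q k = P (d + k) z / T" if "k < d" for k
      proof -
        have "(\<Sum>j<d. c k j * a i j) = complex_of_real (sqrt (l i / T)) * (\<Sum>x<d. cnj (\<phi> (d + k) x) * u i x)" for i
        proof -
          have "(\<Sum>j<d. c k j * a i j) = complex_of_real (sqrt (l i / T)) * (\<Sum>j<d. c k j * (\<Sum>x<d. cnj (\<phi> j x) * u i x))"
            unfolding a_def sum_distrib_left by (simp only: mult_ac)
          then show ?thesis unfolding c_def orthonormal_expand[OF o0] .
        qed
        then show ?thesis using Ps[of "d + k"] that unfolding q_def by (simp add: sq)
      qed
      have "(\<Sum>j<d. p j * ln (p j)) + (\<Sum>k<d. q k * ln (q k)) \<le> 2 * ln (1 / sqrt (real d))"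
      proof (rule entropic_uncertainty[where I="{..<d}" and a=a and c=c])
        fix j j' assume "j \<in> {..<d}" "j' \<in> {..<d}"
        then have j: "j < d" "j' < d" by auto
        have "(\<Sum>k<d. cnj (c k j) * c k j') = (\<Sum>k<d. (\<Sum>x<d. cnj (\<phi> j x) * \<phi> (d + k) x) * (\<Sum>x<d. cnj (\<phi> (d + k) x) * \<phi> j' x))"
          unfolding c_def cnj_sum by (simp add: mult.commute)
        also have "\<dots> = (\<Sum>x<d. cnj (\<phi> j x) * \<phi> j' x)" by (rule orthonormal_expand[OF o1])
        also have "\<dots> = (if j = j' then 1 else 0)" using o0 j by (simp add: orthonormal_def)
        finally show "(\<Sum>k<d. cnj (c k j) * c k j') = (if j = j' then 1 else 0)" .
      next
        fix k j assume "k \<in> {..<d}" "j \<in> {..<d}"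
        then show "norm (c k j) \<le> 1 / sqrt (real d)"
          using eve_ket_overlap[OF d ket, of j k] by (simp add: c_def \<phi>_def)
      next
        show "0 < 1 / sqrt (real d)" using d by simp
        have "(\<Sum>j<d. p j) = (\<Sum>j<d. P j z) / T" unfolding sum_divide_distrib by (intro sum.cong refl) (simp add: pj)
        then show "(\<Sum>j<d. p j) = 1" using False by (simp add: T_def[symmetric])
      qed (simp_all add: p_def q_def)
      \<comment> \<open>Unbiasedness at its best: the overlap 1 / sqrt d gives the full ln
        d.\<close>
      also have "2 * ln (1 / sqrt (real d)) = - ln (real d)"
        using d by (simp add: ln_div ln_sqrt)
      finally have mu: "(\<Sum>j<d. p j * ln (p j)) + (\<Sum>k<d. q k * ln (q k)) \<le> - ln (real d)" .
      have summand: "P y z / real (2 * d) * log 2 ((T / real d) / (P y z / real (2 * d))) = T / (2 * real d) * (P y z / T - (P y z / T) * ln (P y z / T) / ln 2)" for y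
      proof (cases "P y z = 0")
        case nz: False
        then have Pp: "0 < P y z" using P0[of y z] by simp
        have "(T / real d) / (P y z / real (2 * d)) = 2 / (P y z / T)" using d Tp Pp by (simp add: field_simps)
        then have "log 2 ((T / real d) / (P y z / real (2 * d))) = log 2 (2 / (P y z / T))" by (simp only:)
        also have "\<dots> = log 2 2 - log 2 (P y z / T)" using Pp Tp by (intro log_divide_pos) auto
        also have "\<dots> = 1 - ln (P y z / T) / ln 2" unfolding log_def by simp
        finally have lg: "log 2 ((T / real d) / (P y z / real (2 * d))) = 1 - ln (P y z / T) / ln 2" .
        have P: "P y z / real (2 * d) = T / (2 * real d) * (P y z / T)" using Tp by simp
        have alg: "c * x * (1 - v / w) = c * (x - x * v / w)" for c x v w :: real by (simp add: algebra_simps)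
        show ?thesis by (subst lg, subst P, rule alg)
      qed simp
      have "(\<Sum>y<2 * d. P y z / real (2 * d) * log 2 ((\<Sum>y<2 * d. P y z / real (2 * d)) / (P y z / real (2 * d))))
        = T / (2 * real d) * (\<Sum>y<2 * d. P y z / T - (P y z / T) * ln (P y z / T) / ln 2)"
        unfolding qz summand sum_distrib_left ..
      also have "(\<Sum>y<2 * d. P y z / T - (P y z / T) * ln (P y z / T) / ln 2)
        = (\<Sum>y<2 * d. P y z) / T - (\<Sum>y<2 * d. (P y z / T) * ln (P y z / T)) / ln 2"
        by (simp only: sum_subtractf sum_divide_distrib)
      also have "(\<Sum>y<2 * d. P y z) / T = 2" unfolding split T2 T_def[symmetric] using False by simp
      also have "(\<Sum>y<2 * d. (P y z / T) * ln (P y z / T)) = (\<Sum>j<d. p j * ln (p j)) + (\<Sum>k<d. q k * ln (q k))"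
        unfolding split by (simp add: pj qk)
      finally have "(\<Sum>y<2 * d. P y z / real (2 * d) * log 2 ((\<Sum>y<2 * d. P y z / real (2 * d)) / (P y z / real (2 * d))))
        = T / (2 * real d) * (2 - ((\<Sum>j<d. p j * ln (p j)) + (\<Sum>k<d. q k * ln (q k))) / ln 2)" .
      note total = this
      have le: "2 + log 2 (real d) \<le> 2 - ((\<Sum>j<d. p j * ln (p j)) + (\<Sum>k<d. q k * ln (q k))) / ln 2"
      proof -
        have "((\<Sum>j<d. p j * ln (p j)) + (\<Sum>k<d. q k * ln (q k))) / ln 2 \<le> - ln (real d) / ln 2"
          by (rule divide_right_mono[OF mu]) simp
        then show ?thesis by (simp add: log_def)
      qed
      show ?thesis unfolding T_def[symmetric] total by (rule mult_left_mono[OF le]) (use Tp in simp)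
    qed
  qed
  \<comment> \<open>The outcome probabilities of each of the d letters of the first basis sum to 1,
    so the shares of all outcomes add up to the claimed value.\<close>
  have "(\<Sum>z<m. (\<Sum>j<d. P j z) / (2 * real d) * (2 + log 2 (real d))) = (\<Sum>j<d. \<Sum>z<m. P j z) / (2 * real d) * (2 + log 2 (real d))"
    by (simp only: sum_distrib_right[symmetric] sum_divide_distrib[symmetric] sum.swap[of _ "{..<d}"])
  also have "(\<Sum>j<d. \<Sum>z<m. P j z) = real d" unfolding P_def by (simp add: outcome_prob_sum[OF M])
  also have "real d / (2 * real d) * (2 + log 2 (real d)) = 1 + 1 / 2 * log 2 (real d)" using d by (simp add: field_simps)
  finally have "1 + 1 / 2 * log 2 (real d) = (\<Sum>z<m. (\<Sum>j<d. P j z) / (2 * real d) * (2 + log 2 (real d)))" by simp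
  also have "\<dots> \<le> (\<Sum>z<m. \<Sum>y<2 * d. P y z / real (2 * d) * log 2 ((\<Sum>y<2 * d. P y z / real (2 * d)) / (P y z / real (2 * d))))"
    by (intro sum_mono z) simp
  also have "\<dots> = cond_entropy (2 * d) m P" unfolding cond_entropy_def by (rule sum.swap)
  finally show ?thesis unfolding P_def .
qed

text \<open>After outcome z of a measurement in the first basis, the posterior gives letter z
  probability 1/2 and each of the d letters of the second basis 1/(2 d). Its entropy is 1/2 + 1/2
  log (2 d).\<close>

lemma basis_measurement:
  "\<exists>M. povm d d M \<and> cond_entropy (2 * d) d (outcome_prob d ket d M) = 1 + 1 / 2 * log 2 (real d)"
proof -
  define M where "M z = proj (eve_ket d ket z)" for z
  have pv: "povm d d M" unfolding povm_def
  proof (intro conjI allI impI)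
    show "psd d (M z)" if "z < d" for z unfolding M_def using ek(1)[of z] that by (intro psd_proj) auto
    show "mat_sum d {..<d} M = 1\<^sub>m d"
    proof (rule eq_matI)
      fix i j assume "i < dim_row (1\<^sub>m d :: cmat)" "j < dim_col (1\<^sub>m d :: cmat)"
      then have ij: "i < d" "j < d" by auto
      have dv: "dim_vec (eve_ket d ket z) = d" if "z < d" for z using ek(1)[of z] that by auto
      show "mat_sum d {..<d} M $$ (i, j) = 1\<^sub>m d $$ (i, j)"
        using ij orthonormal_complete[OF ek(2) ij] by (simp add: M_def dv)
    qed auto
  qed
  define P where "P = outcome_prob d ket d M"
  have Pq: "P y z = (norm (\<Sum>i<d. cnj (eve_ket d ket z $ i) * eve_ket d ket y $ i))^2" if "y < 2 * d" "z < d" for y z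
    using that ek(1)[of z] unfolding P_def outcome_prob_def M_def by (simp add: qform_proj)
  have P1: "P y z = (if y = z then 1 else 0)" if "y < d" "z < d" for y z
    using that ek(2) by (simp add: Pq orthonormal_def)
  have P2: "P (d + k) z = 1 / real d" if "k < d" "z < d" for k z
  proof -
    have "(\<Sum>i<d. cnj (eve_ket d ket z $ i) * eve_ket d ket (d + k) $ i) = cnj (\<Sum>i<d. cnj (eve_ket d ket (d + k) $ i) * eve_ket d ket z $ i)"
      by (simp add: mult.commute)
    then have "norm (\<Sum>i<d. cnj (eve_ket d ket z $ i) * eve_ket d ket (d + k) $ i) = 1 / sqrt (real d)"
      using eve_ket_overlap[OF d ket that(2,1)] by (simp only: complex_mod_cnj)
    then show ?thesis using that by (simp add: Pq power_divide)
  qed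
  have split: "(\<Sum>y<2 * d. f y) = (\<Sum>j<d. f j) + (\<Sum>k<d. f (d + k))" for f :: "nat \<Rightarrow> real"
    unfolding sum_lessThan_mult by (simp add: numeral_2_eq_2)
  have q: "(\<Sum>y<2 * d. P y z / real (2 * d)) = 1 / real d" if z: "z < d" for z
  proof -
    have "(\<Sum>j<d. P j z) = 1" using z P1 by (subst sum_one_support[OF z]) auto
    moreover have "(\<Sum>k<d. P (d + k) z) = 1" using z P2 d by simp
    ultimately show ?thesis unfolding sum_divide_distrib[symmetric] split using d by simp
  qed
  have "cond_entropy (2 * d) d P = (\<Sum>z<d. \<Sum>y<2 * d. P y z / real (2 * d) * log 2 ((1 / real d) / (P y z / real (2 * d))))"
    unfolding cond_entropy_def
  proof (subst sum.swap, rule sum.cong[OF refl], rule sum.cong[OF refl])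
    fix z y assume "z \<in> {..<d}"
    then have z: "z < d" by simp
    show "P y z / real (2 * d) * log 2 ((\<Sum>y<2 * d. P y z / real (2 * d)) / (P y z / real (2 * d)))
      = P y z / real (2 * d) * log 2 ((1 / real d) / (P y z / real (2 * d)))"
      unfolding q[OF z] ..
  qed
  also have "\<dots> = (\<Sum>z<d. 1 / (2 * real d) * (2 + log 2 (real d)))"
  proof (intro sum.cong refl)
    fix z assume "z \<in> {..<d}"
    then have z: "z < d" by simp
    have "(\<Sum>j<d. P j z / real (2 * d) * log 2 ((1 / real d) / (P j z / real (2 * d)))) = 1 / (2 * real d)"
      using d z P1 by (subst sum_one_support[OF z]) auto
    moreover have "(\<Sum>k<d. P (d + k) z / real (2 * d) * log 2 ((1 / real d) / (P (d + k) z / real (2 * d)))) = 1 / (2 * real d) * (1 + log 2 (real d))"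
    proof -
      have "(1 / real d) / (1 / real d / real (2 * d)) = 2 * real d" using d by (simp add: field_simps)
      moreover have "log 2 (2 * real d) = 1 + log 2 (real d)" using d by (simp add: log_mult)
      ultimately show ?thesis using d z by (simp add: P2)
    qed
    ultimately show "(\<Sum>y<2 * d. P y z / real (2 * d) * log 2 ((1 / real d) / (P y z / real (2 * d)))) = 1 / (2 * real d) * (2 + log 2 (real d))"
      unfolding split using d by (simp add: field_simps)
  qed
  also have "\<dots> = 1 + 1 / 2 * log 2 (real d)" using d by (simp add: field_simps)
  finally show ?thesis using pv unfolding P_def by blast
qed

text \<open>The information gained is log (2 d) minus the conditional entropy, so an optimal
  measurement minimises the latter. Since the lower bound is attained, every optimal M has exactly
  that value, whatever its number of outcomes, and the key rate depends on M through it
  alone.\<close>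

lemma key_rate_measured:
  assumes opt: "optimal_measurement (2 * d, 2 * d, d) (rho_AABBE d ket) m M"
  shows "key_rate (2 * d, 2 * d, m) (measure_eve (2 * d, 2 * d, d) m M (rho_AABBE d ket)) = ereal (1 + 1 / 2 * log 2 (real d))"
proof -
  have M: "povm d m M" and best: "\<And>m' M'. povm d m' M' \<Longrightarrow>
      outcome_info (2 * d, 2 * d, d) (rho_AABBE d ket) m' M' \<le> outcome_info (2 * d, 2 * d, d) (rho_AABBE d ket) m M"
    using opt unfolding optimal_measurement_def by auto
  obtain M0 where M0: "povm d d M0" "cond_entropy (2 * d) d (outcome_prob d ket d M0) = 1 + 1 / 2 * log 2 (real d)"
    using basis_measurement by blast
  have H: "cond_entropy (2 * d) m (outcome_prob d ket m M) = 1 + 1 / 2 * log 2 (real d)"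
    using best[OF M0(1)] cond_entropy_lower[OF M] M0(2) unfolding outcome_info_rho[OF M] outcome_info_rho[OF M0(1)] by simp
  have "0 \<le> log 2 (real d)" using d by (simp add: zero_le_log_cancel_iff)
  then have pos: "0 < 1 + 1 / 2 * log 2 (real d)" by simp
  show ?thesis unfolding measured_cq_state[OF M]
    by (rule key_rate_classical[OF _ alice_ket_onb[OF d ket] outcome_prob_nonneg[OF M] outcome_prob_sum[OF M] refl refl _ pos])
       (use d H in \<open>simp_all add: cond_entropy_def\<close>)
qed

end

theorem mainTheorem12:
  fixes d :: nat and ket :: "nat \<Rightarrow> complex vec"
  assumes "0 < d" and "orthonormal_basis d ket"
  shows "key_rate (2 * d, 2 * d, d) (rho_AABBE d ket) = key_rate (2, 2, 1) (rho_AB d ket) \<and>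
    key_rate (2, 2, 1) (rho_AB d ket) = 1 \<and>
    (\<forall>m M. optimal_measurement (2 * d, 2 * d, d) (rho_AABBE d ket) m M \<longrightarrow>
      key_rate (2 * d, 2 * d, m) (measure_eve (2 * d, 2 * d, d) m M (rho_AABBE d ket))
        = ereal (1 + 1 / 2 * log 2 (real d)))"
  using key_rate_rho[OF assms] key_rate_rho_AB[OF assms] key_rate_measured[OF assms] by simp

end
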